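(* Let $G$ be a unimodular quasi-transitive quasi-tree, and let $\mathcal{B}$ be its Bernoulli graphing. Then $\sigma_R(\mathcal{B})=\sigma(G)$.
   Context: A connected bounded degree graph $G$ (with no isolated vertices) is quasi-transitive if $\mathrm{Aut}(G)$ acts on $V(G)$ with finitely many orbits. It is unimodular if $\mathrm{Aut}(G)$ is unimodular as a locally compact second countable group; equivalently, there is a unimodular random graph $(H,o)$ (a random connected rooted graph, up to isomorphism, whose law $\nu$ satisfies the Mass Transport Principle $\int\sum_{o'\in V(H)}f(H,o',o)\,d\nu=\int\sum_{o'\in V(H)}f(H,o,o')\,d\nu$ for all Borel $f\ge0$ on isomorphism classes of connected doubly rooted graphs) with $H\cong G$ almost surely; we write this (uniquely distributed) unimodular random graph as $(G,o)$, with law $\nu$. $G$ is a quasi-tree if it is quasi-isometric to a tree. $\sigma(G)$ denotes the spectrum of the Markov operator $(M_Gf)(u)=\frac{1}{\deg(u)}\sum_{(u,v)\in E(G)}f(v)$ on $\ell^2(G,\deg)$, the functions on $V(G)$ with inner product $\langle f,g\rangle=\sum_uf(u)\overline{g(u)}\deg(u)$. Let $\mathbb{G}_\bullet$ be the standard Borel space of isomorphism classes of connected rooted graphs of degree at most $D$ (for a fixed sufficiently large $D$), and $\mathbb{G}^+_\bullet$ that of connected rooted graphs $(G,\xi,o)$ with vertex labels $\xi:V(G)\to[0,1]$. The Bernoulli graphing of $G$ is that of the unimodular random graph $(G,o)$: the triple $(\mathcal{B},\mathbb{G}_\bullet^+,\mu)$, where $\mathcal B$ is the Borel graph on $\mathbb{G}_\bullet^+$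 with an edge between $(G,\xi,o)$ and $(H,\eta,p)$ iff there is a neighbour $o'$ of $o$ in $G$ with $(G,\xi,o')\cong(H,\eta,p)$, and $\int f\,d\mu=\int_{\mathbb{G}_\bullet}\int_{[0,1]^{V(G)}} f(G,\xi,o)\,d\mathrm{Leb}^{\otimes V(G)}(\xi)\,d\nu(G,o)$. The degree-biased measure $\mu^*$ is given by $\int f\,d\mu^*=\int f\deg\,d\mu/\int\deg\,d\mu$, and $\nu^*$ is defined from $\nu$ in the same way using $\deg_G(o)$. The Markov operator of $\mathcal{B}$ is $(\mathcal{M}f)(x)=\frac{1}{\deg(x)}\sum_{(x,y)\in\mathcal{B}} f(y)$ on $L^2(\mathbb{G}_\bullet^+,\mu^* )$. Let $\iota:L^2(\mathbb{G}_\bullet,\nu^* )\to L^2(\mathbb{G}_\bullet^+,\mu^* )$, $(\iota f)(G,\xi,o)=f(G,o)$. The structured subspace is $S=\mathrm{Ran}(\iota)$, the random subspace is $R=S^\perp$; both are $\mathcal{M}$-invariant, and the random spectrum is $\sigma_R(\mathcal{B})=\sigma(\mathcal{M}|_R)$. *)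

theory Defs
  imports "HOL-Probability.Probability"
begin

record 'a graph =
  verts :: "'a set"
  edges :: "'a rel"

definition connected_graph :: "'a graph \<Rightarrow> bool" where
  "connected_graph G \<longleftrightarrow>
     verts G \<noteq> {} \<and> edges G \<subseteq> verts G \<times> verts G \<and> sym (edges G) \<and> irrefl (edges G) \<and>
     (\<forall>u\<in>verts G. \<forall>v\<in>verts G. (u, v) \<in> (edges G)\<^sup>*)"

definition no_isolated :: "'a graph \<Rightarrow> bool" where
  "no_isolated G \<longleftrightarrow> (\<forall>v\<in>verts G. edges G `` {v} \<noteq> {})"

definition vertex_degree :: "'x rel \<Rightarrow> 'x \<Rightarrow> nat" where
  "vertex_degree E v = card (E `` {v})"

definition degree_bounded :: "nat \<Rightarrow> 'a graph \<Rightarrow> bool" where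
  "degree_bounded D G \<longleftrightarrow>
     (\<forall>v\<in>verts G. finite (edges G `` {v}) \<and> vertex_degree (edges G) v \<le> D)"

definition graph_dist :: "'a graph \<Rightarrow> 'a \<Rightarrow> 'a \<Rightarrow> nat" where
  "graph_dist G u v = (LEAST n. (u, v) \<in> edges G ^^ n)"

definition is_cycle :: "'a graph \<Rightarrow> 'a list \<Rightarrow> bool" where
  "is_cycle G vs \<longleftrightarrow> length vs \<ge> 3 \<and> distinct vs \<and>
     (\<forall>i. Suc i < length vs \<longrightarrow> (vs ! i, vs ! Suc i) \<in> edges G) \<and> (last vs, hd vs) \<in> edges G"

definition is_tree :: "'a graph \<Rightarrow> bool" where
  "is_tree T \<longleftrightarrow> connected_graph T \<and> (\<nexists>vs. is_cycle T vs)"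

definition quasi_isometric :: "'a graph \<Rightarrow> 'b graph \<Rightarrow> bool" where
  "quasi_isometric G H \<longleftrightarrow>
     (\<exists>f (A::real) (B::real). f ` verts G \<subseteq> verts H \<and> A \<ge> 1 \<and> B \<ge> 0 \<and>
        (\<forall>u\<in>verts G. \<forall>v\<in>verts G.
           graph_dist G u v / A - B \<le> graph_dist H (f u) (f v) \<and>
           graph_dist H (f u) (f v) \<le> A * graph_dist G u v + B) \<and>
        (\<forall>w\<in>verts H. \<exists>v\<in>verts G. graph_dist H w (f v) \<le> B))"

definition graph_iso :: "('a \<Rightarrow> 'b) \<Rightarrow> 'a graph \<Rightarrow> 'b graph \<Rightarrow> bool" where
  "graph_iso \<phi> G H \<longleftrightarrow>
     bij_betw \<phi> (verts G) (verts H) \<and> edges H = map_prod \<phi> \<phi> ` edges G"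

definition orbit :: "'a graph \<Rightarrow> 'a \<Rightarrow> 'a set" where
  "orbit G v = {\<phi> v | \<phi>. graph_iso \<phi> G G}"

definition quasi_transitive :: "'a graph \<Rightarrow> bool" where
  "quasi_transitive G \<longleftrightarrow> finite (orbit G ` verts G)"

text \<open>Connected graphs of bounded degree are countable, so every isomorphism class is represented
  by its members whose vertices are natural numbers.  The graph whose class is taken
  may have vertices of any type.\<close>

type_synonym 'a rgraph = "'a graph \<times> 'a list"
type_synonym 'a lgraph = "'a graph \<times> ('a \<Rightarrow> real) \<times> 'a"

definition rgraph_iso :: "'a rgraph \<Rightarrow> 'b rgraph \<Rightarrow> bool" where
  "rgraph_iso = (\<lambda>(G, vs) (H, ws). \<exists>\<phi>. graph_iso \<phi> G H \<and> map \<phi> vs = ws)"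

definition lgraph_iso :: "'a lgraph \<Rightarrow> 'b lgraph \<Rightarrow> bool" where
  "lgraph_iso = (\<lambda>(G, \<xi>, v) (H, \<eta>, w).
     \<exists>\<phi>. graph_iso \<phi> G H \<and> \<phi> v = w \<and> (\<forall>u\<in>verts G. \<eta> (\<phi> u) = \<xi> u))"

definition rclass :: "'a rgraph \<Rightarrow> nat rgraph set" where
  "rclass x = {y. rgraph_iso x y}"

definition lclass :: "'a lgraph \<Rightarrow> nat lgraph set" where
  "lclass x = {y. lgraph_iso x y}"

definition rgraphs :: "nat \<Rightarrow> nat \<Rightarrow> nat rgraph set" where
  "rgraphs D k = {(G, vs). connected_graph G \<and> degree_bounded D G \<and>
                     set vs \<subseteq> verts G \<and> length vs = k}"

definition lgraphs :: "nat \<Rightarrow> nat lgraph set" where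
  "lgraphs D = {(G, \<xi>, v). connected_graph G \<and> degree_bounded D G \<and>
                     \<xi> ` verts G \<subseteq> {0..1} \<and> v \<in> verts G}"

definition roots_ball :: "nat \<Rightarrow> 'a graph \<Rightarrow> 'a list \<Rightarrow> 'a graph" where
  "roots_ball r G vs = (let A = {u \<in> verts G. \<exists>v\<in>set vs. graph_dist G v u \<le> r}
                        in \<lparr>verts = A, edges = edges G \<inter> A \<times> A\<rparr>)"

definition rnear :: "nat \<Rightarrow> 'a rgraph \<Rightarrow> 'b rgraph \<Rightarrow> bool" where
  "rnear r = (\<lambda>(G, vs) (H, ws).
     \<exists>\<phi>. graph_iso \<phi> (roots_ball r G vs) (roots_ball r H ws) \<and> map \<phi> vs = ws)"

definition lnear :: "nat \<Rightarrow> 'a lgraph \<Rightarrow> 'b lgraph \<Rightarrow> bool" where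
  "lnear r = (\<lambda>(G, \<xi>, v) (H, \<eta>, w).
     \<exists>\<phi>. graph_iso \<phi> (roots_ball r G [v]) (roots_ball r H [w]) \<and> \<phi> v = w \<and>
         (\<forall>u\<in>verts (roots_ball r G [v]). \<bar>\<eta> (\<phi> u) - \<xi> u\<bar> < 1 / Suc r))"

text \<open>The Borel \<open>\<sigma>\<close>-algebra of the topology on the classes of the members of \<open>X\<close> in which
  \<open>near r x\<close>, for \<open>r\<close> in \<open>\<nat>\<close>, is a neighbourhood basis of the class of \<open>x\<close>.  Below this is
  the local (Benjamini--Schramm) topology.\<close>

definition local_borel :: "'x set \<Rightarrow> ('x \<Rightarrow> 'c) \<Rightarrow> (nat \<Rightarrow> 'x \<Rightarrow> 'x \<Rightarrow> bool) \<Rightarrow> 'c measure" where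
  "local_borel X cl near = sigma (cl ` X)
     {U. U \<subseteq> cl ` X \<and> (\<forall>x\<in>X. cl x \<in> U \<longrightarrow> (\<exists>r. \<forall>y\<in>X. near r x y \<longrightarrow> cl y \<in> U))}"

text \<open>Graphs with \<open>k\<close> ordered roots: \<open>k = 1\<close> gives the rooted graphs, \<open>k = 2\<close> the doubly rooted
  ones.\<close>

definition rooted_space :: "nat \<Rightarrow> nat \<Rightarrow> nat rgraph set measure" where
  "rooted_space D k = local_borel (rgraphs D k) rclass rnear"

definition labelled_space :: "nat \<Rightarrow> nat lgraph set measure" where
  "labelled_space D = local_borel (lgraphs D) lclass lnear"

text \<open>Representatives of a class.  Everything computed from them below is invariant under
  isomorphism, hence independent of the choice.\<close>

definition the_graph :: "nat rgraph set \<Rightarrow> nat graph" where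
  "the_graph c = fst (SOME x. x \<in> c)"

definition the_root :: "nat rgraph set \<Rightarrow> nat" where
  "the_root c = hd (snd (SOME x. x \<in> c))"

definition mass_transport :: "nat \<Rightarrow> nat rgraph set measure \<Rightarrow> bool" where
  "mass_transport D \<nu> \<longleftrightarrow>
     (\<forall>f :: nat rgraph set \<Rightarrow> ennreal. f \<in> borel_measurable (rooted_space D 2) \<longrightarrow>
        (\<integral>\<^sup>+c. (\<integral>\<^sup>+v. f (rclass (the_graph c, [v, the_root c]))
                  \<partial>count_space (verts (the_graph c))) \<partial>\<nu>) =
        (\<integral>\<^sup>+c. (\<integral>\<^sup>+v. f (rclass (the_graph c, [the_root c, v]))
                  \<partial>count_space (verts (the_graph c))) \<partial>\<nu>))"

text \<open>\<open>\<nu>\<close> is the law of a unimodular random rooted graph which is almost surely isomorphic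
  to \<open>G\<close>.  The graph \<open>G\<close> is unimodular when such a law exists; for connected \<open>G\<close> it is then
  unique.\<close>

definition unimodular_law :: "nat \<Rightarrow> 'a graph \<Rightarrow> nat rgraph set measure \<Rightarrow> bool" where
  "unimodular_law D G \<nu> \<longleftrightarrow>
     prob_space \<nu> \<and> sets \<nu> = sets (rooted_space D 1) \<and> mass_transport D \<nu> \<and>
     (AE c in \<nu>. \<exists>\<phi>. graph_iso \<phi> G (the_graph c))"

definition L2_space :: "'x measure \<Rightarrow> ('x \<Rightarrow> complex) set" where
  "L2_space M = {f \<in> borel_measurable M. integrable M (\<lambda>x. (cmod (f x))\<^sup>2)}"

definition L2_inner :: "'x measure \<Rightarrow> ('x \<Rightarrow> complex) \<Rightarrow> ('x \<Rightarrow> complex) \<Rightarrow> complex" where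
  "L2_inner M f g = (\<integral>x. f x * cnj (g x) \<partial>M)"

definition L2_norm :: "'x measure \<Rightarrow> ('x \<Rightarrow> complex) \<Rightarrow> real" where
  "L2_norm M f = sqrt (\<integral>x. (cmod (f x))\<^sup>2 \<partial>M)"

definition orth_complement :: "'x measure \<Rightarrow> ('x \<Rightarrow> complex) set \<Rightarrow> ('x \<Rightarrow> complex) set" where
  "orth_complement M S = {f \<in> L2_space M. \<forall>g\<in>S. L2_inner M f g = 0}"

text \<open>Elements of the Hilbert space are represented by functions, and equality is equality almost
  everywhere.  Linearity and boundedness together imply that a bounded operator respects
  this equality.\<close>

definition bounded_op ::
  "'x measure \<Rightarrow> ('x \<Rightarrow> complex) set \<Rightarrow> (('x \<Rightarrow> complex) \<Rightarrow> ('x \<Rightarrow> complex)) \<Rightarrow> bool" where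
  "bounded_op M X A \<longleftrightarrow>
     (\<forall>f\<in>X. A f \<in> X) \<and>
     (\<forall>f\<in>X. \<forall>g\<in>X. \<forall>a b. AE x in M. A (\<lambda>y. a * f y + b * g y) x = a * A f x + b * A g x) \<and>
     (\<exists>C. \<forall>f\<in>X. L2_norm M (A f) \<le> C * L2_norm M f)"

text \<open>The spectrum of \<open>T\<close> on the closed \<open>T\<close>-invariant subspace \<open>X\<close> of \<open>L2_space M\<close>: those \<open>z\<close>
  for which \<open>z - T\<close> has no bounded inverse on \<open>X\<close>.\<close>

definition spectrum_on ::
  "'x measure \<Rightarrow> ('x \<Rightarrow> complex) set \<Rightarrow> (('x \<Rightarrow> complex) \<Rightarrow> ('x \<Rightarrow> complex)) \<Rightarrow> complex set" where
  "spectrum_on M X T =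
     {z. \<not> (\<exists>A. bounded_op M X A \<and>
              (\<forall>f\<in>X. (AE x in M. A (\<lambda>y. z * f y - T f y) x = f x) \<and>
                      (AE x in M. z * A f x - T (A f) x = f x)))}"

definition markov :: "'x rel \<Rightarrow> ('x \<Rightarrow> complex) \<Rightarrow> 'x \<Rightarrow> complex" where
  "markov E f x = (1 / of_nat (vertex_degree E x)) * (\<Sum>y\<in>E `` {x}. f y)"

definition degree_measure :: "'a graph \<Rightarrow> 'a measure" where
  "degree_measure G = point_measure (verts G) (\<lambda>v. ennreal (vertex_degree (edges G) v))"

definition graph_spectrum :: "'a graph \<Rightarrow> complex set" where
  "graph_spectrum G =
     spectrum_on (degree_measure G) (L2_space (degree_measure G)) (markov (edges G))"

definition bernoulli_edges :: "nat \<Rightarrow> nat lgraph set rel" where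
  "bernoulli_edges D =
     {(lclass (G, \<xi>, v), lclass (G, \<xi>, w)) | G \<xi> v w. (G, \<xi>, v) \<in> lgraphs D \<and> (v, w) \<in> edges G}"

definition label_measure :: "nat graph \<Rightarrow> (nat \<Rightarrow> real) measure" where
  "label_measure G = (\<Pi>\<^sub>M v\<in>verts G. restrict_space lborel {0..1})"

definition bernoulli_measure :: "nat \<Rightarrow> nat rgraph set measure \<Rightarrow> nat lgraph set measure" where
  "bernoulli_measure D \<nu> =
     measure_of (space (labelled_space D)) (sets (labelled_space D))
       (\<lambda>A. \<integral>\<^sup>+c. (\<integral>\<^sup>+\<xi>. indicator A (lclass (the_graph c, \<xi>, the_root c))
                     \<partial>label_measure (the_graph c)) \<partial>\<nu>)"

definition biased :: "('x \<Rightarrow> real) \<Rightarrow> 'x measure \<Rightarrow> 'x measure" where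
  "biased d M = density M (\<lambda>x. ennreal (d x / (\<integral>y. d y \<partial>M)))"

definition \<mu>_star :: "nat \<Rightarrow> nat rgraph set measure \<Rightarrow> nat lgraph set measure" where
  "\<mu>_star D \<nu> = biased (\<lambda>x. real (vertex_degree (bernoulli_edges D) x)) (bernoulli_measure D \<nu>)"

definition \<nu>_star :: "nat rgraph set measure \<Rightarrow> nat rgraph set measure" where
  "\<nu>_star \<nu> = biased (\<lambda>c. real (vertex_degree (edges (the_graph c)) (the_root c))) \<nu>"

definition forget_labels :: "nat lgraph set \<Rightarrow> nat rgraph set" where
  "forget_labels x = (case SOME z. z \<in> x of (G, \<xi>, v) \<Rightarrow> rclass (G, [v]))"

definition structured_subspace ::
  "nat \<Rightarrow> nat rgraph set measure \<Rightarrow> (nat lgraph set \<Rightarrow> complex) set" where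
  "structured_subspace D \<nu> =
     {F \<in> L2_space (\<mu>_star D \<nu>).
        \<exists>f\<in>L2_space (\<nu>_star \<nu>). AE x in \<mu>_star D \<nu>. F x = f (forget_labels x)}"

definition random_subspace ::
  "nat \<Rightarrow> nat rgraph set measure \<Rightarrow> (nat lgraph set \<Rightarrow> complex) set" where
  "random_subspace D \<nu> = orth_complement (\<mu>_star D \<nu>) (structured_subspace D \<nu>)"

definition random_spectrum :: "nat \<Rightarrow> nat rgraph set measure \<Rightarrow> complex set" where
  "random_spectrum D \<nu> =
     spectrum_on (\<mu>_star D \<nu>) (random_subspace D \<nu>) (markov (bernoulli_edges D))"

end

theory Submission
  imports Defs
begin

text \<open>The spectra are compared through a single criterion that refers to neither operator's inverse.  For a
self-adjoint contraction \<open>T\<close> and \<open>z \<in> \<complex>\<close> let \<open>K = 1 - t (z - T)\<^sup>* (z - T)\<close> with \<open>t = 1 / (\<bar>z\<bar> + 1)\<^sup>2\<close>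
(\<open>defect z T\<close> below).  Then \<open>0 \<le> K \<le> 1\<close>, and \<open>z\<close> lies outside the spectrum of \<open>T\<close> exactly when
\<open>\<parallel>K\<parallel> \<le> q\<close> for some \<open>q < 1\<close> (\<open>notin_spectrum_iff\<close>): if \<open>z - T\<close> is bounded below then \<open>K\<close> is a strict
contraction, and conversely the Neumann series of \<open>K\<close> inverts \<open>(z - T)\<^sup>* (z - T)\<close>.  As \<open>K\<close> is symmetric, the
norms \<open>\<parallel>K\<^sup>n f\<parallel>\<close> are log-convex in \<open>n\<close>, so \<open>\<parallel>K\<parallel> \<le> q\<close> follows once \<open>\<langle>K\<^sup>n f, f\<rangle> = O(q\<^sup>n)\<close> for a dense set
of \<open>f\<close>, with constants that may depend on \<open>f\<close> (\<open>defect_bound_of_dense\<close>).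

So for each \<open>q\<close> it suffices to relate the norm of \<open>K\<close> on \<open>\<ell>\<^sup>2\<close> of the graph to its norm on the random
subspace.  Both are equivalent to exponential decay of the kernel \<open>k\<^sub>n(u, v) = (K\<^sup>n \<delta>\<^sub>u)(v)\<close> of the graph,
\<open>\<bar>k\<^sub>n(u, v)\<bar> \<le> C(u, v) q\<^sup>n\<close> for all vertices \<open>u, v\<close> (\<open>kernel_decay\<close>).

On the graph this is immediate in one direction, and in the other the finitely supported functions are
the required dense set.

On the graphing, almost every labelling \<open>\<xi>\<close> is injective and so identifies the graph with a component of the
graphing, on which the Markov operator of the graphing acts as that of the graph.  Hence over a vertex \<open>v\<close>
one has \<open>(K\<^sup>n F)(\<xi>, v) = \<Sum>\<^sub>w k\<^sub>n(w, v) F(\<xi>, w)\<close>, a finite sum.  A bound on \<open>K\<close> yields the kernel: take for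
\<open>F\<close> the centred label \<open>\<xi>(root) - 1/2\<close> of the root.  It lies in the random subspace, distinct labels
are orthogonal, and pairing \<open>K\<^sup>n F\<close> over \<open>v\<close> with the centred label of \<open>u\<close> gives \<open>k\<^sub>n(u, v) / 12\<close>
(\<open>kernel_decay_of_random_bound\<close>).  Conversely, functions in the random subspace that depend on a ball of
finite radius around the root are dense in it (\<open>centred_local_dense\<close>).  For such \<open>F\<close> the random variables
\<open>F(\<xi>, w)\<close> and \<open>F(\<xi>, v)\<close> have mean zero and are independent once the balls around \<open>w\<close> and \<open>v\<close> are disjoint, so
only finitely many kernel entries contribute to \<open>\<langle>K\<^sup>n F, F\<rangle>\<close> (\<open>random_bound_of_kernel_decay\<close>).

Unimodularity enters through the mass transport principle, which makes the Markov operator of the graphing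
self-adjoint and gives every orbit positive weight.  By quasi-transitivity there are finitely many orbits, so
that integrals over the graphing are finite weighted sums, one term per orbit, of integrals over the
labellings.\<close>

section \<open>Square-integrable functions\<close>

lemma L2_spaceI:
  "f \<in> borel_measurable M \<Longrightarrow> integrable M (\<lambda>x. (cmod (f x))\<^sup>2) \<Longrightarrow> f \<in> L2_space M"
  by (simp add: L2_space_def)

lemma L2_measurable: "f \<in> L2_space M \<Longrightarrow> f \<in> borel_measurable M"
  by (simp add: L2_space_def)

lemma L2_integrable_sq: "f \<in> L2_space M \<Longrightarrow> integrable M (\<lambda>x. (cmod (f x))\<^sup>2)"
  by (simp add: L2_space_def)

lemma borel_measurable_cnj [measurable (raw)]:
  "f \<in> borel_measurable M \<Longrightarrow> (\<lambda>x. cnj (f x)) \<in> borel_measurable M"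
  by (rule measurable_compose[OF _ borel_measurable_continuous_onI[OF continuous_on_cnj[OF continuous_on_id]], simplified])

lemma cmod_lincomb_sq:
  "(cmod (a * u + b * v))\<^sup>2 \<le> 2 * (cmod a)\<^sup>2 * (cmod u)\<^sup>2 + 2 * (cmod b)\<^sup>2 * (cmod v)\<^sup>2"
proof -
  have "cmod (a * u + b * v) \<le> cmod a * cmod u + cmod b * cmod v"
    by (metis norm_mult norm_triangle_ineq)
  then have "(cmod (a * u + b * v))\<^sup>2 \<le> (cmod a * cmod u + cmod b * cmod v)\<^sup>2"
    by (intro power_mono) auto
  also have "\<dots> \<le> 2 * (cmod a * cmod u)\<^sup>2 + 2 * (cmod b * cmod v)\<^sup>2"
    using sum_squares_bound[of "cmod a * cmod u" "cmod b * cmod v"]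
    by (simp add: power2_sum)
  finally show ?thesis by (simp add: power_mult_distrib mult.assoc)
qed

lemma L2_lincomb:
  assumes "f \<in> L2_space M" "g \<in> L2_space M"
  shows "(\<lambda>x. a * f x + b * g x) \<in> L2_space M"
proof (rule L2_spaceI)
  note [measurable] = L2_measurable[OF assms(1)] L2_measurable[OF assms(2)]
  show "(\<lambda>x. a * f x + b * g x) \<in> borel_measurable M" by measurable
  have "integrable M (\<lambda>x. 2 * (cmod a)\<^sup>2 * (cmod (f x))\<^sup>2 + 2 * (cmod b)\<^sup>2 * (cmod (g x))\<^sup>2)"
    using L2_integrable_sq[OF assms(1)] L2_integrable_sq[OF assms(2)] by simp
  then show "integrable M (\<lambda>x. (cmod (a * f x + b * g x))\<^sup>2)"
    by (rule Bochner_Integration.integrable_bound) (use cmod_lincomb_sq in auto)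
qed

lemma L2_add: "f \<in> L2_space M \<Longrightarrow> g \<in> L2_space M \<Longrightarrow> (\<lambda>x. f x + g x) \<in> L2_space M"
  using L2_lincomb[of f M g 1 1] by simp

lemma L2_diff: "f \<in> L2_space M \<Longrightarrow> g \<in> L2_space M \<Longrightarrow> (\<lambda>x. f x - g x) \<in> L2_space M"
  using L2_lincomb[of f M g 1 "-1"] by simp

lemma L2_scale: "f \<in> L2_space M \<Longrightarrow> (\<lambda>x. a * f x) \<in> L2_space M"
  using L2_lincomb[of f M f a 0] by simp

lemma L2_zero: "(\<lambda>x. 0) \<in> L2_space M"
  by (simp add: L2_space_def)

lemma L2_sum:
  assumes "finite I" "\<And>i. i \<in> I \<Longrightarrow> f i \<in> L2_space M"
  shows "(\<lambda>x. \<Sum>i\<in>I. f i x) \<in> L2_space M"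
  using assms by (induction I rule: finite_induct) (auto intro: L2_add L2_zero)

lemma L2_inner_integrable:
  assumes "f \<in> L2_space M" "g \<in> L2_space M"
  shows "integrable M (\<lambda>x. f x * cnj (g x))"
proof -
  note [measurable] = L2_measurable[OF assms(1)] L2_measurable[OF assms(2)]
  have "integrable M (\<lambda>x. (cmod (f x))\<^sup>2 + (cmod (g x))\<^sup>2)"
    using L2_integrable_sq[OF assms(1)] L2_integrable_sq[OF assms(2)] by simp
  then show ?thesis
  proof (rule Bochner_Integration.integrable_bound)
    show "AE x in M. norm (f x * cnj (g x)) \<le> norm ((cmod (f x))\<^sup>2 + (cmod (g x))\<^sup>2)"
    proof (rule AE_I2)
      fix x
      have "2 * (cmod (f x) * cmod (g x)) \<le> (cmod (f x))\<^sup>2 + (cmod (g x))\<^sup>2"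
        using sum_squares_bound[of "cmod (f x)" "cmod (g x)"] by (simp add: mult.assoc)
      moreover have "0 \<le> cmod (f x) * cmod (g x)" by simp
      ultimately have "cmod (f x) * cmod (g x) \<le> (cmod (f x))\<^sup>2 + (cmod (g x))\<^sup>2" by linarith
      then show "norm (f x * cnj (g x)) \<le> norm ((cmod (f x))\<^sup>2 + (cmod (g x))\<^sup>2)"
        by (simp add: norm_mult)
    qed
  qed measurable
qed

lemma L2_norm_nonneg [simp]: "0 \<le> L2_norm M f"
  by (simp add: L2_norm_def)

lemma L2_norm_sq: "(L2_norm M f)\<^sup>2 = (\<integral>x. (cmod (f x))\<^sup>2 \<partial>M)"
  by (simp add: L2_norm_def)

lemma L2_inner_self: "L2_inner M f f = of_real ((L2_norm M f)\<^sup>2)"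
proof -
  have "L2_inner M f f = (\<integral>x. complex_of_real ((cmod (f x))\<^sup>2) \<partial>M)"
    unfolding L2_inner_def complex_norm_square ..
  then show ?thesis
    by (simp only: integral_complex_of_real L2_norm_sq)
qed

lemma L2_inner_cnj: "L2_inner M g f = cnj (L2_inner M f g)"
proof -
  have "cnj (L2_inner M f g) = (\<integral>x. cnj (f x * cnj (g x)) \<partial>M)"
    unfolding L2_inner_def by (simp del: complex_cnj_mult)
  also have "\<dots> = L2_inner M g f"
    unfolding L2_inner_def by (simp add: mult.commute)
  finally show ?thesis by simp
qed

lemma L2_inner_lincomb_left:
  assumes "f \<in> L2_space M" "g \<in> L2_space M" "h \<in> L2_space M"
  shows "L2_inner M (\<lambda>x. a * f x + b * g x) h = a * L2_inner M f h + b * L2_inner M g h"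
proof -
  have "L2_inner M (\<lambda>x. a * f x + b * g x) h =
      (\<integral>x. a * (f x * cnj (h x)) + b * (g x * cnj (h x)) \<partial>M)"
    unfolding L2_inner_def by (simp add: algebra_simps)
  also have "\<dots> = (\<integral>x. a * (f x * cnj (h x)) \<partial>M) + (\<integral>x. b * (g x * cnj (h x)) \<partial>M)"
    using assms by (intro Bochner_Integration.integral_add integrable_mult_right L2_inner_integrable)
  finally show ?thesis by (simp add: L2_inner_def)
qed

lemma L2_inner_lincomb_right:
  assumes "f \<in> L2_space M" "g \<in> L2_space M" "h \<in> L2_space M"
  shows "L2_inner M h (\<lambda>x. a * f x + b * g x) = cnj a * L2_inner M h f + cnj b * L2_inner M h g"
  using L2_inner_lincomb_left[OF assms, of a b]
  by (subst (1 2 3) L2_inner_cnj) simp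

lemma L2_norm_lincomb_sq:
  assumes "f \<in> L2_space M" "g \<in> L2_space M"
  shows "(L2_norm M (\<lambda>x. a * f x + b * g x))\<^sup>2 =
    (cmod a)\<^sup>2 * (L2_norm M f)\<^sup>2 + (cmod b)\<^sup>2 * (L2_norm M g)\<^sup>2 + 2 * Re (a * cnj b * L2_inner M f g)"
proof -
  let ?h = "\<lambda>x. a * f x + b * g x"
  have h: "?h \<in> L2_space M" using assms by (rule L2_lincomb)
  have "complex_of_real ((L2_norm M ?h)\<^sup>2) = L2_inner M ?h ?h" by (simp add: L2_inner_self)
  also have "\<dots> = a * (cnj a * L2_inner M f f + cnj b * L2_inner M f g)
      + b * (cnj a * L2_inner M g f + cnj b * L2_inner M g g)"
    by (simp only: L2_inner_lincomb_left[OF assms h] L2_inner_lincomb_right[OF assms assms(1)]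
        L2_inner_lincomb_right[OF assms assms(2)])
  finally have "Re (complex_of_real ((L2_norm M ?h)\<^sup>2)) = Re (a * (cnj a * L2_inner M f f + cnj b * L2_inner M f g)
      + b * (cnj a * L2_inner M g f + cnj b * L2_inner M g g))" by (rule arg_cong)
  then show ?thesis
    unfolding L2_inner_self L2_inner_cnj[of M g f] cmod_power2 by (simp add: algebra_simps power2_eq_square)
qed

lemma L2_norm_cong_AE:
  assumes "AE x in M. f x = g x" "f \<in> borel_measurable M" "g \<in> borel_measurable M"
  shows "L2_norm M f = L2_norm M g"
  unfolding L2_norm_def using assms by (intro arg_cong[where f = sqrt] integral_cong_AE) auto

lemma L2_norm_eq_0_iff:
  assumes "f \<in> L2_space M"
  shows "L2_norm M f = 0 \<longleftrightarrow> (AE x in M. f x = 0)"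
  unfolding L2_norm_def
  using integral_nonneg_eq_0_iff_AE[OF L2_integrable_sq[OF assms]] by simp

lemma L2_norm_diff_eq_0_iff:
  assumes "f \<in> L2_space M" "g \<in> L2_space M"
  shows "L2_norm M (\<lambda>x. f x - g x) = 0 \<longleftrightarrow> (AE x in M. f x = g x)"
  using L2_norm_eq_0_iff[OF L2_diff[OF assms]] by simp

lemma L2_norm_scale: "L2_norm M (\<lambda>x. a * f x) = cmod a * L2_norm M f"
proof -
  have "(\<integral>x. (cmod (a * f x))\<^sup>2 \<partial>M) = (\<integral>x. (cmod a)\<^sup>2 * (cmod (f x))\<^sup>2 \<partial>M)"
    by (simp add: norm_mult power_mult_distrib)
  then show ?thesis by (simp add: L2_norm_def real_sqrt_mult)
qed

text \<open>The optimal choice is \<open>s = 1 / G\<close>.  For \<open>G = 0\<close> the expression is affine in \<open>s\<close>, and \<open>s = (F + 1) / b\<close> makes it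
  negative.\<close>

lemma quadratic_nonneg_imp_bound:
  fixes F G b :: real
  assumes *: "\<And>s. 0 \<le> F + (s\<^sup>2 * G - 2 * s) * b" and "0 \<le> F" "0 \<le> G" "0 \<le> b"
  shows "b \<le> F * G"
proof (cases "G = 0")
  case False
  with \<open>0 \<le> G\<close> have "G > 0" by simp
  moreover have "(1 / G)\<^sup>2 * G - 2 * (1 / G) = - (1 / G)"
    using False by (simp add: field_simps power2_eq_square)
  ultimately have "0 \<le> F - b / G" using *[of "1 / G"] by simp
  with \<open>G > 0\<close> show ?thesis by (simp add: field_simps)
next
  case True
  have "b = 0"
  proof (rule ccontr)
    assume "b \<noteq> 0"
    have "0 \<le> F + (((F + 1) / b)\<^sup>2 * G - 2 * ((F + 1) / b)) * b" by (rule *)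
    also have "\<dots> = F - 2 * (F + 1)" using \<open>b \<noteq> 0\<close> True by (simp add: left_diff_distrib)
    finally show False using \<open>0 \<le> F\<close> by simp
  qed
  with True show ?thesis by simp
qed

lemma L2_Cauchy_Schwarz:
  assumes "f \<in> L2_space M" "g \<in> L2_space M"
  shows "cmod (L2_inner M f g) \<le> L2_norm M f * L2_norm M g"
proof -
  let ?c = "L2_inner M f g" and ?F = "(L2_norm M f)\<^sup>2" and ?G = "(L2_norm M g)\<^sup>2"
  \<comment> \<open>this is \<open>\<parallel>f - s \<langle>f, g\<rangle> g\<parallel>\<^sup>2\<close>\<close>
  have *: "0 \<le> ?F + (s\<^sup>2 * ?G - 2 * s) * (cmod ?c)\<^sup>2" for s :: real
  proof -
    have "0 \<le> (L2_norm M (\<lambda>x. 1 * f x + (- (of_real s * ?c)) * g x))\<^sup>2" by simp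
    also have "\<dots> = ?F + (cmod (- (of_real s * ?c)))\<^sup>2 * ?G + 2 * Re (cnj (- (of_real s * ?c)) * ?c)"
      unfolding L2_norm_lincomb_sq[OF assms] by simp
    also have "Re (cnj (- (of_real s * ?c)) * ?c) = - s * (cmod ?c)\<^sup>2"
      unfolding cmod_power2 by (simp add: power2_eq_square algebra_simps)
    also have "(cmod (- (of_real s * ?c)))\<^sup>2 = s\<^sup>2 * (cmod ?c)\<^sup>2"
      by (simp add: norm_mult power_mult_distrib)
    finally show ?thesis
      by (simp add: algebra_simps)
  qed
  have "(cmod ?c)\<^sup>2 \<le> ?F * ?G"
    using * by (rule quadratic_nonneg_imp_bound) simp_all
  then have "(cmod ?c)\<^sup>2 \<le> (L2_norm M f * L2_norm M g)\<^sup>2" by (simp add: power_mult_distrib)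
  then show ?thesis by (rule power2_le_imp_le) simp
qed

lemma L2_norm_triangle:
  assumes "f \<in> L2_space M" "g \<in> L2_space M"
  shows "L2_norm M (\<lambda>x. f x + g x) \<le> L2_norm M f + L2_norm M g"
proof (rule power2_le_imp_le)
  have "(L2_norm M (\<lambda>x. f x + g x))\<^sup>2 = (L2_norm M f)\<^sup>2 + (L2_norm M g)\<^sup>2 + 2 * Re (L2_inner M f g)"
    using L2_norm_lincomb_sq[OF assms, of 1 1] by simp
  also have "Re (L2_inner M f g) \<le> L2_norm M f * L2_norm M g"
    using L2_Cauchy_Schwarz[OF assms] complex_Re_le_cmod order_trans by blast
  finally show "(L2_norm M (\<lambda>x. f x + g x))\<^sup>2 \<le> (L2_norm M f + L2_norm M g)\<^sup>2"
    by (simp add: power2_sum)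
qed simp

lemma L2_norm_triangle_lincomb:
  assumes "f \<in> L2_space M" "g \<in> L2_space M"
  shows "L2_norm M (\<lambda>x. a * f x + b * g x) \<le> cmod a * L2_norm M f + cmod b * L2_norm M g"
  using L2_norm_triangle[OF L2_scale[OF assms(1), of a] L2_scale[OF assms(2), of b]]
  by (simp add: L2_norm_scale)

lemma L2_norm_triangle_diff:
  assumes "f \<in> L2_space M" "g \<in> L2_space M"
  shows "L2_norm M (\<lambda>x. f x - g x) \<le> L2_norm M f + L2_norm M g"
  using L2_norm_triangle_lincomb[OF assms, of 1 "-1"] by simp

lemma L2_norm_minus_commute: "L2_norm M (\<lambda>x. f x - g x) = L2_norm M (\<lambda>x. g x - f x)"
  by (simp add: L2_norm_def norm_minus_commute)

lemma L2_norm_sum: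
  assumes "finite I" "\<And>i. i \<in> I \<Longrightarrow> f i \<in> L2_space M"
  shows "L2_norm M (\<lambda>x. \<Sum>i\<in>I. f i x) \<le> (\<Sum>i\<in>I. L2_norm M (f i))"
  using assms
proof (induction I rule: finite_induct)
  case empty
  then show ?case by (simp add: L2_norm_def)
next
  case (insert i I)
  have "L2_norm M (\<lambda>x. f i x + (\<Sum>i\<in>I. f i x)) \<le> L2_norm M (f i) + L2_norm M (\<lambda>x. \<Sum>i\<in>I. f i x)"
    using insert by (intro L2_norm_triangle L2_sum) auto
  with insert show ?case by simp
qed

lemma L2_norm_real_mono:
  assumes "f \<in> L2_space M" "g \<in> borel_measurable M" "\<And>x. x \<in> space M \<Longrightarrow> cmod (g x) \<le> cmod (f x)"
  shows "g \<in> L2_space M"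
proof (rule L2_spaceI[OF assms(2)])
  note [measurable] = assms(2)
  show "integrable M (\<lambda>x. (cmod (g x))\<^sup>2)"
  proof (rule Bochner_Integration.integrable_bound[OF L2_integrable_sq[OF assms(1)]])
    show "AE x in M. norm ((cmod (g x))\<^sup>2) \<le> norm ((cmod (f x))\<^sup>2)"
      by (rule AE_I2) (simp add: assms(3) power_mono)
  qed measurable
qed

text \<open>Riesz--Fischer.  The partial sums of \<open>\<Sum>n. \<bar>f n\<bar>\<close> have bounded norm, so by monotone
  convergence this sum is square integrable; it dominates the partial sums of \<open>f\<close>.\<close>

lemma L2_complete:
  assumes f: "\<And>n. f n \<in> L2_space M" and sum: "summable (\<lambda>n. L2_norm M (f n))"
  shows "\<exists>F\<in>L2_space M. (\<lambda>n. L2_norm M (\<lambda>x. (\<Sum>k<n. f k x) - F x)) \<longlonglongrightarrow> 0"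
proof -
  note [measurable] = L2_measurable[OF f]
  define S where "S = (\<Sum>n. L2_norm M (f n))"
  define g where "g n x = (\<Sum>k<n. cmod (f k x))" for n x
  have [measurable]: "g n \<in> borel_measurable M" for n unfolding g_def by measurable
  have g0: "0 \<le> g n x" for n x unfolding g_def by (simp add: sum_nonneg)
  have gmono: "g n x \<le> g m x" if "n \<le> m" for n m x
    unfolding g_def using that by (intro sum_mono2) auto
  have absL2: "(\<lambda>x. of_real (cmod (f n x))) \<in> L2_space M" for n
    using f[of n] by (auto simp: L2_space_def)
  have gL2: "(\<lambda>x. of_real (g n x)) \<in> L2_space M" for n
    unfolding g_def of_real_sum using absL2 by (intro L2_sum) auto
  have gnorm: "L2_norm M (\<lambda>x. of_real (g n x)) \<le> S" for n
  proof -
    have "L2_norm M (\<lambda>x. of_real (g n x)) \<le> (\<Sum>k<n. L2_norm M (\<lambda>x. of_real (cmod (f k x))))"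
      unfolding g_def of_real_sum using absL2 by (intro L2_norm_sum) auto
    also have "\<dots> = (\<Sum>k<n. L2_norm M (f k))" by (simp add: L2_norm_def)
    also have "\<dots> \<le> S" unfolding S_def using sum by (intro sum_le_suminf) auto
    finally show ?thesis .
  qed
  have S0: "0 \<le> S" unfolding S_def using sum by (intro suminf_nonneg) auto
  have gint: "(\<integral>\<^sup>+x. ennreal ((g n x)\<^sup>2) \<partial>M) \<le> ennreal (S\<^sup>2)" for n
  proof -
    have i: "integrable M (\<lambda>x. (g n x)\<^sup>2)" using L2_integrable_sq[OF gL2[of n]] by simp
    have "(\<integral>x. (g n x)\<^sup>2 \<partial>M) = (L2_norm M (\<lambda>x. of_real (g n x)))\<^sup>2" by (simp add: L2_norm_sq)
    also have "\<dots> \<le> S\<^sup>2" using gnorm by (intro power_mono) auto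
    finally show ?thesis using i by (simp add: nn_integral_eq_integral ennreal_leI)
  qed
  have "(\<integral>\<^sup>+x. (SUP n. ennreal ((g n x)\<^sup>2)) \<partial>M) = (SUP n. \<integral>\<^sup>+x. ennreal ((g n x)\<^sup>2) \<partial>M)"
    by (rule nn_integral_monotone_convergence_SUP)
       (auto simp: incseq_def le_fun_def intro!: ennreal_leI power_mono gmono g0)
  also have "\<dots> \<le> ennreal (S\<^sup>2)" by (rule SUP_least) (rule gint)
  finally have sup: "(\<integral>\<^sup>+x. (SUP n. ennreal ((g n x)\<^sup>2)) \<partial>M) < \<infinity>" by (rule le_less_trans) simp
  then have "AE x in M. (SUP n. ennreal ((g n x)\<^sup>2)) \<noteq> \<infinity>"
    by (intro nn_integral_PInf_AE) auto
  then have fin: "AE x in M. summable (\<lambda>n. cmod (f n x))"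
  proof eventually_elim
    case (elim x)
    obtain c where c: "0 \<le> c" "(SUP n. ennreal ((g n x)\<^sup>2)) = ennreal c"
      using elim by (cases "SUP n. ennreal ((g n x)\<^sup>2)") auto
    have "g n x \<le> sqrt c" for n
    proof -
      have "ennreal ((g n x)\<^sup>2) \<le> ennreal c" unfolding c(2)[symmetric] by (rule SUP_upper) simp
      then have "(g n x)\<^sup>2 \<le> c" using c(1) by simp
      then show ?thesis by (rule real_le_rsqrt)
    qed
    then show ?case
      unfolding g_def by (intro summableI_nonneg_bounded[where x = "sqrt c"]) auto
  qed
  define h where "h x = (SUP n. ennreal ((g n x)\<^sup>2))" for x
  have [measurable]: "h \<in> borel_measurable M" unfolding h_def by measurable
  have hfin: "AE x in M. h x \<noteq> \<infinity>" 
    by (rule nn_integral_PInf_AE[OF \<open>h \<in> borel_measurable M\<close> less_imp_neq[OF sup[folded h_def]]])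
  have hi: "integrable M (\<lambda>x. enn2real (h x))"
  proof (rule integrableI_nonneg)
    have "(\<integral>\<^sup>+x. ennreal (enn2real (h x)) \<partial>M) = (\<integral>\<^sup>+x. h x \<partial>M)"
    proof (rule nn_integral_cong_AE)
      show "AE x in M. ennreal (enn2real (h x)) = h x"
        using hfin by eventually_elim (simp add: ennreal_enn2real_if)
    qed
    also have "\<dots> < \<infinity>" unfolding h_def by (rule sup)
    finally show "(\<integral>\<^sup>+x. ennreal (enn2real (h x)) \<partial>M) < \<infinity>" .
  qed simp_all
  define F where "F x = (\<Sum>n. f n x)" for x
  have [measurable]: "F \<in> borel_measurable M" unfolding F_def by measurable
  have gh: "AE x in M. \<forall>n. (g n x)\<^sup>2 \<le> enn2real (h x)"
    using hfin
  proof eventually_elim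
    case (elim x)
    have "ennreal ((g n x)\<^sup>2) \<le> h x" for n unfolding h_def by (rule SUP_upper) simp
    moreover have "h x = ennreal (enn2real (h x))" using elim by (simp add: ennreal_enn2real_if)
    ultimately show ?case by (metis enn2real_nonneg ennreal_le_iff)
  qed
  have tail: "AE x in M. \<forall>n. (cmod ((\<Sum>k<n. f k x) - F x))\<^sup>2 \<le> enn2real (h x)"
    using fin gh
  proof eventually_elim
    case (elim x)
    show ?case
    proof
      fix n
      have s: "summable (\<lambda>n. f n x)" using elim(1) by (rule summable_norm_cancel)
      have conv: "(\<lambda>m. cmod ((\<Sum>k<n. f k x) - (\<Sum>k<m. f k x))) \<longlonglongrightarrow> cmod ((\<Sum>k<n. f k x) - F x)"
        unfolding F_def by (intro tendsto_intros summable_LIMSEQ s)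
      have le: "cmod ((\<Sum>k<n. f k x) - (\<Sum>k<m. f k x)) \<le> sqrt (enn2real (h x))" if "m \<ge> n" for m
      proof -
        have "(\<Sum>k<m. f k x) = (\<Sum>k<n. f k x) + (\<Sum>k\<in>{n..<m}. f k x)"
          using that by (simp add: sum.atLeastLessThan_concat lessThan_atLeast0)
        then have "cmod ((\<Sum>k<n. f k x) - (\<Sum>k<m. f k x)) = cmod (\<Sum>k\<in>{n..<m}. f k x)" by simp
        also have "\<dots> \<le> (\<Sum>k\<in>{n..<m}. cmod (f k x))" by (rule norm_sum)
        also have "\<dots> \<le> g m x" unfolding g_def by (intro sum_mono2) auto
        also have "\<dots> \<le> sqrt (enn2real (h x))" by (rule real_le_rsqrt[OF elim(2)[rule_format]])
        finally show ?thesis .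
      qed
      have "cmod ((\<Sum>k<n. f k x) - F x) \<le> sqrt (enn2real (h x))"
        using le by (intro LIMSEQ_le_const2[OF conv] exI[of _ n]) blast
      then have "(cmod ((\<Sum>k<n. f k x) - F x))\<^sup>2 \<le> (sqrt (enn2real (h x)))\<^sup>2" by (intro power_mono) auto
      then show "(cmod ((\<Sum>k<n. f k x) - F x))\<^sup>2 \<le> enn2real (h x)" by simp
    qed
  qed
  have lim: "AE x in M. (\<lambda>n. (cmod ((\<Sum>k<n. f k x) - F x))\<^sup>2) \<longlonglongrightarrow> 0"
    using fin
  proof eventually_elim
    case (elim x)
    have "(\<lambda>n. \<Sum>k<n. f k x) \<longlonglongrightarrow> F x"
      unfolding F_def by (rule summable_LIMSEQ[OF summable_norm_cancel[OF elim]])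
    then have "(\<lambda>n. (cmod ((\<Sum>k<n. f k x) - F x))\<^sup>2) \<longlonglongrightarrow> (cmod (F x - F x))\<^sup>2" by (intro tendsto_intros)
    then show ?case by simp
  qed
  have Fi: "integrable M (\<lambda>x. (cmod (F x))\<^sup>2)"
  proof (rule Bochner_Integration.integrable_bound[OF hi])
    show "AE x in M. norm ((cmod (F x))\<^sup>2) \<le> norm (enn2real (h x))"
      using tail
    proof eventually_elim
      case (elim x)
      from elim[rule_format, of 0] show ?case by simp
    qed
  qed measurable
  have "(\<lambda>n. \<integral>x. (cmod ((\<Sum>k<n. f k x) - F x))\<^sup>2 \<partial>M) \<longlonglongrightarrow> (\<integral>x. 0 \<partial>M)"
  proof (rule integral_dominated_convergence[OF _ _ hi lim])
    show "AE x in M. norm ((cmod ((\<Sum>k<n. f k x) - F x))\<^sup>2) \<le> enn2real (h x)" for n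
      using tail by eventually_elim auto
  qed measurable
  from tendsto_real_sqrt[OF this]
  have "(\<lambda>n. L2_norm M (\<lambda>x. (\<Sum>k<n. f k x) - F x)) \<longlonglongrightarrow> 0"
    by (simp add: L2_norm_def)
  then show ?thesis
  proof (rule bexI[of _ F])
    show "F \<in> L2_space M" by (rule L2_spaceI[OF \<open>F \<in> borel_measurable M\<close> Fi])
  qed
qed

section \<open>Spectra of self-adjoint contractions\<close>

text \<open>\<open>X\<close> is a closed subspace of functions rather than of classes of functions, and \<open>T\<close> is linear
  everywhere rather than almost everywhere.  Markov operators are defined pointwise and satisfy this,
  so that almost-everywhere statements are confined to the inverse.\<close>

locale self_adjoint_contraction =
  fixes M :: "'x measure" and X :: "('x \<Rightarrow> complex) set"
    and T :: "('x \<Rightarrow> complex) \<Rightarrow> ('x \<Rightarrow> complex)"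
  assumes subspace: "X \<subseteq> L2_space M"
    and lincomb: "\<And>f g a b. f \<in> X \<Longrightarrow> g \<in> X \<Longrightarrow> (\<lambda>x. a * f x + b * g x) \<in> X"
    and closed: "\<And>s f. (\<And>n. s n \<in> X) \<Longrightarrow> f \<in> L2_space M \<Longrightarrow>
        (\<lambda>n. L2_norm M (\<lambda>x. s n x - f x)) \<longlonglongrightarrow> 0 \<Longrightarrow> f \<in> X"
    and T_in: "\<And>f. f \<in> X \<Longrightarrow> T f \<in> X"
    and T_lincomb: "\<And>f g a b. T (\<lambda>x. a * f x + b * g x) = (\<lambda>x. a * T f x + b * T g x)"
    and T_sym: "\<And>f g. f \<in> X \<Longrightarrow> g \<in> X \<Longrightarrow> L2_inner M (T f) g = L2_inner M f (T g)"
    and T_contr: "\<And>f. f \<in> X \<Longrightarrow> L2_norm M (T f) \<le> L2_norm M f"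
begin

lemma in_L2: "f \<in> X \<Longrightarrow> f \<in> L2_space M"
  using subspace by auto

lemma in_X_diff: "f \<in> X \<Longrightarrow> g \<in> X \<Longrightarrow> (\<lambda>x. f x - g x) \<in> X"
  using lincomb[of f g 1 "-1"] by simp

lemma in_X_sum:
  assumes "I \<noteq> {}" "finite I" "\<And>i. i \<in> I \<Longrightarrow> f i \<in> X"
  shows "(\<lambda>x. \<Sum>i\<in>I. f i x) \<in> X"
  using assms(2,1,3)
proof (induction I rule: finite_ne_induct)
  case (insert i I)
  then show ?case using lincomb[of "f i" "\<lambda>x. \<Sum>i\<in>I. f i x" 1 1] by simp
qed auto

lemma norm_diff_small_imp_AE:
  assumes "f \<in> X" "g \<in> X" "\<And>e. e > 0 \<Longrightarrow> L2_norm M (\<lambda>x. f x - g x) \<le> e"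
  shows "AE x in M. f x = g x"
proof -
  have "L2_norm M (\<lambda>x. f x - g x) \<le> 0" by (rule field_le_epsilon) (use assms(3) in simp)
  then show ?thesis
    using L2_norm_diff_eq_0_iff[OF in_L2[OF assms(1)] in_L2[OF assms(2)]]
      L2_norm_nonneg[of M "\<lambda>x. f x - g x"] by simp
qed

end

text \<open>At most \<open>\<parallel>z - T\<parallel>\<^sup>-\<^sup>2\<close> for every contraction \<open>T\<close>.\<close>

definition resolvent_scale :: "complex \<Rightarrow> real" where
  "resolvent_scale z = 1 / (cmod z + 1)\<^sup>2"

text \<open>With \<open>t = resolvent_scale z\<close> and self-adjoint \<open>T\<close> this is \<open>1 - t (z - T)\<^sup>* (z - T)\<close>, expanded as a real
  polynomial in \<open>T\<close> so that it makes sense for the Markov operator of any graph.\<close>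

definition defect ::
  "complex \<Rightarrow> (('x \<Rightarrow> complex) \<Rightarrow> ('x \<Rightarrow> complex)) \<Rightarrow> ('x \<Rightarrow> complex) \<Rightarrow> ('x \<Rightarrow> complex)" where
  "defect z T f = (\<lambda>x. of_real (1 - resolvent_scale z * (cmod z)\<^sup>2) * f x
      + of_real (resolvent_scale z) * (of_real (2 * Re z) * T f x - T (T f) x))"

lemma resolvent_scale_pos: "0 < resolvent_scale z"
proof -
  have "0 < cmod z + 1" by (rule add_nonneg_pos) auto
  then show ?thesis by (simp add: resolvent_scale_def)
qed

context self_adjoint_contraction
begin

abbreviation "zshift z f \<equiv> (\<lambda>x. z * f x - T f x)"

lemma shift_in: "f \<in> X \<Longrightarrow> zshift z f \<in> X"
  using lincomb[of f "T f" z "-1"] T_in by simp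

lemma shift_lincomb: "zshift z (\<lambda>x. a * f x + b * g x) = (\<lambda>x. a * zshift z f x + b * zshift z g x)"
  by (simp add: T_lincomb fun_eq_iff algebra_simps)

lemma shift_bound:
  assumes "f \<in> X"
  shows "L2_norm M (zshift z f) \<le> (cmod z + 1) * L2_norm M f"
  using L2_norm_triangle_lincomb[OF in_L2[OF assms] in_L2[OF T_in[OF assms]], of z "-1"]
    T_contr[OF assms] by (simp add: algebra_simps)

lemma shift_adjoint:
  assumes "f \<in> X" "g \<in> X"
  shows "L2_inner M (zshift z f) g = L2_inner M f (zshift (cnj z) g)"
proof -
  note L = in_L2[OF assms(1)] in_L2[OF assms(2)] in_L2[OF T_in[OF assms(1)]] in_L2[OF T_in[OF assms(2)]]
  have "L2_inner M (zshift z f) g = z * L2_inner M f g - L2_inner M (T f) g"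
    using L2_inner_lincomb_left[OF L(1,3,2), of z "-1"] by simp
  moreover have "L2_inner M f (zshift (cnj z) g) = z * L2_inner M f g - L2_inner M f (T g)"
    using L2_inner_lincomb_right[OF L(2,4,1), of "cnj z" "-1"] by simp
  ultimately show ?thesis using T_sym[OF assms] by simp
qed

lemma defect_eq: "defect z T f = (\<lambda>x. 1 * f x + (- of_real (resolvent_scale z)) * zshift (cnj z) (zshift z f) x)"
proof -
  have TT: "T (zshift z f) = (\<lambda>x. z * T f x - T (T f) x)"
    using T_lincomb[of z f "-1" "T f"] by simp
  have zz: "complex_of_real ((cmod z)\<^sup>2) = cnj z * z" by (metis complex_norm_square mult.commute)
  have z2: "complex_of_real (2 * Re z) = z + cnj z" by (simp add: complex_add_cnj)
  show ?thesis
    unfolding defect_def TT of_real_diff of_real_mult[of "resolvent_scale z"] zz z2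
    by (simp add: fun_eq_iff algebra_simps)
qed

lemma defect_in: "f \<in> X \<Longrightarrow> defect z T f \<in> X"
  unfolding defect_eq by (rule lincomb[OF _ shift_in[OF shift_in]])

lemma defect_lincomb:
  "defect z T (\<lambda>x. a * f x + b * g x) = (\<lambda>x. a * defect z T f x + b * defect z T g x)"
  by (simp add: defect_def T_lincomb fun_eq_iff algebra_simps)

lemma defect_sym:
  assumes "f \<in> X" "g \<in> X"
  shows "L2_inner M (defect z T f) g = L2_inner M f (defect z T g)"
proof -
  note S = shift_in[OF shift_in[OF assms(1), of z], of "cnj z"] shift_in[OF shift_in[OF assms(2), of z], of "cnj z"]
  have *: "L2_inner M (zshift (cnj z) (zshift z f)) g = L2_inner M f (zshift (cnj z) (zshift z g))"
    using shift_adjoint[OF shift_in[OF assms(1)] assms(2), of "cnj z" z]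
      shift_adjoint[OF assms(1) shift_in[OF assms(2)], of z z] by simp
  show ?thesis
    unfolding defect_eq
    by (subst L2_inner_lincomb_left[OF in_L2[OF assms(1)] in_L2[OF S(1)] in_L2[OF assms(2)]],
        subst L2_inner_lincomb_right[OF in_L2[OF assms(2)] in_L2[OF S(2)] in_L2[OF assms(1)]])
      (simp add: *)
qed

text \<open>Expanding \<open>\<parallel>f - t (z - T)\<^sup>* (z - T) f\<parallel>\<^sup>2\<close> gives the cross term \<open>- 2 t \<parallel>(z - T) f\<parallel>\<^sup>2\<close>, and the choice of
  \<open>t\<close> bounds the quadratic term by \<open>t \<parallel>(z - T) f\<parallel>\<^sup>2\<close>.\<close>

lemma defect_norm_sq:
  assumes "f \<in> X"
  shows "(L2_norm M (defect z T f))\<^sup>2 \<le> (L2_norm M f)\<^sup>2 - resolvent_scale z * (L2_norm M (zshift z f))\<^sup>2"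
proof -
  let ?t = "resolvent_scale z" and ?g = "zshift (cnj z) (zshift z f)"
  note S = shift_in[OF assms, of z]
  note S2 = shift_in[OF S, of "cnj z"]
  have "L2_inner M f ?g = L2_inner M (zshift z f) (zshift z f)"
    using shift_adjoint[OF assms S, of z] by simp
  then have i: "L2_inner M f ?g = of_real ((L2_norm M (zshift z f))\<^sup>2)"
    by (simp add: L2_inner_self)
  have "(L2_norm M (defect z T f))\<^sup>2 =
      (L2_norm M f)\<^sup>2 + ?t\<^sup>2 * (L2_norm M ?g)\<^sup>2 - 2 * ?t * (L2_norm M (zshift z f))\<^sup>2"
    unfolding defect_eq L2_norm_lincomb_sq[OF in_L2[OF assms] in_L2[OF S2]] i by simp
  also have "(L2_norm M ?g)\<^sup>2 \<le> ((cmod z + 1) * L2_norm M (zshift z f))\<^sup>2"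
    using shift_bound[OF S, of "cnj z"] by (intro power_mono) auto
  also have "?t\<^sup>2 * ((cmod z + 1) * L2_norm M (zshift z f))\<^sup>2 = ?t * (L2_norm M (zshift z f))\<^sup>2"
  proof -
    have "cmod z + 1 \<noteq> 0" by (metis add_nonneg_pos norm_ge_zero less_irrefl zero_less_one)
    then have "?t * (cmod z + 1)\<^sup>2 = 1" by (simp add: resolvent_scale_def)
    then show ?thesis by (simp add: power_mult_distrib power2_eq_square[of ?t] mult.assoc mult.left_commute)
  qed
  finally show ?thesis by (simp add: mult_left_mono)
qed

lemma defect_contr:
  assumes "f \<in> X"
  shows "L2_norm M (defect z T f) \<le> L2_norm M f"
proof (rule power2_le_imp_le)
  have "0 \<le> resolvent_scale z * (L2_norm M (zshift z f))\<^sup>2"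
    using resolvent_scale_pos[of z] by (intro mult_nonneg_nonneg) auto
  then show "(L2_norm M (defect z T f))\<^sup>2 \<le> (L2_norm M f)\<^sup>2"
    using defect_norm_sq[OF assms, of z] by linarith
qed simp

lemma defect_pow_in: "f \<in> X \<Longrightarrow> (defect z T ^^ n) f \<in> X"
  by (induction n) (auto intro: defect_in)

lemma defect_pow_sym:
  assumes "f \<in> X" "g \<in> X"
  shows "L2_inner M ((defect z T ^^ n) f) g = L2_inner M f ((defect z T ^^ n) g)"
  using assms
proof (induction n arbitrary: g)
  case (Suc n)
  have "L2_inner M ((defect z T ^^ Suc n) f) g = L2_inner M ((defect z T ^^ n) f) (defect z T g)"
    using defect_sym[OF defect_pow_in[OF Suc.prems(1)] Suc.prems(2)] by simp
  also have "\<dots> = L2_inner M f ((defect z T ^^ n) (defect z T g))"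
    by (rule Suc.IH[OF Suc.prems(1) defect_in[OF Suc.prems(2)]])
  finally show ?case by (simp add: funpow_swap1)
qed simp

lemma defect_pow_norm:
  assumes "f \<in> X" "0 \<le> q" "\<And>f. f \<in> X \<Longrightarrow> L2_norm M (defect z T f) \<le> q * L2_norm M f"
  shows "L2_norm M ((defect z T ^^ n) f) \<le> q ^ n * L2_norm M f"
proof (induction n)
  case (Suc n)
  have "L2_norm M ((defect z T ^^ Suc n) f) \<le> q * L2_norm M ((defect z T ^^ n) f)"
    using assms(3)[OF defect_pow_in[OF assms(1)]] by simp
  also have "\<dots> \<le> q * (q ^ n * L2_norm M f)" using Suc assms(2) by (rule mult_left_mono)
  finally show ?case by (simp add: mult.assoc)
qed simp

lemma defect_bound_of_shift_bound:
  assumes "c > 0" "\<And>f. f \<in> X \<Longrightarrow> c * L2_norm M f \<le> L2_norm M (zshift z f)"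
  shows "\<exists>q. 0 < q \<and> q < 1 \<and> (\<forall>f\<in>X. L2_norm M (defect z T f) \<le> q * L2_norm M f)"
proof -
  let ?t = "resolvent_scale z"
  \<comment> \<open>the maximum with \<open>1 / 4\<close> only serves to keep \<open>q\<close> positive\<close>
  define p where "p = max (1 / 4) (1 - ?t * c\<^sup>2)"
  have "0 < ?t * c\<^sup>2" using resolvent_scale_pos[of z] assms(1) by simp
  then have p: "0 < p" "p < 1" by (auto simp: p_def)
  show ?thesis
  proof (intro exI[of _ "sqrt p"] conjI ballI)
    show "0 < sqrt p" "sqrt p < 1" using p by auto
    fix f assume f: "f \<in> X"
    have "(c * L2_norm M f)\<^sup>2 \<le> (L2_norm M (zshift z f))\<^sup>2"
      using assms f by (intro power_mono) auto
    then have "?t * (c\<^sup>2 * (L2_norm M f)\<^sup>2) \<le> ?t * (L2_norm M (zshift z f))\<^sup>2"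
      using resolvent_scale_pos[of z] by (intro mult_left_mono) (auto simp: power_mult_distrib)
    then have "(L2_norm M (defect z T f))\<^sup>2 \<le> (1 - ?t * c\<^sup>2) * (L2_norm M f)\<^sup>2"
      using defect_norm_sq[OF f, of z] by (simp add: algebra_simps)
    also have "\<dots> \<le> p * (L2_norm M f)\<^sup>2" by (intro mult_right_mono) (auto simp: p_def)
    also have "\<dots> = (sqrt p * L2_norm M f)\<^sup>2" using p by (simp add: power_mult_distrib)
    finally show "L2_norm M (defect z T f) \<le> sqrt p * L2_norm M f"
      using p by (elim power2_le_imp_le) auto
  qed
qed

text \<open>The Neumann series \<open>\<Sum>n. defect\<^sup>n\<close> inverts \<open>t (z - T)\<^sup>* (z - T)\<close>, and \<open>t (z - T)\<^sup>*\<close> applied to it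
  inverts \<open>z - T\<close>.\<close>

lemma zshift_surj_of_defect_bound:
  assumes q: "0 < q" "q < 1" "\<And>f. f \<in> X \<Longrightarrow> L2_norm M (defect z T f) \<le> q * L2_norm M f"
    and f: "f \<in> X"
  shows "\<exists>g\<in>X. AE x in M. z * g x - T g x = f x"
proof -
  let ?K = "defect z T" and ?t = "complex_of_real (resolvent_scale z)"
  define s where "s n = (\<lambda>x. \<Sum>k<Suc n. (?K ^^ k) f x)" for n
  have Kn: "(?K ^^ n) f \<in> X" for n by (rule defect_pow_in[OF f])
  have Kq: "L2_norm M ((?K ^^ n) f) \<le> q ^ n * L2_norm M f" for n
    using q f by (intro defect_pow_norm) auto
  have "summable (\<lambda>n. q ^ n * L2_norm M f)"
    using q by (intro summable_mult2 summable_geometric) auto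
  then have "summable (\<lambda>n. L2_norm M ((?K ^^ n) f))"
    by (rule summable_comparison_test[rotated]) (use Kq in auto)
  then obtain F where F: "F \<in> L2_space M"
      "(\<lambda>n. L2_norm M (\<lambda>x. (\<Sum>k<n. (?K ^^ k) f x) - F x)) \<longlonglongrightarrow> 0"
    using L2_complete[of "\<lambda>n. (?K ^^ n) f" M] in_L2[OF Kn] by blast
  have lim: "(\<lambda>n. L2_norm M (\<lambda>x. s n x - F x)) \<longlonglongrightarrow> 0"
    unfolding s_def using LIMSEQ_Suc[OF F(2)] .
  have sX: "s n \<in> X" for n unfolding s_def by (rule in_X_sum) (use Kn in auto)
  have FX: "F \<in> X" by (rule closed[OF sX F(1) lim])
  define h where "h x = F x - ?K F x" for x
  have hX: "h \<in> X" unfolding h_def by (rule in_X_diff[OF FX defect_in[OF FX]])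
  \<comment> \<open>telescoping\<close>
  have sK: "(\<lambda>x. s n x - ?K (s n) x) = (\<lambda>x. f x - (?K ^^ Suc n) f x)" for n
  proof (induction n)
    case 0
    have "s 0 = f" unfolding s_def by simp
    then show ?case by (simp only: funpow.simps o_apply id_apply)
  next
    case (Suc n)
    have e: "s (Suc n) = (\<lambda>x. 1 * s n x + 1 * (?K ^^ Suc n) f x)"
      unfolding s_def by (simp add: fun_eq_iff)
    have "?K (s (Suc n)) = (\<lambda>x. 1 * ?K (s n) x + 1 * ?K ((?K ^^ Suc n) f) x)"
      unfolding e by (rule defect_lincomb)
    with e have "(\<lambda>x. s (Suc n) x - ?K (s (Suc n)) x)
        = (\<lambda>x. (s n x - ?K (s n) x) + ((?K ^^ Suc n) f x - (?K ^^ Suc (Suc n)) f x))"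
      by (simp add: fun_eq_iff)
    also have "\<dots> = (\<lambda>x. f x - (?K ^^ Suc (Suc n)) f x)"
      using fun_cong[OF Suc.IH] by (simp add: fun_eq_iff)
    finally show ?case .
  qed
  have "AE x in M. h x = f x"
  proof (rule norm_diff_small_imp_AE[OF hX f])
    fix e :: real assume e: "e > 0"
    have "\<forall>\<^sub>F n in sequentially. L2_norm M (\<lambda>x. s n x - F x) < e / 4"
      using order_tendstoD(2)[OF lim, of "e / 4"] e by simp
    moreover have "(\<lambda>n. q ^ Suc n * L2_norm M f) \<longlonglongrightarrow> 0 * L2_norm M f"
      using q by (intro tendsto_mult LIMSEQ_Suc[OF LIMSEQ_power_zero]) auto
    then have "\<forall>\<^sub>F n in sequentially. q ^ Suc n * L2_norm M f < e / 4"
      using order_tendstoD(2)[of _ "0 * L2_norm M f" sequentially "e / 4"] e by simp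
    ultimately have "\<forall>\<^sub>F n in sequentially. L2_norm M (\<lambda>x. s n x - F x) < e / 4 \<and> q ^ Suc n * L2_norm M f < e / 4"
      by (rule eventually_conj)
    then obtain n where n: "L2_norm M (\<lambda>x. s n x - F x) < e / 4" "q ^ Suc n * L2_norm M f < e / 4"
      using eventually_happens'[OF sequentially_bot] by blast
    define d where "d x = F x - s n x" for x
    have dX: "d \<in> X" unfolding d_def by (rule in_X_diff[OF FX sX])
    have dn: "L2_norm M d < e / 4" using n(1) unfolding d_def by (simp only: L2_norm_minus_commute)
    have Kd: "?K d = (\<lambda>x. 1 * ?K F x + (- 1) * ?K (s n) x)"
      using defect_lincomb[of z 1 F "- 1" "s n"] by (simp add: d_def[abs_def])
    have "(\<lambda>x. h x - f x) = (\<lambda>x. (d x - ?K d x) + (- 1) * (?K ^^ Suc n) f x)"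
    proof
      fix x
      have "s n x - ?K (s n) x = f x - (?K ^^ Suc n) f x" using fun_cong[OF sK] .
      then show "h x - f x = (d x - ?K d x) + (- 1) * (?K ^^ Suc n) f x"
        unfolding Kd h_def d_def by (simp add: algebra_simps)
    qed
    then have "L2_norm M (\<lambda>x. h x - f x) \<le> L2_norm M (\<lambda>x. d x - ?K d x) + L2_norm M (\<lambda>x. (- 1) * (?K ^^ Suc n) f x)"
      using L2_norm_triangle[OF in_L2[OF in_X_diff[OF dX defect_in[OF dX, of z]]] L2_scale[OF in_L2[OF Kn[of "Suc n"]], of "- 1"]]
      by (simp only:)
    moreover have "L2_norm M (\<lambda>x. (- 1) * (?K ^^ Suc n) f x) = L2_norm M ((?K ^^ Suc n) f)"
      by (subst L2_norm_scale) simp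
    moreover have "L2_norm M (\<lambda>x. d x - ?K d x) \<le> L2_norm M d + L2_norm M (?K d)"
      by (rule L2_norm_triangle_diff[OF in_L2[OF dX] in_L2[OF defect_in[OF dX]]])
    ultimately show "L2_norm M (\<lambda>x. h x - f x) \<le> e"
      using defect_contr[OF dX, of z] dn Kq[of "Suc n"] n(2) e by linarith
  qed
  moreover have "z * (?t * zshift (cnj z) F x) - T (\<lambda>x. ?t * zshift (cnj z) F x) x = h x" for x
  proof -
    have T1: "T (\<lambda>x. ?t * zshift (cnj z) F x) = (\<lambda>x. ?t * (cnj z * T F x - T (T F) x))"
      using T_lincomb[of "?t" "zshift (cnj z) F" 0 F] T_lincomb[of "cnj z" F "- 1" "T F"] by simp
    have T2: "T (zshift z F) = (\<lambda>x. z * T F x - T (T F) x)"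
      using T_lincomb[of z F "- 1" "T F"] by simp
    show ?thesis unfolding h_def defect_eq T1 T2 by (simp add: algebra_simps)
  qed
  moreover have "(\<lambda>x. ?t * zshift (cnj z) F x) \<in> X"
    using lincomb[OF shift_in[OF FX, of "cnj z"] FX, of ?t 0] by simp
  ultimately show ?thesis by (intro bexI[of _ "\<lambda>x. ?t * zshift (cnj z) F x"]) auto
qed

text \<open>If \<open>A\<close> is a bounded inverse then \<open>\<parallel>f\<parallel> = \<parallel>A (z - T) f\<parallel> \<le> C \<parallel>(z - T) f\<parallel>\<close>, which bounds the defect.  Conversely the
  Neumann series shows that \<open>z - T\<close> is onto, and the bound on the defect that it is bounded below.\<close>

theorem notin_spectrum_iff:
  assumes "X \<noteq> {}"
  shows "z \<notin> spectrum_on M X T \<longleftrightarrow>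
    (\<exists>q. 0 < q \<and> q < 1 \<and> (\<forall>f\<in>X. L2_norm M (defect z T f) \<le> q * L2_norm M f))"
proof
  assume "z \<notin> spectrum_on M X T"
  then obtain A C where A: "\<And>f. f \<in> X \<Longrightarrow> A f \<in> X" "\<And>f. f \<in> X \<Longrightarrow> L2_norm M (A f) \<le> C * L2_norm M f"
      "\<And>f. f \<in> X \<Longrightarrow> AE x in M. A (zshift z f) x = f x"
    unfolding spectrum_on_def bounded_op_def by blast
  have "L2_norm M f \<le> max C 1 * L2_norm M (zshift z f)" if f: "f \<in> X" for f
  proof -
    have "L2_norm M f = L2_norm M (A (zshift z f))"
      using A(3)[OF f] in_L2[OF f] in_L2[OF A(1)[OF shift_in[OF f]]]
      by (intro L2_norm_cong_AE) (auto intro: L2_measurable)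
    also have "\<dots> \<le> C * L2_norm M (zshift z f)" by (rule A(2)[OF shift_in[OF f]])
    also have "\<dots> \<le> max C 1 * L2_norm M (zshift z f)" by (intro mult_right_mono) auto
    finally show ?thesis .
  qed
  then have "1 / max C 1 * L2_norm M f \<le> L2_norm M (zshift z f)" if "f \<in> X" for f
    using that by (simp add: pos_divide_le_eq mult.commute)
  then show "\<exists>q. 0 < q \<and> q < 1 \<and> (\<forall>f\<in>X. L2_norm M (defect z T f) \<le> q * L2_norm M f)"
    by (rule defect_bound_of_shift_bound[OF divide_pos_pos[OF zero_less_one less_le_trans[OF zero_less_one max.cobounded2]]])
next
  assume "\<exists>q. 0 < q \<and> q < 1 \<and> (\<forall>f\<in>X. L2_norm M (defect z T f) \<le> q * L2_norm M f)"
  then obtain q where q: "0 < q" "q < 1" "\<And>f. f \<in> X \<Longrightarrow> L2_norm M (defect z T f) \<le> q * L2_norm M f"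
    by blast
  let ?t = "resolvent_scale z"
  define c where "c = (1 - q) * ?t"
  have t0: "?t > 0" by (rule resolvent_scale_pos)
  have c: "c > 0" using q t0 by (simp add: c_def)
  \<comment> \<open>\<open>(1 - q) \<bar>f\<bar> \<le> \<bar>f - defect f\<bar> = t \<bar>(z - T)\<^sup>* (z - T) f\<bar>\<close>\<close>
  have low: "(1 - q) * L2_norm M f \<le> ?t * ((cmod z + 1) * L2_norm M (zshift z f))" if f: "f \<in> X" for f
  proof -
    let ?g = "zshift (cnj z) (zshift z f)"
    have gX: "?g \<in> X" by (rule shift_in[OF shift_in[OF f]])
    have "f = (\<lambda>x. 1 * defect z T f x + of_real ?t * ?g x)"
      unfolding defect_eq by (simp add: fun_eq_iff)
    then have "L2_norm M f \<le> L2_norm M (defect z T f) + ?t * L2_norm M ?g"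
      using L2_norm_triangle_lincomb[OF in_L2[OF defect_in[OF f]] in_L2[OF gX], of 1 z "of_real ?t"] t0
      by (simp del: mult_1)
    moreover have "?t * L2_norm M ?g \<le> ?t * ((cmod z + 1) * L2_norm M (zshift z f))"
      using shift_bound[OF shift_in[OF f], of "cnj z" z] t0 by (intro mult_left_mono) auto
    ultimately show ?thesis using q(3)[OF f] by (simp add: algebra_simps)
  qed
  define C where "C = ?t * (cmod z + 1) / (1 - q)"
  have C: "L2_norm M f \<le> C * L2_norm M (zshift z f)" if "f \<in> X" for f
    using low[OF that] q by (simp add: C_def field_simps)
  have inj: "AE x in M. f x = g x" if fg: "f \<in> X" "g \<in> X" "AE x in M. zshift z f x = zshift z g x" for f g
  proof (rule norm_diff_small_imp_AE[OF fg(1,2)])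
    fix e :: real assume "e > 0"
    have dX: "(\<lambda>x. f x - g x) \<in> X" by (rule in_X_diff[OF fg(1,2)])
    have "zshift z (\<lambda>x. f x - g x) = (\<lambda>x. zshift z f x - zshift z g x)"
      using shift_lincomb[of z 1 f "- 1" g] by (simp add: algebra_simps)
    then have "L2_norm M (zshift z (\<lambda>x. f x - g x)) = 0"
      using fg(3) L2_norm_diff_eq_0_iff[OF in_L2[OF shift_in[OF fg(1)]] in_L2[OF shift_in[OF fg(2)]]] by simp
    with C[OF dX] have "L2_norm M (\<lambda>x. f x - g x) \<le> C * 0" by (simp only:)
    then show "L2_norm M (\<lambda>x. f x - g x) \<le> e" using \<open>e > 0\<close> by linarith
  qed
  \<comment> \<open>preimages are unique up to null sets, so any choice is linear almost everywhere\<close>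
  define A where "A f = (SOME g. g \<in> X \<and> (AE x in M. zshift z g x = f x))" for f
  have A: "A f \<in> X \<and> (AE x in M. zshift z (A f) x = f x)" if "f \<in> X" for f
  proof -
    have "\<exists>g. g \<in> X \<and> (AE x in M. zshift z g x = f x)"
      using zshift_surj_of_defect_bound[OF q that] by blast
    then show ?thesis unfolding A_def by (rule someI_ex)
  qed
  have "bounded_op M X A"
    unfolding bounded_op_def
  proof (intro conjI ballI allI exI[of _ C])
    fix f assume f: "f \<in> X"
    show "A f \<in> X" using A[OF f] by blast
    have "L2_norm M (zshift z (A f)) = L2_norm M f"
      using A[OF f] in_L2[OF f] in_L2[OF shift_in[of "A f" z]]
      by (intro L2_norm_cong_AE) (auto intro: L2_measurable)
    then show "L2_norm M (A f) \<le> C * L2_norm M f" using C[of "A f"] A[OF f] by simp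
    fix g a b assume g: "g \<in> X"
    have "AE x in M. zshift z (A (\<lambda>y. a * f y + b * g y)) x = zshift z (\<lambda>x. a * A f x + b * A g x) x"
      using conjunct2[OF A[OF lincomb[OF f g, of a b]]] conjunct2[OF A[OF f]] conjunct2[OF A[OF g]]
    proof eventually_elim
      case (elim x)
      have "zshift z (\<lambda>x. a * A f x + b * A g x) x = a * zshift z (A f) x + b * zshift z (A g) x"
        by (simp add: T_lincomb algebra_simps)
      with elim show ?case by simp
    qed
    then show "AE x in M. A (\<lambda>y. a * f y + b * g y) x = a * A f x + b * A g x"
      by (rule inj[OF conjunct1[OF A[OF lincomb[OF f g]]]
            lincomb[OF conjunct1[OF A[OF f]] conjunct1[OF A[OF g]]]])
  qed
  moreover have "AE x in M. A (zshift z f) x = f x" if f: "f \<in> X" for f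
    by (rule inj[OF conjunct1[OF A[OF shift_in[OF f]]] f conjunct2[OF A[OF shift_in[OF f]]]])
  ultimately show "z \<notin> spectrum_on M X T"
    unfolding spectrum_on_def using A by blast
qed

text \<open>The norms \<open>b n = \<parallel>defect\<^sup>n f\<parallel>\<close> are log-convex, because \<open>b (n + 1)\<^sup>2 = \<langle>defect\<^sup>n f, defect\<^sup>n\<^sup>+\<^sup>2 f\<rangle>\<close>.
  Hence \<open>b 1 / b 0\<close> cannot exceed the exponential growth rate of \<open>b\<close>.\<close>

lemma defect_bound_of_growth:
  assumes f: "f \<in> X" and q: "0 < q"
    and growth: "\<And>n. cmod (L2_inner M ((defect z T ^^ n) f) f) \<le> C * q ^ n"
  shows "L2_norm M (defect z T f) \<le> q * L2_norm M f"
proof (rule ccontr)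
  define b where "b n = L2_norm M ((defect z T ^^ n) f)" for n
  have Kn: "(defect z T ^^ n) f \<in> X" for n by (rule defect_pow_in[OF f])
  have b0: "0 \<le> b n" for n by (simp add: b_def)
  have shiftpow: "L2_inner M ((defect z T ^^ Suc n) f) ((defect z T ^^ Suc n) f)
      = L2_inner M ((defect z T ^^ n) f) ((defect z T ^^ Suc (Suc n)) f)" for n
    using defect_sym[OF Kn[of n] Kn[of "Suc n"], of z] by simp
  have convex: "(b (Suc n))\<^sup>2 \<le> b n * b (Suc (Suc n))" for n
  proof -
    have "(b (Suc n))\<^sup>2 = cmod (L2_inner M ((defect z T ^^ Suc n) f) ((defect z T ^^ Suc n) f))"
      unfolding b_def L2_inner_self norm_of_real by simp
    also have "\<dots> \<le> b n * b (Suc (Suc n))"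
      unfolding shiftpow b_def by (rule L2_Cauchy_Schwarz[OF in_L2[OF Kn] in_L2[OF Kn]])
    finally show ?thesis .
  qed
  have bound: "(b n)\<^sup>2 \<le> C * (q\<^sup>2) ^ n" for n
  proof -
    have "(b n)\<^sup>2 = cmod (L2_inner M ((defect z T ^^ n) f) ((defect z T ^^ n) f))"
      unfolding b_def L2_inner_self norm_of_real by simp
    also have "L2_inner M ((defect z T ^^ n) f) ((defect z T ^^ n) f) = cnj (L2_inner M ((defect z T ^^ (n + n)) f) f)"
      unfolding defect_pow_sym[OF f Kn] L2_inner_cnj[of M f] funpow_add by simp
    also have "cmod \<dots> \<le> C * q ^ (n + n)" unfolding complex_mod_cnj by (rule growth)
    also have "q ^ (n + n) = (q\<^sup>2) ^ n" by (simp add: power_add power2_eq_square power_mult_distrib)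
    finally show ?thesis .
  qed
  assume "\<not> L2_norm M (defect z T f) \<le> q * L2_norm M f"
  then have b1: "q * b 0 < b 1" by (simp add: b_def)
  then have "b 1 > 0" using mult_nonneg_nonneg[of q "b 0"] b0[of 0] q by linarith
  then have "0 < (b 1)\<^sup>2" by simp
  then have "b 0 \<noteq> 0" using convex[of 0] by auto
  then have bp: "b 0 > 0" using b0[of 0] by simp
  define r where "r = b 1 / b 0"
  have r: "r > q" "r > 0" using b1 bp \<open>b 1 > 0\<close> by (auto simp: r_def field_simps)
  have step: "b n > 0 \<and> b (Suc n) \<ge> r * b n" for n
  proof (induction n)
    case 0
    then show ?case using bp by (simp add: r_def)
  next
    case (Suc n)
    then have p: "b (Suc n) > 0" using r mult_pos_pos[of r "b n"] by linarith
    have "r * b (Suc n) * b n \<le> b (Suc n) * b (Suc n)"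
      using Suc p by (simp add: mult.commute mult.left_commute)
    also have "\<dots> \<le> b (Suc (Suc n)) * b n" using convex[of n] by (simp add: power2_eq_square mult.commute)
    finally have "r * b (Suc n) \<le> b (Suc (Suc n))" using Suc by (simp only: mult_le_cancel_right_pos)
    with p show ?case by simp
  qed
  have geo: "r ^ n * b 0 \<le> b n" for n
  proof (induction n)
    case (Suc n)
    have "r ^ Suc n * b 0 = r * (r ^ n * b 0)" by simp
    also have "\<dots> \<le> r * b n" using Suc r by (intro mult_left_mono) auto
    also have "\<dots> \<le> b (Suc n)" using step by blast
    finally show ?case .
  qed simp
  have ratio: "((r / q)\<^sup>2) ^ n \<le> C / (b 0)\<^sup>2" for n
  proof -
    have "(r ^ n * b 0)\<^sup>2 \<le> (b n)\<^sup>2" using geo[of n] r bp by (intro power_mono) auto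
    then have "(r ^ n * b 0)\<^sup>2 \<le> C * (q\<^sup>2) ^ n" using bound[of n] by linarith
    moreover have "(r ^ n * b 0)\<^sup>2 = ((r / q)\<^sup>2) ^ n * (q\<^sup>2) ^ n * (b 0)\<^sup>2"
    proof -
      have "((r / q)\<^sup>2) ^ n * (q\<^sup>2) ^ n = (r\<^sup>2) ^ n"
        using q by (subst power_mult_distrib[symmetric]) (simp add: power_divide)
      moreover have "(r ^ n)\<^sup>2 = (r\<^sup>2) ^ n" by (simp add: power_mult[symmetric] mult.commute)
      ultimately show ?thesis by (simp only: power_mult_distrib)
    qed
    moreover have "((r / q)\<^sup>2) ^ n * (q\<^sup>2) ^ n * (b 0)\<^sup>2 = (((r / q)\<^sup>2) ^ n * (b 0)\<^sup>2) * (q\<^sup>2) ^ n"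
      by (simp only: mult.assoc mult.commute[of "(q\<^sup>2) ^ n"])
    ultimately have "(((r / q)\<^sup>2) ^ n * (b 0)\<^sup>2) * (q\<^sup>2) ^ n \<le> C * (q\<^sup>2) ^ n" by argo
    moreover have "(q\<^sup>2) ^ n > 0" using q by simp
    ultimately have "((r / q)\<^sup>2) ^ n * (b 0)\<^sup>2 \<le> C"
      by (rule mult_right_le_imp_le)
    then show ?thesis using bp by (simp add: pos_le_divide_eq)
  qed
  have "1 < (r / q)\<^sup>2"
    using r q by (intro one_less_power) simp_all
  from real_arch_pow[OF this, of "C / (b 0)\<^sup>2"]
  obtain n where "C / (b 0)\<^sup>2 < ((r / q)\<^sup>2) ^ n" by (rule exE)
  then show False using ratio[of n] by simp
qed

text \<open>The rate \<open>q\<close> is uniform over \<open>Y\<close> although the constants of the growth are not, which is what allows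
  the bound to pass to the closure.\<close>

lemma defect_bound_of_dense:
  assumes Y: "Y \<subseteq> X" and q: "0 < q"
    and dense: "\<And>f e. f \<in> X \<Longrightarrow> e > 0 \<Longrightarrow> \<exists>g\<in>Y. L2_norm M (\<lambda>x. f x - g x) \<le> e"
    and growth: "\<And>f. f \<in> Y \<Longrightarrow> \<exists>C. \<forall>n. cmod (L2_inner M ((defect z T ^^ n) f) f) \<le> C * q ^ n"
    and f: "f \<in> X"
  shows "L2_norm M (defect z T f) \<le> q * L2_norm M f"
proof (rule field_le_epsilon)
  fix e :: real assume "e > 0"
  define d where "d = e / (1 + q)"
  have "d * (1 + q) = e" using q by (simp add: d_def)
  then have "d + q * d = e" by argo
  moreover have "d > 0" using \<open>e > 0\<close> q by (simp add: d_def)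
  ultimately have d: "d > 0" "d + q * d = e" by auto
  obtain g where g: "g \<in> Y" "L2_norm M (\<lambda>x. f x - g x) \<le> d" using dense[OF f d(1)] by blast
  have gX: "g \<in> X" using g Y by blast
  have dX: "(\<lambda>x. f x - g x) \<in> X" by (rule in_X_diff[OF f gX])
  obtain C where "\<And>n. cmod (L2_inner M ((defect z T ^^ n) g) g) \<le> C * q ^ n" using growth[OF g(1)] by blast
  then have gq: "L2_norm M (defect z T g) \<le> q * L2_norm M g" by (rule defect_bound_of_growth[OF gX q])
  have Kf: "defect z T f = (\<lambda>x. defect z T g x + defect z T (\<lambda>x. f x - g x) x)"
    using defect_lincomb[of z 1 g 1 "\<lambda>x. f x - g x"] by simp
  have "L2_norm M (defect z T f) \<le> L2_norm M (defect z T g) + L2_norm M (defect z T (\<lambda>x. f x - g x))"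
    unfolding Kf by (rule L2_norm_triangle[OF in_L2[OF defect_in[OF gX]] in_L2[OF defect_in[OF dX]]])
  also have "\<dots> \<le> q * L2_norm M g + d" using gq defect_contr[OF dX, of z] g(2) by linarith
  also have "\<dots> \<le> q * (L2_norm M f + d) + d"
  proof -
    have "L2_norm M g \<le> L2_norm M f + d"
      using L2_norm_triangle_diff[OF in_L2[OF f] in_L2[OF dX]] g(2) by simp
    then show ?thesis using q by simp
  qed
  also have "\<dots> = q * L2_norm M f + e" unfolding d(2)[symmetric] by (simp add: distrib_left)
  finally show "L2_norm M (defect z T f) \<le> q * L2_norm M f + e" .
qed

end

section \<open>Markov operators of reversible graphs on measure spaces\<close>

text \<open>Real and imaginary, positive and negative parts.  This transfers identities of \<open>L\<^sup>2\<close> inner products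
  from nonnegative functions, for which mass transport holds.\<close>

lemma L2_induct_nonneg [consumes 1, case_names nonneg lincomb]:
  assumes f: "f \<in> L2_space M"
    and nonneg: "\<And>p. p \<in> borel_measurable M \<Longrightarrow> (\<And>x. (0::real) \<le> p x) \<Longrightarrow>
        (\<lambda>x. complex_of_real (p x)) \<in> L2_space M \<Longrightarrow> P (\<lambda>x. of_real (p x))"
    and lincomb: "\<And>f g a b. f \<in> L2_space M \<Longrightarrow> g \<in> L2_space M \<Longrightarrow> P f \<Longrightarrow> P g \<Longrightarrow>
        P (\<lambda>x. a * f x + b * g x)"
  shows "P f"
proof -
  note [measurable] = L2_measurable[OF f]
  have part: "P (\<lambda>x. of_real (h x)) \<and> (\<lambda>x. complex_of_real (h x)) \<in> L2_space M"
    if [measurable]: "h \<in> borel_measurable M" and le: "\<And>x. \<bar>h x\<bar> \<le> cmod (f x)" for h :: "'a \<Rightarrow> real"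
  proof -
    have p: "(\<lambda>x. complex_of_real (max (h x) 0)) \<in> L2_space M"
    proof (rule L2_norm_real_mono[OF f])
      show "cmod (complex_of_real (max (h x) 0)) \<le> cmod (f x)" if "x \<in> space M" for x
        using le[of x] unfolding norm_of_real by linarith
    qed measurable
    have m: "(\<lambda>x. complex_of_real (max (- h x) 0)) \<in> L2_space M"
    proof (rule L2_norm_real_mono[OF f])
      show "cmod (complex_of_real (max (- h x) 0)) \<le> cmod (f x)" if "x \<in> space M" for x
        using le[of x] unfolding norm_of_real by linarith
    qed measurable
    have "P (\<lambda>x. 1 * complex_of_real (max (h x) 0) + (- 1) * complex_of_real (max (- h x) 0))"
      by (rule lincomb[OF p m nonneg[OF _ _ p] nonneg[OF _ _ m]]) simp_all
    moreover have "(\<lambda>x. 1 * complex_of_real (max (h x) 0) + (- 1) * complex_of_real (max (- h x) 0)) = (\<lambda>x. of_real (h x))"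
      by (auto simp: fun_eq_iff max_def)
    ultimately show ?thesis using L2_lincomb[OF p m, of 1 "- 1"] by (simp only:)
  qed
  have "P (\<lambda>x. 1 * complex_of_real (Re (f x)) + \<i> * complex_of_real (Im (f x)))"
    using part[of "\<lambda>x. Re (f x)"] part[of "\<lambda>x. Im (f x)"] abs_Re_le_cmod abs_Im_le_cmod
    by (intro lincomb) auto
  then show ?thesis by (simp add: complex_eq[symmetric])
qed

lemma markov_lincomb: "markov E (\<lambda>x. a * f x + b * g x) = (\<lambda>x. a * markov E f x + b * markov E g x)"
  by (simp add: markov_def fun_eq_iff sum.distrib sum_distrib_left[symmetric] algebra_simps)

lemma cmod_sum_sq_le: "(cmod (\<Sum>y\<in>A. f y))\<^sup>2 \<le> card A * (\<Sum>y\<in>A. (cmod (f y))\<^sup>2)"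
proof -
  have "(cmod (\<Sum>y\<in>A. f y))\<^sup>2 \<le> (\<Sum>y\<in>A. 1 * cmod (f y))\<^sup>2"
    by (intro power_mono) (auto intro: norm_sum)
  also have "\<dots> \<le> (\<Sum>y\<in>A. 1\<^sup>2) * (\<Sum>y\<in>A. (cmod (f y))\<^sup>2)" by (rule Cauchy_Schwarz_ineq_sum)
  finally show ?thesis by simp
qed

lemma enn2real_sum: "finite A \<Longrightarrow> (\<And>x. x \<in> A \<Longrightarrow> 0 \<le> f x) \<Longrightarrow> enn2real (\<Sum>x\<in>A. ennreal (f x)) = (\<Sum>x\<in>A. f x)"
  by (simp add: sum_nonneg)

text \<open>A Borel graph on a measure space satisfying the mass transport principle for the
  transports \<open>(x, y) \<mapsto> f x * g y\<close> along edges.  Both a countable graph with counting measure and the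
  Bernoulli graphing are of this kind.\<close>

locale reversible_graph =
  fixes m :: "'x measure" and E :: "'x rel" and c :: real
  assumes c_pos: "0 < c"
    and finite_nbrs: "\<And>x. x \<in> space m \<Longrightarrow> finite (E `` {x})"
    and nbrs_in_space: "\<And>x. x \<in> space m \<Longrightarrow> E `` {x} \<subseteq> space m"
    and nbr_sum_measurable: "\<And>f :: 'x \<Rightarrow> ennreal. f \<in> borel_measurable m \<Longrightarrow>
        (\<lambda>x. \<Sum>y\<in>E `` {x}. f y) \<in> borel_measurable m"
    and reversible: "\<And>f g :: 'x \<Rightarrow> ennreal. f \<in> borel_measurable m \<Longrightarrow> g \<in> borel_measurable m \<Longrightarrow>
        (\<integral>\<^sup>+x. (\<Sum>y\<in>E `` {x}. f y) * g x \<partial>m) = (\<integral>\<^sup>+x. f x * (\<Sum>y\<in>E `` {x}. g y) \<partial>m)"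
begin

definition deg_measure :: "'x measure" where
  "deg_measure = density m (\<lambda>x. ennreal (c * real (vertex_degree E x)))"

lemma borel_measurable_deg_measure: "borel_measurable deg_measure = borel_measurable m"
  unfolding deg_measure_def by (rule measurable_cong_sets) auto

lemma nbr_sum_real_measurable:
  fixes f :: "'x \<Rightarrow> real"
  assumes [measurable]: "f \<in> borel_measurable m"
  shows "(\<lambda>x. \<Sum>y\<in>E `` {x}. f y) \<in> borel_measurable m"
proof -
  have [measurable]: "(\<lambda>x. \<Sum>y\<in>E `` {x}. ennreal (max (f y) 0)) \<in> borel_measurable m"
    "(\<lambda>x. \<Sum>y\<in>E `` {x}. ennreal (max (- f y) 0)) \<in> borel_measurable m"
    by (rule nbr_sum_measurable, measurable)+
  have "(\<lambda>x. enn2real (\<Sum>y\<in>E `` {x}. ennreal (max (f y) 0)) - enn2real (\<Sum>y\<in>E `` {x}. ennreal (max (- f y) 0)))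
      \<in> borel_measurable m" by measurable
  also have "?this \<longleftrightarrow> ?thesis"
  proof (rule measurable_cong)
    fix x assume x: "x \<in> space m"
    show "enn2real (\<Sum>y\<in>E `` {x}. ennreal (max (f y) 0)) - enn2real (\<Sum>y\<in>E `` {x}. ennreal (max (- f y) 0))
        = (\<Sum>y\<in>E `` {x}. f y)"
      by (subst (1 2) enn2real_sum, use finite_nbrs[OF x] in \<open>simp_all add: sum_subtractf[symmetric]\<close>)
        (intro sum.cong, auto simp: max_def)
  qed
  finally show ?thesis .
qed

lemma degree_measurable [measurable]: "(\<lambda>x. real (vertex_degree E x)) \<in> borel_measurable m"
  using nbr_sum_real_measurable[of "\<lambda>_. 1"] by (simp add: vertex_degree_def)

lemma markov_measurable:
  assumes [measurable]: "f \<in> borel_measurable m"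
  shows "markov E f \<in> borel_measurable m"
proof -
  have [measurable]: "(\<lambda>x. \<Sum>y\<in>E `` {x}. Re (f y)) \<in> borel_measurable m"
    "(\<lambda>x. \<Sum>y\<in>E `` {x}. Im (f y)) \<in> borel_measurable m"
    by (rule nbr_sum_real_measurable, measurable)+
  have "markov E f = (\<lambda>x. complex_of_real (1 / real (vertex_degree E x)) *
      (complex_of_real (\<Sum>y\<in>E `` {x}. Re (f y)) + \<i> * complex_of_real (\<Sum>y\<in>E `` {x}. Im (f y))))"
    by (simp add: markov_def fun_eq_iff complex_eq_iff)
  also have "\<dots> \<in> borel_measurable m" by measurable
  finally show ?thesis .
qed

lemma nn_integral_deg_measure:
  assumes [measurable]: "f \<in> borel_measurable m"
  shows "(\<integral>\<^sup>+x. f x \<partial>deg_measure) = (\<integral>\<^sup>+x. ennreal c * (f x * (\<Sum>y\<in>E `` {x}. 1)) \<partial>m)"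
proof -
  have "(\<integral>\<^sup>+x. f x \<partial>deg_measure) = (\<integral>\<^sup>+x. ennreal (c * real (vertex_degree E x)) * f x \<partial>m)"
    unfolding deg_measure_def by (rule nn_integral_density) measurable
  also have "\<dots> = (\<integral>\<^sup>+x. ennreal c * (f x * (\<Sum>y\<in>E `` {x}. 1)) \<partial>m)"
    using c_pos by (intro nn_integral_cong)
      (simp add: ennreal_mult vertex_degree_def ennreal_of_nat_eq_real_of_nat ac_simps)
  finally show ?thesis .
qed

text \<open>By Cauchy--Schwarz \<open>deg(x) \<bar>M f(x)\<bar>\<^sup>2\<close> is at most the sum of \<open>\<bar>f\<bar>\<^sup>2\<close> over the neighbours of \<open>x\<close>, and
  reversibility turns the integral of this sum into that of \<open>deg \<bar>f\<bar>\<^sup>2\<close>.\<close>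

lemma markov_nn_integral_le:
  assumes f: "f \<in> borel_measurable m"
  shows "(\<integral>\<^sup>+x. ennreal ((cmod (markov E f x))\<^sup>2) \<partial>deg_measure) \<le> (\<integral>\<^sup>+x. ennreal ((cmod (f x))\<^sup>2) \<partial>deg_measure)"
proof -
  note [measurable] = f markov_measurable[OF f]
  let ?h = "\<lambda>x. ennreal ((cmod (f x))\<^sup>2)"
  have [measurable]: "(\<lambda>x. \<Sum>y\<in>E `` {x}. ?h y) \<in> borel_measurable m"
    "(\<lambda>x. \<Sum>y\<in>E `` {x}. 1::ennreal) \<in> borel_measurable m"
    by (rule nbr_sum_measurable, measurable)+
  have "(\<integral>\<^sup>+x. ennreal ((cmod (markov E f x))\<^sup>2) \<partial>deg_measure)
      = (\<integral>\<^sup>+x. ennreal c * (ennreal ((cmod (markov E f x))\<^sup>2) * (\<Sum>y\<in>E `` {x}. 1)) \<partial>m)"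
    by (rule nn_integral_deg_measure) measurable
  also have "\<dots> \<le> (\<integral>\<^sup>+x. ennreal c * ((\<Sum>y\<in>E `` {x}. ?h y) * 1) \<partial>m)"
  proof (intro nn_integral_mono mult_left_mono)
    fix x assume x: "x \<in> space m"
    define d where "d = card (E `` {x})"
    show "ennreal ((cmod (markov E f x))\<^sup>2) * (\<Sum>y\<in>E `` {x}. 1) \<le> (\<Sum>y\<in>E `` {x}. ?h y) * 1"
    proof (cases "d = 0")
      case True
      then show ?thesis by (simp add: d_def)
    next
      case False
      have "(cmod (markov E f x))\<^sup>2 * d = (cmod (\<Sum>y\<in>E `` {x}. f y))\<^sup>2 / d"
        using False by (simp add: markov_def vertex_degree_def d_def[symmetric] norm_divide power_divide
            power2_eq_square)
      also have "\<dots> \<le> d * (\<Sum>y\<in>E `` {x}. (cmod (f y))\<^sup>2) / d"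
        unfolding d_def by (intro divide_right_mono cmod_sum_sq_le) auto
      also have "\<dots> = (\<Sum>y\<in>E `` {x}. (cmod (f y))\<^sup>2)" using False by simp
      finally have "ennreal ((cmod (markov E f x))\<^sup>2 * d) \<le> ennreal (\<Sum>y\<in>E `` {x}. (cmod (f y))\<^sup>2)"
        by (rule ennreal_leI)
      also have "\<dots> = (\<Sum>y\<in>E `` {x}. ?h y)" by (rule sum_ennreal[symmetric]) simp
      also have "ennreal ((cmod (markov E f x))\<^sup>2 * d) = ennreal ((cmod (markov E f x))\<^sup>2) * (\<Sum>y\<in>E `` {x}. 1)"
        by (simp add: ennreal_mult ennreal_of_nat_eq_real_of_nat d_def)
      finally show ?thesis by simp
    qed
  qed simp
  also have "\<dots> = ennreal c * (\<integral>\<^sup>+x. (\<Sum>y\<in>E `` {x}. ?h y) * 1 \<partial>m)"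
    by (rule nn_integral_cmult) measurable
  also have "(\<integral>\<^sup>+x. (\<Sum>y\<in>E `` {x}. ?h y) * 1 \<partial>m) = (\<integral>\<^sup>+x. ?h x * (\<Sum>y\<in>E `` {x}. 1) \<partial>m)"
    by (rule reversible) measurable
  also have "ennreal c * (\<integral>\<^sup>+x. ?h x * (\<Sum>y\<in>E `` {x}. 1) \<partial>m) = (\<integral>\<^sup>+x. ennreal c * (?h x * (\<Sum>y\<in>E `` {x}. 1)) \<partial>m)"
    by (rule nn_integral_cmult[symmetric]) measurable
  also have "\<dots> = (\<integral>\<^sup>+x. ?h x \<partial>deg_measure)"
    by (rule nn_integral_deg_measure[symmetric]) measurable
  finally show ?thesis .
qed

lemma markov_L2:
  assumes f: "f \<in> L2_space deg_measure"
  shows "markov E f \<in> L2_space deg_measure" "L2_norm deg_measure (markov E f) \<le> L2_norm deg_measure f"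
proof -
  have fm: "f \<in> borel_measurable m" using L2_measurable[OF f] by (simp add: borel_measurable_deg_measure)
  have [measurable]: "markov E f \<in> borel_measurable deg_measure"
    unfolding borel_measurable_deg_measure by (rule markov_measurable[OF fm])
  have fi: "(\<integral>\<^sup>+x. ennreal ((cmod (f x))\<^sup>2) \<partial>deg_measure) = ennreal ((L2_norm deg_measure f)\<^sup>2)"
    unfolding L2_norm_sq by (rule nn_integral_eq_integral[OF L2_integrable_sq[OF f]]) simp
  have le: "(\<integral>\<^sup>+x. ennreal ((cmod (markov E f x))\<^sup>2) \<partial>deg_measure) \<le> ennreal ((L2_norm deg_measure f)\<^sup>2)"
    using markov_nn_integral_le[OF fm] by (simp only: fi)
  have "integrable deg_measure (\<lambda>x. (cmod (markov E f x))\<^sup>2)"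
    by (rule integrableI_bounded) (use le in \<open>auto intro: le_less_trans\<close>)
  then show L: "markov E f \<in> L2_space deg_measure" by (intro L2_spaceI) auto
  have "ennreal ((L2_norm deg_measure (markov E f))\<^sup>2) \<le> ennreal ((L2_norm deg_measure f)\<^sup>2)"
    using le unfolding L2_norm_sq[of _ "markov E f"]
    by (subst nn_integral_eq_integral[OF L2_integrable_sq[OF L], symmetric]) auto
  then show "L2_norm deg_measure (markov E f) \<le> L2_norm deg_measure f"
    by (intro power2_le_imp_le[where x = "L2_norm deg_measure (markov E f)"]) auto
qed

text \<open>The degree in the measure cancels the normalisation of the Markov operator and leaves the mass
  \<open>p(y) r(x)\<close> transported along the edges.\<close>

lemma markov_sym_nonneg:
  fixes p r :: "'x \<Rightarrow> real"
  assumes [measurable]: "p \<in> borel_measurable m" "r \<in> borel_measurable m"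
    and p: "\<And>x. 0 \<le> p x" and r: "\<And>x. 0 \<le> r x"
  shows "L2_inner deg_measure (markov E (\<lambda>x. of_real (p x))) (\<lambda>x. of_real (r x))
    = of_real (enn2real (ennreal c * (\<integral>\<^sup>+x. (\<Sum>y\<in>E `` {x}. ennreal (p y)) * ennreal (r x) \<partial>m)))"
proof -
  have [measurable]: "(\<lambda>x. \<Sum>y\<in>E `` {x}. p y) \<in> borel_measurable m"
    by (rule nbr_sum_real_measurable) measurable
  have [measurable]: "(\<lambda>x. \<Sum>y\<in>E `` {x}. ennreal (p y)) \<in> borel_measurable m"
    by (rule nbr_sum_measurable) measurable
  let ?u = "\<lambda>x. 1 / real (vertex_degree E x) * (\<Sum>y\<in>E `` {x}. p y) * r x"
  have u0: "0 \<le> ?u x" for x using p r by (intro mult_nonneg_nonneg sum_nonneg) auto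
  have [measurable]: "?u \<in> borel_measurable m" by measurable
  have "L2_inner deg_measure (markov E (\<lambda>x. of_real (p x))) (\<lambda>x. of_real (r x))
      = (\<integral>x. complex_of_real (?u x) \<partial>deg_measure)"
    unfolding L2_inner_def markov_def by (intro Bochner_Integration.integral_cong) auto
  also have "\<dots> = complex_of_real (\<integral>x. ?u x \<partial>deg_measure)" by (rule integral_complex_of_real)
  also have "(\<integral>x. ?u x \<partial>deg_measure) = enn2real (\<integral>\<^sup>+x. ennreal (?u x) \<partial>deg_measure)"
    by (rule integral_eq_nn_integral) (use u0 in \<open>auto simp: borel_measurable_deg_measure\<close>)
  also have "(\<integral>\<^sup>+x. ennreal (?u x) \<partial>deg_measure) = (\<integral>\<^sup>+x. ennreal c * (ennreal (?u x) * (\<Sum>y\<in>E `` {x}. 1)) \<partial>m)"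
    by (rule nn_integral_deg_measure) measurable
  also have "\<dots> = (\<integral>\<^sup>+x. ennreal c * ((\<Sum>y\<in>E `` {x}. ennreal (p y)) * ennreal (r x)) \<partial>m)"
  proof (rule nn_integral_cong)
    fix x assume x: "x \<in> space m"
    have "ennreal (?u x) * (\<Sum>y\<in>E `` {x}. 1) = ennreal (?u x * real (vertex_degree E x))"
    proof -
      have "(\<Sum>y\<in>E `` {x}. 1) = ennreal (real (vertex_degree E x))"
        by (simp add: vertex_degree_def ennreal_of_nat_eq_real_of_nat)
      then show ?thesis by (simp only: ennreal_mult[OF u0 of_nat_0_le_iff])
    qed
    also have "?u x * real (vertex_degree E x) = (\<Sum>y\<in>E `` {x}. p y) * r x"
    proof (cases "vertex_degree E x = 0")
      case True
      then have "E `` {x} = {}" using finite_nbrs[OF x] by (simp add: vertex_degree_def)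
      then show ?thesis by simp
    qed simp
    also have "ennreal ((\<Sum>y\<in>E `` {x}. p y) * r x) = (\<Sum>y\<in>E `` {x}. ennreal (p y)) * ennreal (r x)"
      using p r by (simp add: ennreal_mult sum_nonneg)
    finally show "ennreal c * (ennreal (?u x) * (\<Sum>y\<in>E `` {x}. 1))
        = ennreal c * ((\<Sum>y\<in>E `` {x}. ennreal (p y)) * ennreal (r x))" by simp
  qed
  also have "\<dots> = ennreal c * (\<integral>\<^sup>+x. (\<Sum>y\<in>E `` {x}. ennreal (p y)) * ennreal (r x) \<partial>m)"
    by (rule nn_integral_cmult) measurable
  finally show ?thesis .
qed

lemma markov_sym:
  assumes f: "f \<in> L2_space deg_measure" and g: "g \<in> L2_space deg_measure"
  shows "L2_inner deg_measure (markov E f) g = L2_inner deg_measure f (markov E g)"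
  using f
proof (induction rule: L2_induct_nonneg)
  case (lincomb f1 f2 a b)
  show ?case
    unfolding markov_lincomb
    by (simp only: L2_inner_lincomb_left[OF markov_L2(1)[OF lincomb(1)] markov_L2(1)[OF lincomb(2)] g]
        L2_inner_lincomb_left[OF lincomb(1,2) markov_L2(1)[OF g]] lincomb(3,4))
next
  case (nonneg p)
  let ?p = "\<lambda>x. complex_of_real (p x)"
  show ?case
    using g
  proof (induction rule: L2_induct_nonneg)
    case (lincomb g1 g2 a b)
    show ?case
      unfolding markov_lincomb
      by (simp only: L2_inner_lincomb_right[OF lincomb(1,2) markov_L2(1)[OF nonneg(3)]]
          L2_inner_lincomb_right[OF markov_L2(1)[OF lincomb(1)] markov_L2(1)[OF lincomb(2)] nonneg(3)] lincomb(3,4))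
  next
    case n2: (nonneg r)
    have pm: "p \<in> borel_measurable m" and rm: "r \<in> borel_measurable m"
      using nonneg(1) n2(1) by (simp_all add: borel_measurable_deg_measure)
    have "(\<integral>\<^sup>+x. (\<Sum>y\<in>E `` {x}. ennreal (p y)) * ennreal (r x) \<partial>m)
        = (\<integral>\<^sup>+x. ennreal (p x) * (\<Sum>y\<in>E `` {x}. ennreal (r y)) \<partial>m)"
      using pm rm by (intro reversible) auto
    then have "(\<integral>\<^sup>+x. (\<Sum>y\<in>E `` {x}. ennreal (p y)) * ennreal (r x) \<partial>m)
        = (\<integral>\<^sup>+x. (\<Sum>y\<in>E `` {x}. ennreal (r y)) * ennreal (p x) \<partial>m)" by (simp only: mult.commute)
    then show ?case
      by (subst L2_inner_cnj)
        (simp only: markov_sym_nonneg[OF pm rm nonneg(2) n2(2)] markov_sym_nonneg[OF rm pm n2(2) nonneg(2)]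
          complex_cnj_complex_of_real)
  qed
qed

end

section \<open>Balls, local isomorphisms and compactness\<close>

text \<open>Isomorphism of the subgraphs induced on \<open>A\<close> and \<open>B\<close>, without forming these subgraphs.\<close>

definition iso_on :: "'a rel \<Rightarrow> 'b rel \<Rightarrow> 'a set \<Rightarrow> 'b set \<Rightarrow> ('a \<Rightarrow> 'b) \<Rightarrow> bool" where
  "iso_on E F A B \<phi> \<longleftrightarrow> bij_betw \<phi> A B \<and> (\<forall>u\<in>A. \<forall>v\<in>A. (u, v) \<in> E \<longleftrightarrow> (\<phi> u, \<phi> v) \<in> F)"

definition nball :: "'a rel \<Rightarrow> nat \<Rightarrow> 'a set \<Rightarrow> 'a set" where
  "nball E r S = {u. \<exists>v\<in>S. \<exists>n\<le>r. (v, u) \<in> E ^^ n}"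

lemma iso_on_comp:
  assumes "iso_on E F A B \<phi>" "iso_on F K B C \<psi>"
  shows "iso_on E K A C (\<psi> \<circ> \<phi>)"
proof -
  have "\<phi> u \<in> B" if "u \<in> A" for u using assms(1) that by (auto simp: iso_on_def bij_betw_def)
  then show ?thesis using assms unfolding iso_on_def by (auto intro: bij_betw_trans)
qed

lemma iso_on_inv:
  assumes "iso_on E F A B \<phi>"
  shows "iso_on F E B A (the_inv_into A \<phi>)"
proof -
  have b: "bij_betw \<phi> A B" using assms by (simp add: iso_on_def)
  have in_A: "the_inv_into A \<phi> y \<in> A" and eq: "\<phi> (the_inv_into A \<phi> y) = y" if "y \<in> B" for y
    using b that by (auto simp: bij_betw_def intro: the_inv_into_into f_the_inv_into_f)
  show ?thesis
    unfolding iso_on_def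
  proof (intro conjI ballI)
    show "bij_betw (the_inv_into A \<phi>) B A" using b by (rule bij_betw_the_inv_into)
    fix u v assume "u \<in> B" "v \<in> B"
    then show "(u, v) \<in> F \<longleftrightarrow> (the_inv_into A \<phi> u, the_inv_into A \<phi> v) \<in> E"
      using assms in_A eq unfolding iso_on_def by metis
  qed
qed

lemma nballI: "v \<in> S \<Longrightarrow> n \<le> r \<Longrightarrow> (v, u) \<in> E ^^ n \<Longrightarrow> u \<in> nball E r S"
  unfolding nball_def by blast

lemma nball_refl: "S \<subseteq> nball E r S"
  unfolding nball_def using relpow_0_I by fastforce

lemma nball_mono: "r \<le> r' \<Longrightarrow> nball E r S \<subseteq> nball E r' S"
  unfolding nball_def using order_trans by blast

lemma nball_step: "(v, w) \<in> E \<Longrightarrow> nball E r {w} \<subseteq> nball E (Suc r) {v}"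
  unfolding nball_def using relpow_Suc_I2 by fastforce

lemma nball_Suc: "nball E (Suc r) S = nball E r S \<union> E `` nball E r S"
proof
  show "nball E (Suc r) S \<subseteq> nball E r S \<union> E `` nball E r S"
  proof
    fix u assume "u \<in> nball E (Suc r) S"
    then obtain v n where vn: "v \<in> S" "n \<le> Suc r" "(v, u) \<in> E ^^ n" unfolding nball_def by blast
    show "u \<in> nball E r S \<union> E `` nball E r S"
    proof (cases "n = Suc r")
      case True
      with vn obtain w where "(v, w) \<in> E ^^ r" "(w, u) \<in> E" by auto
      with vn(1) show ?thesis unfolding nball_def by blast
    next
      case False
      with vn show ?thesis unfolding nball_def by force
    qed
  qed
  have "u \<in> nball E (Suc r) S" if w: "w \<in> nball E r S" "(w, u) \<in> E" for w u
  proof -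
    obtain v n where "v \<in> S" "n \<le> r" "(v, w) \<in> E ^^ n" using w(1) unfolding nball_def by blast
    then have "v \<in> S" "Suc n \<le> Suc r" "(v, u) \<in> E ^^ Suc n" using w(2) by auto
    then show ?thesis unfolding nball_def by blast
  qed
  then show "nball E r S \<union> E `` nball E r S \<subseteq> nball E (Suc r) S"
    using nball_mono[of r "Suc r" E S] by auto
qed

lemma nball_0: "nball E 0 S = S"
  unfolding nball_def by auto

lemma nball_finite:
  assumes "finite S" "S \<subseteq> V" "E \<subseteq> V \<times> V" "\<And>v. v \<in> V \<Longrightarrow> finite (E `` {v})"
  shows "finite (nball E r S) \<and> nball E r S \<subseteq> V"
proof (induction r)
  case (Suc r)
  have "E `` nball E r S = (\<Union>v\<in>nball E r S. E `` {v})" by blast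
  moreover have "finite (E `` {v})" if "v \<in> nball E r S" for v using Suc that assms(4) by blast
  ultimately show ?case using Suc assms(3) unfolding nball_Suc by auto
qed (use assms in \<open>simp add: nball_0\<close>)

lemma iso_on_relpow:
  assumes iso: "iso_on E F A B \<phi>" and S: "S \<subseteq> A" "nball E r S \<subseteq> A"
    and v: "v \<in> S" and "n \<le> r" "(v, u) \<in> E ^^ n"
  shows "(\<phi> v, \<phi> u) \<in> F ^^ n"
  using assms(5,6)
proof (induction n arbitrary: u)
  case (Suc n)
  then obtain w where w: "(v, w) \<in> E ^^ n" "(w, u) \<in> E" by auto
  have n: "n \<le> r" using Suc.prems(1) by simp
  have "w \<in> A" "u \<in> A" using nballI[OF v n w(1)] nballI[OF v Suc.prems] S(2) by auto
  then have "(\<phi> w, \<phi> u) \<in> F" using iso w(2) unfolding iso_on_def by blast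
  then show ?case by (rule relpow_Suc_I[OF Suc.IH[OF n w(1)]])
qed simp

lemma iso_on_nball:
  assumes iso: "iso_on E F A B \<phi>" and S: "S \<subseteq> A" and E: "nball E r S \<subseteq> A" and F: "nball F r (\<phi> ` S) \<subseteq> B"
  shows "iso_on E F (nball E r S) (nball F r (\<phi> ` S)) \<phi>"
proof -
  have b: "inj_on \<phi> A" "\<phi> ` A = B" using iso by (auto simp: iso_on_def bij_betw_def)
  have "\<phi> ` nball E r S \<subseteq> nball F r (\<phi> ` S)"
    using iso_on_relpow[OF iso S E] unfolding nball_def by blast
  moreover have "nball F r (\<phi> ` S) \<subseteq> \<phi> ` nball E r S"
  proof
    fix y assume "y \<in> nball F r (\<phi> ` S)"
    then obtain v n where v: "v \<in> S" and n: "n \<le> r" "(\<phi> v, y) \<in> F ^^ n" unfolding nball_def by blast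
    have "\<exists>u. y = \<phi> u \<and> (v, u) \<in> E ^^ n"
      using n
    proof (induction n arbitrary: y)
      case 0
      then show ?case by auto
    next
      case (Suc n)
      then obtain w' where w': "(\<phi> v, w') \<in> F ^^ n" "(w', y) \<in> F" by auto
      obtain w where w: "w' = \<phi> w" "(v, w) \<in> E ^^ n" using Suc.IH[OF _ w'(1)] Suc.prems(1) by auto
      have n: "n \<le> r" using Suc.prems(1) by simp
      have wA: "w \<in> A" using nballI[OF v n w(2)] E by blast
      have "y \<in> nball F r (\<phi> ` S)" by (rule nballI[OF _ Suc.prems]) (use v in blast)
      then obtain u where u: "u \<in> A" "y = \<phi> u" using F b(2) by blast
      have "(w, u) \<in> E" using iso wA u w'(2) w(1) unfolding iso_on_def by blast
      then show ?case using u(2) w(2) by (auto intro: relpow_Suc_I)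
    qed
    then show "y \<in> \<phi> ` nball E r S" using v n(1) unfolding nball_def by blast
  qed
  ultimately have "bij_betw \<phi> (nball E r S) (nball F r (\<phi> ` S))"
    using b(1) E inj_on_subset unfolding bij_betw_def by blast
  then show ?thesis using iso E unfolding iso_on_def by blast
qed

text \<open>Common generalisation of the two relations defining the local topologies: labels agree up to
  an error \<open>e\<close> on the ball of radius \<open>r\<close> around a list of roots.\<close>

definition near_map ::
  "nat \<Rightarrow> real \<Rightarrow> 'a rel \<Rightarrow> ('a \<Rightarrow> real) \<Rightarrow> 'a list \<Rightarrow> 'b rel \<Rightarrow> ('b \<Rightarrow> real) \<Rightarrow> 'b list \<Rightarrow> ('a \<Rightarrow> 'b) \<Rightarrow> bool" where
  "near_map r e E \<xi> vs F \<eta> ws \<phi> \<longleftrightarrow>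
     iso_on E F (nball E r (set vs)) (nball F r (set ws)) \<phi> \<and> map \<phi> vs = ws \<and>
     (\<forall>u\<in>nball E r (set vs). \<bar>\<eta> (\<phi> u) - \<xi> u\<bar> < e)"

lemma near_map_comp:
  assumes 1: "near_map r e E \<xi> vs F \<eta> ws \<phi>" and 2: "near_map r e' F \<eta> ws K \<zeta> us \<psi>"
  shows "near_map r (e + e') E \<xi> vs K \<zeta> us (\<psi> \<circ> \<phi>)"
proof -
  have "\<bar>\<zeta> (\<psi> (\<phi> u)) - \<xi> u\<bar> < e + e'" if u: "u \<in> nball E r (set vs)" for u
  proof -
    have "\<phi> u \<in> nball F r (set ws)" using 1 u by (auto simp: near_map_def iso_on_def bij_betw_def)
    then have "\<bar>\<zeta> (\<psi> (\<phi> u)) - \<eta> (\<phi> u)\<bar> < e'" using 2 by (auto simp: near_map_def)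
    moreover have "\<bar>\<eta> (\<phi> u) - \<xi> u\<bar> < e" using 1 u by (auto simp: near_map_def)
    ultimately show ?thesis by linarith
  qed
  moreover have "map (\<psi> \<circ> \<phi>) vs = us" using 1 2 unfolding near_map_def by (metis map_map)
  ultimately show ?thesis using 1 2 iso_on_comp unfolding near_map_def by fastforce
qed

lemma near_map_inv:
  assumes "near_map r e E \<xi> vs F \<eta> ws \<phi>"
  shows "near_map r e F \<eta> ws E \<xi> vs (the_inv_into (nball E r (set vs)) \<phi>)"
proof -
  let ?A = "nball E r (set vs)" and ?B = "nball F r (set ws)"
  have b: "inj_on \<phi> ?A" "\<phi> ` ?A = ?B" and m: "map \<phi> vs = ws"
    and l: "\<And>u. u \<in> ?A \<Longrightarrow> \<bar>\<eta> (\<phi> u) - \<xi> u\<bar> < e"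
    using assms by (auto simp: near_map_def iso_on_def bij_betw_def)
  have "map (the_inv_into ?A \<phi>) (map \<phi> vs) = vs"
    unfolding map_map using nball_refl[of "set vs" E r] by (intro map_idI) (auto simp: the_inv_into_f_f[OF b(1)])
  moreover have "\<bar>\<xi> (the_inv_into ?A \<phi> y) - \<eta> y\<bar> < e" if "y \<in> ?B" for y
    using l[of "the_inv_into ?A \<phi> y"] that b
    by (metis abs_minus_commute f_the_inv_into_f order_refl the_inv_into_into)
  ultimately show ?thesis using assms iso_on_inv unfolding near_map_def by blast
qed

lemma near_map_mono:
  assumes "near_map r' e' E \<xi> vs F \<eta> ws \<phi>" "r \<le> r'" "e' \<le> e"
  shows "near_map r e E \<xi> vs F \<eta> ws \<phi>"
proof -
  have iso: "iso_on E F (nball E r' (set vs)) (nball F r' (set ws)) \<phi>" and m: "map \<phi> vs = ws"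
    and l: "\<And>u. u \<in> nball E r' (set vs) \<Longrightarrow> \<bar>\<eta> (\<phi> u) - \<xi> u\<bar> < e'"
    using assms(1) by (auto simp: near_map_def)
  have ws: "set ws = \<phi> ` set vs" using m by auto
  have "iso_on E F (nball E r (set vs)) (nball F r (set ws)) \<phi>"
    using iso unfolding ws
    by (rule iso_on_nball[OF _ nball_refl nball_mono[OF assms(2)] nball_mono[OF assms(2)]])
  moreover have "\<bar>\<eta> (\<phi> u) - \<xi> u\<bar> < e" if "u \<in> nball E r (set vs)" for u
    using l[of u] that nball_mono[OF assms(2)] assms(3) by fastforce
  ultimately show ?thesis using m unfolding near_map_def by blast
qed

lemma near_map_of_iso:
  assumes "iso_on E F V W \<phi>" "E \<subseteq> V \<times> V" "F \<subseteq> W \<times> W" "set vs \<subseteq> V" "map \<phi> vs = ws"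
    and "\<And>u. u \<in> V \<Longrightarrow> \<eta> (\<phi> u) = \<xi> u" and "e > 0"
  shows "near_map r e E \<xi> vs F \<eta> ws \<phi>"
proof -
  have sub: "nball K r S \<subseteq> U" if "K \<subseteq> U \<times> U" "S \<subseteq> U" for K :: "'c rel" and S U
    by (induction r) (use that in \<open>auto simp: nball_0 nball_Suc\<close>)
  have ws: "set ws = \<phi> ` set vs" using assms(5) by auto
  have "\<phi> ` set vs \<subseteq> W" using assms(1,4) by (auto simp: iso_on_def bij_betw_def)
  then have "iso_on E F (nball E r (set vs)) (nball F r (set ws)) \<phi>"
    unfolding ws by (intro iso_on_nball[OF assms(1,4)] sub assms)
  then show ?thesis using assms(5-7) sub[OF assms(2,4)] unfolding near_map_def by auto
qed

text \<open>Moving the root to a neighbour costs one unit of radius.\<close>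

lemma near_map_step:
  assumes "near_map (Suc r) e E \<xi> [v] F \<eta> [w] \<phi>" "(v, v') \<in> E"
  shows "(w, \<phi> v') \<in> F" "near_map r e E \<xi> [v'] F \<eta> [\<phi> v'] \<phi>"
proof -
  let ?A = "nball E (Suc r) {v}" and ?B = "nball F (Suc r) {w}"
  have iso: "iso_on E F ?A ?B \<phi>" and w: "\<phi> v = w" and l: "\<And>u. u \<in> ?A \<Longrightarrow> \<bar>\<eta> (\<phi> u) - \<xi> u\<bar> < e"
    using assms(1) by (auto simp: near_map_def)
  have vA: "v \<in> ?A" "v' \<in> ?A"
    using nball_refl[of "{v}" E] nball_step[OF assms(2), of r] nball_refl[of "{v'}" E r] by auto
  show wF: "(w, \<phi> v') \<in> F" using iso vA assms(2) w unfolding iso_on_def by blast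
  have "iso_on E F (nball E r {v'}) (nball F r (\<phi> ` {v'})) \<phi>"
    using nball_step[OF assms(2), of r] nball_step[OF wF, of r] vA by (intro iso_on_nball[OF iso]) auto
  then show "near_map r e E \<xi> [v'] F \<eta> [\<phi> v'] \<phi>"
    using l nball_step[OF assms(2), of r] unfolding near_map_def by auto
qed

text \<open>A compactness argument, as in Koenig's lemma.  For each \<open>n\<close> only finitely many
  restrictions to the ball of radius \<open>n\<close> occur, so one passes to infinite sets \<open>I 0 \<supseteq> I 1 \<supseteq> \<dots>\<close> of
  radii such that the isomorphisms with radius in \<open>I n\<close> agree on the ball of radius \<open>n\<close>.\<close>

lemma near_map_all_imp_iso:
  fixes E :: "'a rel" and F :: "'b rel"
  assumes near: "\<And>r. \<exists>\<phi>. near_map r (1 / Suc r) E \<xi> vs F \<eta> ws \<phi>"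
    and finE: "\<And>r. finite (nball E r (set vs))" and finF: "\<And>r. finite (nball F r (set ws))"
  shows "\<exists>\<phi>. iso_on E F (\<Union>r. nball E r (set vs)) (\<Union>r. nball F r (set ws)) \<phi> \<and> map \<phi> vs = ws \<and>
    (\<forall>u\<in>\<Union>r. nball E r (set vs). \<eta> (\<phi> u) = \<xi> u)"
proof -
  define A where "A r = nball E r (set vs)" for r
  define B where "B r = nball F r (set ws)" for r
  obtain f where f: "\<And>r. near_map r (1 / Suc r) E \<xi> vs F \<eta> ws (f r)" using near by metis
  have fn: "near_map n (1 / Suc n) E \<xi> vs F \<eta> ws (f r)" if "n \<le> r" for n r
    by (rule near_map_mono[OF f that]) (use that in \<open>simp add: frac_le\<close>)
  have fbij: "bij_betw (f r) (A n) (B n)" if "n \<le> r" for n r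
    using fn[OF that] by (simp add: near_map_def iso_on_def A_def B_def)
  have refine: "\<exists>J\<subseteq>I. infinite J \<and> (\<forall>r\<in>J. n \<le> r) \<and> (\<forall>r\<in>J. \<forall>s\<in>J. \<forall>u\<in>A n. f r u = f s u)"
    if I: "infinite I" for I n
  proof -
    define I' where "I' = {r\<in>I. n \<le> r}"
    have I': "infinite I'"
    proof
      assume "finite I'"
      moreover have "I \<subseteq> I' \<union> {..<n}" by (auto simp: I'_def)
      ultimately show False using I finite_subset by blast
    qed
    have "(\<lambda>r. restrict (f r) (A n)) ` I' \<subseteq> A n \<rightarrow>\<^sub>E B n"
      using fbij by (fastforce simp: I'_def bij_betw_def)
    moreover have "finite (A n \<rightarrow>\<^sub>E B n)" using finE finF by (simp add: finite_PiE A_def B_def)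
    ultimately have "finite ((\<lambda>r. restrict (f r) (A n)) ` I')" by (rule finite_subset)
    from pigeonhole_infinite[OF I' this] obtain r0 where
      r0: "infinite {r\<in>I'. restrict (f r) (A n) = restrict (f r0) (A n)}" by blast
    let ?J = "{r\<in>I'. restrict (f r) (A n) = restrict (f r0) (A n)}"
    have "f r u = f r0 u" if "r \<in> ?J" "u \<in> A n" for r u
      using that by (metis (mono_tags, lifting) mem_Collect_eq restrict_apply')
    then show ?thesis using r0 by (intro exI[of _ ?J]) (auto simp: I'_def)
  qed
  have "\<exists>I. \<forall>n. (infinite (I n) \<and> (\<forall>r\<in>I n. n \<le> r) \<and> (\<forall>r\<in>I n. \<forall>s\<in>I n. \<forall>u\<in>A n. f r u = f s u))
      \<and> I (Suc n) \<subseteq> I n"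
  proof (rule dependent_nat_choice)
    show "\<exists>x. infinite x \<and> (\<forall>r\<in>x. 0 \<le> r) \<and> (\<forall>r\<in>x. \<forall>s\<in>x. \<forall>u\<in>A 0. f r u = f s u)"
      using refine[of UNIV 0] by auto
    fix I :: "nat set" and n
    assume "infinite I \<and> (\<forall>r\<in>I. n \<le> r) \<and> (\<forall>r\<in>I. \<forall>s\<in>I. \<forall>u\<in>A n. f r u = f s u)"
    then show "\<exists>y. (infinite y \<and> (\<forall>r\<in>y. Suc n \<le> r) \<and> (\<forall>r\<in>y. \<forall>s\<in>y. \<forall>u\<in>A (Suc n). f r u = f s u)) \<and> y \<subseteq> I"
      using refine[of I "Suc n"] by blast
  qed
  then obtain I where II: "\<forall>n. (infinite (I n) \<and> (\<forall>r\<in>I n. n \<le> r) \<and> (\<forall>r\<in>I n. \<forall>s\<in>I n. \<forall>u\<in>A n. f r u = f s u))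
      \<and> I (Suc n) \<subseteq> I n" ..
  note In = spec[OF II]
  have I: "infinite (I n)" "r \<in> I n \<Longrightarrow> n \<le> r" "I (Suc n) \<subseteq> I n"
    "r \<in> I n \<Longrightarrow> s \<in> I n \<Longrightarrow> u \<in> A n \<Longrightarrow> f r u = f s u" for n r s u
    by (rule conjunct1[OF conjunct1[OF In]], erule bspec[OF conjunct1[OF conjunct2[OF conjunct1[OF In]]]],
      rule conjunct2[OF In], erule (2) bspec[OF bspec[OF bspec[OF conjunct2[OF conjunct2[OF conjunct1[OF In]]]]]])
  have Imono: "I n' \<subseteq> I n" if "n \<le> n'" for n n' using that I(3) by (rule lift_Suc_antimono_le[rotated])
  \<comment> \<open>the limit map; every \<open>f r\<close> with \<open>r\<close> in \<open>I (rad u)\<close> has the same value at \<open>u\<close>\<close>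
  define rad where "rad u = (LEAST n. u \<in> A n)" for u
  define \<phi> where "\<phi> u = f (SOME r. r \<in> I (rad u)) u" for u
  have phi: "\<phi> u = f r u" if u: "u \<in> A n" and r: "r \<in> I n" for u n r
  proof -
    have radA: "u \<in> A (rad u)" unfolding rad_def using u by (rule LeastI)
    have "rad u \<le> n" unfolding rad_def using u by (rule Least_le)
    then have "r \<in> I (rad u)" using Imono r by blast
    moreover from this have "(SOME r. r \<in> I (rad u)) \<in> I (rad u)" by (rule someI)
    ultimately show ?thesis unfolding \<phi>_def using I(4)[OF _ _ radA] by blast
  qed
  have ex: "\<exists>r. r \<in> I n" for n using I(1)[of n] by (metis finite.emptyI equals0I)
  have Amono: "A n \<subseteq> A n'" if "n \<le> n'" for n n' unfolding A_def using that by (rule nball_mono)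
  have common: "\<exists>r n. r \<in> I n \<and> u \<in> A n \<and> v \<in> A n" if "u \<in> (\<Union>r. A r)" "v \<in> (\<Union>r. A r)" for u v
  proof -
    obtain a b where "u \<in> A a" "v \<in> A b" using \<open>u \<in> (\<Union>r. A r)\<close> \<open>v \<in> (\<Union>r. A r)\<close> by blast
    then have "u \<in> A (max a b)" "v \<in> A (max a b)" using Amono[of a "max a b"] Amono[of b "max a b"] by auto
    then show ?thesis using ex by blast
  qed
  have iso: "iso_on E F (A n) (B n) (f r)" if "r \<in> I n" for r n
    using fn[OF I(2)[OF that]] by (simp add: near_map_def A_def B_def)
  have "iso_on E F (\<Union>r. A r) (\<Union>r. B r) \<phi>"
    unfolding iso_on_def bij_betw_def
  proof (intro conjI ballI inj_onI)
    fix u v assume uv: "u \<in> (\<Union>r. A r)" "v \<in> (\<Union>r. A r)"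
    then obtain r n where rn: "r \<in> I n" "u \<in> A n" "v \<in> A n" using common by blast
    show "u = v" if "\<phi> u = \<phi> v"
      using that phi[OF rn(2,1)] phi[OF rn(3,1)] rn iso[OF rn(1)]
      by (auto simp: iso_on_def bij_betw_def inj_on_def)
    show "(u, v) \<in> E \<longleftrightarrow> (\<phi> u, \<phi> v) \<in> F"
      using phi[OF rn(2,1)] phi[OF rn(3,1)] rn iso[OF rn(1)] by (auto simp: iso_on_def)
  next
    have "\<phi> ` A n = B n" for n
    proof -
      obtain r where r: "r \<in> I n" using ex by blast
      then have "\<phi> ` A n = f r ` A n" using phi by (intro image_cong) auto
      then show ?thesis using iso[OF r] by (simp add: iso_on_def bij_betw_def)
    qed
    then show "\<phi> ` (\<Union>r. A r) = (\<Union>r. B r)" by (simp add: image_UN)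
  qed
  moreover have "map \<phi> vs = ws"
  proof -
    obtain r where r: "r \<in> I 0" using ex by blast
    have "map \<phi> vs = map (f r) vs" using phi[OF _ r] by (intro map_cong) (auto simp: A_def nball_0)
    also have "\<dots> = ws" using f[of r] unfolding near_map_def by blast
    finally show ?thesis .
  qed
  moreover have "\<eta> (\<phi> u) = \<xi> u" if u: "u \<in> (\<Union>r. A r)" for u
  proof (rule ccontr)
    assume "\<eta> (\<phi> u) \<noteq> \<xi> u"
    then have "0 < \<bar>\<eta> (\<phi> u) - \<xi> u\<bar>" by simp
    from nat_approx_posE[OF this] obtain k where k: "1 / Suc k < \<bar>\<eta> (\<phi> u) - \<xi> u\<bar>" .
    obtain n where n: "u \<in> A n" using u by blast
    obtain r where r: "r \<in> I n" "k \<le> r" using I(1)[of n] by (meson infinite_nat_iff_unbounded_le)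
    have "\<bar>\<eta> (f r u) - \<xi> u\<bar> < 1 / Suc r"
      using f[of r] n Amono[OF I(2)[OF r(1)]] by (auto simp: near_map_def A_def)
    moreover have "1 / Suc r \<le> (1 / Suc k :: real)" using r(2) by (simp add: frac_le)
    ultimately show False using k phi[OF n r(1)] by simp
  qed
  ultimately show ?thesis unfolding A_def B_def by blast
qed

section \<open>The local topologies\<close>

lemma connected_graphD:
  assumes "connected_graph G"
  shows "edges G \<subseteq> verts G \<times> verts G" "sym (edges G)" "irrefl (edges G)"
    "u \<in> verts G \<Longrightarrow> v \<in> verts G \<Longrightarrow> (u, v) \<in> (edges G)\<^sup>*"
  using assms by (auto simp: connected_graph_def)

lemma graph_iso_iff_iso_on:
  assumes "edges G \<subseteq> verts G \<times> verts G" "edges H \<subseteq> verts H \<times> verts H"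
  shows "graph_iso \<phi> G H \<longleftrightarrow> iso_on (edges G) (edges H) (verts G) (verts H) \<phi>"
proof
  assume "graph_iso \<phi> G H"
  then have b: "bij_betw \<phi> (verts G) (verts H)" and e: "edges H = map_prod \<phi> \<phi> ` edges G"
    by (auto simp: graph_iso_def)
  have "(u, v) \<in> edges G" if uv: "u \<in> verts G" "v \<in> verts G" "(\<phi> u, \<phi> v) \<in> edges H" for u v
  proof -
    obtain u' v' where *: "(u', v') \<in> edges G" "\<phi> u = \<phi> u'" "\<phi> v = \<phi> v'" using uv(3) unfolding e by auto
    then have "u' \<in> verts G" "v' \<in> verts G" using assms(1) by auto
    then have "u = u'" "v = v'" using b uv * by (auto simp: bij_betw_def inj_on_def)
    then show ?thesis using * by simp
  qed
  moreover have "(\<phi> u, \<phi> v) \<in> edges H" if "(u, v) \<in> edges G" for u v unfolding e using that by force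
  ultimately show "iso_on (edges G) (edges H) (verts G) (verts H) \<phi>" using b unfolding iso_on_def by blast
next
  assume iso: "iso_on (edges G) (edges H) (verts G) (verts H) \<phi>"
  then have b: "\<phi> ` verts G = verts H" "bij_betw \<phi> (verts G) (verts H)" by (auto simp: iso_on_def bij_betw_def)
  have "edges H \<subseteq> map_prod \<phi> \<phi> ` edges G"
  proof
    fix e assume e: "e \<in> edges H"
    obtain x y where xy: "e = (x, y)" by (cases e)
    then obtain u v where "u \<in> verts G" "v \<in> verts G" "x = \<phi> u" "y = \<phi> v" using e assms(2) b(1) by blast
    then show "e \<in> map_prod \<phi> \<phi> ` edges G" using e xy iso unfolding iso_on_def by force
  qed
  moreover have "map_prod \<phi> \<phi> ` edges G \<subseteq> edges H" using iso assms(1) unfolding iso_on_def by fastforce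
  ultimately show "graph_iso \<phi> G H" using b(2) unfolding graph_iso_def by blast
qed

lemma graph_dist_le_iff:
  assumes "connected_graph G" "u \<in> verts G" "v \<in> verts G"
  shows "graph_dist G u v \<le> r \<longleftrightarrow> (\<exists>n\<le>r. (u, v) \<in> edges G ^^ n)"
proof -
  obtain n where n: "(u, v) \<in> edges G ^^ n"
    using connected_graphD(4)[OF assms] rtrancl_imp_relpow by blast
  show ?thesis
  proof
    show "\<exists>n\<le>r. (u, v) \<in> edges G ^^ n" if "graph_dist G u v \<le> r"
      using that LeastI[of "\<lambda>n. (u, v) \<in> edges G ^^ n", OF n] unfolding graph_dist_def by blast
    show "graph_dist G u v \<le> r" if "\<exists>n\<le>r. (u, v) \<in> edges G ^^ n"
      using that Least_le[of "\<lambda>n. (u, v) \<in> edges G ^^ n"] order_trans unfolding graph_dist_def by blast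
  qed
qed

lemma nball_subset: "E \<subseteq> V \<times> V \<Longrightarrow> S \<subseteq> V \<Longrightarrow> nball E r S \<subseteq> V"
  by (induction r) (auto simp: nball_0 nball_Suc)

lemma verts_roots_ball:
  assumes G: "connected_graph G" and vs: "set vs \<subseteq> verts G"
  shows "verts (roots_ball r G vs) = nball (edges G) r (set vs)"
proof -
  have "verts (roots_ball r G vs) = {u \<in> verts G. \<exists>v\<in>set vs. \<exists>n\<le>r. (v, u) \<in> edges G ^^ n}"
  proof -
    have "(graph_dist G v u \<le> r) \<longleftrightarrow> (\<exists>n\<le>r. (v, u) \<in> edges G ^^ n)" if "u \<in> verts G" "v \<in> set vs" for u v
      using that vs by (intro graph_dist_le_iff[OF G]) auto
    then show ?thesis by (simp add: roots_ball_def Let_def cong: conj_cong bex_cong)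
  qed
  also have "\<dots> = nball (edges G) r (set vs)"
    using nball_subset[OF connected_graphD(1)[OF G] vs, of r] unfolding nball_def by blast
  finally show ?thesis .
qed

lemma graph_iso_roots_ball:
  assumes "connected_graph G" "set vs \<subseteq> verts G" "connected_graph H" "set ws \<subseteq> verts H"
  shows "graph_iso \<phi> (roots_ball r G vs) (roots_ball r H ws) \<longleftrightarrow>
    iso_on (edges G) (edges H) (nball (edges G) r (set vs)) (nball (edges H) r (set ws)) \<phi>"
proof -
  have e: "edges (roots_ball r G vs) = edges G \<inter> nball (edges G) r (set vs) \<times> nball (edges G) r (set vs)"
    "edges (roots_ball r H ws) = edges H \<inter> nball (edges H) r (set ws) \<times> nball (edges H) r (set ws)"
    using verts_roots_ball[OF assms(1,2), of r] verts_roots_ball[OF assms(3,4), of r]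
    by (simp_all add: roots_ball_def Let_def)
  have "graph_iso \<phi> (roots_ball r G vs) (roots_ball r H ws) \<longleftrightarrow>
    iso_on (edges (roots_ball r G vs)) (edges (roots_ball r H ws)) (nball (edges G) r (set vs)) (nball (edges H) r (set ws)) \<phi>"
    using verts_roots_ball[OF assms(1,2), of r] verts_roots_ball[OF assms(3,4), of r]
    by (subst graph_iso_iff_iso_on) (auto simp: e)
  also have "\<dots> \<longleftrightarrow> iso_on (edges G) (edges H) (nball (edges G) r (set vs)) (nball (edges H) r (set ws)) \<phi>"
    unfolding iso_on_def e by (intro conj_cong refl ball_cong) (auto simp: bij_betw_def)
  finally show ?thesis .
qed

lemma lgraphsD:
  assumes "(G, \<xi>, v) \<in> lgraphs D"
  shows "connected_graph G" "degree_bounded D G" "v \<in> verts G" "\<xi> ` verts G \<subseteq> {0..1}"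
  using assms by (auto simp: lgraphs_def)

lemma rgraphsD:
  assumes "(G, vs) \<in> rgraphs D k"
  shows "connected_graph G" "degree_bounded D G" "set vs \<subseteq> verts G" "length vs = k"
  using assms by (auto simp: rgraphs_def)

lemma lnear_iff:
  assumes "(G, \<xi>, v) \<in> lgraphs D" "(H, \<eta>, w) \<in> lgraphs D'"
  shows "lnear r (G, \<xi>, v) (H, \<eta>, w) \<longleftrightarrow> (\<exists>\<phi>. near_map r (1 / Suc r) (edges G) \<xi> [v] (edges H) \<eta> [w] \<phi>)"
  unfolding lnear_def near_map_def
  using graph_iso_roots_ball[of G "[v]" H "[w]"] verts_roots_ball[of G "[v]" r] lgraphsD[OF assms(1)] lgraphsD[OF assms(2)]
  by simp

text \<open>Without labels the tolerance \<open>e\<close> is arbitrary; constant labels make this an instance of \<open>near_map\<close>.\<close>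

lemma rnear_iff:
  assumes "(G, vs) \<in> rgraphs D k" "(H, ws) \<in> rgraphs D' k'" "e > 0"
  shows "rnear r (G, vs) (H, ws) \<longleftrightarrow> (\<exists>\<phi>. near_map r e (edges G) (\<lambda>_. 0) vs (edges H) (\<lambda>_. 0) ws \<phi>)"
  unfolding rnear_def near_map_def
  using graph_iso_roots_ball[of G vs H ws] rgraphsD[OF assms(1)] rgraphsD[OF assms(2)] assms(3)
  by simp

lemma lgraph_iso_iff:
  assumes "(G, \<xi>, v) \<in> lgraphs D" "(H, \<eta>, w) \<in> lgraphs D'"
  shows "lgraph_iso (G, \<xi>, v) (H, \<eta>, w) \<longleftrightarrow>
    (\<exists>\<phi>. iso_on (edges G) (edges H) (verts G) (verts H) \<phi> \<and> \<phi> v = w \<and> (\<forall>u\<in>verts G. \<eta> (\<phi> u) = \<xi> u))"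
  using graph_iso_iff_iso_on[of G H] connected_graphD(1)[of G] connected_graphD(1)[of H]
    lgraphsD(1)[OF assms(1)] lgraphsD(1)[OF assms(2)] by (simp add: lgraph_iso_def)

lemma rgraph_iso_iff:
  assumes "(G, vs) \<in> rgraphs D k" "(H, ws) \<in> rgraphs D' k'"
  shows "rgraph_iso (G, vs) (H, ws) \<longleftrightarrow>
    (\<exists>\<phi>. iso_on (edges G) (edges H) (verts G) (verts H) \<phi> \<and> map \<phi> vs = ws)"
  using graph_iso_iff_iso_on[of G H] connected_graphD(1)[of G] connected_graphD(1)[of H]
    rgraphsD(1)[OF assms(1)] rgraphsD(1)[OF assms(2)] by (simp add: rgraph_iso_def)

lemma graph_iso_id: "graph_iso id G G"
  by (simp add: graph_iso_def map_prod.id)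

lemma graph_iso_comp:
  assumes "graph_iso \<phi> G H" "graph_iso \<psi> H K"
  shows "graph_iso (\<psi> \<circ> \<phi>) G K"
  using assms unfolding graph_iso_def by (auto intro: bij_betw_trans simp: image_image map_prod_def split_beta)

lemma graph_iso_inv:
  assumes "graph_iso \<phi> G H" "edges G \<subseteq> verts G \<times> verts G"
  shows "graph_iso (the_inv_into (verts G) \<phi>) H G"
proof -
  have b: "bij_betw \<phi> (verts G) (verts H)" "edges H = map_prod \<phi> \<phi> ` edges G"
    using assms(1) by (auto simp: graph_iso_def)
  have H: "edges H \<subseteq> verts H \<times> verts H" using b assms(2) by (auto simp: bij_betw_def)
  show ?thesis
    using assms iso_on_inv graph_iso_iff_iso_on[OF assms(2) H] graph_iso_iff_iso_on[OF H assms(2)] by blast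
qed

lemma lgraph_iso_refl: "lgraph_iso x x"
  unfolding lgraph_iso_def using graph_iso_id by (cases x) (auto intro!: exI[of _ id])

lemma lgraph_iso_trans:
  assumes "lgraph_iso x y" "lgraph_iso y z"
  shows "lgraph_iso x z"
proof (cases x, cases y, cases z)
  fix G \<xi> v H \<eta> w K \<zeta> u
  assume x: "x = (G, \<xi>, v)" and y: "y = (H, \<eta>, w)" and z: "z = (K, \<zeta>, u)"
  obtain \<phi> where p: "graph_iso \<phi> G H" "\<phi> v = w" "\<forall>a\<in>verts G. \<eta> (\<phi> a) = \<xi> a"
    using assms(1) unfolding x y lgraph_iso_def by auto
  obtain \<psi> where q: "graph_iso \<psi> H K" "\<psi> w = u" "\<forall>a\<in>verts H. \<zeta> (\<psi> a) = \<eta> a"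
    using assms(2) unfolding y z lgraph_iso_def by auto
  have "\<phi> a \<in> verts H" if "a \<in> verts G" for a using p(1) that by (auto simp: graph_iso_def bij_betw_def)
  then have "\<forall>a\<in>verts G. \<zeta> ((\<psi> \<circ> \<phi>) a) = \<xi> a" using p q by simp
  then show ?thesis using graph_iso_comp[OF p(1) q(1)] p(2) q(2) unfolding x z lgraph_iso_def by auto
qed

lemma lgraph_iso_sym:
  assumes "lgraph_iso (G, \<xi>, v) (H, \<eta>, w)" "edges G \<subseteq> verts G \<times> verts G" "v \<in> verts G"
  shows "lgraph_iso (H, \<eta>, w) (G, \<xi>, v)"
proof -
  obtain \<phi> where p: "graph_iso \<phi> G H" "\<phi> v = w" "\<forall>a\<in>verts G. \<eta> (\<phi> a) = \<xi> a"
    using assms(1) unfolding lgraph_iso_def by auto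
  have b: "inj_on \<phi> (verts G)" "\<phi> ` verts G = verts H" using p(1) by (auto simp: graph_iso_def bij_betw_def)
  let ?\<psi> = "the_inv_into (verts G) \<phi>"
  have "?\<psi> w = v" using the_inv_into_f_f[OF b(1) assms(3)] p(2) by simp
  moreover have "\<xi> (?\<psi> a) = \<eta> a" if "a \<in> verts H" for a
  proof -
    have "?\<psi> a \<in> verts G" "\<phi> (?\<psi> a) = a"
      using that b by (auto intro: the_inv_into_into f_the_inv_into_f)
    then show ?thesis using p(3) by metis
  qed
  ultimately show ?thesis using graph_iso_inv[OF p(1) assms(2)] unfolding lgraph_iso_def by auto
qed

lemma lclass_eqI:
  assumes "lgraph_iso (G, \<xi>, v) y" "edges G \<subseteq> verts G \<times> verts G" "v \<in> verts G"
  shows "lclass (G, \<xi>, v) = lclass y"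
proof -
  obtain H \<eta> w where y: "y = (H, \<eta>, w)" by (cases y)
  have "lgraph_iso y (G, \<xi>, v)" using lgraph_iso_sym[OF assms(1)[unfolded y] assms(2,3)] unfolding y .
  then show ?thesis
    unfolding lclass_def by (auto intro: lgraph_iso_trans lgraph_iso_trans[OF assms(1)])
qed

lemma lclass_eq_iff:
  assumes "x \<in> lgraphs D" "y \<in> lgraphs D'"
  shows "lclass x = lclass y \<longleftrightarrow> lgraph_iso x y"
proof (cases x, cases y)
  fix G \<xi> v H \<eta> w assume x: "x = (G, \<xi>, v)" and y: "y = (H, \<eta>, w)"
  show ?thesis
  proof
    assume "lclass x = lclass y"
    then show "lgraph_iso x y" using lgraph_iso_refl[of y] unfolding lclass_def by blast
  next
    assume *: "lgraph_iso x y"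
    note D = lgraphsD[OF assms(1)[unfolded x]]
    have "lgraph_iso y x"
      using lgraph_iso_sym[OF *[unfolded x y] connected_graphD(1)[OF D(1)] D(3)] unfolding x y .
    then show "lclass x = lclass y" using * lgraph_iso_trans unfolding lclass_def by blast
  qed
qed

lemma lclass_eq_iff_iso_on:
  assumes "(G, \<xi>, v) \<in> lgraphs D" "(H, \<eta>, w) \<in> lgraphs D'"
  shows "lclass (G, \<xi>, v) = lclass (H, \<eta>, w) \<longleftrightarrow>
    (\<exists>\<phi>. iso_on (edges G) (edges H) (verts G) (verts H) \<phi> \<and> \<phi> v = w \<and> (\<forall>u\<in>verts G. \<eta> (\<phi> u) = \<xi> u))"
  unfolding lclass_eq_iff[OF assms] lgraph_iso_iff[OF assms] ..

lemma rgraph_iso_refl: "rgraph_iso x x"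
  unfolding rgraph_iso_def using graph_iso_id by (cases x) (auto intro!: exI[of _ id])

lemma rgraph_iso_trans:
  assumes "rgraph_iso x y" "rgraph_iso y z"
  shows "rgraph_iso x z"
proof (cases x, cases y, cases z)
  fix G vs H ws K us assume x: "x = (G, vs)" and y: "y = (H, ws)" and z: "z = (K, us)"
  obtain \<phi> where p: "graph_iso \<phi> G H" "map \<phi> vs = ws" using assms(1) unfolding x y rgraph_iso_def by auto
  obtain \<psi> where q: "graph_iso \<psi> H K" "map \<psi> ws = us" using assms(2) unfolding y z rgraph_iso_def by auto
  have "map (\<psi> \<circ> \<phi>) vs = us" using p(2) q(2) by auto
  then show ?thesis using graph_iso_comp[OF p(1) q(1)] unfolding x z rgraph_iso_def by auto
qed

lemma rgraph_iso_sym: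
  assumes "rgraph_iso (G, vs) (H, ws)" "edges G \<subseteq> verts G \<times> verts G" "set vs \<subseteq> verts G"
  shows "rgraph_iso (H, ws) (G, vs)"
proof -
  obtain \<phi> where p: "graph_iso \<phi> G H" "map \<phi> vs = ws" using assms(1) unfolding rgraph_iso_def by auto
  have b: "inj_on \<phi> (verts G)" using p(1) by (auto simp: graph_iso_def bij_betw_def)
  have "map (the_inv_into (verts G) \<phi>) (map \<phi> vs) = vs"
    unfolding map_map using assms(3) by (intro map_idI) (auto simp: the_inv_into_f_f[OF b])
  then show ?thesis using graph_iso_inv[OF p(1) assms(2)] p(2) unfolding rgraph_iso_def by auto
qed

lemma rclass_eqI:
  assumes "rgraph_iso (G, vs) y" "edges G \<subseteq> verts G \<times> verts G" "set vs \<subseteq> verts G"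
  shows "rclass (G, vs) = rclass y"
proof -
  obtain H ws where y: "y = (H, ws)" by (cases y)
  have "rgraph_iso y (G, vs)" using rgraph_iso_sym[OF assms(1)[unfolded y] assms(2,3)] unfolding y .
  then show ?thesis
    unfolding rclass_def by (auto intro: rgraph_iso_trans rgraph_iso_trans[OF assms(1)])
qed

lemma rclass_eq_iff:
  assumes "x \<in> rgraphs D k" "y \<in> rgraphs D' k'"
  shows "rclass x = rclass y \<longleftrightarrow> rgraph_iso x y"
proof (cases x, cases y)
  fix G vs H ws assume x: "x = (G, vs)" and y: "y = (H, ws)"
  show ?thesis
  proof
    assume "rclass x = rclass y"
    then show "rgraph_iso x y" using rgraph_iso_refl[of y] unfolding rclass_def by blast
  next
    assume *: "rgraph_iso x y"
    note D = rgraphsD[OF assms(1)[unfolded x]]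
    have "rgraph_iso y x"
      using rgraph_iso_sym[OF *[unfolded x y] connected_graphD(1)[OF D(1)] D(3)] unfolding x y .
    then show "rclass x = rclass y" using * rgraph_iso_trans unfolding rclass_def by blast
  qed
qed

lemma rclass_eq_iff_iso_on:
  assumes "(G, vs) \<in> rgraphs D k" "(H, ws) \<in> rgraphs D' k'"
  shows "rclass (G, vs) = rclass (H, ws) \<longleftrightarrow>
    (\<exists>\<phi>. iso_on (edges G) (edges H) (verts G) (verts H) \<phi> \<and> map \<phi> vs = ws)"
  unfolding rclass_eq_iff[OF assms] rgraph_iso_iff[OF assms] ..

lemma degree_bounded_finite:
  assumes "degree_bounded D G" "connected_graph G" "finite S" "S \<subseteq> verts G"
  shows "finite (nball (edges G) r S)"
  using nball_finite[OF assms(3,4) connected_graphD(1)[OF assms(2)]] assms(1)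
  by (auto simp: degree_bounded_def)

lemma nball_UN_verts:
  assumes "connected_graph G" "set vs \<subseteq> verts G" "vs \<noteq> []"
  shows "(\<Union>r. nball (edges G) r (set vs)) = verts G"
proof
  show "(\<Union>r. nball (edges G) r (set vs)) \<subseteq> verts G"
    using nball_subset[OF connected_graphD(1)[OF assms(1)] assms(2)] by blast
  show "verts G \<subseteq> (\<Union>r. nball (edges G) r (set vs))"
  proof
    fix u assume u: "u \<in> verts G"
    have v: "hd vs \<in> set vs" using assms(3) by simp
    then obtain n where "(hd vs, u) \<in> edges G ^^ n"
      using connected_graphD(4)[OF assms(1) _ u] assms(2) rtrancl_imp_relpow by blast
    then show "u \<in> (\<Union>r. nball (edges G) r (set vs))" using nballI[OF v order_refl] by blast
  qed
qed

text \<open>A strict inequality on a finite ball leaves room, which is the reason why neighbourhoods are open.\<close>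

lemma near_map_slack:
  assumes "near_map r e E \<xi> vs F \<eta> ws \<phi>" "finite (nball E r (set vs))"
  shows "\<exists>e'<e. near_map r e' E \<xi> vs F \<eta> ws \<phi>"
proof -
  let ?m = "Max (insert (e - 1) ((\<lambda>u. \<bar>\<eta> (\<phi> u) - \<xi> u\<bar>) ` nball E r (set vs)))"
  have fin: "finite (insert (e - 1) ((\<lambda>u. \<bar>\<eta> (\<phi> u) - \<xi> u\<bar>) ` nball E r (set vs)))" using assms(2) by simp
  have m: "?m < e" using assms(1) fin by (subst Max_less_iff) (auto simp: near_map_def)
  have "\<bar>\<eta> (\<phi> u) - \<xi> u\<bar> < (?m + e) / 2" if "u \<in> nball E r (set vs)" for u
  proof -
    have "\<bar>\<eta> (\<phi> u) - \<xi> u\<bar> \<le> ?m" using fin that by (intro Max_ge) auto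
    then show ?thesis using m by simp
  qed
  then have "near_map r ((?m + e) / 2) E \<xi> vs F \<eta> ws \<phi>" using assms(1) unfolding near_map_def by blast
  moreover have "(?m + e) / 2 < e" using m by simp
  ultimately show ?thesis by blast
qed

lemma near_map_open:
  assumes "near_map r e E \<xi> vs F \<eta> ws \<phi>" "finite (nball E r (set vs))"
  shows "\<exists>r'\<ge>r. \<forall>K \<zeta> us \<psi>. near_map r' (1 / Suc r') F \<eta> ws (K :: 'c rel) \<zeta> us \<psi> \<longrightarrow>
    near_map r e E \<xi> vs K \<zeta> us (\<psi> \<circ> \<phi>)"
proof -
  obtain e' where e': "e' < e" "near_map r e' E \<xi> vs F \<eta> ws \<phi>" using near_map_slack[OF assms] by blast
  from e'(1) have "0 < e - e'" by simp
  from nat_approx_posE[OF this] obtain k where k: "1 / Suc k < e - e'" .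
  let ?r = "max r k"
  have "1 / real (Suc ?r) \<le> 1 / Suc k" by (intro divide_left_mono) auto
  with k have le: "e' + 1 / Suc ?r \<le> e" by linarith
  have "near_map r e E \<xi> vs K \<zeta> us (\<psi> \<circ> \<phi>)" if psi: "near_map ?r (1 / Suc ?r) F \<eta> ws K \<zeta> us \<psi>"
    for K :: "'c rel" and \<zeta> us \<psi>
  proof -
    have "near_map r (1 / Suc ?r) F \<eta> ws K \<zeta> us \<psi>" by (rule near_map_mono[OF psi]) auto
    from near_map_comp[OF e'(2) this] show ?thesis by (rule near_map_mono[OF _ order_refl le])
  qed
  then show ?thesis by (intro exI[of _ ?r]) auto
qed

text \<open>The properties of \<open>near\<close> from which the Borel structure is analysed: the neighbourhoods of a
  class are open (\<open>near_open\<close>) and shrink to the class (\<open>near_all\<close>).\<close>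

locale local_topology =
  fixes X :: "'x set" and cl :: "'x \<Rightarrow> 'c" and near :: "nat \<Rightarrow> 'x \<Rightarrow> 'x \<Rightarrow> bool"
  assumes near_refl: "\<And>x r. x \<in> X \<Longrightarrow> near r x x"
    and near_sym: "\<And>x y r. x \<in> X \<Longrightarrow> y \<in> X \<Longrightarrow> near r x y \<Longrightarrow> near r y x"
    and near_mono: "\<And>x y r r'. x \<in> X \<Longrightarrow> y \<in> X \<Longrightarrow> near r' x y \<Longrightarrow> r \<le> r' \<Longrightarrow> near r x y"
    and near_cl: "\<And>x y z r. x \<in> X \<Longrightarrow> y \<in> X \<Longrightarrow> z \<in> X \<Longrightarrow> cl x = cl y \<Longrightarrow> near r y z \<Longrightarrow> near r x z"
    and near_open: "\<And>x y r. x \<in> X \<Longrightarrow> y \<in> X \<Longrightarrow> near r x y \<Longrightarrow> \<exists>r'. \<forall>z\<in>X. near r' y z \<longrightarrow> near r x z"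
    and near_all: "\<And>x y. x \<in> X \<Longrightarrow> y \<in> X \<Longrightarrow> (\<And>r. near r x y) \<Longrightarrow> cl x = cl y"
begin

definition opens :: "'c set set" where
  "opens = {U. U \<subseteq> cl ` X \<and> (\<forall>x\<in>X. cl x \<in> U \<longrightarrow> (\<exists>r. \<forall>y\<in>X. near r x y \<longrightarrow> cl y \<in> U))}"

lemma local_borel_eq: "local_borel X cl near = sigma (cl ` X) opens"
  by (simp add: local_borel_def opens_def)

lemma space_local_borel: "space (local_borel X cl near) = cl ` X"
  unfolding local_borel_eq by (rule space_measure_of) (auto simp: opens_def)

lemma sets_local_borel: "sets (local_borel X cl near) = sigma_sets (cl ` X) opens"
  unfolding local_borel_eq by (rule sets_measure_of) (auto simp: opens_def)

lemma open_measurable: "U \<in> opens \<Longrightarrow> U \<in> sets (local_borel X cl near)"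
  unfolding sets_local_borel by (rule sigma_sets.Basic)

lemma opensI:
  assumes "U \<subseteq> cl ` X" "\<And>x. x \<in> X \<Longrightarrow> cl x \<in> U \<Longrightarrow> \<exists>r. \<forall>y\<in>X. near r x y \<longrightarrow> cl y \<in> U"
  shows "U \<in> opens"
  using assms by (simp add: opens_def)

lemma Int_stable_opens: "Int_stable opens"
  unfolding Int_stable_def
proof (intro ballI opensI)
  fix U V assume U: "U \<in> opens" and V: "V \<in> opens"
  show "U \<inter> V \<subseteq> cl ` X" using U by (auto simp: opens_def)
  fix x assume x: "x \<in> X" "cl x \<in> U \<inter> V"
  obtain r where r: "\<forall>y\<in>X. near r x y \<longrightarrow> cl y \<in> U" using U x by (auto simp: opens_def)
  obtain s where s: "\<forall>y\<in>X. near s x y \<longrightarrow> cl y \<in> V" using V x by (auto simp: opens_def)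
  have "\<forall>y\<in>X. near (max r s) x y \<longrightarrow> cl y \<in> U \<inter> V"
    using r s near_mono[OF x(1), of _ "max r s"] by (metis IntI max.cobounded1 max.cobounded2)
  then show "\<exists>r. \<forall>y\<in>X. near r x y \<longrightarrow> cl y \<in> U \<inter> V" by blast
qed

lemma nbhd_open:
  assumes x: "x \<in> X"
  shows "cl ` {y\<in>X. near r x y} \<in> opens"
proof (rule opensI)
  fix y assume y: "y \<in> X" "cl y \<in> cl ` {y\<in>X. near r x y}"
  then obtain y' where y': "y' \<in> X" "near r x y'" "cl y = cl y'" by auto
  have "near r y x" by (rule near_cl[OF y(1) y'(1) x y'(3) near_sym[OF x y'(1,2)]])
  then have "near r x y" by (rule near_sym[OF y(1) x])
  then show "\<exists>r'. \<forall>z\<in>X. near r' y z \<longrightarrow> cl z \<in> cl ` {y\<in>X. near r x y}"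
    using near_open[OF x y(1)] by blast
qed auto

lemma singleton_measurable:
  assumes x: "x \<in> X"
  shows "{cl x} \<in> sets (local_borel X cl near)"
proof -
  have "{cl x} = (\<Inter>r. cl ` {y\<in>X. near r x y})"
  proof
    show "{cl x} \<subseteq> (\<Inter>r. cl ` {y\<in>X. near r x y})" using x near_refl[OF x] by blast
    show "(\<Inter>r. cl ` {y\<in>X. near r x y}) \<subseteq> {cl x}"
    proof
      fix c assume c: "c \<in> (\<Inter>r. cl ` {y\<in>X. near r x y})"
      then obtain y where y: "y \<in> X" "c = cl y" by blast
      have "near r x y" for r
      proof -
        obtain y' where y': "y' \<in> X" "near r x y'" "cl y = cl y'" using c y by blast
        have "near r y x" by (rule near_cl[OF y(1) y'(1) x y'(3) near_sym[OF x y'(1,2)]])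
        then show ?thesis by (rule near_sym[OF y(1) x])
      qed
      then show "c \<in> {cl x}" using near_all[OF x y(1)] y(2) by simp
    qed
  qed
  also have "\<dots> \<in> sets (local_borel X cl near)"
    using open_measurable[OF nbhd_open[OF x]] by (intro sets.countable_INT) auto
  finally show ?thesis .
qed

text \<open>For open \<open>U\<close> these sets exhaust \<open>U\<close>, and membership in \<open>core r U\<close> is decided by the ball of radius \<open>r\<close>.\<close>

definition core :: "nat \<Rightarrow> 'c set \<Rightarrow> 'c set" where
  "core r U = cl ` {x\<in>X. \<forall>y\<in>X. near r x y \<longrightarrow> cl y \<in> U}"

lemma cl_in_core_iff:
  assumes "x \<in> X"
  shows "cl x \<in> core r U \<longleftrightarrow> (\<forall>y\<in>X. near r x y \<longrightarrow> cl y \<in> U)"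
proof
  assume "cl x \<in> core r U"
  then obtain x' where x': "x' \<in> X" "cl x' = cl x" "\<forall>y\<in>X. near r x' y \<longrightarrow> cl y \<in> U"
    unfolding core_def by auto
  then show "\<forall>y\<in>X. near r x y \<longrightarrow> cl y \<in> U" using near_cl[OF x'(1) assms _ x'(2)] by blast
qed (use assms in \<open>auto simp: core_def\<close>)

text \<open>The complement is a union of neighbourhoods, by symmetry of \<open>near\<close>.\<close>

lemma core_measurable: "core r U \<in> sets (local_borel X cl near)"
proof -
  have "cl ` X - core r U \<in> opens"
  proof (rule opensI)
    fix x assume x: "x \<in> X" "cl x \<in> cl ` X - core r U"
    then obtain y where y: "y \<in> X" "near r x y" "cl y \<notin> U" using cl_in_core_iff by blast
    obtain r' where r': "\<forall>z\<in>X. near r' x z \<longrightarrow> near r y z" using near_open[OF y(1) x(1) near_sym[OF x(1) y(1,2)]] by blast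
    have "cl z \<in> cl ` X - core r U" if z: "z \<in> X" "near r' x z" for z
      using r' z y near_sym[OF y(1) z(1)] cl_in_core_iff[OF z(1)] by blast
    then show "\<exists>r'. \<forall>y\<in>X. near r' x y \<longrightarrow> cl y \<in> cl ` X - core r U" by blast
  qed auto
  from open_measurable[OF this] have "space (local_borel X cl near) - (cl ` X - core r U) \<in> sets (local_borel X cl near)"
    by (rule sets.compl_sets)
  moreover have "core r U \<subseteq> cl ` X" by (auto simp: core_def)
  ultimately show ?thesis by (simp add: space_local_borel double_diff)
qed

lemma incseq_core: "incseq (\<lambda>r. core r U)"
proof (rule incseq_SucI)
  fix r show "core r U \<subseteq> core (Suc r) U"
  proof
    fix c assume "c \<in> core r U"
    then obtain x where x: "x \<in> X" "c = cl x" "\<forall>y\<in>X. near r x y \<longrightarrow> cl y \<in> U" by (auto simp: core_def)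
    then have "\<forall>y\<in>X. near (Suc r) x y \<longrightarrow> cl y \<in> U" using near_mono[OF x(1)] by (meson le_SucI order_refl)
    then show "c \<in> core (Suc r) U" using x by (auto simp: core_def)
  qed
qed

lemma open_eq_UN_core:
  assumes "U \<in> opens"
  shows "U = (\<Union>r. core r U)"
proof
  show "U \<subseteq> (\<Union>r. core r U)"
  proof
    fix c assume c: "c \<in> U"
    then obtain x where x: "x \<in> X" "c = cl x" using assms by (auto simp: opens_def)
    then obtain r where "\<forall>y\<in>X. near r x y \<longrightarrow> cl y \<in> U" using assms c by (auto simp: opens_def)
    then show "c \<in> (\<Union>r. core r U)" using x by (auto simp: core_def)
  qed
  show "(\<Union>r. core r U) \<subseteq> U" using near_refl by (auto simp: core_def)
qed

lemma borel_measurable_of_open: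
  fixes f :: "'c \<Rightarrow> real"
  assumes "\<And>x a. x \<in> X \<Longrightarrow> a < f (cl x) \<Longrightarrow> \<exists>r. \<forall>y\<in>X. near r x y \<longrightarrow> a < f (cl y)"
  shows "f \<in> borel_measurable (local_borel X cl near)"
  unfolding borel_measurable_iff_greater
proof
  fix a
  have "{c \<in> cl ` X. a < f c} \<in> opens" by (rule opensI) (use assms in auto)
  then show "{w \<in> space (local_borel X cl near). a < f w} \<in> sets (local_borel X cl near)"
    unfolding space_local_borel by (rule open_measurable)
qed

end

text \<open>Neighbourhoods are open by \<open>near_map_open\<close>, and they shrink to one class by the compactness of
  \<open>near_map_all_imp_iso\<close>.\<close>

lemma local_topology_labelled: "local_topology (lgraphs D) lclass lnear"
proof (rule local_topology.intro)
  fix x y z :: "nat lgraph" and r r' :: nat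
  obtain G \<xi> v where x: "x = (G, \<xi>, v)" by (cases x)
  obtain H \<eta> w where y: "y = (H, \<eta>, w)" by (cases y)
  obtain K \<zeta> u where z: "z = (K, \<zeta>, u)" by (cases z)
  assume xX: "x \<in> lgraphs D"
  note xX' = xX[unfolded x]
  note gx = lgraphsD[OF xX']
  have iso_near: "\<exists>\<phi>. near_map r e (edges G) \<xi> [v] (edges H) \<eta> [w] \<phi>"
    if yX: "(H, \<eta>, w) \<in> lgraphs D" and c: "lclass (G, \<xi>, v) = lclass (H, \<eta>, w)" and e: "e > 0" for e H \<eta> w r
  proof -
    note gy = lgraphsD[OF yX]
    obtain \<phi> where p: "iso_on (edges G) (edges H) (verts G) (verts H) \<phi>" "\<phi> v = w" "\<forall>u\<in>verts G. \<eta> (\<phi> u) = \<xi> u"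
      using c unfolding lclass_eq_iff_iso_on[OF xX' yX] by blast
    have "near_map r e (edges G) \<xi> [v] (edges H) \<eta> [w] \<phi>"
      by (rule near_map_of_iso[OF p(1) connected_graphD(1)[OF gx(1)] connected_graphD(1)[OF gy(1)]])
        (use p gx e in auto)
    then show ?thesis by blast
  qed
  show "lnear r x x" using iso_near[OF xX' refl, of "1 / Suc r" r] unfolding x lnear_iff[OF xX' xX'] by simp
  assume yX: "y \<in> lgraphs D"
  note yX' = yX[unfolded y]
  note gy = lgraphsD[OF yX']
  note ln = lnear_iff[OF xX' yX'] and ln' = lnear_iff[OF yX' xX']
  have fx: "finite (nball (edges G) r (set [v]))" for r by (rule degree_bounded_finite[OF gx(2,1)]) (use gx in auto)
  have fy: "finite (nball (edges H) r (set [w]))" for r by (rule degree_bounded_finite[OF gy(2,1)]) (use gy in auto)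
  show "lnear r y x" if n: "lnear r x y"
    using n near_map_inv unfolding x y ln ln' by blast
  show "lnear r x y" if n: "lnear r' x y" "r \<le> r'"
  proof -
    have le: "1 / real (Suc r') \<le> 1 / Suc r" using n(2) by (intro divide_left_mono) auto
    show ?thesis using n(1) near_map_mono[OF _ n(2) le] unfolding x y ln by blast
  qed
  show "\<exists>r'. \<forall>z\<in>lgraphs D. lnear r' y z \<longrightarrow> lnear r x z" if n: "lnear r x y"
  proof -
    obtain \<phi> where "near_map r (1 / Suc r) (edges G) \<xi> [v] (edges H) \<eta> [w] \<phi>"
      using n unfolding x y ln by blast
    from near_map_open[OF this fx, where ?'c = nat] obtain r' where
      r': "\<And>K \<zeta> us \<psi>. near_map r' (1 / Suc r') (edges H) \<eta> [w] (K :: nat rel) \<zeta> us \<psi> \<Longrightarrow>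
        near_map r (1 / Suc r) (edges G) \<xi> [v] K \<zeta> us (\<psi> \<circ> \<phi>)" by blast
    have "lnear r x z" if zX: "z \<in> lgraphs D" and nz: "lnear r' y z" for z
    proof -
      obtain K \<zeta> u where z: "z = (K, \<zeta>, u)" by (cases z)
      note zX' = zX[unfolded z]
      show ?thesis using nz r' unfolding x y z lnear_iff[OF yX' zX'] lnear_iff[OF xX' zX'] by blast
    qed
    then show ?thesis by blast
  qed
  show "lclass x = lclass y" if n: "\<And>r. lnear r x y"
  proof -
    have "\<exists>\<phi>. near_map r (1 / Suc r) (edges G) \<xi> [v] (edges H) \<eta> [w] \<phi>" for r
      using n[of r] unfolding x y ln .
    note iso = near_map_all_imp_iso[OF this fx fy]
    have GV: "(\<Union>r. nball (edges G) r (set [v])) = verts G" by (rule nball_UN_verts) (use gx in auto)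
    have HV: "(\<Union>r. nball (edges H) r (set [w])) = verts H" by (rule nball_UN_verts) (use gy in auto)
    have "\<exists>\<phi>. iso_on (edges G) (edges H) (verts G) (verts H) \<phi> \<and> map \<phi> [v] = [w] \<and> (\<forall>u\<in>verts G. \<eta> (\<phi> u) = \<xi> u)"
      using iso unfolding GV HV .
    then show ?thesis unfolding x y lclass_eq_iff_iso_on[OF xX' yX'] by auto
  qed
  assume zX: "z \<in> lgraphs D"
  note zX' = zX[unfolded z]
  show "lnear r x z" if c: "lclass x = lclass y" and n: "lnear r y z"
  proof -
    obtain \<psi> where psi: "near_map r (1 / Suc r) (edges H) \<eta> [w] (edges K) \<zeta> [u] \<psi>"
      using n unfolding y z lnear_iff[OF yX' zX'] by blast
    obtain e where e: "e < 1 / Suc r" "near_map r e (edges H) \<eta> [w] (edges K) \<zeta> [u] \<psi>"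
      using near_map_slack[OF psi fy] by blast
    obtain \<phi> where p: "near_map r (1 / Suc r - e) (edges G) \<xi> [v] (edges H) \<eta> [w] \<phi>"
      using iso_near[OF yX' c[unfolded x y], of "1 / Suc r - e" r] e by auto
    have "near_map r (1 / Suc r) (edges G) \<xi> [v] (edges K) \<zeta> [u] (\<psi> \<circ> \<phi>)"
      using near_map_comp[OF p e(2)] by simp
    then show ?thesis unfolding x z lnear_iff[OF xX' zX'] by blast
  qed
qed

text \<open>Without labels \<open>rnear r\<close> is transitive, so its neighbourhoods are open for the same radius.\<close>

lemma local_topology_rooted:
  assumes k: "k > 0"
  shows "local_topology (rgraphs D k) rclass rnear"
proof (rule local_topology.intro)
  fix x y z :: "nat rgraph" and r r' :: nat
  obtain G vs where x: "x = (G, vs)" by (cases x)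
  obtain H ws where y: "y = (H, ws)" by (cases y)
  obtain K us where z: "z = (K, us)" by (cases z)
  assume xX: "x \<in> rgraphs D k"
  note xX' = xX[unfolded x]
  note gx = rgraphsD[OF xX']
  have iso_near: "rnear r (G, vs) (H, ws)" if yX: "(H, ws) \<in> rgraphs D k" and c: "rclass (G, vs) = rclass (H, ws)" for H ws r
  proof -
    note gy = rgraphsD[OF yX]
    obtain \<phi> where p: "iso_on (edges G) (edges H) (verts G) (verts H) \<phi>" "map \<phi> vs = ws"
      using c unfolding rclass_eq_iff_iso_on[OF xX' yX] by blast
    have "near_map r 1 (edges G) (\<lambda>_. 0) vs (edges H) (\<lambda>_. 0) ws \<phi>"
      by (rule near_map_of_iso[OF p(1) connected_graphD(1)[OF gx(1)] connected_graphD(1)[OF gy(1)]])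
        (use p gx in auto)
    then show ?thesis unfolding rnear_iff[OF xX' yX zero_less_one] by blast
  qed
  show "rnear r x x" using iso_near[OF xX' refl] unfolding x .
  assume yX: "y \<in> rgraphs D k"
  note yX' = yX[unfolded y]
  note gy = rgraphsD[OF yX']
  note rn = rnear_iff[OF xX' yX' zero_less_one] and rn' = rnear_iff[OF yX' xX' zero_less_one]
  have fx: "finite (nball (edges G) r (set vs))" for r by (rule degree_bounded_finite[OF gx(2,1)]) (use gx in auto)
  have fy: "finite (nball (edges H) r (set ws))" for r by (rule degree_bounded_finite[OF gy(2,1)]) (use gy in auto)
  show "rnear r y x" if n: "rnear r x y"
    using n near_map_inv unfolding x y rn rn' by blast
  show "rnear r x y" if n: "rnear r' x y" "r \<le> r'"
    using n(1) near_map_mono[OF _ n(2) order_refl] unfolding x y rn by blast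
  have trans: "rnear r x z" if n: "rnear r x y" "rnear r y z" and zX: "z \<in> rgraphs D k" for z r
  proof -
    obtain K us where z: "z = (K, us)" by (cases z)
    note zX' = zX[unfolded z]
    obtain \<phi> where p: "near_map r 1 (edges G) (\<lambda>_. 0) vs (edges H) (\<lambda>_. 0) ws \<phi>"
      using n(1) unfolding x y rn by blast
    obtain \<psi> where q: "near_map r 1 (edges H) (\<lambda>_. 0) ws (edges K) (\<lambda>_. 0) us \<psi>"
      using n(2) unfolding y z rnear_iff[OF yX' zX' zero_less_one] by blast
    show ?thesis using near_map_comp[OF p q] unfolding x z rnear_iff[OF xX' zX', of "1 + 1", simplified] by auto
  qed
  show "\<exists>r'. \<forall>z\<in>rgraphs D k. rnear r' y z \<longrightarrow> rnear r x z" if n: "rnear r x y"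
    using trans[OF n] by blast
  show "rclass x = rclass y" if n: "\<And>r. rnear r x y"
  proof -
    have "\<exists>\<phi>. near_map r (1 / Suc r) (edges G) (\<lambda>_. 0) vs (edges H) (\<lambda>_. 0) ws \<phi>" for r
      using n[of r] rnear_iff[OF xX' yX', of "1 / Suc r" r] unfolding x y by simp
    note iso = near_map_all_imp_iso[OF this fx fy]
    have GV: "(\<Union>r. nball (edges G) r (set vs)) = verts G" by (rule nball_UN_verts) (use gx k in auto)
    have HV: "(\<Union>r. nball (edges H) r (set ws)) = verts H" by (rule nball_UN_verts) (use gy k in auto)
    have "\<exists>\<phi>. iso_on (edges G) (edges H) (verts G) (verts H) \<phi> \<and> map \<phi> vs = ws"
      using iso unfolding GV HV by blast
    then show ?thesis unfolding x y rclass_eq_iff_iso_on[OF xX' yX'] .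
  qed
  assume zX: "z \<in> rgraphs D k"
  show "rnear r x z" if c: "rclass x = rclass y" and n: "rnear r y z"
    by (rule trans[OF iso_near[OF yX' c[unfolded x y], folded x y] n zX])
qed

section \<open>Borel functions of labelled graphs\<close>

interpretation labelled: local_topology "lgraphs D" lclass lnear for D
  by (rule local_topology_labelled)

lemma labelled_space_eq: "labelled_space D = sigma (lclass ` lgraphs D) (labelled.opens D)"
  unfolding labelled_space_def by (rule labelled.local_borel_eq)

lemma space_labelled_space: "space (labelled_space D) = lclass ` lgraphs D"
  unfolding labelled_space_def by (rule labelled.space_local_borel)

lemma sets_labelled_space: "sets (labelled_space D) = sigma_sets (lclass ` lgraphs D) (labelled.opens D)"
  unfolding labelled_space_def by (rule labelled.sets_local_borel)

lemma space_rooted_space: "k > 0 \<Longrightarrow> space (rooted_space D k) = rclass ` rgraphs D k"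
  unfolding rooted_space_def
  by (rule local_topology.space_local_borel[OF local_topology_rooted])

lemma rooted_singleton_measurable:
  "x \<in> rgraphs D k \<Longrightarrow> k > 0 \<Longrightarrow> {rclass x} \<in> sets (rooted_space D k)"
  unfolding rooted_space_def
  by (rule local_topology.singleton_measurable[OF local_topology_rooted])

lemma lgraphs_nbr:
  assumes "(G, \<xi>, v) \<in> lgraphs D" "(v, w) \<in> edges G"
  shows "(G, \<xi>, w) \<in> lgraphs D"
  using assms connected_graphD(1)[OF lgraphsD(1)[OF assms(1)]] by (auto simp: lgraphs_def)

text \<open>Isomorphisms carry neighbours of the root to neighbours of the root, so the edges of the graphing can be
  read off from any representative.\<close>

lemma bernoulli_nbrs:
  assumes x: "(G, \<xi>, v) \<in> lgraphs D"
  shows "bernoulli_edges D `` {lclass (G, \<xi>, v)} = (\<lambda>w. lclass (G, \<xi>, w)) ` (edges G `` {v})"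
proof
  show "(\<lambda>w. lclass (G, \<xi>, w)) ` (edges G `` {v}) \<subseteq> bernoulli_edges D `` {lclass (G, \<xi>, v)}"
    using x unfolding bernoulli_edges_def by blast
  show "bernoulli_edges D `` {lclass (G, \<xi>, v)} \<subseteq> (\<lambda>w. lclass (G, \<xi>, w)) ` (edges G `` {v})"
  proof
    fix y assume "y \<in> bernoulli_edges D `` {lclass (G, \<xi>, v)}"
    then obtain G' \<xi>' v' w' where y: "lclass (G', \<xi>', v') = lclass (G, \<xi>, v)" "y = lclass (G', \<xi>', w')"
      and x': "(G', \<xi>', v') \<in> lgraphs D" and e: "(v', w') \<in> edges G'"
      unfolding bernoulli_edges_def by auto
    obtain \<phi> where p: "iso_on (edges G') (edges G) (verts G') (verts G) \<phi>" "\<phi> v' = v" "\<forall>u\<in>verts G'. \<xi> (\<phi> u) = \<xi>' u"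
      using y(1) unfolding lclass_eq_iff_iso_on[OF x' x] by blast
    have "v' \<in> verts G'" "w' \<in> verts G'" using e connected_graphD(1)[OF lgraphsD(1)[OF x']] by auto
    then have vw: "(v, \<phi> w') \<in> edges G" using p(1,2) e unfolding iso_on_def by blast
    have "lclass (G', \<xi>', w') = lclass (G, \<xi>, \<phi> w')"
      unfolding lclass_eq_iff_iso_on[OF lgraphs_nbr[OF x' e] lgraphs_nbr[OF x vw]] using p by blast
    then show "y \<in> (\<lambda>w. lclass (G, \<xi>, w)) ` (edges G `` {v})" using y(2) vw by blast
  qed
qed

lemma bernoulli_nbrs_finite:
  assumes "c \<in> space (labelled_space D)"
  shows "finite (bernoulli_edges D `` {c})" "bernoulli_edges D `` {c} \<subseteq> space (labelled_space D)"
proof -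
  obtain G \<xi> v where x: "(G, \<xi>, v) \<in> lgraphs D" and c: "c = lclass (G, \<xi>, v)"
    using assms unfolding space_labelled_space by auto
  have "finite (edges G `` {v})" using lgraphsD[OF x] by (auto simp: degree_bounded_def)
  then show "finite (bernoulli_edges D `` {c})" unfolding c bernoulli_nbrs[OF x] by (rule finite_imageI)
  show "bernoulli_edges D `` {c} \<subseteq> space (labelled_space D)"
    unfolding c bernoulli_nbrs[OF x] space_labelled_space using lgraphs_nbr[OF x] by auto
qed

lemma lnear_step:
  assumes x: "(G, \<xi>, v) \<in> lgraphs D" and y: "(H, \<eta>, w) \<in> lgraphs D"
    and near: "lnear (Suc r) (G, \<xi>, v) (H, \<eta>, w)"
  shows "\<exists>\<phi>. \<forall>v'. (v, v') \<in> edges G \<longrightarrow> (w, \<phi> v') \<in> edges H \<and> lnear r (G, \<xi>, v') (H, \<eta>, \<phi> v')"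
proof -
  obtain \<phi> where p: "near_map (Suc r) (1 / Suc (Suc r)) (edges G) \<xi> [v] (edges H) \<eta> [w] \<phi>"
    using near unfolding lnear_iff[OF x y] by blast
  have "(w, \<phi> v') \<in> edges H \<and> lnear r (G, \<xi>, v') (H, \<eta>, \<phi> v')" if v': "(v, v') \<in> edges G" for v'
  proof -
    note s = near_map_step[OF p v']
    have "1 / real (Suc (Suc r)) \<le> 1 / Suc r" by (intro divide_left_mono) auto
    from near_map_mono[OF s(2) order_refl this]
    show ?thesis using s(1) lnear_iff[OF lgraphs_nbr[OF x v'] lgraphs_nbr[OF y s(1)]] by blast
  qed
  then show ?thesis by blast
qed

text \<open>The topology is Hausdorff: two errors \<open>1 / (2 r + 2)\<close> add up to \<open>1 / (r + 1)\<close>, the tolerance at radius \<open>r\<close>.\<close>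

lemma lnear_separate:
  assumes x: "x \<in> lgraphs D" and y: "y \<in> lgraphs D" and ne: "lclass x \<noteq> lclass y"
  shows "\<exists>r. \<forall>z\<in>lgraphs D. \<not> (lnear r x z \<and> lnear r y z)"
proof -
  obtain r0 where r0: "\<not> lnear r0 x y" using labelled.near_all[OF x y] ne by blast
  have "\<not> (lnear (2 * r0 + 1) x z \<and> lnear (2 * r0 + 1) y z)" if z: "z \<in> lgraphs D" for z
  proof
    assume n: "lnear (2 * r0 + 1) x z \<and> lnear (2 * r0 + 1) y z"
    obtain G \<xi> v where x': "x = (G, \<xi>, v)" by (cases x)
    obtain H \<eta> w where y': "y = (H, \<eta>, w)" by (cases y)
    obtain K \<zeta> u where z': "z = (K, \<zeta>, u)" by (cases z)
    note X = x[unfolded x'] and Y = y[unfolded y'] and Z = z[unfolded z']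
    have "lnear (2 * r0 + 1) z y" using n labelled.near_sym[OF y z] by blast
    then obtain \<psi> where q: "near_map (2 * r0 + 1) (1 / Suc (2 * r0 + 1)) (edges K) \<zeta> [u] (edges H) \<eta> [w] \<psi>"
      unfolding y' z' lnear_iff[OF Z Y] by blast
    obtain \<phi> where p: "near_map (2 * r0 + 1) (1 / Suc (2 * r0 + 1)) (edges G) \<xi> [v] (edges K) \<zeta> [u] \<phi>"
      using n unfolding x' z' lnear_iff[OF X Z] by blast
    have "1 / real (Suc (2 * r0 + 1)) + 1 / real (Suc (2 * r0 + 1)) \<le> 1 / real (Suc r0)"
      by (simp add: field_simps)
    from near_map_mono[OF near_map_comp[OF p q] _ this, of r0]
    have "lnear r0 x y" unfolding x' y' lnear_iff[OF X Y] by auto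
    then show False using r0 by blast
  qed
  then show ?thesis by blast
qed

text \<open>Distinct neighbours in \<open>U\<close> remain distinct and in \<open>U\<close> under small perturbations.\<close>

lemma nbr_card_ge_open:
  assumes U: "U \<in> labelled.opens D"
  shows "{c \<in> lclass ` lgraphs D. k \<le> card (bernoulli_edges D `` {c} \<inter> U)} \<in> labelled.opens D"
proof (rule labelled.opensI)
  fix x assume x: "x \<in> lgraphs D" and "lclass x \<in> {c \<in> lclass ` lgraphs D. k \<le> card (bernoulli_edges D `` {c} \<inter> U)}"
  then have k: "k \<le> card (bernoulli_edges D `` {lclass x} \<inter> U)" by blast
  obtain G \<xi> v where x': "x = (G, \<xi>, v)" by (cases x)
  note X = x[unfolded x']
  let ?c = "\<lambda>w. lclass (G, \<xi>, w)"
  obtain S where S0: "S \<subseteq> bernoulli_edges D `` {lclass x} \<inter> U" "card S = k" "finite S"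
    using obtain_subset_with_card_n[OF k] by metis
  have S: "S \<subseteq> ?c ` (edges G `` {v})" "S \<subseteq> U" using S0(1) unfolding x' bernoulli_nbrs[OF X] by auto
  obtain W where W: "W \<subseteq> edges G `` {v}" "inj_on ?c W" "?c ` W = S"
    using S(1) unfolding subset_image_inj by metis
  have finW: "finite W" using finite_imageD[of ?c W] W S0(3) by simp
  have cardW: "card W = k" using card_image[OF W(2)] W(3) S0(2) by simp
  have W_in: "(G, \<xi>, w) \<in> lgraphs D" if "w \<in> W" for w using W(1) that lgraphs_nbr[OF X] by blast
  have "\<forall>w\<in>W. \<exists>r. \<forall>y\<in>lgraphs D. lnear r (G, \<xi>, w) y \<longrightarrow> lclass y \<in> U"
  proof
    fix w assume w: "w \<in> W"
    then have "?c w \<in> U" using W(3) S(2) by auto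
    then show "\<exists>r. \<forall>y\<in>lgraphs D. lnear r (G, \<xi>, w) y \<longrightarrow> lclass y \<in> U"
      using U W_in[OF w] unfolding labelled.opens_def by simp
  qed
  then obtain a where a: "\<And>w y. w \<in> W \<Longrightarrow> y \<in> lgraphs D \<Longrightarrow> lnear (a w) (G, \<xi>, w) y \<Longrightarrow> lclass y \<in> U"
    by metis
  have "\<forall>w w'. \<exists>r. w \<in> W \<longrightarrow> w' \<in> W \<longrightarrow> w \<noteq> w' \<longrightarrow>
      (\<forall>z\<in>lgraphs D. \<not> (lnear r (G, \<xi>, w) z \<and> lnear r (G, \<xi>, w') z))"
  proof (intro allI)
    fix w w'
    show "\<exists>r. w \<in> W \<longrightarrow> w' \<in> W \<longrightarrow> w \<noteq> w' \<longrightarrow>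
        (\<forall>z\<in>lgraphs D. \<not> (lnear r (G, \<xi>, w) z \<and> lnear r (G, \<xi>, w') z))"
    proof (cases "w \<in> W \<and> w' \<in> W \<and> w \<noteq> w'")
      case True
      then have "?c w \<noteq> ?c w'" using W(2) unfolding inj_on_def by blast
      then show ?thesis using lnear_separate[OF W_in W_in, of w w'] True by blast
    qed blast
  qed
  then obtain b where b: "\<And>w w' z. w \<in> W \<Longrightarrow> w' \<in> W \<Longrightarrow> w \<noteq> w' \<Longrightarrow> z \<in> lgraphs D \<Longrightarrow>
      \<not> (lnear (b w w') (G, \<xi>, w) z \<and> lnear (b w w') (G, \<xi>, w') z)"
    by metis
  define R where "R = Max (insert 0 (a ` W \<union> case_prod b ` (W \<times> W)))"
  have Rfin: "finite (insert 0 (a ` W \<union> case_prod b ` (W \<times> W)))" using finW by simp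
  have Ra: "a w \<le> R" if "w \<in> W" for w unfolding R_def using Rfin that by (intro Max_ge) auto
  have Rb: "b w w' \<le> R" if "w \<in> W" "w' \<in> W" for w w' unfolding R_def using Rfin that by (intro Max_ge) auto
  have "lclass y \<in> {c \<in> lclass ` lgraphs D. k \<le> card (bernoulli_edges D `` {c} \<inter> U)}"
    if y: "y \<in> lgraphs D" and n: "lnear (Suc R) x y" for y
  proof -
    obtain H \<eta> w0 where y': "y = (H, \<eta>, w0)" by (cases y)
    note Y = y[unfolded y']
    obtain \<phi> where p: "\<And>w. w \<in> W \<Longrightarrow> (w0, \<phi> w) \<in> edges H \<and> lnear R (G, \<xi>, w) (H, \<eta>, \<phi> w)"
      using lnear_step[OF X Y n[unfolded x' y']] W(1) by blast
    have H_in: "(H, \<eta>, \<phi> w) \<in> lgraphs D" if w: "w \<in> W" for w using p[OF w] lgraphs_nbr[OF Y] by blast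
    let ?d = "\<lambda>w. lclass (H, \<eta>, \<phi> w)"
    have "inj_on ?d W"
    proof (rule inj_onI, rule ccontr)
      fix w w' assume w: "w \<in> W" "w' \<in> W" "?d w = ?d w'" "w \<noteq> w'"
      have "lnear R (H, \<eta>, \<phi> w) (G, \<xi>, w')"
        using labelled.near_cl[OF H_in[OF w(1)] H_in[OF w(2)] W_in[OF w(2)] w(3)]
          labelled.near_sym[OF W_in[OF w(2)] H_in[OF w(2)]] p[OF w(2)] by blast
      then have "lnear R (G, \<xi>, w') (H, \<eta>, \<phi> w)" by (rule labelled.near_sym[OF H_in[OF w(1)] W_in[OF w(2)]])
      then have "lnear (b w w') (G, \<xi>, w') (H, \<eta>, \<phi> w)" "lnear (b w w') (G, \<xi>, w) (H, \<eta>, \<phi> w)"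
        using p[OF w(1)] labelled.near_mono[OF W_in[OF w(1)] H_in[OF w(1)] _ Rb[OF w(1,2)]]
          labelled.near_mono[OF W_in[OF w(2)] H_in[OF w(1)] _ Rb[OF w(1,2)]] by blast+
      then show False using b[OF w(1,2,4) H_in[OF w(1)]] by blast
    qed
    moreover have "?d ` W \<subseteq> bernoulli_edges D `` {lclass y} \<inter> U"
    proof -
      have "?d w \<in> U" if w: "w \<in> W" for w
        using a[OF w H_in[OF w]] labelled.near_mono[OF W_in[OF w] H_in[OF w] _ Ra[OF w]] p[OF w] by blast
      then show ?thesis unfolding y' bernoulli_nbrs[OF Y] using p by blast
    qed
    moreover have "lclass y \<in> space (labelled_space D)" using y by (simp add: space_labelled_space)
    ultimately have "k \<le> card (bernoulli_edges D `` {lclass y} \<inter> U)"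
      using card_mono[of "bernoulli_edges D `` {lclass y} \<inter> U" "?d ` W"] bernoulli_nbrs_finite(1)[of "lclass y" D] cardW
      by (simp add: card_image)
    then show ?thesis using y by blast
  qed
  then show "\<exists>r. \<forall>y\<in>lgraphs D. lnear r x y \<longrightarrow>
      lclass y \<in> {c \<in> lclass ` lgraphs D. k \<le> card (bernoulli_edges D `` {c} \<inter> U)}" by blast
qed auto

text \<open>The number of neighbours in an open set is lower semicontinuous.  The count is additive in the set, so
  Dynkin's \<open>\<pi>\<close>-\<open>\<lambda>\<close> theorem applies.\<close>

lemma nbr_count_measurable:
  assumes A: "A \<in> sets (labelled_space D)"
  shows "(\<lambda>c. real (card (bernoulli_edges D `` {c} \<inter> A))) \<in> borel_measurable (labelled_space D)"
proof -
  let ?B = "\<lambda>c. bernoulli_edges D `` {c}" and ?M = "labelled_space D"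
  have base: "(\<lambda>c. real (card (?B c \<inter> U))) \<in> borel_measurable ?M" if U: "U \<in> labelled.opens D" for U
    unfolding borel_measurable_iff_ge
  proof
    fix a :: real
    have eq: "{c \<in> space ?M. a \<le> real (card (?B c \<inter> U))}
        = {c \<in> lclass ` lgraphs D. nat \<lceil>a\<rceil> \<le> card (?B c \<inter> U)}"
      unfolding space_labelled_space by (auto simp: nat_le_iff ceiling_le_iff)
    show "{c \<in> space ?M. a \<le> real (card (?B c \<inter> U))} \<in> sets ?M"
      unfolding eq sets_labelled_space by (rule sigma_sets.Basic[OF nbr_card_ge_open[OF U]])
  qed
  have whole: "lclass ` lgraphs D \<in> labelled.opens D" by (rule labelled.opensI) auto
  have sub: "labelled.opens D \<subseteq> Pow (lclass ` lgraphs D)" by (auto simp: labelled.opens_def)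
  show ?thesis
    using labelled.Int_stable_opens[of D] sub A[unfolded sets_labelled_space]
  proof (induction rule: sigma_sets_induct_disjoint)
    case (basic A)
    then show ?case by (rule base)
  next
    case empty
    then show ?case by simp
  next
    case (compl A)
    have "(\<lambda>c. real (card (?B c \<inter> (lclass ` lgraphs D))) - real (card (?B c \<inter> A))) \<in> borel_measurable ?M"
      using base[OF whole] compl.IH by (rule borel_measurable_diff)
    also have "?this \<longleftrightarrow> ?case"
    proof (rule measurable_cong)
      fix c assume c: "c \<in> space ?M"
      have "A \<subseteq> lclass ` lgraphs D"
        by (rule sigma_sets_into_sp[OF sub compl.hyps])
      then have "card (?B c \<inter> (lclass ` lgraphs D)) = card (?B c \<inter> A) + card (?B c \<inter> (lclass ` lgraphs D - A))"
        using bernoulli_nbrs_finite(1)[OF c] by (subst card_Un_disjoint[symmetric]) (auto intro!: arg_cong[where f = card])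
      then show "real (card (?B c \<inter> (lclass ` lgraphs D))) - real (card (?B c \<inter> A))
          = real (card (?B c \<inter> (lclass ` lgraphs D - A)))" by simp
    qed
    finally show ?case .
  next
    case (union A)
    have e: "ennreal (real (card (?B c \<inter> X))) = (\<Sum>y\<in>?B c. indicator X y)" if "c \<in> space ?M" for c X
      using bernoulli_nbrs_finite(1)[OF that]
      by (simp add: sum.If_cases indicator_def ennreal_of_nat_eq_real_of_nat)
    have [measurable]: "(\<lambda>c. real (card (?B c \<inter> A i))) \<in> borel_measurable ?M" for i by (rule union.IH)
    have "(\<lambda>c. enn2real (\<Sum>i. ennreal (real (card (?B c \<inter> A i))))) \<in> borel_measurable ?M" by measurable
    also have "?this \<longleftrightarrow> ?case"
    proof (rule measurable_cong)
      fix c assume c: "c \<in> space ?M"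
      have "(\<Sum>i. ennreal (real (card (?B c \<inter> A i)))) = (\<Sum>i. \<Sum>y\<in>?B c. indicator (A i) y)"
        by (simp only: e[OF c])
      also have "\<dots> = (\<Sum>y\<in>?B c. \<Sum>i. indicator (A i) y)" by (rule suminf_sum) simp
      also have "\<dots> = (\<Sum>y\<in>?B c. indicator (\<Union>i. A i) y)"
        by (intro sum.cong refl suminf_indicator union.hyps(1))
      also have "\<dots> = ennreal (real (card (?B c \<inter> (\<Union>i. A i))))" by (simp only: e[OF c])
      finally show "enn2real (\<Sum>i. ennreal (real (card (?B c \<inter> A i)))) = real (card (?B c \<inter> (\<Union>i. A i)))"
        by (simp only: enn2real_ennreal of_nat_0_le_iff)
    qed
    finally show ?case .
  qed
qed

lemma bernoulli_nbr_sum_measurable: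
  fixes f :: "nat lgraph set \<Rightarrow> ennreal"
  assumes f: "f \<in> borel_measurable (labelled_space D)"
  shows "(\<lambda>c. \<Sum>y\<in>bernoulli_edges D `` {c}. f y) \<in> borel_measurable (labelled_space D)"
proof -
  let ?B = "\<lambda>c. bernoulli_edges D `` {c}" and ?M = "labelled_space D"
  note fin = bernoulli_nbrs_finite(1)[where D = D] and sub = bernoulli_nbrs_finite(2)[where D = D]
  show ?thesis
    using f
  proof (induction rule: borel_measurable_induct)
    case (cong f g)
    have "(\<Sum>y\<in>?B c. f y) = (\<Sum>y\<in>?B c. g y)" if "c \<in> space ?M" for c
      using cong(3) sub[OF that] by (intro sum.cong) auto
    then show ?case using cong(4) by (subst (asm) measurable_cong) auto
  next
    case (set A)
    have "(\<lambda>c. ennreal (real (card (?B c \<inter> A)))) \<in> borel_measurable ?M"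
      using nbr_count_measurable[OF set] by measurable
    also have "?this \<longleftrightarrow> ?case"
      using fin by (intro measurable_cong)
        (simp add: sum.If_cases indicator_def ennreal_of_nat_eq_real_of_nat)
    finally show ?case .
  next
    case (mult u a)
    then show ?case by (simp add: sum_distrib_left[symmetric])
  next
    case (add u v)
    then show ?case by (simp add: sum.distrib)
  next
    case (seq U)
    have [measurable]: "(\<lambda>c. \<Sum>y\<in>?B c. U i y) \<in> borel_measurable ?M" for i by (rule seq)
    have inc: "incseq U" by (rule seq)
    have "(\<lambda>c. SUP i. \<Sum>y\<in>?B c. U i y) \<in> borel_measurable ?M" by measurable
    also have "(\<lambda>c. SUP i. \<Sum>y\<in>?B c. U i y) = (\<lambda>c. \<Sum>y\<in>?B c. (SUP i. U i) y)"
    proof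
      fix c
      show "(SUP i. \<Sum>y\<in>?B c. U i y) = (\<Sum>y\<in>?B c. (SUP i. U i) y)"
        using inc by (subst ennreal_SUP_sum) (auto simp: incseq_def le_fun_def image_comp)
    qed
    finally show ?case .
  qed
qed

lemma forget_labels_lclass:
  assumes x: "(G, \<xi>, v) \<in> lgraphs D"
  shows "forget_labels (lclass (G, \<xi>, v)) = rclass (G, [v])"
proof -
  define z where "z = (SOME z. z \<in> lclass (G, \<xi>, v))"
  have "z \<in> lclass (G, \<xi>, v)" unfolding z_def
    by (rule someI[of _ "(G, \<xi>, v)"]) (simp add: lclass_def lgraph_iso_refl)
  then have iso: "lgraph_iso (G, \<xi>, v) z" by (simp add: lclass_def)
  obtain G' \<xi>' v' where z: "z = (G', \<xi>', v')" by (cases z)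
  have "rgraph_iso (G, [v]) (G', [v'])" using iso unfolding z lgraph_iso_def rgraph_iso_def by auto
  then have "rclass (G, [v]) = rclass (G', [v'])"
    by (rule rclass_eqI) (use lgraphsD[OF x] connected_graphD(1) in auto)
  moreover have "forget_labels (lclass (G, \<xi>, v)) = rclass (G', [v'])"
    unfolding forget_labels_def z_def[symmetric] z by simp
  ultimately show ?thesis by simp
qed

lemma forget_labels_measurable: "forget_labels \<in> measurable (labelled_space D) (rooted_space D 1)"
proof -
  interpret rooted: local_topology "rgraphs D 1" rclass rnear by (rule local_topology_rooted) simp
  have rooted_in: "(G, [v]) \<in> rgraphs D 1" if "(G, \<xi>, v) \<in> lgraphs D" for G \<xi> v
    using lgraphsD[OF that] by (simp add: rgraphs_def)
  show ?thesis
    unfolding rooted_space_def rooted.local_borel_eq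
  proof (rule measurable_measure_of)
    show "rooted.opens \<subseteq> Pow (rclass ` rgraphs D 1)" unfolding rooted.opens_def by blast
    show "forget_labels \<in> space (labelled_space D) \<rightarrow> rclass ` rgraphs D 1"
      unfolding space_labelled_space using forget_labels_lclass rooted_in by auto
    fix U assume U: "U \<in> rooted.opens"
    have "forget_labels -` U \<inter> lclass ` lgraphs D \<in> labelled.opens D"
    proof (rule labelled.opensI)
      fix x assume x: "x \<in> lgraphs D" "lclass x \<in> forget_labels -` U \<inter> lclass ` lgraphs D"
      obtain G \<xi> v where x': "x = (G, \<xi>, v)" by (cases x)
      note X = x(1)[unfolded x']
      have "rclass (G, [v]) \<in> U" using x(2) unfolding x' by (simp add: forget_labels_lclass[OF X])
      moreover have "\<forall>x\<in>rgraphs D 1. rclass x \<in> U \<longrightarrow> (\<exists>r. \<forall>y\<in>rgraphs D 1. rnear r x y \<longrightarrow> rclass y \<in> U)"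
        using U unfolding rooted.opens_def by simp
      ultimately have "\<exists>r. \<forall>y\<in>rgraphs D 1. rnear r (G, [v]) y \<longrightarrow> rclass y \<in> U"
        using rooted_in[OF X] by simp
      then obtain r where r: "\<And>y. y \<in> rgraphs D 1 \<Longrightarrow> rnear r (G, [v]) y \<Longrightarrow> rclass y \<in> U" by metis
      have "lclass y \<in> forget_labels -` U \<inter> lclass ` lgraphs D" if y: "y \<in> lgraphs D" "lnear r x y" for y
      proof -
        obtain H \<eta> w where y': "y = (H, \<eta>, w)" by (cases y)
        note Y = y(1)[unfolded y']
        obtain \<phi> where "near_map r (1 / Suc r) (edges G) \<xi> [v] (edges H) \<eta> [w] \<phi>"
          using y(2) unfolding x' y' lnear_iff[OF X Y] by blast
        then have "near_map r 1 (edges G) (\<lambda>_. 0) [v] (edges H) (\<lambda>_. 0) [w] \<phi>" unfolding near_map_def by auto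
        then have "rclass (H, [w]) \<in> U"
          using r[OF rooted_in[OF Y]] unfolding rnear_iff[OF rooted_in[OF X] rooted_in[OF Y] zero_less_one] by blast
        then show ?thesis using y(1) unfolding y' by (simp add: forget_labels_lclass[OF Y])
      qed
      then show "\<exists>r. \<forall>y\<in>lgraphs D. lnear r x y \<longrightarrow> lclass y \<in> forget_labels -` U \<inter> lclass ` lgraphs D" by blast
    qed auto
    then show "forget_labels -` U \<inter> space (labelled_space D) \<in> sets (labelled_space D)"
      unfolding space_labelled_space sets_labelled_space by (rule sigma_sets.Basic)
  qed
qed

text \<open>As for \<open>forget_labels\<close>, the value does not depend on the chosen representative.\<close>

definition root_label :: "nat lgraph set \<Rightarrow> real" where
  "root_label c = (case SOME z. z \<in> c of (G, \<xi>, v) \<Rightarrow> \<xi> v)"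

lemma root_label_lclass:
  assumes x: "(G, \<xi>, v) \<in> lgraphs D"
  shows "root_label (lclass (G, \<xi>, v)) = \<xi> v"
proof -
  define z where "z = (SOME z. z \<in> lclass (G, \<xi>, v))"
  have "z \<in> lclass (G, \<xi>, v)" unfolding z_def
    by (rule someI[of _ "(G, \<xi>, v)"]) (simp add: lclass_def lgraph_iso_refl)
  then have iso: "lgraph_iso (G, \<xi>, v) z" by (simp add: lclass_def)
  obtain G' \<xi>' v' where z: "z = (G', \<xi>', v')" by (cases z)
  have "\<xi>' v' = \<xi> v" using iso lgraphsD(3)[OF x] unfolding z lgraph_iso_def by auto
  then show ?thesis unfolding root_label_def z_def[symmetric] z by simp
qed

lemma root_label_measurable: "root_label \<in> borel_measurable (labelled_space D)"
  unfolding labelled_space_def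
proof (rule labelled.borel_measurable_of_open)
  fix x a assume x: "x \<in> lgraphs D" and a: "a < root_label (lclass x)"
  obtain G \<xi> v where x': "x = (G, \<xi>, v)" by (cases x)
  note X = x[unfolded x']
  have "0 < \<xi> v - a" using a unfolding x' root_label_lclass[OF X] by simp
  from nat_approx_posE[OF this] obtain r where r: "1 / Suc r < \<xi> v - a" .
  have "a < root_label (lclass y)" if y: "y \<in> lgraphs D" "lnear r x y" for y
  proof -
    obtain H \<eta> w where y': "y = (H, \<eta>, w)" by (cases y)
    note Y = y(1)[unfolded y']
    obtain \<phi> where p: "near_map r (1 / Suc r) (edges G) \<xi> [v] (edges H) \<eta> [w] \<phi>"
      using y(2) unfolding x' y' lnear_iff[OF X Y] by blast
    have "v \<in> nball (edges G) r (set [v])" using nball_refl[of "set [v]"] by auto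
    then have "\<bar>\<eta> w - \<xi> v\<bar> < 1 / Suc r" using p unfolding near_map_def by fastforce
    then show ?thesis using r unfolding y' root_label_lclass[OF Y] by linarith
  qed
  then show "\<exists>r. \<forall>y\<in>lgraphs D. lnear r x y \<longrightarrow> a < root_label (lclass y)" by blast
qed

lemma space_label_measure: "space (label_measure H) = verts H \<rightarrow>\<^sub>E {0..1}"
  unfolding label_measure_def space_PiM by (simp add: space_restrict_space)

lemma label_component_measurable:
  assumes "u \<in> verts H"
  shows "(\<lambda>\<xi>. \<xi> u) \<in> borel_measurable (label_measure H)"
proof -
  have "(\<lambda>\<xi>. \<xi> u) \<in> measurable (label_measure H) (restrict_space lborel {0..1})"
    unfolding label_measure_def by (rule measurable_component_singleton[OF assms])
  moreover have "(\<lambda>x. x) \<in> borel_measurable (restrict_space lborel {0..1::real})"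
    by (rule measurable_restrict_space1) simp
  ultimately show ?thesis by (rule measurable_compose)
qed

lemma lgraphs_label:
  assumes "connected_graph H" "degree_bounded D H" "v \<in> verts H" "\<xi> \<in> space (label_measure H)"
  shows "(H, \<xi>, v) \<in> lgraphs D"
  using assms unfolding space_label_measure lgraphs_def by (auto simp: PiE_mem)

text \<open>The preimage of an open set is open in the product topology, hence a countable union of
  rational cylinders.\<close>

lemma lclass_measurable:
  assumes H: "connected_graph H" "degree_bounded D H" and v: "v \<in> verts H"
  shows "(\<lambda>\<xi>. lclass (H, \<xi>, v)) \<in> measurable (label_measure H) (labelled_space D)"
  unfolding labelled_space_eq
proof (rule measurable_measure_of)
  let ?P = "label_measure H"
  show "labelled.opens D \<subseteq> Pow (lclass ` lgraphs D)" by (auto simp: labelled.opens_def)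
  show "(\<lambda>\<xi>. lclass (H, \<xi>, v)) \<in> space ?P \<rightarrow> lclass ` lgraphs D" using lgraphs_label[OF H v] by auto
  fix U assume U: "U \<in> labelled.opens D"
  define S where "S = {\<xi> \<in> space ?P. lclass (H, \<xi>, v) \<in> U}"
  define ball where "ball r = nball (edges H) r {v}" for r
  have fin: "finite (ball r)" and ballV: "ball r \<subseteq> verts H" for r
    unfolding ball_def using degree_bounded_finite[OF H(2,1)] nball_subset[OF connected_graphD(1)[OF H(1)]] v by auto
  define C where "C r xs = {\<eta> \<in> space ?P. \<forall>u\<in>ball r. \<bar>\<eta> u - real_of_rat (xs ! u)\<bar> < 1 / (2 * real (Suc r))}" for r xs
  have C: "C r xs \<in> sets ?P" for r xs
    unfolding C_def
  proof (rule sets.sets_Collect_finite_All[OF _ fin])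
    fix u assume "u \<in> ball r"
    then have [measurable]: "(\<lambda>\<xi>. \<xi> u) \<in> borel_measurable ?P" using ballV by (intro label_component_measurable) auto
    show "{\<eta> \<in> space ?P. \<bar>\<eta> u - real_of_rat (xs ! u)\<bar> < 1 / (2 * real (Suc r))} \<in> sets ?P" by measurable
  qed
  have "\<exists>r xs. \<xi> \<in> C r xs \<and> C r xs \<subseteq> S" if xi: "\<xi> \<in> S" for \<xi>
  proof -
    have xiP: "\<xi> \<in> space ?P" "lclass (H, \<xi>, v) \<in> U" using xi by (auto simp: S_def)
    note X = lgraphs_label[OF H v xiP(1)]
    have "\<exists>r. \<forall>y\<in>lgraphs D. lnear r (H, \<xi>, v) y \<longrightarrow> lclass y \<in> U"
      using U X xiP(2) unfolding labelled.opens_def by simp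
    then obtain r where r: "\<And>y. y \<in> lgraphs D \<Longrightarrow> lnear r (H, \<xi>, v) y \<Longrightarrow> lclass y \<in> U" by metis
    have "\<exists>q::rat. \<bar>\<xi> u - real_of_rat q\<bar> < 1 / (2 * real (Suc r))" for u
    proof -
      have "\<xi> u - 1 / (2 * real (Suc r)) < \<xi> u + 1 / (2 * real (Suc r))" by (simp add: add_pos_pos)
      from of_rat_dense[OF this] obtain q where "\<xi> u - 1 / (2 * real (Suc r)) < real_of_rat q"
        "real_of_rat q < \<xi> u + 1 / (2 * real (Suc r))" by blast
      then have "\<bar>\<xi> u - real_of_rat q\<bar> < 1 / (2 * real (Suc r))" by linarith
      then show ?thesis by blast
    qed
    then obtain q where q: "\<And>u. \<bar>\<xi> u - real_of_rat (q u)\<bar> < 1 / (2 * real (Suc r))" by metis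
    \<comment> \<open>the vertices are natural numbers, so a finite list encodes the rational labels on the ball\<close>
    define xs where "xs = map q [0..<Suc (Max (insert 0 (ball r)))]"
    have xs: "xs ! u = q u" if u: "u \<in> ball r" for u
    proof -
      have "u \<le> Max (insert 0 (ball r))" using u fin by (intro Max_ge) auto
      then have "u < length [0..<Suc (Max (insert 0 (ball r)))]" by simp
      then show ?thesis unfolding xs_def by (simp only: nth_map nth_upt length_upt) simp
    qed
    have "\<eta> \<in> S" if eta: "\<eta> \<in> C r xs" for \<eta>
    proof -
      have etaP: "\<eta> \<in> space ?P" using eta by (simp add: C_def)
      note Y = lgraphs_label[OF H v etaP]
      have half: "1 / (2 * real (Suc r)) + 1 / (2 * real (Suc r)) = 1 / real (Suc r)" by (simp add: field_simps)
      have close: "\<bar>\<eta> u - \<xi> u\<bar> < 1 / real (Suc r)" if u: "u \<in> ball r" for u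
      proof -
        have "\<bar>\<eta> u - real_of_rat (q u)\<bar> < 1 / (2 * real (Suc r))" using eta u xs[OF u] unfolding C_def by auto
        with q[of u] have "\<bar>\<eta> u - \<xi> u\<bar> < 1 / (2 * real (Suc r)) + 1 / (2 * real (Suc r))"
          unfolding abs_diff_less_iff by argo
        then show ?thesis using half by simp
      qed
      have "iso_on (edges H) (edges H) (nball (edges H) r (set [v])) (nball (edges H) r (set [v])) id"
        by (simp add: iso_on_def)
      then have "near_map r (1 / Suc r) (edges H) \<xi> [v] (edges H) \<eta> [v] id"
        using close unfolding near_map_def ball_def by simp
      then have "lnear r (H, \<xi>, v) (H, \<eta>, v)" unfolding lnear_iff[OF X Y] by blast
      then show ?thesis using r[OF Y] etaP by (simp add: S_def)
    qed
    moreover have "\<xi> \<in> C r xs" using q xs xiP(1) by (simp add: C_def)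
    ultimately show ?thesis by blast
  qed
  then have "S = (\<Union>p\<in>{p. C (fst p) (snd p) \<subseteq> S}. C (fst p) (snd p))"
    by (intro equalityI subsetI) (simp_all, blast+)
  also have "\<dots> \<in> sets ?P" by (rule sets.countable_UN') (use C in auto)
  finally show "(\<lambda>\<xi>. lclass (H, \<xi>, v)) -` U \<inter> space ?P \<in> sets ?P"
    unfolding S_def by (simp add: vimage_def Int_def conj_commute)
qed

section \<open>Independent uniform labels\<close>

abbreviation uniform01 :: "real measure" where
  "uniform01 \<equiv> restrict_space lborel {0..1}"

lemma prob_space_uniform01: "prob_space uniform01"
  by (rule prob_spaceI) (simp add: emeasure_restrict_space space_restrict_space)

lemma prob_space_label_measure: "prob_space (label_measure H)"
  unfolding label_measure_def by (rule prob_space_PiM) (rule prob_space_uniform01)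

lemma distr_label_component: "u \<in> verts H \<Longrightarrow> distr (label_measure H) uniform01 (\<lambda>\<xi>. \<xi> u) = uniform01"
  unfolding label_measure_def by (rule distr_PiM_component) (rule prob_space_uniform01)

lemma indep_labels:
  assumes "verts H \<noteq> {}"
  shows "prob_space.indep_vars (label_measure H) (\<lambda>_. uniform01) (\<lambda>u \<xi>. \<xi> u) (verts H)"
proof -
  interpret P: prob_space "label_measure H" by (rule prob_space_label_measure)
  let ?Q = "PiM (verts H) (\<lambda>_. uniform01)"
  show ?thesis
  proof (subst P.indep_vars_iff_distr_eq_PiM'[OF assms])
    show "(\<lambda>\<xi>. \<xi> u) \<in> measurable (label_measure H) uniform01" if "u \<in> verts H" for u
      unfolding label_measure_def using that by (rule measurable_component_singleton)
    have "distr (label_measure H) ?Q (\<lambda>x. \<lambda>i\<in>verts H. x i) = distr ?Q ?Q (\<lambda>x. x)"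
      unfolding label_measure_def by (rule distr_cong) (auto simp: space_PiM intro!: PiE_restrict)
    also have "\<dots> = PiM (verts H) (\<lambda>i. distr (label_measure H) uniform01 (\<lambda>x. x i))"
      using distr_label_component by (simp cong: PiM_cong)
    finally show "distr (label_measure H) ?Q (\<lambda>x. \<lambda>i\<in>verts H. x i)
        = PiM (verts H) (\<lambda>i. distr (label_measure H) uniform01 (\<lambda>x. x i))" .
  qed
qed

text \<open>The diagonal of the unit square is a null set.\<close>

lemma labels_distinct_AE:
  assumes u: "u \<in> verts H" and v: "v \<in> verts H" and ne: "u \<noteq> v"
  shows "AE \<xi> in label_measure H. \<xi> u \<noteq> \<xi> v"
proof -
  interpret P: prob_space "label_measure H" by (rule prob_space_label_measure)
  interpret U: prob_space uniform01 by (rule prob_space_uniform01)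
  have U1: "(\<lambda>x. x) \<in> borel_measurable uniform01" by (rule measurable_restrict_space1) simp
  have "P.indep_var (PiM {u} (\<lambda>_. uniform01)) (\<lambda>\<xi>. restrict (\<lambda>i. \<xi> i) {u})
      (PiM {v} (\<lambda>_. uniform01)) (\<lambda>\<xi>. restrict (\<lambda>i. \<xi> i) {v})"
    using u v ne by (intro P.indep_var_restrict[OF indep_labels]) auto
  then have "P.indep_var uniform01 ((\<lambda>f. f u) \<circ> (\<lambda>\<xi>. restrict (\<lambda>i. \<xi> i) {u})) uniform01 ((\<lambda>f. f v) \<circ> (\<lambda>\<xi>. restrict (\<lambda>i. \<xi> i) {v}))"
    by (rule P.indep_var_compose) (auto intro: measurable_component_singleton)
  then have "P.indep_var uniform01 (\<lambda>\<xi>. \<xi> u) uniform01 (\<lambda>\<xi>. \<xi> v)" by (simp add: comp_def)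
  then have d: "distr (label_measure H) (uniform01 \<Otimes>\<^sub>M uniform01) (\<lambda>\<xi>. (\<xi> u, \<xi> v)) = uniform01 \<Otimes>\<^sub>M uniform01"
    and rv: "(\<lambda>\<xi>. \<xi> u) \<in> measurable (label_measure H) uniform01" "(\<lambda>\<xi>. \<xi> v) \<in> measurable (label_measure H) uniform01"
    unfolding P.indep_var_distribution_eq by (simp_all add: distr_label_component[OF u] distr_label_component[OF v])
  let ?D = "{p \<in> space (uniform01 \<Otimes>\<^sub>M uniform01). fst p = snd p}"
  have [measurable]: "fst \<in> borel_measurable (uniform01 \<Otimes>\<^sub>M uniform01)" "snd \<in> borel_measurable (uniform01 \<Otimes>\<^sub>M uniform01)"
    by (rule measurable_compose[OF measurable_fst U1], rule measurable_compose[OF measurable_snd U1])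
  have D: "?D \<in> sets (uniform01 \<Otimes>\<^sub>M uniform01)" by measurable
  have "emeasure (uniform01 \<Otimes>\<^sub>M uniform01) ?D = (\<integral>\<^sup>+x. emeasure uniform01 (Pair x -` ?D) \<partial>uniform01)"
    by (rule U.emeasure_pair_measure_alt[OF D])
  also have "\<dots> = (\<integral>\<^sup>+x. 0 \<partial>uniform01)"
  proof (rule nn_integral_cong)
    fix x assume x: "x \<in> space uniform01"
    then have "Pair x -` ?D = {x}" by (auto simp: space_pair_measure)
    then show "emeasure uniform01 (Pair x -` ?D) = 0"
      using x by (simp add: emeasure_restrict_space space_restrict_space)
  qed
  finally have "AE p in uniform01 \<Otimes>\<^sub>M uniform01. fst p \<noteq> snd p" using D by (intro AE_I[of _ _ ?D]) auto
  then have "AE p in distr (label_measure H) (uniform01 \<Otimes>\<^sub>M uniform01) (\<lambda>\<xi>. (\<xi> u, \<xi> v)). fst p \<noteq> snd p"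
    by (simp only: d)
  then show ?thesis by (drule_tac AE_distrD[rotated]) (use rv in auto)
qed

text \<open>A graph with injective labels has no nontrivial automorphism, so its rooted versions at different vertices
  are different points of the graphing.\<close>

lemma labels_inj_AE:
  assumes "countable (verts H)"
  shows "AE \<xi> in label_measure H. inj_on \<xi> (verts H)"
proof -
  have "AE \<xi> in label_measure H. \<forall>p\<in>verts H \<times> verts H. fst p \<noteq> snd p \<longrightarrow> \<xi> (fst p) \<noteq> \<xi> (snd p)"
  proof (subst AE_ball_countable)
    show "countable (verts H \<times> verts H)" using assms by simp
    show "\<forall>p\<in>verts H \<times> verts H. AE \<xi> in label_measure H. fst p \<noteq> snd p \<longrightarrow> \<xi> (fst p) \<noteq> \<xi> (snd p)"
    proof
      fix p assume p: "p \<in> verts H \<times> verts H"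
      show "AE \<xi> in label_measure H. fst p \<noteq> snd p \<longrightarrow> \<xi> (fst p) \<noteq> \<xi> (snd p)"
      proof (cases "fst p = snd p")
        case False
        have "AE \<xi> in label_measure H. \<xi> (fst p) \<noteq> \<xi> (snd p)" using p False by (intro labels_distinct_AE) auto
        then show ?thesis by eventually_elim simp
      qed simp
    qed
  qed
  then show ?thesis by eventually_elim (auto simp: inj_on_def)
qed

lemma distr_label_reindex:
  assumes "bij_betw \<phi> (verts H) (verts K)"
  shows "distr (label_measure K) (label_measure H) (\<lambda>\<omega>. \<lambda>n\<in>verts H. \<omega> (\<phi> n)) = label_measure H"
  unfolding label_measure_def using assms
  by (intro distr_PiM_reindex[where M = "\<lambda>_. uniform01"] prob_space_uniform01) (auto simp: bij_betw_def)

lemma label_reindex_measurable: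
  assumes "bij_betw \<phi> (verts H) (verts K)"
  shows "(\<lambda>\<omega>. \<lambda>n\<in>verts H. \<omega> (\<phi> n)) \<in> measurable (label_measure K) (label_measure H)"
  unfolding label_measure_def using assms
  by (intro measurable_restrict measurable_component_singleton) (auto simp: bij_betw_def)

lemma lclass_reindex:
  assumes "graph_iso \<phi> H K" "edges H \<subseteq> verts H \<times> verts H" "v \<in> verts H"
  shows "lclass (H, \<lambda>n\<in>verts H. \<omega> (\<phi> n), v) = lclass (K, \<omega>, \<phi> v)"
  using assms by (intro lclass_eqI) (auto simp: lgraph_iso_def)

text \<open>The functions to which the mass transport principle is applied live on the countably many classes of
  one graph with two roots.\<close>

lemma borel_measurable_countable_support:
  fixes f :: "'x \<Rightarrow> 'y :: {zero, topological_space}"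
  assumes C: "countable C" "\<And>c. c \<in> C \<Longrightarrow> {c} \<in> sets M" and 0: "\<And>x. x \<in> space M \<Longrightarrow> x \<notin> C \<Longrightarrow> f x = 0"
  shows "f \<in> borel_measurable M"
proof (rule measurableI)
  fix B :: "'y set"
  have cm: "A \<in> sets M" if "A \<subseteq> C" for A
    using C that by (intro sets.countable[of A]) (auto intro: countable_subset)
  have CS: "C \<subseteq> space M" using sets.sets_into_space[OF cm[OF order_refl]] .
  show "f -` B \<inter> space M \<in> sets M"
  proof (cases "0 \<in> B")
    case True
    then have "f -` B \<inter> space M = space M - (C \<inter> f -` (- B))" using 0 CS by auto
    then show ?thesis using cm[of "C \<inter> f -` (- B)"] by auto
  next
    case False
    then have "f -` B \<inter> space M = C \<inter> f -` B" using 0 CS by (auto, metis)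
    then show ?thesis using cm[of "C \<inter> f -` B"] by auto
  qed
qed simp

section \<open>The Bernoulli graphing of a quasi-transitive graph\<close>

text \<open>The vertices are natural numbers, so that \<open>H\<close> can itself represent the classes that it belongs to.\<close>

locale unimodular_quasi_transitive =
  fixes H :: "nat graph" and D :: nat and \<nu> :: "nat rgraph set measure"
  assumes conn: "connected_graph H" and no_isol: "no_isolated H" and deg: "degree_bounded D H"
    and qt: "quasi_transitive H" and law: "unimodular_law D H \<nu>"
begin

abbreviation "V \<equiv> verts H"
abbreviation "E \<equiv> edges H"
abbreviation "P \<equiv> label_measure H"
abbreviation "LM \<equiv> labelled_space D"
abbreviation "B \<equiv> bernoulli_edges D"
abbreviation "\<mu> \<equiv> bernoulli_measure D \<nu>"

definition L :: "(nat \<Rightarrow> real) \<Rightarrow> nat \<Rightarrow> nat lgraph set" where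
  "L \<xi> v = lclass (H, \<xi>, v)"

definition cls :: "nat \<Rightarrow> nat rgraph set" where
  "cls v = rclass (H, [v])"

lemma E_sub: "E \<subseteq> V \<times> V" and symE: "sym E"
  using connected_graphD[OF conn] by auto

lemma V_ne: "V \<noteq> {}"
  using conn by (auto simp: connected_graph_def)

lemma nbrs: "v \<in> V \<Longrightarrow> finite (E `` {v})" "v \<in> V \<Longrightarrow> E `` {v} \<noteq> {}" "E `` {v} \<subseteq> V"
  using deg no_isol E_sub by (auto simp: degree_bounded_def no_isolated_def)

sublocale P: prob_space P
  by (rule prob_space_label_measure)

sublocale nu: prob_space \<nu>
  using law by (simp add: unimodular_law_def)

lemma sets_nu: "sets \<nu> = sets (rooted_space D 1)"
  using law by (simp add: unimodular_law_def)

lemma space_nu: "space \<nu> = rclass ` rgraphs D 1"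
  using sets_eq_imp_space_eq[OF sets_nu] by (simp add: space_rooted_space)

lemma rooted_in: "v \<in> V \<Longrightarrow> (H, [v]) \<in> rgraphs D 1"
  using conn deg by (simp add: rgraphs_def)

lemma labelled_in: "v \<in> V \<Longrightarrow> \<xi> \<in> space P \<Longrightarrow> (H, \<xi>, v) \<in> lgraphs D"
  by (rule lgraphs_label[OF conn deg])

lemma L_in_space: "v \<in> V \<Longrightarrow> \<xi> \<in> space P \<Longrightarrow> L \<xi> v \<in> space LM"
  unfolding space_labelled_space L_def using labelled_in by blast

lemma L_measurable [measurable]: "v \<in> V \<Longrightarrow> (\<lambda>\<xi>. L \<xi> v) \<in> measurable P LM"
  unfolding L_def by (rule lclass_measurable[OF conn deg])

lemma forget_L: "v \<in> V \<Longrightarrow> \<xi> \<in> space P \<Longrightarrow> forget_labels (L \<xi> v) = cls v"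
  unfolding L_def cls_def by (rule forget_labels_lclass[OF labelled_in])

lemma cls_singleton: "v \<in> V \<Longrightarrow> {cls v} \<in> sets \<nu>"
  unfolding sets_nu cls_def by (rule rooted_singleton_measurable[OF rooted_in]) auto

lemma cls_eq_iff: "u \<in> V \<Longrightarrow> v \<in> V \<Longrightarrow> cls u = cls v \<longleftrightarrow> (\<exists>\<phi>. graph_iso \<phi> H H \<and> \<phi> u = v)"
  unfolding cls_def rclass_eq_iff_iso_on[OF rooted_in rooted_in] graph_iso_iff_iso_on[OF E_sub E_sub] by simp

text \<open>Whatever representative is chosen for a class of \<open>H\<close>, it is a copy of \<open>H\<close> with the corresponding root.\<close>

lemma the_rep:
  assumes "c = rclass (H, [v])"
  shows "\<exists>\<phi>. graph_iso \<phi> H (the_graph c) \<and> the_root c = \<phi> v"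
proof -
  define x where "x = (SOME x. x \<in> c)"
  have "x \<in> c" unfolding x_def assms by (rule someI[of _ "(H, [v])"]) (simp add: rclass_def rgraph_iso_refl)
  then have iso: "rgraph_iso (H, [v]) x" unfolding assms rclass_def by simp
  obtain K ws where x: "x = (K, ws)" by (cases x)
  obtain \<phi> where "graph_iso \<phi> H K" "map \<phi> [v] = ws" using iso unfolding x rgraph_iso_def by auto
  then show ?thesis unfolding the_graph_def the_root_def x_def[symmetric] x by auto
qed

lemma AE_nu_cls: "AE c in \<nu>. c \<in> cls ` V"
proof -
  have "AE c in \<nu>. \<exists>\<phi>. graph_iso \<phi> H (the_graph c)" using law by (simp add: unimodular_law_def)
  then show ?thesis
  proof (rule AE_mp, intro AE_I2 impI)
    fix c assume c: "c \<in> space \<nu>" and "\<exists>\<phi>. graph_iso \<phi> H (the_graph c)"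
    then obtain \<phi> where phi: "graph_iso \<phi> H (the_graph c)" by blast
    obtain K0 w0 where x: "(K0, [w0]) \<in> rgraphs D 1" "c = rclass (K0, [w0])"
      using c unfolding space_nu by (auto simp: rgraphs_def length_Suc_conv)
    define x where "x = (SOME x. x \<in> c)"
    have "x \<in> c" unfolding x_def x(2) by (rule someI[of _ "(K0, [w0])"]) (simp add: rclass_def rgraph_iso_refl)
    then have iso: "rgraph_iso (K0, [w0]) x" unfolding x(2) rclass_def by simp
    obtain K ws where xx: "x = (K, ws)" by (cases x)
    obtain \<psi> where psi: "graph_iso \<psi> K0 K" "ws = [\<psi> w0]" using iso unfolding xx rgraph_iso_def by auto
    have K: "the_graph c = K" unfolding the_graph_def x_def[symmetric] xx by simp
    note x0 = rgraphsD[OF x(1)]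
    have cK: "c = rclass (K, [\<psi> w0])"
      unfolding x(2) using rclass_eqI[OF iso connected_graphD(1)[OF x0(1)]] x0 unfolding xx psi(2) by simp
    have "\<psi> w0 \<in> verts K" using psi(1) x0 by (auto simp: graph_iso_def bij_betw_def)
    moreover have "\<phi> ` V = verts K" using phi unfolding K by (simp add: graph_iso_def bij_betw_def)
    ultimately obtain v where v: "v \<in> V" "\<phi> v = \<psi> w0" by (metis imageE)
    have "rgraph_iso (H, [v]) (K, [\<psi> w0])" unfolding rgraph_iso_def using phi v unfolding K by auto
    then have "cls v = c" unfolding cls_def cK using E_sub v by (intro rclass_eqI) auto
    then show "c \<in> cls ` V" using v by blast
  qed
qed

lemma finite_cls: "finite (cls ` V)"
proof -
  have "cls ` orbit H v = {cls v}" if v: "v \<in> V" for v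
  proof -
    have "cls w = cls v" if w: "w \<in> orbit H v" for w
    proof -
      obtain \<phi> where p: "graph_iso \<phi> H H" "w = \<phi> v" using w by (auto simp: orbit_def)
      then have "w \<in> V" using v by (auto simp: graph_iso_def bij_betw_def)
      then show ?thesis using cls_eq_iff[OF v] p by blast
    qed
    moreover have "v \<in> orbit H v" unfolding orbit_def using graph_iso_id by (auto intro!: exI[of _ id])
    ultimately show ?thesis by blast
  qed
  then have "cls ` V = (\<lambda>S. the_elem (cls ` S)) ` (orbit H ` V)"
    unfolding image_image by (intro image_cong) auto
  moreover have "finite (orbit H ` V)" using qt by (simp add: quasi_transitive_def)
  ultimately show ?thesis by simp
qed

text \<open>By \<open>cls_eq_iff\<close> the values of \<open>cls\<close> correspond to the orbits, so these are representatives of the orbits.\<close>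

definition reps :: "nat set" where
  "reps = (\<lambda>c. SOME v. v \<in> V \<and> cls v = c) ` (cls ` V)"

lemma finite_reps: "finite reps"
  unfolding reps_def using finite_cls by simp

lemma rep_props:
  assumes "c \<in> cls ` V"
  shows "(SOME v. v \<in> V \<and> cls v = c) \<in> V" "cls (SOME v. v \<in> V \<and> cls v = c) = c"
proof -
  have "\<exists>v. v \<in> V \<and> cls v = c" using assms by auto
  from someI_ex[OF this] show "(SOME v. v \<in> V \<and> cls v = c) \<in> V" "cls (SOME v. v \<in> V \<and> cls v = c) = c" by auto
qed

lemma reps_sub: "reps \<subseteq> V"
  unfolding reps_def using rep_props(1) by blast

lemma bij_reps: "bij_betw cls reps (cls ` V)"
  unfolding bij_betw_def
proof
  show "inj_on cls reps"
  proof (rule inj_onI)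
    fix i j assume ij: "i \<in> reps" "j \<in> reps" "cls i = cls j"
    obtain c where c: "c \<in> cls ` V" "i = (SOME v. v \<in> V \<and> cls v = c)" using ij(1) unfolding reps_def by (rule imageE)
    obtain d where d: "d \<in> cls ` V" "j = (SOME v. v \<in> V \<and> cls v = d)" using ij(2) unfolding reps_def by (rule imageE)
    have "c = d" using ij(3) unfolding c(2) d(2) rep_props(2)[OF c(1)] rep_props(2)[OF d(1)] .
    then show "i = j" using c d by simp
  qed
  show "cls ` reps = cls ` V"
  proof -
    have "cls ` reps = (\<lambda>c. cls (SOME v. v \<in> V \<and> cls v = c)) ` (cls ` V)"
      unfolding reps_def by (rule image_image)
    also have "\<dots> = (\<lambda>c. c) ` (cls ` V)" by (intro image_cong refl rep_props(2))
    finally show ?thesis by simp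
  qed
qed

lemma rep_exists:
  assumes "v \<in> V"
  shows "\<exists>i\<in>reps. \<exists>\<phi>. graph_iso \<phi> H H \<and> \<phi> i = v"
proof -
  have "cls v \<in> cls ` reps" using bij_reps assms by (simp add: bij_betw_def)
  then obtain i where i: "cls v = cls i" "i \<in> reps" by (rule imageE)
  then have iV: "i \<in> V" using reps_sub by blast
  show ?thesis using cls_eq_iff[OF iV assms] i by auto
qed

text \<open>The probability that the root of the unimodular random graph lies in the orbit of \<open>v\<close>.\<close>

definition wt :: "nat \<Rightarrow> real" where
  "wt v = measure \<nu> {cls v}"

lemma wt_nonneg: "0 \<le> wt v"
  by (simp add: wt_def)

lemma nn_integral_nu: "(\<integral>\<^sup>+c. F c \<partial>\<nu>) = (\<Sum>i\<in>reps. ennreal (wt i) * F (cls i))"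
proof -
  have "(\<integral>\<^sup>+c. F c \<partial>\<nu>) = (\<integral>\<^sup>+c. (\<Sum>d\<in>cls ` V. F d * indicator {d} c) \<partial>\<nu>)"
  proof (rule nn_integral_cong_AE)
    show "AE c in \<nu>. F c = (\<Sum>d\<in>cls ` V. F d * indicator {d} c)"
      using AE_nu_cls
    proof eventually_elim
      case (elim c)
      have "(\<Sum>d\<in>cls ` V. F d * indicator {d} c) = (\<Sum>d\<in>cls ` V. if d = c then F d else 0)"
        by (intro sum.cong) (auto simp: indicator_def)
      also have "\<dots> = F c" using elim finite_cls by (subst sum.delta) auto
      finally show ?case by simp
    qed
  qed
  also have "\<dots> = (\<Sum>d\<in>cls ` V. \<integral>\<^sup>+c. F d * indicator {d} c \<partial>\<nu>)"
    using cls_singleton by (intro nn_integral_sum) auto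
  also have "\<dots> = (\<Sum>d\<in>cls ` V. F d * emeasure \<nu> {d})"
    using cls_singleton by (intro sum.cong refl nn_integral_cmult_indicator) auto
  also have "\<dots> = (\<Sum>i\<in>reps. F (cls i) * emeasure \<nu> {cls i})"
    by (rule sum.reindex_bij_betw[OF bij_reps, symmetric])
  also have "\<dots> = (\<Sum>i\<in>reps. ennreal (wt i) * F (cls i))"
    by (simp add: wt_def nu.emeasure_eq_measure mult.commute)
  finally show ?thesis .
qed

lemma wt_sum: "(\<Sum>i\<in>reps. wt i) = 1"
proof -
  have "ennreal (\<Sum>i\<in>reps. wt i) = (\<integral>\<^sup>+c. 1 \<partial>\<nu>)"
    unfolding nn_integral_nu by (simp add: wt_nonneg sum_ennreal)
  also have "\<dots> = 1" by (simp add: nu.emeasure_space_1)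
  finally show ?thesis by (simp add: ennreal_eq_1 sum_nonneg wt_nonneg)
qed

lemma label_integral_iso:
  assumes iso: "graph_iso \<phi> H K" and \<Phi>: "\<Phi> \<in> borel_measurable P"
  shows "(\<integral>\<^sup>+\<xi>. \<Phi> \<xi> \<partial>P) = (\<integral>\<^sup>+\<omega>. \<Phi> (\<lambda>n\<in>V. \<omega> (\<phi> n)) \<partial>label_measure K)"
proof -
  have b: "bij_betw \<phi> V (verts K)" using iso by (simp add: graph_iso_def)
  show ?thesis
    by (subst distr_label_reindex[OF b, symmetric])
      (rule nn_integral_distr[OF label_reindex_measurable[OF b]], use \<Phi> in simp)
qed

lemma nn_integral_L_aut:
  assumes iso: "graph_iso \<phi> H H" and uv: "u \<in> V" "v \<in> V"
    and [measurable]: "F \<in> borel_measurable LM" "G \<in> borel_measurable LM"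
  shows "(\<integral>\<^sup>+\<xi>. F (L \<xi> (\<phi> u)) * G (L \<xi> (\<phi> v)) \<partial>P) = (\<integral>\<^sup>+\<xi>. F (L \<xi> u) * (G (L \<xi> v) :: ennreal) \<partial>P)"
proof -
  have [measurable]: "(\<lambda>\<xi>. L \<xi> u) \<in> measurable P LM" "(\<lambda>\<xi>. L \<xi> v) \<in> measurable P LM" using uv by simp_all
  have "(\<integral>\<^sup>+\<xi>. F (L \<xi> u) * G (L \<xi> v) \<partial>P)
      = (\<integral>\<^sup>+\<omega>. F (L (\<lambda>n\<in>V. \<omega> (\<phi> n)) u) * G (L (\<lambda>n\<in>V. \<omega> (\<phi> n)) v) \<partial>P)"
    by (rule label_integral_iso[OF iso]) measurable
  then show ?thesis using lclass_reindex[OF iso E_sub] uv by (simp add: L_def)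
qed

text \<open>A function of two vertices that is invariant under automorphisms descends to the classes of doubly rooted
  graphs, where the mass transport principle can be applied to it.  Here it is restricted to edges, which makes the
  sums finite.\<close>

lemma mass_transport_reps:
  fixes \<psi> :: "nat \<Rightarrow> nat \<Rightarrow> ennreal"
  assumes inv: "\<And>\<phi> u v. graph_iso \<phi> H H \<Longrightarrow> u \<in> V \<Longrightarrow> v \<in> V \<Longrightarrow> \<psi> (\<phi> u) (\<phi> v) = \<psi> u v"
  shows "(\<Sum>i\<in>reps. ennreal (wt i) * (\<Sum>v\<in>E `` {i}. \<psi> v i)) = (\<Sum>i\<in>reps. ennreal (wt i) * (\<Sum>v\<in>E `` {i}. \<psi> i v))"
proof -
  define cl2 where "cl2 u v = rclass (H, [u, v])" for u v
  have in2: "(H, [u, v]) \<in> rgraphs D 2" if "u \<in> V" "v \<in> V" for u v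
    using that conn deg by (simp add: rgraphs_def)
  have cl2_eq: "\<exists>\<phi>. graph_iso \<phi> H H \<and> \<phi> u = u' \<and> \<phi> v = v'"
    if "u \<in> V" "v \<in> V" "u' \<in> V" "v' \<in> V" "cl2 u v = cl2 u' v'" for u v u' v'
    using that(5) unfolding cl2_def rclass_eq_iff_iso_on[OF in2[OF that(1,2)] in2[OF that(3,4)]]
      graph_iso_iff_iso_on[OF E_sub E_sub] by simp
  define f where "f c = (if \<exists>u v. (u, v) \<in> E \<and> c = cl2 u v
      then (case SOME p. p \<in> E \<and> c = cl2 (fst p) (snd p) of (u, v) \<Rightarrow> \<psi> u v) else 0)" for c
  have f: "f (cl2 u v) = (if (u, v) \<in> E then \<psi> u v else 0)" if uv: "u \<in> V" "v \<in> V" for u v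
  proof (cases "\<exists>u' v'. (u', v') \<in> E \<and> cl2 u v = cl2 u' v'")
    case True
    define p where "p = (SOME p. p \<in> E \<and> cl2 u v = cl2 (fst p) (snd p))"
    have "\<exists>p. p \<in> E \<and> cl2 u v = cl2 (fst p) (snd p)" using True by auto
    from someI_ex[OF this] have p: "p \<in> E" "cl2 u v = cl2 (fst p) (snd p)" unfolding p_def by auto
    then have "fst p \<in> V" "snd p \<in> V" using E_sub by auto
    from cl2_eq[OF uv this p(2)] obtain \<phi> where phi: "graph_iso \<phi> H H" "\<phi> u = fst p" "\<phi> v = snd p" by blast
    have "(u, v) \<in> E" using phi(1) p(1) uv unfolding graph_iso_iff_iso_on[OF E_sub E_sub] iso_on_def
      by (metis phi(2,3) prod.collapse)
    moreover have "f (cl2 u v) = \<psi> (fst p) (snd p)"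
      unfolding f_def p_def[symmetric] using True by (simp add: split_beta)
    ultimately show ?thesis using inv[OF phi(1) uv] phi by simp
  next
    case False
    then have "(u, v) \<notin> E" by blast
    then show ?thesis unfolding f_def by (simp only: False if_False)
  qed
  have fm: "f \<in> borel_measurable (rooted_space D 2)"
  proof (rule borel_measurable_countable_support)
    show "countable ((\<lambda>(u, v). cl2 u v) ` (V \<times> V))" by simp
    show "{c} \<in> sets (rooted_space D 2)" if "c \<in> (\<lambda>(u, v). cl2 u v) ` (V \<times> V)" for c
      using that in2 unfolding cl2_def by (auto intro: rooted_singleton_measurable)
    show "f c = 0" if "c \<notin> (\<lambda>(u, v). cl2 u v) ` (V \<times> V)" for c
    proof -
      have "\<not> (\<exists>u v. (u, v) \<in> E \<and> c = cl2 u v)" using that E_sub by fastforce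
      then show ?thesis unfolding f_def by (simp only: if_False)
    qed
  qed
  have left: "(\<integral>\<^sup>+v. f (rclass (the_graph (cls i), [v, the_root (cls i)])) \<partial>count_space (verts (the_graph (cls i))))
      = (\<Sum>v\<in>E `` {i}. \<psi> v i)"
    and right: "(\<integral>\<^sup>+v. f (rclass (the_graph (cls i), [the_root (cls i), v])) \<partial>count_space (verts (the_graph (cls i))))
      = (\<Sum>v\<in>E `` {i}. \<psi> i v)" if i: "i \<in> V" for i
  proof -
    obtain \<phi> where p: "graph_iso \<phi> H (the_graph (cls i))" "the_root (cls i) = \<phi> i" using the_rep[OF cls_def] by blast
    have b: "bij_betw \<phi> V (verts (the_graph (cls i)))" using p(1) by (simp add: graph_iso_def)
    have cl: "rclass (the_graph (cls i), [\<phi> u, \<phi> v]) = cl2 u v" if "u \<in> V" "v \<in> V" for u v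
      unfolding cl2_def using p(1) that E_sub by (intro rclass_eqI[symmetric]) (auto simp: rgraph_iso_def)
    have fin: "finite (E `` {i})" "E `` {i} \<subseteq> V" using nbrs(1)[OF i] nbrs(3) by auto
    have "(\<integral>\<^sup>+v. f (rclass (the_graph (cls i), [v, the_root (cls i)])) \<partial>count_space (verts (the_graph (cls i))))
        = (\<integral>\<^sup>+u. f (rclass (the_graph (cls i), [\<phi> u, \<phi> i])) \<partial>count_space V)"
      unfolding p(2) by (rule nn_integral_bij_count_space[OF b, symmetric])
    also have "\<dots> = (\<integral>\<^sup>+u. (if (u, i) \<in> E then \<psi> u i else 0) \<partial>count_space V)"
      using i by (intro nn_integral_cong) (simp add: cl f)
    also have "\<dots> = (\<Sum>u\<in>E `` {i}. if (u, i) \<in> E then \<psi> u i else 0)"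
      using symE by (intro nn_integral_count_space'[OF fin(1) _ fin(2)]) (auto dest: symD)
    also have "\<dots> = (\<Sum>u\<in>E `` {i}. \<psi> u i)" using symE by (intro sum.cong) (auto dest: symD)
    finally show "(\<integral>\<^sup>+v. f (rclass (the_graph (cls i), [v, the_root (cls i)])) \<partial>count_space (verts (the_graph (cls i))))
      = (\<Sum>v\<in>E `` {i}. \<psi> v i)" .
    have "(\<integral>\<^sup>+v. f (rclass (the_graph (cls i), [the_root (cls i), v])) \<partial>count_space (verts (the_graph (cls i))))
        = (\<integral>\<^sup>+u. f (rclass (the_graph (cls i), [\<phi> i, \<phi> u])) \<partial>count_space V)"
      unfolding p(2) by (rule nn_integral_bij_count_space[OF b, symmetric])
    also have "\<dots> = (\<integral>\<^sup>+u. (if (i, u) \<in> E then \<psi> i u else 0) \<partial>count_space V)"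
      using i by (intro nn_integral_cong) (simp add: cl f)
    also have "\<dots> = (\<Sum>u\<in>E `` {i}. if (i, u) \<in> E then \<psi> i u else 0)"
      by (intro nn_integral_count_space'[OF fin(1) _ fin(2)]) auto
    also have "\<dots> = (\<Sum>u\<in>E `` {i}. \<psi> i u)" by (intro sum.cong) auto
    finally show "(\<integral>\<^sup>+v. f (rclass (the_graph (cls i), [the_root (cls i), v])) \<partial>count_space (verts (the_graph (cls i))))
      = (\<Sum>v\<in>E `` {i}. \<psi> i v)" .
  qed
  have "mass_transport D \<nu>" using law by (simp add: unimodular_law_def)
  from this[unfolded mass_transport_def, rule_format, OF fm]
  show ?thesis unfolding nn_integral_nu using left right reps_sub by (simp add: subset_iff cong: sum.cong)
qed

text \<open>Transport mass along the edges from the orbit of \<open>v\<close> to that of \<open>u\<close>.  If the latter had weight zero, the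
  expected mass received would vanish, but not the expected mass sent.\<close>

lemma wt_pos_step:
  assumes vu: "(v, u) \<in> E" and v: "0 < wt v"
  shows "0 < wt u"
proof (rule ccontr)
  assume "\<not> 0 < wt u"
  then have u0: "wt u = 0" using wt_nonneg[of u] by simp
  have V: "v \<in> V" "u \<in> V" using vu E_sub by auto
  define \<psi> where "\<psi> x y = (if cls x = cls v \<and> cls y = cls u then 1 else 0 :: ennreal)" for x y
  have inv: "\<psi> (\<phi> x) (\<phi> y) = \<psi> x y" if "graph_iso \<phi> H H" "x \<in> V" "y \<in> V" for \<phi> x y
  proof -
    have "\<phi> x \<in> V" "\<phi> y \<in> V" using that by (auto simp: graph_iso_def bij_betw_def)
    then have "cls (\<phi> x) = cls x" "cls (\<phi> y) = cls y" using cls_eq_iff that by metis+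
    then show ?thesis by (simp add: \<psi>_def)
  qed
  have "(\<Sum>i\<in>reps. ennreal (wt i) * (\<Sum>w\<in>E `` {i}. \<psi> w i)) = 0"
  proof (intro sum.neutral ballI)
    fix i assume i: "i \<in> reps"
    show "ennreal (wt i) * (\<Sum>w\<in>E `` {i}. \<psi> w i) = 0"
    proof (cases "cls i = cls u")
      case True
      then show ?thesis using u0 by (simp add: wt_def)
    next
      case False
      then show ?thesis by (simp add: \<psi>_def)
    qed
  qed
  then have 0: "(\<Sum>i\<in>reps. ennreal (wt i) * (\<Sum>w\<in>E `` {i}. \<psi> i w)) = 0" using mass_transport_reps[of \<psi>, OF inv] by simp
  obtain i \<phi> where i: "i \<in> reps" "graph_iso \<phi> H H" "\<phi> i = v" using rep_exists[OF V(1)] by blast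
  have iV: "i \<in> V" using i reps_sub by blast
  have "\<phi> ` V = V" using i(2) by (simp add: graph_iso_def bij_betw_def)
  then obtain w where w: "w \<in> V" "\<phi> w = u" using V(2) by (metis imageE)
  have iw: "(i, w) \<in> E" using i(2) vu w i(3) iV unfolding graph_iso_iff_iso_on[OF E_sub E_sub] iso_on_def by blast
  have ci: "cls i = cls v" and cw: "cls w = cls u" using cls_eq_iff iV w V i by metis+
  have "ennreal (wt i) * (\<Sum>w\<in>E `` {i}. \<psi> i w) = 0" using 0 finite_reps i(1) by (simp add: sum_eq_0_iff)
  moreover have "ennreal (wt i) \<noteq> 0" using v ci by (simp add: wt_def)
  ultimately have "\<psi> i w = 0" using iw nbrs(1)[OF iV] by (auto simp: sum_eq_0_iff)
  then show False using ci cw by (simp add: \<psi>_def)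
qed

lemma wt_pos: "v \<in> V \<Longrightarrow> 0 < wt v"
proof -
  assume v: "v \<in> V"
  have "\<exists>i\<in>reps. 0 < wt i"
  proof (rule ccontr)
    assume "\<not> (\<exists>i\<in>reps. 0 < wt i)"
    then have "(\<Sum>i\<in>reps. wt i) = 0" using wt_nonneg by (intro sum.neutral) (auto simp: order_less_le)
    then show False using wt_sum by simp
  qed
  then obtain i where i: "i \<in> reps" "0 < wt i" by blast
  then have "(i, v) \<in> E\<^sup>*" using connected_graphD(4)[OF conn _ v] reps_sub by blast
  then show "0 < wt v" by (induction rule: rtrancl_induct) (use i wt_pos_step in auto)
qed

end

section \<open>Integration over the Bernoulli graphing\<close>

context unimodular_quasi_transitive
begin

text \<open>A point of the graphing is a vertex, which up to automorphism is one of \<open>reps\<close>, with a labelling.  Both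
  \<open>\<mu>\<close> and its degree-biased version are of this form, for different weights \<open>a\<close>.\<close>

definition orbit_measure :: "(nat \<Rightarrow> real) \<Rightarrow> nat lgraph set measure" where
  "orbit_measure a = distr (point_measure reps a \<Otimes>\<^sub>M P) LM (\<lambda>p. L (snd p) (fst p))"

lemma orbit_map_measurable:
  "(\<lambda>p. L (snd p) (fst p)) \<in> measurable (point_measure reps a \<Otimes>\<^sub>M P) LM"
proof -
  have "(\<lambda>p. L (snd p) (fst p)) \<in> measurable (count_space reps \<Otimes>\<^sub>M P) LM"
  proof (rule measurable_pair_measure_countable1)
    show "countable reps" using finite_reps by (rule countable_finite)
    show "(\<lambda>y. L (snd (i, y)) (fst (i, y))) \<in> measurable P LM" if "i \<in> reps" for i
      using L_measurable[of i] reps_sub that by auto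
  qed
  also have "measurable (count_space reps \<Otimes>\<^sub>M P) LM = measurable (point_measure reps a \<Otimes>\<^sub>M P) LM"
    by (intro measurable_cong_sets sets_pair_measure_cong) (simp_all add: sets_point_measure)
  finally show ?thesis .
qed

lemma sets_orbit_measure: "sets (orbit_measure a) = sets LM"
  by (simp add: orbit_measure_def)

lemma nn_integral_orbit_measure:
  assumes [measurable]: "\<Phi> \<in> borel_measurable LM"
  shows "(\<integral>\<^sup>+x. \<Phi> x \<partial>orbit_measure a) = (\<Sum>i\<in>reps. ennreal (a i) * (\<integral>\<^sup>+\<xi>. \<Phi> (L \<xi> i) \<partial>P))"
proof -
  note [measurable] = orbit_map_measurable[of a]
  have m: "(\<lambda>p. \<Phi> (L (snd p) (fst p))) \<in> borel_measurable (point_measure reps a \<Otimes>\<^sub>M P)" by measurable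
  have "(\<integral>\<^sup>+x. \<Phi> x \<partial>orbit_measure a) = (\<integral>\<^sup>+p. \<Phi> (L (snd p) (fst p)) \<partial>(point_measure reps a \<Otimes>\<^sub>M P))"
    unfolding orbit_measure_def by (rule nn_integral_distr) measurable
  also have "\<dots> = (\<integral>\<^sup>+i. (\<integral>\<^sup>+\<xi>. \<Phi> (L \<xi> i) \<partial>P) \<partial>point_measure reps a)"
    using P.nn_integral_fst[OF m] by simp
  also have "\<dots> = (\<Sum>i\<in>reps. ennreal (a i) * (\<integral>\<^sup>+\<xi>. \<Phi> (L \<xi> i) \<partial>P))"
    by (rule nn_integral_point_measure_finite[OF finite_reps])
  finally show ?thesis .
qed

lemma orbit_measure_eqI:
  assumes "sets M = sets LM"
    and "\<And>\<Phi>. \<Phi> \<in> borel_measurable LM \<Longrightarrow> (\<integral>\<^sup>+x. \<Phi> x \<partial>M) = (\<Sum>i\<in>reps. ennreal (a i) * (\<integral>\<^sup>+\<xi>. \<Phi> (L \<xi> i) \<partial>P))"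
  shows "M = orbit_measure a"
proof (rule measure_eqI)
  show "sets M = sets (orbit_measure a)" using assms(1) by (simp add: sets_orbit_measure)
  fix A assume A: "A \<in> sets M"
  then have i: "indicator A \<in> borel_measurable LM" using assms(1) by (intro borel_measurable_indicator) simp
  have "emeasure M A = (\<integral>\<^sup>+x. indicator A x \<partial>M)" using A by simp
  also have "\<dots> = (\<integral>\<^sup>+x. indicator A x \<partial>orbit_measure a)" by (simp only: assms(2)[OF i] nn_integral_orbit_measure[OF i])
  also have "\<dots> = emeasure (orbit_measure a) A" using A assms(1) by (simp add: sets_orbit_measure)
  finally show "emeasure M A = emeasure (orbit_measure a) A" .
qed

lemma integral_orbit_measure:
  fixes \<Phi> :: "nat lgraph set \<Rightarrow> complex"
  assumes a: "\<And>i. i \<in> reps \<Longrightarrow> 0 \<le> a i" and int: "integrable (orbit_measure a) \<Phi>"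
  shows "(\<integral>x. \<Phi> x \<partial>orbit_measure a) = (\<Sum>i\<in>reps. of_real (a i) * (\<integral>\<xi>. \<Phi> (L \<xi> i) \<partial>P))"
proof -
  interpret pm: finite_measure "point_measure reps a"
  proof (rule finite_measureI)
    have "emeasure (point_measure reps a) (space (point_measure reps a)) = (\<Sum>i\<in>reps. ennreal (a i))"
      using finite_reps by (simp add: space_point_measure emeasure_point_measure_finite)
    also have "\<dots> \<noteq> \<infinity>" by (simp add: a sum_ennreal)
    finally show "emeasure (point_measure reps a) (space (point_measure reps a)) \<noteq> \<infinity>" .
  qed
  interpret pair_sigma_finite "point_measure reps a" P ..
  have \<Phi>m: "\<Phi> \<in> borel_measurable LM"
    using borel_measurable_integrable[OF int] by (simp add: orbit_measure_def)
  have i2: "integrable (point_measure reps a \<Otimes>\<^sub>M P) (\<lambda>p. \<Phi> (L (snd p) (fst p)))"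
    using int unfolding orbit_measure_def by (rule integrable_distr[OF orbit_map_measurable])
  have "(\<integral>x. \<Phi> x \<partial>orbit_measure a) = (\<integral>p. \<Phi> (L (snd p) (fst p)) \<partial>(point_measure reps a \<Otimes>\<^sub>M P))"
    unfolding orbit_measure_def by (rule integral_distr[OF orbit_map_measurable \<Phi>m])
  also have "\<dots> = (\<integral>i. (\<integral>\<xi>. \<Phi> (L \<xi> i) \<partial>P) \<partial>point_measure reps a)"
    using integral_fst'[OF i2] by simp
  also have "\<dots> = (\<Sum>i\<in>reps. a i *\<^sub>R (\<integral>\<xi>. \<Phi> (L \<xi> i) \<partial>P))"
    by (rule lebesgue_integral_point_measure_finite[OF finite_reps a])
  finally show ?thesis by (simp add: scaleR_conv_of_real)
qed

lemma mu_eq: "\<mu> = orbit_measure wt"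
proof -
  have inner: "(\<integral>\<^sup>+\<omega>. indicator A (lclass (the_graph (cls i), \<omega>, the_root (cls i))) \<partial>label_measure (the_graph (cls i)))
      = (\<integral>\<^sup>+\<xi>. indicator A (L \<xi> i) \<partial>P)" if A[measurable]: "A \<in> sets LM" and i: "i \<in> V" for A i
  proof -
    obtain \<phi> where p: "graph_iso \<phi> H (the_graph (cls i))" "the_root (cls i) = \<phi> i" using the_rep[OF cls_def] by blast
    have [measurable]: "(\<lambda>\<xi>. L \<xi> i) \<in> measurable P LM" using i by simp
    have "(\<integral>\<^sup>+\<xi>. indicator A (L \<xi> i) \<partial>P)
        = (\<integral>\<^sup>+\<omega>. indicator A (L (\<lambda>n\<in>V. \<omega> (\<phi> n)) i) \<partial>label_measure (the_graph (cls i)))"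
      by (rule label_integral_iso[OF p(1)]) measurable
    then show ?thesis unfolding L_def p(2) lclass_reindex[OF p(1) E_sub i] by simp
  qed
  have "\<mu> = measure_of (space LM) (sets LM) (emeasure (orbit_measure wt))"
    unfolding bernoulli_measure_def
  proof (rule measure_of_eq)
    show "sets LM \<subseteq> Pow (space LM)" by (rule sets.space_closed)
    fix A assume "A \<in> sigma_sets (space LM) (sets LM)"
    then have A: "A \<in> sets LM" by (simp add: sets.sigma_sets_eq)
    then have im: "indicator A \<in> borel_measurable LM" by (rule borel_measurable_indicator)
    have "(\<integral>\<^sup>+c. (\<integral>\<^sup>+\<xi>. indicator A (lclass (the_graph c, \<xi>, the_root c)) \<partial>label_measure (the_graph c)) \<partial>\<nu>)
        = (\<Sum>i\<in>reps. ennreal (wt i) * (\<integral>\<^sup>+\<xi>. indicator A (L \<xi> i) \<partial>P))"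
      unfolding nn_integral_nu using inner[OF A] reps_sub by (intro sum.cong) auto
    also have "\<dots> = (\<integral>\<^sup>+x. indicator A x \<partial>orbit_measure wt)" by (simp only: nn_integral_orbit_measure[OF im])
    also have "\<dots> = emeasure (orbit_measure wt) A" using A by (simp add: sets_orbit_measure)
    finally show "(\<integral>\<^sup>+c. (\<integral>\<^sup>+\<xi>. indicator A (lclass (the_graph c, \<xi>, the_root c)) \<partial>label_measure (the_graph c)) \<partial>\<nu>)
        = emeasure (orbit_measure wt) A" .
  qed
  also have "\<dots> = measure_of (space (orbit_measure wt)) (sets (orbit_measure wt)) (emeasure (orbit_measure wt))"
    using sets_orbit_measure[of wt] sets_eq_imp_space_eq[OF sets_orbit_measure[of wt]] by simp
  also have "\<dots> = orbit_measure wt" by (rule measure_of_of_measure)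
  finally show ?thesis .
qed

lemma sets_mu: "sets \<mu> = sets LM"
  by (simp add: mu_eq sets_orbit_measure)

lemma space_mu: "space \<mu> = space LM"
  using sets_eq_imp_space_eq[OF sets_mu] .

lemma borel_measurable_mu: "borel_measurable \<mu> = borel_measurable LM"
  by (rule measurable_cong_sets[OF sets_mu refl])

text \<open>An isomorphism between the graph rooted at \<open>u\<close> and at \<open>v\<close> preserves the injective labels, hence is the
  identity.\<close>

lemma L_inj:
  assumes xi: "\<xi> \<in> space P" and inj: "inj_on \<xi> V"
  shows "inj_on (L \<xi>) V"
proof (rule inj_onI)
  fix u v assume uv: "u \<in> V" "v \<in> V" "L \<xi> u = L \<xi> v"
  obtain \<phi> where p: "iso_on E E V V \<phi>" "\<phi> u = v" "\<forall>a\<in>V. \<xi> (\<phi> a) = \<xi> a"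
    using uv(3) unfolding L_def lclass_eq_iff_iso_on[OF labelled_in[OF uv(1) xi] labelled_in[OF uv(2) xi]] by blast
  have "\<phi> u \<in> V" using p(2) uv(2) by simp
  then have "\<phi> u = u" using p(3) uv(1) inj by (auto dest: inj_onD)
  then show "u = v" using p(2) by simp
qed

lemma nbrs_L: "v \<in> V \<Longrightarrow> \<xi> \<in> space P \<Longrightarrow> B `` {L \<xi> v} = L \<xi> ` (E `` {v})"
  unfolding L_def by (rule bernoulli_nbrs[OF labelled_in])

lemma nbr_sum_L:
  assumes v: "v \<in> V" and xi: "\<xi> \<in> space P" and inj: "inj_on \<xi> V"
  shows "(\<Sum>y\<in>B `` {L \<xi> v}. f y) = (\<Sum>w\<in>E `` {v}. f (L \<xi> w))"
  unfolding nbrs_L[OF v xi] using inj_on_subset[OF L_inj[OF xi inj] nbrs(3)] by (simp add: sum.reindex)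

lemma degree_L:
  assumes v: "v \<in> V" and xi: "\<xi> \<in> space P" and inj: "inj_on \<xi> V"
  shows "vertex_degree B (L \<xi> v) = vertex_degree E v"
  unfolding vertex_degree_def nbrs_L[OF v xi]
  by (rule card_image[OF inj_on_subset[OF L_inj[OF xi inj] nbrs(3)]])

lemma AE_inj: "AE \<xi> in P. \<xi> \<in> space P \<and> inj_on \<xi> V"
  using labels_inj_AE[of H] by (auto intro: AE_space)

lemma degree_pos: "v \<in> V \<Longrightarrow> 0 < vertex_degree E v"
  using nbrs[of v] by (auto simp: vertex_degree_def card_gt_0_iff)

definition total_degree :: real where
  "total_degree = (\<Sum>i\<in>reps. wt i * real (vertex_degree E i))"

lemma total_degree_pos: "0 < total_degree"
proof -
  have "reps \<noteq> {}" using wt_sum by auto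
  then show ?thesis
    unfolding total_degree_def using finite_reps wt_pos degree_pos reps_sub by (intro sum_pos) auto
qed

text \<open>Over the labellings the edges at a root are those of \<open>H\<close> almost surely, so integrating out the labels leaves
  a transport between vertices of \<open>H\<close>, which is invariant because the labels are identically distributed.\<close>

lemma bernoulli_reversible: "reversible_graph \<mu> B (1 / total_degree)"
proof
  show "0 < 1 / total_degree" using total_degree_pos by simp
  show "finite (B `` {x})" "B `` {x} \<subseteq> space \<mu>" if "x \<in> space \<mu>" for x
    using that bernoulli_nbrs_finite unfolding space_mu by auto
  show "(\<lambda>x. \<Sum>y\<in>B `` {x}. f y) \<in> borel_measurable \<mu>" if "f \<in> borel_measurable \<mu>" for f :: "nat lgraph set \<Rightarrow> ennreal"
    using that bernoulli_nbr_sum_measurable unfolding borel_measurable_mu by blast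
  fix f g :: "nat lgraph set \<Rightarrow> ennreal" assume fg: "f \<in> borel_measurable \<mu>" "g \<in> borel_measurable \<mu>"
  note [measurable] = fg[unfolded borel_measurable_mu]
  note [measurable] = bernoulli_nbr_sum_measurable[OF fg(1)[unfolded borel_measurable_mu]]
    bernoulli_nbr_sum_measurable[OF fg(2)[unfolded borel_measurable_mu]]
  define \<psi> where "\<psi> u v = (\<integral>\<^sup>+\<xi>. f (L \<xi> u) * g (L \<xi> v) \<partial>P)" for u v
  have inv: "\<psi> (\<phi> u) (\<phi> v) = \<psi> u v" if "graph_iso \<phi> H H" "u \<in> V" "v \<in> V" for \<phi> u v
    unfolding \<psi>_def by (rule nn_integral_L_aut[OF that]) measurable
  have m1: "(\<lambda>\<xi>. f (L \<xi> u) * g (L \<xi> v)) \<in> borel_measurable P" if "u \<in> V" "v \<in> V" for u v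
  proof -
    have [measurable]: "(\<lambda>\<xi>. L \<xi> u) \<in> measurable P LM" "(\<lambda>\<xi>. L \<xi> v) \<in> measurable P LM" using that by simp_all
    show ?thesis by measurable
  qed
  have "(\<integral>\<^sup>+x. (\<Sum>y\<in>B `` {x}. f y) * g x \<partial>\<mu>)
      = (\<Sum>i\<in>reps. ennreal (wt i) * (\<integral>\<^sup>+\<xi>. (\<Sum>y\<in>B `` {L \<xi> i}. f y) * g (L \<xi> i) \<partial>P))"
    unfolding mu_eq by (rule nn_integral_orbit_measure) measurable
  also have "\<dots> = (\<Sum>i\<in>reps. ennreal (wt i) * (\<Sum>w\<in>E `` {i}. \<psi> w i))"
  proof (intro sum.cong refl arg_cong2[where f = "(*)"])
    fix i assume "i \<in> reps"
    then have i: "i \<in> V" using reps_sub by blast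
    have "(\<integral>\<^sup>+\<xi>. (\<Sum>y\<in>B `` {L \<xi> i}. f y) * g (L \<xi> i) \<partial>P) = (\<integral>\<^sup>+\<xi>. (\<Sum>w\<in>E `` {i}. f (L \<xi> w) * g (L \<xi> i)) \<partial>P)"
    proof (rule nn_integral_cong_AE)
      show "AE \<xi> in P. (\<Sum>y\<in>B `` {L \<xi> i}. f y) * g (L \<xi> i) = (\<Sum>w\<in>E `` {i}. f (L \<xi> w) * g (L \<xi> i))"
        using AE_inj by eventually_elim (simp add: nbr_sum_L[OF i] sum_distrib_right)
    qed
    also have "\<dots> = (\<Sum>w\<in>E `` {i}. \<psi> w i)"
      unfolding \<psi>_def using m1 i nbrs(3) by (intro nn_integral_sum) blast
    finally show "(\<integral>\<^sup>+\<xi>. (\<Sum>y\<in>B `` {L \<xi> i}. f y) * g (L \<xi> i) \<partial>P) = (\<Sum>w\<in>E `` {i}. \<psi> w i)" .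
  qed
  also have "\<dots> = (\<Sum>i\<in>reps. ennreal (wt i) * (\<Sum>w\<in>E `` {i}. \<psi> i w))"
    by (rule mass_transport_reps[OF inv])
  also have "\<dots> = (\<Sum>i\<in>reps. ennreal (wt i) * (\<integral>\<^sup>+\<xi>. f (L \<xi> i) * (\<Sum>y\<in>B `` {L \<xi> i}. g y) \<partial>P))"
  proof (intro sum.cong refl arg_cong2[where f = "(*)"])
    fix i assume "i \<in> reps"
    then have i: "i \<in> V" using reps_sub by blast
    have "(\<integral>\<^sup>+\<xi>. f (L \<xi> i) * (\<Sum>y\<in>B `` {L \<xi> i}. g y) \<partial>P) = (\<integral>\<^sup>+\<xi>. (\<Sum>w\<in>E `` {i}. f (L \<xi> i) * g (L \<xi> w)) \<partial>P)"
    proof (rule nn_integral_cong_AE)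
      show "AE \<xi> in P. f (L \<xi> i) * (\<Sum>y\<in>B `` {L \<xi> i}. g y) = (\<Sum>w\<in>E `` {i}. f (L \<xi> i) * g (L \<xi> w))"
        using AE_inj by eventually_elim (simp add: nbr_sum_L[OF i] sum_distrib_left)
    qed
    also have "\<dots> = (\<Sum>w\<in>E `` {i}. \<psi> i w)"
      unfolding \<psi>_def using m1 i nbrs(3) by (intro nn_integral_sum) blast
    finally show "(\<Sum>w\<in>E `` {i}. \<psi> i w) = (\<integral>\<^sup>+\<xi>. f (L \<xi> i) * (\<Sum>y\<in>B `` {L \<xi> i}. g y) \<partial>P)" by simp
  qed
  also have "\<dots> = (\<integral>\<^sup>+x. f x * (\<Sum>y\<in>B `` {x}. g y) \<partial>\<mu>)"
    unfolding mu_eq by (rule nn_integral_orbit_measure[symmetric]) measurable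
  finally show "(\<integral>\<^sup>+x. (\<Sum>y\<in>B `` {x}. f y) * g x \<partial>\<mu>) = (\<integral>\<^sup>+x. f x * (\<Sum>y\<in>B `` {x}. g y) \<partial>\<mu>)" .
qed

sublocale bern: reversible_graph \<mu> B "1 / total_degree"
  by (rule bernoulli_reversible)

abbreviation "\<mu>s \<equiv> \<mu>_star D \<nu>"

lemma integral_degree: "(\<integral>x. real (vertex_degree B x) \<partial>\<mu>) = total_degree"
proof -
  have m: "(\<lambda>x. ennreal (real (vertex_degree B x))) \<in> borel_measurable LM"
    using bern.degree_measurable unfolding borel_measurable_mu by measurable
  have "(\<integral>x. real (vertex_degree B x) \<partial>\<mu>) = enn2real (\<integral>\<^sup>+x. ennreal (real (vertex_degree B x)) \<partial>\<mu>)"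
    by (rule integral_eq_nn_integral) (use bern.degree_measurable in auto)
  also have "(\<integral>\<^sup>+x. ennreal (real (vertex_degree B x)) \<partial>\<mu>)
      = (\<Sum>i\<in>reps. ennreal (wt i) * (\<integral>\<^sup>+\<xi>. ennreal (real (vertex_degree B (L \<xi> i))) \<partial>P))"
    unfolding mu_eq by (rule nn_integral_orbit_measure[OF m])
  also have "\<dots> = (\<Sum>i\<in>reps. ennreal (wt i * real (vertex_degree E i)))"
  proof (intro sum.cong refl)
    fix i assume "i \<in> reps"
    then have i: "i \<in> V" using reps_sub by blast
    have "(\<integral>\<^sup>+\<xi>. ennreal (real (vertex_degree B (L \<xi> i))) \<partial>P) = (\<integral>\<^sup>+\<xi>. ennreal (real (vertex_degree E i)) \<partial>P)"
    proof (rule nn_integral_cong_AE)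
      show "AE \<xi> in P. ennreal (real (vertex_degree B (L \<xi> i))) = ennreal (real (vertex_degree E i))"
        using AE_inj by eventually_elim (simp add: degree_L[OF i])
    qed
    then show "ennreal (wt i) * (\<integral>\<^sup>+\<xi>. ennreal (real (vertex_degree B (L \<xi> i))) \<partial>P) = ennreal (wt i * real (vertex_degree E i))"
      by (simp add: P.emeasure_space_1 ennreal_mult wt_nonneg)
  qed
  also have "\<dots> = ennreal total_degree"
    unfolding total_degree_def by (rule sum_ennreal) (simp add: wt_nonneg)
  finally show ?thesis using total_degree_pos by simp
qed

lemma mu_star_eq_deg_measure: "\<mu>s = bern.deg_measure"
  unfolding \<mu>_star_def biased_def bern.deg_measure_def integral_degree by simp

text \<open>The weight of the orbit of \<open>v\<close> after degree-biasing.\<close>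

definition swt :: "nat \<Rightarrow> real" where
  "swt v = wt v * real (vertex_degree E v) / total_degree"

lemma swt_pos: "v \<in> V \<Longrightarrow> 0 < swt v"
  using wt_pos degree_pos total_degree_pos by (simp add: swt_def)

lemma mu_star_eq: "\<mu>s = orbit_measure swt"
proof (rule orbit_measure_eqI)
  show "sets \<mu>s = sets LM" by (simp add: mu_star_eq_deg_measure bern.deg_measure_def sets_mu)
  fix \<Phi> :: "nat lgraph set \<Rightarrow> ennreal" assume \<Phi>[measurable]: "\<Phi> \<in> borel_measurable LM"
  have [measurable]: "(\<lambda>x. real (vertex_degree B x)) \<in> borel_measurable LM"
    using bern.degree_measurable unfolding borel_measurable_mu .
  have "(\<integral>\<^sup>+x. \<Phi> x \<partial>\<mu>s) = (\<integral>\<^sup>+x. ennreal (1 / total_degree * real (vertex_degree B x)) * \<Phi> x \<partial>\<mu>)"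
    unfolding mu_star_eq_deg_measure bern.deg_measure_def
    by (rule nn_integral_density) (unfold borel_measurable_mu, measurable)
  also have "\<dots> = (\<Sum>i\<in>reps. ennreal (wt i) * (\<integral>\<^sup>+\<xi>. ennreal (1 / total_degree * real (vertex_degree B (L \<xi> i))) * \<Phi> (L \<xi> i) \<partial>P))"
    unfolding mu_eq by (rule nn_integral_orbit_measure) measurable
  also have "\<dots> = (\<Sum>i\<in>reps. ennreal (swt i) * (\<integral>\<^sup>+\<xi>. \<Phi> (L \<xi> i) \<partial>P))"
  proof (intro sum.cong refl)
    fix i assume "i \<in> reps"
    then have i: "i \<in> V" using reps_sub by blast
    have [measurable]: "(\<lambda>\<xi>. L \<xi> i) \<in> measurable P LM" using i by simp
    have "(\<integral>\<^sup>+\<xi>. ennreal (1 / total_degree * real (vertex_degree B (L \<xi> i))) * \<Phi> (L \<xi> i) \<partial>P)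
        = (\<integral>\<^sup>+\<xi>. ennreal (1 / total_degree * real (vertex_degree E i)) * \<Phi> (L \<xi> i) \<partial>P)"
    proof (rule nn_integral_cong_AE)
      show "AE \<xi> in P. ennreal (1 / total_degree * real (vertex_degree B (L \<xi> i))) * \<Phi> (L \<xi> i)
          = ennreal (1 / total_degree * real (vertex_degree E i)) * \<Phi> (L \<xi> i)"
        using AE_inj by eventually_elim (simp add: degree_L[OF i])
    qed
    also have "\<dots> = ennreal (1 / total_degree * real (vertex_degree E i)) * (\<integral>\<^sup>+\<xi>. \<Phi> (L \<xi> i) \<partial>P)"
      by (rule nn_integral_cmult) measurable
    finally show "ennreal (wt i) * (\<integral>\<^sup>+\<xi>. ennreal (1 / total_degree * real (vertex_degree B (L \<xi> i))) * \<Phi> (L \<xi> i) \<partial>P)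
        = ennreal (swt i) * (\<integral>\<^sup>+\<xi>. \<Phi> (L \<xi> i) \<partial>P)"
      using total_degree_pos wt_nonneg[of i]
      by (simp add: swt_def ennreal_mult[symmetric] mult.assoc[symmetric])
  qed
  finally show "(\<integral>\<^sup>+x. \<Phi> x \<partial>\<mu>s) = (\<Sum>i\<in>reps. ennreal (swt i) * (\<integral>\<^sup>+\<xi>. \<Phi> (L \<xi> i) \<partial>P))" .
qed

lemma sets_mu_star: "sets \<mu>s = sets LM"
  by (simp add: mu_star_eq sets_orbit_measure)

lemma borel_measurable_mu_star: "borel_measurable \<mu>s = borel_measurable LM"
  by (rule measurable_cong_sets[OF sets_mu_star refl])

lemma swt_sum: "(\<Sum>i\<in>reps. swt i) = 1"
proof -
  have "(\<Sum>i\<in>reps. swt i) = total_degree / total_degree"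
    unfolding swt_def sum_divide_distrib[symmetric] total_degree_def[symmetric] ..
  then show ?thesis using total_degree_pos by simp
qed

lemma nn_integral_mu_star:
  "\<Phi> \<in> borel_measurable LM \<Longrightarrow> (\<integral>\<^sup>+x. \<Phi> x \<partial>\<mu>s) = (\<Sum>i\<in>reps. ennreal (swt i) * (\<integral>\<^sup>+\<xi>. \<Phi> (L \<xi> i) \<partial>P))"
  unfolding mu_star_eq by (rule nn_integral_orbit_measure)

sublocale mus: prob_space \<mu>s
proof (rule prob_spaceI)
  have "emeasure \<mu>s (space \<mu>s) = (\<integral>\<^sup>+x. 1 \<partial>\<mu>s)" by simp
  also have "\<dots> = (\<Sum>i\<in>reps. ennreal (swt i))"
    by (subst nn_integral_mu_star) (simp_all add: P.emeasure_space_1)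
  also have "\<dots> = 1" using swt_pos reps_sub by (subst sum_ennreal) (auto simp: swt_sum intro: less_imp_le)
  finally show "emeasure \<mu>s (space \<mu>s) = 1" .
qed

lemma integral_mu_star:
  fixes \<Phi> :: "nat lgraph set \<Rightarrow> complex"
  assumes "integrable \<mu>s \<Phi>"
  shows "(\<integral>x. \<Phi> x \<partial>\<mu>s) = (\<Sum>i\<in>reps. of_real (swt i) * (\<integral>\<xi>. \<Phi> (L \<xi> i) \<partial>P))"
  using assms swt_pos reps_sub unfolding mu_star_eq
  by (intro integral_orbit_measure) (auto intro: less_imp_le)

text \<open>The fibre over \<open>v\<close> is distributed like the fibre over the representative of its orbit, which is one of the
  finitely many parts of the measure.\<close>

lemma nn_integral_L_le:
  assumes v: "v \<in> V"
  shows "\<exists>i\<in>reps. \<forall>\<Phi>\<in>borel_measurable LM. ennreal (swt i) * (\<integral>\<^sup>+\<xi>. \<Phi> (L \<xi> v) \<partial>P) \<le> (\<integral>\<^sup>+x. \<Phi> x \<partial>\<mu>s)"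
proof -
  obtain i \<phi> where i: "i \<in> reps" "graph_iso \<phi> H H" "\<phi> i = v" using rep_exists[OF v] by blast
  have iV: "i \<in> V" using i reps_sub by blast
  have "ennreal (swt i) * (\<integral>\<^sup>+\<xi>. \<Phi> (L \<xi> v) \<partial>P) \<le> (\<integral>\<^sup>+x. \<Phi> x \<partial>\<mu>s)" if \<Phi>: "\<Phi> \<in> borel_measurable LM" for \<Phi>
  proof -
    have "(\<integral>\<^sup>+\<xi>. \<Phi> (L \<xi> v) \<partial>P) = (\<integral>\<^sup>+\<xi>. \<Phi> (L \<xi> i) \<partial>P)"
      using nn_integral_L_aut[OF i(2) iV iV \<Phi>, of "\<lambda>_. 1"] i(3) by simp
    then have "ennreal (swt i) * (\<integral>\<^sup>+\<xi>. \<Phi> (L \<xi> v) \<partial>P) \<le> (\<Sum>i\<in>reps. ennreal (swt i) * (\<integral>\<^sup>+\<xi>. \<Phi> (L \<xi> i) \<partial>P))"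
      using finite_reps i(1) by (intro member_le_sum[of i reps "\<lambda>i. ennreal (swt i) * (\<integral>\<^sup>+\<xi>. \<Phi> (L \<xi> i) \<partial>P)", THEN order_trans[rotated]]) auto
    then show ?thesis using nn_integral_mu_star[OF \<Phi>] by simp
  qed
  then show ?thesis using i(1) by blast
qed

text \<open>Every orbit has positive weight, so the fibre over a vertex carries a fixed fraction of the measure.\<close>

lemma L2_fibre_bound:
  assumes v: "v \<in> V"
  shows "\<exists>a>0. \<forall>f\<in>L2_space \<mu>s. (\<lambda>\<xi>. f (L \<xi> v)) \<in> L2_space P \<and>
    a * (L2_norm P (\<lambda>\<xi>. f (L \<xi> v)))\<^sup>2 \<le> (L2_norm \<mu>s f)\<^sup>2"
proof -
  obtain i where i: "i \<in> reps" "\<And>\<Phi>. \<Phi> \<in> borel_measurable LM \<Longrightarrow>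
      ennreal (swt i) * (\<integral>\<^sup>+\<xi>. \<Phi> (L \<xi> v) \<partial>P) \<le> (\<integral>\<^sup>+x. \<Phi> x \<partial>\<mu>s)" using nn_integral_L_le[OF v] by blast
  have sp: "swt i > 0" using swt_pos reps_sub i(1) by blast
  have "(\<lambda>\<xi>. f (L \<xi> v)) \<in> L2_space P \<and> swt i * (L2_norm P (\<lambda>\<xi>. f (L \<xi> v)))\<^sup>2 \<le> (L2_norm \<mu>s f)\<^sup>2"
    if f: "f \<in> L2_space \<mu>s" for f
  proof -
    have [measurable]: "f \<in> borel_measurable LM" using L2_measurable[OF f] by (simp add: borel_measurable_mu_star)
    have [measurable]: "(\<lambda>\<xi>. L \<xi> v) \<in> measurable P LM" using v by simp
    have m: "(\<lambda>x. ennreal ((cmod (f x))\<^sup>2)) \<in> borel_measurable LM" by measurable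
    have fi: "(\<integral>\<^sup>+x. ennreal ((cmod (f x))\<^sup>2) \<partial>\<mu>s) = ennreal ((L2_norm \<mu>s f)\<^sup>2)"
      unfolding L2_norm_sq by (rule nn_integral_eq_integral[OF L2_integrable_sq[OF f]]) simp
    note le = i(2)[OF m, unfolded fi]
    have "(\<integral>\<^sup>+\<xi>. ennreal ((cmod (f (L \<xi> v)))\<^sup>2) \<partial>P) \<noteq> \<infinity>"
    proof
      assume "(\<integral>\<^sup>+\<xi>. ennreal ((cmod (f (L \<xi> v)))\<^sup>2) \<partial>P) = \<infinity>"
      then show False using le sp by (simp add: ennreal_mult_top top_unique)
    qed
    then have int: "integrable P (\<lambda>\<xi>. (cmod (f (L \<xi> v)))\<^sup>2)"
      by (intro integrableI_nonneg) (auto simp: less_top)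
    have L: "(\<lambda>\<xi>. f (L \<xi> v)) \<in> L2_space P" by (rule L2_spaceI[OF _ int]) measurable
    have "(\<integral>\<^sup>+\<xi>. ennreal ((cmod (f (L \<xi> v)))\<^sup>2) \<partial>P) = ennreal ((L2_norm P (\<lambda>\<xi>. f (L \<xi> v)))\<^sup>2)"
      unfolding L2_norm_sq by (rule nn_integral_eq_integral[OF int]) simp
    then have "ennreal (swt i * (L2_norm P (\<lambda>\<xi>. f (L \<xi> v)))\<^sup>2) \<le> ennreal ((L2_norm \<mu>s f)\<^sup>2)"
      using le sp by (simp add: ennreal_mult)
    then show ?thesis using L by auto
  qed
  then show ?thesis using sp by blast
qed

lemma L2_fibre: "f \<in> L2_space \<mu>s \<Longrightarrow> v \<in> V \<Longrightarrow> (\<lambda>\<xi>. f (L \<xi> v)) \<in> L2_space P"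
  using L2_fibre_bound by blast

lemma L2_inner_mu_star:
  assumes "f \<in> L2_space \<mu>s" "g \<in> L2_space \<mu>s"
  shows "L2_inner \<mu>s f g = (\<Sum>i\<in>reps. of_real (swt i) * L2_inner P (\<lambda>\<xi>. f (L \<xi> i)) (\<lambda>\<xi>. g (L \<xi> i)))"
  unfolding L2_inner_def by (rule integral_mu_star[OF L2_inner_integrable[OF assms]])

lemma AE_mu_star_fibre:
  assumes ae: "AE x in \<mu>s. Q x" and i: "i \<in> reps"
  shows "AE \<xi> in P. Q (L \<xi> i)"
proof -
  obtain N where N: "N \<in> null_sets \<mu>s" "{x \<in> space \<mu>s. \<not> Q x} \<subseteq> N" using ae unfolding eventually_ae_filter by blast
  have [measurable]: "N \<in> sets LM" using N(1) by (auto simp: sets_mu_star)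
  have iV: "i \<in> V" using i reps_sub by blast
  have [measurable]: "(\<lambda>\<xi>. L \<xi> i) \<in> measurable P LM" using iV by simp
  have "(\<integral>\<^sup>+x. indicator N x \<partial>\<mu>s) = 0" using N(1) by (simp add: sets_mu_star null_sets_def)
  then have "(\<Sum>i\<in>reps. ennreal (swt i) * (\<integral>\<^sup>+\<xi>. indicator N (L \<xi> i) \<partial>P)) = 0"
    by (subst (asm) nn_integral_mu_star) simp_all
  then have "ennreal (swt i) * (\<integral>\<^sup>+\<xi>. indicator N (L \<xi> i) \<partial>P) = 0"
    using finite_reps i by (simp add: sum_eq_0_iff)
  then have "(\<integral>\<^sup>+\<xi>. indicator N (L \<xi> i) \<partial>P) = 0" using swt_pos[OF iV] by simp
  then have "AE \<xi> in P. (indicator N (L \<xi> i) :: ennreal) = 0" by (subst (asm) nn_integral_0_iff_AE) auto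
  then show ?thesis
  proof (rule AE_mp, intro AE_I2 impI)
    fix \<xi> assume xi: "\<xi> \<in> space P" and 0: "(indicator N (L \<xi> i) :: ennreal) = 0"
    have "L \<xi> i \<in> space \<mu>s" using L_in_space[OF iV xi] sets_eq_imp_space_eq[OF sets_mu_star] by simp
    then show "Q (L \<xi> i)" using N(2) 0 by (auto simp: indicator_def split: if_splits)
  qed
qed

end

section \<open>The random subspace\<close>

text \<open>The values of \<open>density M f\<close> are integrals, so \<open>f\<close> matters only up to null sets.  This is applied to the degree
  of the root, of which the values at the atoms of \<open>\<nu>\<close> determine it up to a null set.\<close>

lemma density_cong_AE_nonmeasurable:
  assumes "AE x in M. f x = g x"
  shows "density M f = density M g"
  unfolding density_def
proof (rule measure_of_eq[OF sets.space_closed])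
  fix A
  show "(\<integral>\<^sup>+x. f x * indicator A x \<partial>M) = (\<integral>\<^sup>+x. g x * indicator A x \<partial>M)"
    using assms by (intro nn_integral_cong_AE) auto
qed

lemma (in finite_measure) L2_bounded:
  assumes [measurable]: "f \<in> borel_measurable M" and b: "\<And>x. x \<in> space M \<Longrightarrow> cmod (f x) \<le> C"
  shows "f \<in> L2_space M"
proof (rule L2_spaceI[OF assms(1)])
  show "integrable M (\<lambda>x. (cmod (f x))\<^sup>2)"
  proof (rule integrable_const_bound[of _ "C\<^sup>2"])
    show "AE x in M. norm ((cmod (f x))\<^sup>2) \<le> C\<^sup>2"
      by (rule AE_I2) (simp add: b power_mono)
  qed measurable
qed

context unimodular_quasi_transitive
begin

abbreviation "R \<equiv> random_subspace D \<nu>"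

lemma R_sub: "R \<subseteq> L2_space \<mu>s"
  by (auto simp: random_subspace_def orth_complement_def)

lemma integral_L_aut:
  fixes f :: "nat lgraph set \<Rightarrow> complex"
  assumes iso: "graph_iso \<phi> H H" and u: "u \<in> V" and [measurable]: "f \<in> borel_measurable LM"
  shows "(\<integral>\<xi>. f (L \<xi> (\<phi> u)) \<partial>P) = (\<integral>\<xi>. f (L \<xi> u) \<partial>P)"
proof -
  have [measurable]: "(\<lambda>\<xi>. L \<xi> u) \<in> measurable P LM" using u by simp
  have b: "bij_betw \<phi> V V" using iso by (simp add: graph_iso_def)
  have "(\<integral>\<xi>. f (L \<xi> u) \<partial>P) = (\<integral>\<xi>. f (L \<xi> u) \<partial>distr P P (\<lambda>\<omega>. \<lambda>n\<in>V. \<omega> (\<phi> n)))"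
    by (simp only: distr_label_reindex[OF b])
  also have "\<dots> = (\<integral>\<omega>. f (L (\<lambda>n\<in>V. \<omega> (\<phi> n)) u) \<partial>P)"
    by (rule integral_distr[OF label_reindex_measurable[OF b]]) measurable
  also have "\<dots> = (\<integral>\<xi>. f (L \<xi> (\<phi> u)) \<partial>P)" unfolding L_def lclass_reindex[OF iso E_sub u] ..
  finally show ?thesis by simp
qed

lemma indicator_cls_L2: "v \<in> V \<Longrightarrow> (\<lambda>c. indicator {cls v} c) \<in> L2_space (\<nu>_star \<nu>)"
proof -
  assume v: "v \<in> V"
  define d where "d c = ennreal (real (vertex_degree (edges (the_graph c)) (the_root c)) /
      (\<integral>y. real (vertex_degree (edges (the_graph y)) (the_root y)) \<partial>\<nu>))" for c
  define d' where "d' c = (\<Sum>a\<in>cls ` V. d a * indicator {a} c)" for c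
  have [measurable]: "{cls u} \<in> sets \<nu>" if "u \<in> V" for u using cls_singleton that .
  have d'm: "d' \<in> borel_measurable \<nu>"
    unfolding d'_def using cls_singleton by (intro borel_measurable_sum borel_measurable_times) auto
  have "AE c in \<nu>. d c = d' c"
    using AE_nu_cls
  proof eventually_elim
    case (elim c)
    have "d' c = (\<Sum>a\<in>cls ` V. if a = c then d a else 0)"
      unfolding d'_def by (intro sum.cong) (auto simp: indicator_def)
    also have "\<dots> = d c" using elim finite_cls by (subst sum.delta) auto
    finally show ?case by simp
  qed
  then have s: "\<nu>_star \<nu> = density \<nu> d'"
    unfolding \<nu>_star_def biased_def d_def[symmetric] by (rule density_cong_AE_nonmeasurable)
  have "emeasure (\<nu>_star \<nu>) {cls v} = (\<integral>\<^sup>+c. d' c * indicator {cls v} c \<partial>\<nu>)"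
    unfolding s using d'm cls_singleton[OF v] by (rule emeasure_density)
  also have "\<dots> = (\<Sum>i\<in>reps. ennreal (wt i) * (d' (cls i) * indicator {cls v} (cls i)))"
    by (rule nn_integral_nu)
  also have "\<dots> < \<infinity>"
  proof -
    have "d' c < \<top>" for c
      unfolding d'_def d_def using finite_cls by (auto simp: indicator_def ennreal_mult_less_top)
    then have "ennreal (wt i) * (d' (cls i) * indicator {cls v} (cls i)) < \<top>" for i
      by (auto simp: ennreal_mult_less_top indicator_def)
    then show ?thesis using finite_reps by simp
  qed
  finally have "emeasure (\<nu>_star \<nu>) {cls v} < \<infinity>" .
  moreover have ss: "{cls v} \<in> sets (\<nu>_star \<nu>)" unfolding s using cls_singleton[OF v] by simp
  ultimately have "integrable (\<nu>_star \<nu>) (indicator {cls v} :: _ \<Rightarrow> real)"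
    by (rule integrable_real_indicator[rotated])
  moreover have "(\<lambda>c. (cmod (indicator {cls v} c))\<^sup>2) = (indicator {cls v} :: _ \<Rightarrow> real)"
    by (auto simp: indicator_def)
  ultimately show ?thesis using ss by (intro L2_spaceI) auto
qed

text \<open>Under \<open>\<mu>_star\<close> a structured function is constant on the fibre over each orbit, and all indicators of orbits
  are structured.  So orthogonality to the structured functions says that the mean over each fibre vanishes.\<close>

lemma R_iff: "f \<in> R \<longleftrightarrow> f \<in> L2_space \<mu>s \<and> (\<forall>v\<in>V. (\<integral>\<xi>. f (L \<xi> v) \<partial>P) = 0)"
proof
  assume f: "f \<in> R"
  then have fL: "f \<in> L2_space \<mu>s" using R_sub by blast
  then have fm: "f \<in> borel_measurable LM" using L2_measurable[OF fL] by (simp add: borel_measurable_mu_star)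
  have "(\<integral>\<xi>. f (L \<xi> v) \<partial>P) = 0" if v: "v \<in> V" for v
  proof -
    obtain i \<phi> where i: "i \<in> reps" "graph_iso \<phi> H H" "\<phi> i = v" using rep_exists[OF v] by blast
    have iV: "i \<in> V" using i reps_sub by blast
    define g :: "nat lgraph set \<Rightarrow> complex" where "g x = indicator {cls i} (forget_labels x)" for x
    have "(indicator {cls i} :: _ \<Rightarrow> complex) \<in> borel_measurable (rooted_space D 1)"
      using cls_singleton[OF iV] unfolding sets_nu by (rule borel_measurable_indicator)
    then have [measurable]: "g \<in> borel_measurable LM"
      unfolding g_def by (rule measurable_compose[OF forget_labels_measurable])
    have gL: "g \<in> L2_space \<mu>s"
      by (rule mus.L2_bounded[of _ 1]) (simp_all add: borel_measurable_mu_star g_def indicator_def)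
    have "g \<in> structured_subspace D \<nu>"
      unfolding structured_subspace_def using gL indicator_cls_L2[OF iV] by (auto simp: g_def)
    then have "L2_inner \<mu>s f g = 0" using f by (simp add: random_subspace_def orth_complement_def)
    then have "0 = (\<Sum>j\<in>reps. of_real (swt j) * L2_inner P (\<lambda>\<xi>. f (L \<xi> j)) (\<lambda>\<xi>. g (L \<xi> j)))"
      using L2_inner_mu_star[OF fL gL] by simp
    also have "\<dots> = (\<Sum>j\<in>reps. if j = i then of_real (swt i) * (\<integral>\<xi>. f (L \<xi> i) \<partial>P) else 0)"
    proof (intro sum.cong refl)
      fix j assume j: "j \<in> reps"
      then have jV: "j \<in> V" using reps_sub by blast
      have "cls j = cls i \<longleftrightarrow> j = i" using bij_reps i(1) j by (auto simp: bij_betw_def dest: inj_onD)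
      then have gj: "g (L \<xi> j) = (if j = i then 1 else 0)" if "\<xi> \<in> space P" for \<xi>
        using forget_L[OF jV that] by (simp add: g_def indicator_def)
      have "L2_inner P (\<lambda>\<xi>. f (L \<xi> j)) (\<lambda>\<xi>. g (L \<xi> j)) = (\<integral>\<xi>. (if j = i then f (L \<xi> i) else 0) \<partial>P)"
        unfolding L2_inner_def by (intro Bochner_Integration.integral_cong refl) (simp add: gj)
      then show "of_real (swt j) * L2_inner P (\<lambda>\<xi>. f (L \<xi> j)) (\<lambda>\<xi>. g (L \<xi> j))
          = (if j = i then of_real (swt i) * (\<integral>\<xi>. f (L \<xi> i) \<partial>P) else 0)" by simp
    qed
    also have "\<dots> = of_real (swt i) * (\<integral>\<xi>. f (L \<xi> i) \<partial>P)" using finite_reps i(1) by simp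
    finally have "(\<integral>\<xi>. f (L \<xi> i) \<partial>P) = 0" using swt_pos[OF iV] by simp
    then show ?thesis using integral_L_aut[OF i(2) iV fm] i(3) by simp
  qed
  then show "f \<in> L2_space \<mu>s \<and> (\<forall>v\<in>V. (\<integral>\<xi>. f (L \<xi> v) \<partial>P) = 0)" using fL by blast
next
  assume *: "f \<in> L2_space \<mu>s \<and> (\<forall>v\<in>V. (\<integral>\<xi>. f (L \<xi> v) \<partial>P) = 0)"
  then have fL: "f \<in> L2_space \<mu>s" by blast
  have "L2_inner \<mu>s f g = 0" if g: "g \<in> structured_subspace D \<nu>" for g
  proof -
    obtain h where gL: "g \<in> L2_space \<mu>s" and h: "AE x in \<mu>s. g x = h (forget_labels x)"
      using g unfolding structured_subspace_def by blast
    have "L2_inner P (\<lambda>\<xi>. f (L \<xi> i)) (\<lambda>\<xi>. g (L \<xi> i)) = 0" if i: "i \<in> reps" for i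
    proof -
      have iV: "i \<in> V" using i reps_sub by blast
      have [measurable]: "(\<lambda>\<xi>. f (L \<xi> i)) \<in> borel_measurable P" "(\<lambda>\<xi>. g (L \<xi> i)) \<in> borel_measurable P"
        using L2_measurable[OF L2_fibre[OF fL iV]] L2_measurable[OF L2_fibre[OF gL iV]] by auto
      have "L2_inner P (\<lambda>\<xi>. f (L \<xi> i)) (\<lambda>\<xi>. g (L \<xi> i)) = (\<integral>\<xi>. f (L \<xi> i) * cnj (h (cls i)) \<partial>P)"
        unfolding L2_inner_def
      proof (rule integral_cong_AE)
        show "AE \<xi> in P. f (L \<xi> i) * cnj (g (L \<xi> i)) = f (L \<xi> i) * cnj (h (cls i))"
          using AE_mu_star_fibre[OF h i] AE_space by eventually_elim (simp add: forget_L[OF iV])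
      qed measurable
      also have "\<dots> = (\<integral>\<xi>. f (L \<xi> i) \<partial>P) * cnj (h (cls i))" by simp
      finally show ?thesis using * iV by simp
    qed
    then show ?thesis unfolding L2_inner_mu_star[OF fL gL] by simp
  qed
  then show "f \<in> R" using fL by (simp add: random_subspace_def orth_complement_def)
qed

lemma L2_integrable_P: "f \<in> L2_space P \<Longrightarrow> integrable P f"
  using L2_inner_integrable[of f P "\<lambda>_. 1"] P.L2_bounded[of "\<lambda>_. 1" 1] by simp

lemma markov_L:
  assumes "v \<in> V" "\<xi> \<in> space P" "inj_on \<xi> V"
  shows "markov B f (L \<xi> v) = markov E (\<lambda>w. f (L \<xi> w)) v"
  unfolding markov_def degree_L[OF assms] nbr_sum_L[OF assms] ..

lemma markov_R: "f \<in> R \<Longrightarrow> markov B f \<in> R"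
proof -
  assume f: "f \<in> R"
  then have fL: "f \<in> L2_space \<mu>s" and f0: "\<And>v. v \<in> V \<Longrightarrow> (\<integral>\<xi>. f (L \<xi> v) \<partial>P) = 0" by (auto simp: R_iff)
  have mL: "markov B f \<in> L2_space \<mu>s" using bern.markov_L2(1) fL unfolding mu_star_eq_deg_measure by blast
  have "(\<integral>\<xi>. markov B f (L \<xi> v) \<partial>P) = 0" if v: "v \<in> V" for v
  proof -
    have int: "integrable P (\<lambda>\<xi>. f (L \<xi> w))" if "w \<in> E `` {v}" for w
      using that nbrs(3) by (intro L2_integrable_P L2_fibre[OF fL]) blast
    have [measurable]: "(\<lambda>\<xi>. f (L \<xi> w)) \<in> borel_measurable P" if "w \<in> E `` {v}" for w
      using int[OF that] by (rule borel_measurable_integrable)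
    have "(\<integral>\<xi>. markov B f (L \<xi> v) \<partial>P) = (\<integral>\<xi>. (1 / of_nat (vertex_degree E v)) * (\<Sum>w\<in>E `` {v}. f (L \<xi> w)) \<partial>P)"
    proof (rule integral_cong_AE)
      show "(\<lambda>\<xi>. markov B f (L \<xi> v)) \<in> borel_measurable P" by (rule L2_measurable[OF L2_fibre[OF mL v]])
      show "AE \<xi> in P. markov B f (L \<xi> v) = (1 / of_nat (vertex_degree E v)) * (\<Sum>w\<in>E `` {v}. f (L \<xi> w))"
        using AE_inj
      proof eventually_elim
        case (elim \<xi>)
        have "markov E (\<lambda>w. f (L \<xi> w)) v = (1 / of_nat (vertex_degree E v)) * (\<Sum>w\<in>E `` {v}. f (L \<xi> w))"
          by (simp only: markov_def)
        then show ?case using elim markov_L[OF v, of \<xi> f] by simp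
      qed
    qed measurable
    also have "\<dots> = (1 / of_nat (vertex_degree E v)) * (\<Sum>w\<in>E `` {v}. \<integral>\<xi>. f (L \<xi> w) \<partial>P)"
      using int by simp
    also have "\<dots> = 0" using f0 nbrs(3) by (simp add: subset_iff)
    finally show ?thesis .
  qed
  then show ?thesis using mL by (simp add: R_iff)
qed

lemma random_self_adjoint: "self_adjoint_contraction \<mu>s R (markov B)"
proof
  show "R \<subseteq> L2_space \<mu>s" by (rule R_sub)
  show "(\<lambda>x. a * f x + b * g x) \<in> R" if "f \<in> R" "g \<in> R" for f g a b
  proof -
    have fg: "f \<in> L2_space \<mu>s" "g \<in> L2_space \<mu>s" using that R_sub by auto
    have "L2_inner \<mu>s (\<lambda>x. a * f x + b * g x) h = 0" if h: "h \<in> structured_subspace D \<nu>" for h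
    proof -
      have hL: "h \<in> L2_space \<mu>s" using h by (simp add: structured_subspace_def)
      have "L2_inner \<mu>s f h = 0" "L2_inner \<mu>s g h = 0"
        using \<open>f \<in> R\<close> \<open>g \<in> R\<close> h by (simp_all add: random_subspace_def orth_complement_def)
      then show ?thesis by (simp add: L2_inner_lincomb_left[OF fg hL])
    qed
    then show ?thesis using L2_lincomb[OF fg] by (simp add: random_subspace_def orth_complement_def)
  qed
  show "f \<in> R" if s: "\<And>n. s n \<in> R" and f: "f \<in> L2_space \<mu>s" and lim: "(\<lambda>n. L2_norm \<mu>s (\<lambda>x. s n x - f x)) \<longlonglongrightarrow> 0" for s f
  proof -
    have "L2_inner \<mu>s f h = 0" if h: "h \<in> structured_subspace D \<nu>" for h
    proof -
      have hL: "h \<in> L2_space \<mu>s" using h by (simp add: structured_subspace_def)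
      have sL: "s n \<in> L2_space \<mu>s" for n using s R_sub by blast
      have le: "cmod (L2_inner \<mu>s f h) \<le> L2_norm \<mu>s (\<lambda>x. s n x - f x) * L2_norm \<mu>s h" for n
      proof -
        have "L2_inner \<mu>s (s n) h = 0" using s h by (simp add: random_subspace_def orth_complement_def)
        then have "L2_inner \<mu>s (\<lambda>x. s n x - f x) h = - L2_inner \<mu>s f h"
          using L2_inner_lincomb_left[OF sL[of n] f hL, of 1 "- 1"] by simp
        then show ?thesis using L2_Cauchy_Schwarz[OF L2_diff[OF sL[of n] f] hL] by simp
      qed
      have "(\<lambda>n. L2_norm \<mu>s (\<lambda>x. s n x - f x) * L2_norm \<mu>s h) \<longlonglongrightarrow> 0 * L2_norm \<mu>s h"
        by (intro tendsto_intros lim)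
      then have "cmod (L2_inner \<mu>s f h) \<le> 0 * L2_norm \<mu>s h"
        by (rule LIMSEQ_le_const) (use le in blast)
      then show ?thesis by simp
    qed
    then show ?thesis using f by (simp add: random_subspace_def orth_complement_def)
  qed
  show "markov B f \<in> R" if "f \<in> R" for f using markov_R that .
  show "markov B (\<lambda>x. a * f x + b * g x) = (\<lambda>x. a * markov B f x + b * markov B g x)" for f g a b
    by (rule markov_lincomb)
  show "L2_inner \<mu>s (markov B f) g = L2_inner \<mu>s f (markov B g)" if "f \<in> R" "g \<in> R" for f g
    using that R_sub unfolding mu_star_eq_deg_measure by (intro bern.markov_sym) auto
  show "L2_norm \<mu>s (markov B f) \<le> L2_norm \<mu>s f" if "f \<in> R" for f
    using that R_sub unfolding mu_star_eq_deg_measure by (intro bern.markov_L2(2)) auto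
qed

section \<open>Density of local functions\<close>

text \<open>As the graph underlying \<open>L \<xi> v\<close> is always \<open>H\<close>, being determined by the labelled ball of radius \<open>r\<close> around the
  root can be tested by changing labels outside of this ball.\<close>

definition local_on :: "nat \<Rightarrow> (nat lgraph set \<Rightarrow> 'b) \<Rightarrow> bool" where
  "local_on r f \<longleftrightarrow> (\<forall>v\<in>V. \<forall>\<xi>\<in>space P. \<forall>\<xi>'\<in>space P.
     (\<forall>u\<in>nball E r {v}. \<xi> u = \<xi>' u) \<longrightarrow> f (L \<xi> v) = f (L \<xi>' v))"

definition local_set :: "nat \<Rightarrow> nat lgraph set set \<Rightarrow> bool" where
  "local_set r A \<longleftrightarrow> A \<in> sets LM \<and> local_on r (\<lambda>x. x \<in> A)"

lemma local_onI:
  assumes "\<And>v \<xi> \<xi>'. v \<in> V \<Longrightarrow> \<xi> \<in> space P \<Longrightarrow> \<xi>' \<in> space P \<Longrightarrow>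
    \<forall>u\<in>nball E r {v}. \<xi> u = \<xi>' u \<Longrightarrow> f (L \<xi> v) = f (L \<xi>' v)"
  shows "local_on r f"
  unfolding local_on_def by (intro ballI impI) (rule assms)

lemma local_onD:
  assumes "local_on r f" "v \<in> V" "\<xi> \<in> space P" "\<xi>' \<in> space P" "\<forall>u\<in>nball E r {v}. \<xi> u = \<xi>' u"
  shows "f (L \<xi> v) = f (L \<xi>' v)"
  by (rule mp[OF bspec[OF bspec[OF bspec[OF assms(1)[unfolded local_on_def] assms(2)] assms(3)] assms(4)] assms(5)])

lemma local_on_mono: "local_on r f \<Longrightarrow> r \<le> r' \<Longrightarrow> local_on r' f"
  unfolding local_on_def using nball_mono[of r r' E] by (meson subsetD)

lemma local_on_comp: "local_on r f \<Longrightarrow> local_on r (\<lambda>x. h (f x))"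
  unfolding local_on_def by metis

lemma local_on_comp2: "local_on r f \<Longrightarrow> local_on r g \<Longrightarrow> local_on r (\<lambda>x. h (f x) (g x))"
  unfolding local_on_def by metis

lemma core_local: "local_set r (labelled.core D r U)"
proof -
  have "L \<xi> v \<in> labelled.core D r U \<longleftrightarrow> L \<xi>' v \<in> labelled.core D r U"
    if v: "v \<in> V" and xi: "\<xi> \<in> space P" "\<xi>' \<in> space P" and eq: "\<forall>u\<in>nball E r {v}. \<xi> u = \<xi>' u" for v \<xi> \<xi>'
  proof -
    have near: "lnear r (H, \<xi>, v) y \<longleftrightarrow> lnear r (H, \<xi>', v) y" if y: "y \<in> lgraphs D" for y
    proof -
      obtain K \<eta> w where y': "y = (K, \<eta>, w)" by (cases y)
      note Y = y[unfolded y']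
      have "near_map r d E \<xi> [v] (edges K) \<eta> [w] \<phi> \<longleftrightarrow> near_map r d E \<xi>' [v] (edges K) \<eta> [w] \<phi>" for d \<phi>
        using eq by (simp add: near_map_def)
      then show ?thesis
        unfolding y' lnear_iff[OF labelled_in[OF v xi(1)] Y] lnear_iff[OF labelled_in[OF v xi(2)] Y] by blast
    qed
    show ?thesis
      unfolding L_def labelled.cl_in_core_iff[OF labelled_in[OF v xi(1)]] labelled.cl_in_core_iff[OF labelled_in[OF v xi(2)]]
      using near by blast
  qed
  moreover have "labelled.core D r U \<in> sets LM" unfolding labelled_space_def by (rule labelled.core_measurable)
  ultimately show ?thesis unfolding local_set_def local_on_def by blast
qed

lemma local_set_compl:
  assumes "local_set r A"
  shows "local_set r (space LM - A)"
proof -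
  have A: "A \<in> sets LM" "local_on r (\<lambda>x. x \<in> A)" using assms by (simp_all add: local_set_def)
  have "local_on r (\<lambda>x. x \<in> space LM - A)"
  proof (rule local_onI)
    fix v \<xi> \<xi>'
    assume *: "v \<in> V" "\<xi> \<in> space P" "\<xi>' \<in> space P" "\<forall>u\<in>nball E r {v}. \<xi> u = \<xi>' u"
    show "(L \<xi> v \<in> space LM - A) = (L \<xi>' v \<in> space LM - A)"
      using local_onD[OF A(2) *] L_in_space[OF *(1,2)] L_in_space[OF *(1,3)] by (simp only: Diff_iff simp_thms)
  qed
  then show ?thesis using sets.compl_sets[OF A(1)] unfolding local_set_def by blast
qed

lemma local_set_Un:
  assumes A: "local_set r A" and A': "local_set s A'"
  shows "local_set (max r s) (A \<union> A')"
proof -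
  have 1: "local_on (max r s) (\<lambda>x. x \<in> A)"
    by (rule local_on_mono[of r]) (use A in \<open>simp_all add: local_set_def\<close>)
  have 2: "local_on (max r s) (\<lambda>x. x \<in> A')"
    by (rule local_on_mono[of s]) (use A' in \<open>simp_all add: local_set_def\<close>)
  have "local_on (max r s) (\<lambda>x. x \<in> A \<union> A')" using local_on_comp2[OF 1 2, of "(\<or>)"] by simp
  moreover have "A \<union> A' \<in> sets LM" using A A' by (intro sets.Un) (simp_all add: local_set_def)
  ultimately show ?thesis unfolding local_set_def by blast
qed

lemma local_set_UN:
  fixes A :: "nat \<Rightarrow> nat lgraph set set"
  assumes "\<And>i. i < n \<Longrightarrow> \<exists>r. local_set r (A i)"
  shows "\<exists>r. local_set r (\<Union>i<n. A i)"
  using assms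
proof (induction n)
  case 0
  have "local_set 0 {}" by (simp add: local_set_def local_on_def)
  then show ?case by auto
next
  case (Suc n)
  obtain r where r: "local_set r (\<Union>i<n. A i)" using Suc by auto
  obtain s where s: "local_set s (A n)" using Suc.prems by auto
  show ?case using local_set_Un[OF r s] by (auto simp: lessThan_Suc Un_commute)
qed

text \<open>The sets that can be approximated by local ones form a \<open>\<sigma>\<close>-algebra, and an open set is approximated by its
  cores.\<close>

lemma local_approx_set:
  assumes A: "A \<in> sets LM" and e: "e > 0"
  shows "\<exists>r A'. local_set r A' \<and> measure \<mu>s ((A - A') \<union> (A' - A)) < e"
  using A[unfolded sets_labelled_space] e
proof (induction arbitrary: e rule: sigma_sets.induct)
  case (Basic U)
  have U: "U = (\<Union>r. labelled.core D r U)" by (rule labelled.open_eq_UN_core[OF Basic(1)])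
  have cm: "labelled.core D r U \<in> sets \<mu>s" for r
    using core_local[of r U] by (simp add: local_set_def sets_mu_star)
  have "(\<lambda>r. measure \<mu>s (labelled.core D r U)) \<longlonglongrightarrow> measure \<mu>s (\<Union>r. labelled.core D r U)"
    using cm labelled.incseq_core by (intro mus.finite_Lim_measure_incseq) auto
  then have "(\<lambda>r. measure \<mu>s (labelled.core D r U)) \<longlonglongrightarrow> measure \<mu>s U" unfolding U[symmetric] .
  from order_tendstoD(1)[OF this, of "measure \<mu>s U - e"] Basic(2)
  obtain r where r: "measure \<mu>s U - e < measure \<mu>s (labelled.core D r U)"
    using eventually_happens'[OF sequentially_bot] by fastforce
  have sub: "labelled.core D r U \<subseteq> U" by (subst (2) U) blast
  have Um: "U \<in> sets \<mu>s" using Basic(1) by (auto simp: sets_mu_star sets_labelled_space)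
  have "measure \<mu>s (U - labelled.core D r U) = measure \<mu>s U - measure \<mu>s (labelled.core D r U)"
    by (rule mus.finite_measure_Diff[OF Um cm sub])
  moreover have "(U - labelled.core D r U) \<union> (labelled.core D r U - U) = U - labelled.core D r U" using sub by blast
  ultimately show ?case using r core_local[of r U] by (intro exI[of _ r] exI[of _ "labelled.core D r U"]) simp
next
  case Empty
  have "local_set 0 {}" by (simp add: local_set_def local_on_def)
  then show ?case using Empty by (intro exI[of _ 0] exI[of _ "{}"]) simp
next
  case (Compl A)
  obtain r A' where A': "local_set r A'" "measure \<mu>s ((A - A') \<union> (A' - A)) < e" using Compl by blast
  have "A \<subseteq> space LM" unfolding space_labelled_space
    using Compl(1) by (rule sigma_sets_into_sp[rotated]) (auto simp: labelled.opens_def)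
  moreover have "A' \<subseteq> space LM" using A'(1) sets.sets_into_space by (auto simp: local_set_def)
  ultimately have "((lclass ` lgraphs D - A) - (space LM - A')) \<union> ((space LM - A') - (lclass ` lgraphs D - A)) = (A - A') \<union> (A' - A)"
    unfolding space_labelled_space by blast
  then show ?case using A' local_set_compl by metis
next
  case (Union A)
  have Am: "A i \<in> sets \<mu>s" for i using Union(1) by (simp add: sets_mu_star sets_labelled_space)
  have inc: "incseq (\<lambda>n. \<Union>i<n. A i)"
  proof (rule incseq_SucI)
    fix n show "(\<Union>i<n. A i) \<subseteq> (\<Union>i<Suc n. A i)" unfolding lessThan_Suc by blast
  qed
  have UU: "(\<Union>n. \<Union>i<n. A i) = (\<Union>i. A i)" by blast
  have "(\<lambda>n. measure \<mu>s (\<Union>i<n. A i)) \<longlonglongrightarrow> measure \<mu>s (\<Union>n. \<Union>i<n. A i)"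
    using Am inc by (intro mus.finite_Lim_measure_incseq) auto
  from order_tendstoD(1)[OF this[unfolded UU], of "measure \<mu>s (\<Union>i. A i) - e / 2"] Union(3)
  obtain n where n: "measure \<mu>s (\<Union>i. A i) - e / 2 < measure \<mu>s (\<Union>i<n. A i)"
    using eventually_happens'[OF sequentially_bot] by fastforce
  \<comment> \<open>one half of \<open>e\<close> for truncating the union, the other half for \<open>n\<close> approximations\<close>
  define d where "d = e / (2 * (real n + 1))"
  have d: "d > 0" "real n * d \<le> e / 2" using Union(3) by (auto simp: d_def field_simps)
  have "\<forall>i. \<exists>r A'. local_set r A' \<and> measure \<mu>s ((A i - A') \<union> (A' - A i)) < d" using Union(2) d(1) by blast
  then obtain r A' where A': "\<And>i. local_set (r i) (A' i)" "\<And>i. measure \<mu>s ((A i - A' i) \<union> (A' i - A i)) < d"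
    by metis
  have A'm: "A' i \<in> sets \<mu>s" for i using A'(1)[of i] by (simp add: local_set_def sets_mu_star)
  obtain s where s: "local_set s (\<Union>i<n. A' i)" using local_set_UN[of n A'] A'(1) by blast
  have "((\<Union>i. A i) - (\<Union>i<n. A' i)) \<union> ((\<Union>i<n. A' i) - (\<Union>i. A i))
      \<subseteq> ((\<Union>i. A i) - (\<Union>i<n. A i)) \<union> (\<Union>i<n. (A i - A' i) \<union> (A' i - A i))" by blast
  then have "measure \<mu>s (((\<Union>i. A i) - (\<Union>i<n. A' i)) \<union> ((\<Union>i<n. A' i) - (\<Union>i. A i)))
      \<le> measure \<mu>s (((\<Union>i. A i) - (\<Union>i<n. A i)) \<union> (\<Union>i<n. (A i - A' i) \<union> (A' i - A i)))"
    using Am A'm by (intro mus.finite_measure_mono) auto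
  also have "\<dots> \<le> measure \<mu>s ((\<Union>i. A i) - (\<Union>i<n. A i)) + measure \<mu>s (\<Union>i<n. (A i - A' i) \<union> (A' i - A i))"
    by (rule measure_Un_le) (use Am A'm in auto)
  also have "measure \<mu>s (\<Union>i<n. (A i - A' i) \<union> (A' i - A i)) \<le> (\<Sum>i<n. measure \<mu>s ((A i - A' i) \<union> (A' i - A i)))"
    using Am A'm by (intro mus.finite_measure_subadditive_finite) auto
  also have "\<dots> \<le> (\<Sum>i<n. d)" using A'(2) by (intro sum_mono less_imp_le)
  also have "\<dots> \<le> e / 2" using d(2) by simp
  also have "measure \<mu>s ((\<Union>i. A i) - (\<Union>i<n. A i)) = measure \<mu>s (\<Union>i. A i) - measure \<mu>s (\<Union>i<n. A i)"
    using Am by (intro mus.finite_measure_Diff) auto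
  finally have "measure \<mu>s (((\<Union>i. A i) - (\<Union>i<n. A' i)) \<union> ((\<Union>i<n. A' i) - (\<Union>i. A i))) < e" using n by linarith
  then show ?case using s by blast
qed

definition bounded_local :: "(nat lgraph set \<Rightarrow> complex) set" where
  "bounded_local = {f \<in> borel_measurable LM. (\<exists>C. \<forall>x. cmod (f x) \<le> C) \<and> (\<exists>r. local_on r f)}"

lemma bounded_local_L2: "f \<in> bounded_local \<Longrightarrow> f \<in> L2_space \<mu>s"
  unfolding bounded_local_def using mus.L2_bounded by (auto simp: borel_measurable_mu_star)

lemma bounded_local_lincomb:
  assumes "f \<in> bounded_local" "g \<in> bounded_local"
  shows "(\<lambda>x. a * f x + b * g x) \<in> bounded_local"
proof -
  obtain C1 r1 where f: "f \<in> borel_measurable LM" "\<And>x. cmod (f x) \<le> C1" "local_on r1 f"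
    using assms(1) by (auto simp: bounded_local_def)
  obtain C2 r2 where g: "g \<in> borel_measurable LM" "\<And>x. cmod (g x) \<le> C2" "local_on r2 g"
    using assms(2) by (auto simp: bounded_local_def)
  note [measurable] = f(1) g(1)
  have "(\<lambda>x. a * f x + b * g x) \<in> borel_measurable LM" by measurable
  moreover have "cmod (a * f x + b * g x) \<le> cmod a * C1 + cmod b * C2" for x
    using f(2)[of x] g(2)[of x]
    by (intro norm_triangle_le add_mono) (auto simp: norm_mult intro!: mult_left_mono)
  moreover have "local_on (max r1 r2) (\<lambda>x. a * f x + b * g x)"
    by (rule local_on_comp2[where h = "\<lambda>u v. a * u + b * v", OF local_on_mono[OF f(3)] local_on_mono[OF g(3)]]) auto
  ultimately show ?thesis unfolding bounded_local_def by blast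
qed

lemma bounded_local_indicator: "local_set r A \<Longrightarrow> (\<lambda>x. indicator A x) \<in> bounded_local"
proof -
  assume A: "local_set r A"
  have "(\<lambda>x. indicator A x :: complex) = (\<lambda>x. if x \<in> A then 1 else 0)" by (auto simp: indicator_def)
  then have "local_on r (\<lambda>x. indicator A x :: complex)"
    using A local_on_comp[of r "\<lambda>x. x \<in> A" "\<lambda>b. if b then 1 else 0"] by (simp add: local_set_def)
  moreover have "cmod (indicator A x) \<le> 1" for x :: "nat lgraph set" by (simp add: indicator_def)
  ultimately show ?thesis using A unfolding bounded_local_def local_set_def by auto
qed

definition approximable :: "(nat lgraph set \<Rightarrow> complex) \<Rightarrow> bool" where
  "approximable f \<longleftrightarrow> f \<in> L2_space \<mu>s \<and> (\<forall>e>0. \<exists>g\<in>bounded_local. L2_norm \<mu>s (\<lambda>x. f x - g x) \<le> e)"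

lemma approximable_indicator:
  assumes A: "A \<in> sets LM"
  shows "approximable (\<lambda>x. indicator A x)"
  unfolding approximable_def
proof (intro conjI allI impI)
  have "(indicator A :: _ \<Rightarrow> complex) \<in> borel_measurable \<mu>s"
    unfolding borel_measurable_mu_star by (rule borel_measurable_indicator[OF A])
  then show "(\<lambda>x. indicator A x) \<in> L2_space \<mu>s"
    by (rule mus.L2_bounded[of _ 1]) (simp add: indicator_def)
  fix e :: real assume e: "e > 0"
  then have "0 < e\<^sup>2" by simp
  from local_approx_set[OF A this] obtain r A' where A': "local_set r A'" "measure \<mu>s ((A - A') \<union> (A' - A)) < e\<^sup>2"
    by (elim exE conjE)
  have "A' \<in> sets LM" using A'(1) by (simp add: local_set_def)
  then have m: "(A - A') \<union> (A' - A) \<in> sets \<mu>s" unfolding sets_mu_star using A by (intro sets.Un sets.Diff)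
  have pt: "(cmod (indicator A x - indicator A' x))\<^sup>2 = indicator ((A - A') \<union> (A' - A)) x" for x
    by (simp add: indicator_def)
  have "(L2_norm \<mu>s (\<lambda>x. indicator A x - indicator A' x))\<^sup>2 = (\<integral>x. indicator ((A - A') \<union> (A' - A)) x \<partial>\<mu>s)"
    unfolding L2_norm_sq pt ..
  also have "\<dots> = measure \<mu>s ((A - A') \<union> (A' - A))"
    using Bochner_Integration.integral_indicator[of \<mu>s "(A - A') \<union> (A' - A)"] sets.Int_space_eq2[OF m] by simp
  also have "\<dots> \<le> e\<^sup>2" using A'(2) by simp
  finally have "L2_norm \<mu>s (\<lambda>x. indicator A x - indicator A' x) \<le> e"
    by (rule power2_le_imp_le) (use e in simp)
  then show "\<exists>g\<in>bounded_local. L2_norm \<mu>s (\<lambda>x. indicator A x - g x) \<le> e"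
    by (rule bexI[OF _ bounded_local_indicator[OF A'(1)]])
qed

lemma approximable_lincomb:
  assumes f: "approximable f" and g: "approximable g"
  shows "approximable (\<lambda>x. a * f x + b * g x)"
  unfolding approximable_def
proof (intro conjI allI impI)
  have fL: "f \<in> L2_space \<mu>s" and gL: "g \<in> L2_space \<mu>s" using f g by (auto simp: approximable_def)
  show "(\<lambda>x. a * f x + b * g x) \<in> L2_space \<mu>s" by (rule L2_lincomb[OF fL gL])
  fix e :: real assume e: "e > 0"
  define d where "d = e / (cmod a + cmod b + 1)"
  have pos: "cmod a + cmod b + 1 > 0" by (simp add: add_nonneg_pos)
  have d: "d > 0" "(cmod a + cmod b) * d \<le> e"
    using e pos by (auto simp: d_def pos_divide_le_eq intro!: mult_left_mono)
  obtain f' where f': "f' \<in> bounded_local" "L2_norm \<mu>s (\<lambda>x. f x - f' x) \<le> d" using f d(1) by (auto simp: approximable_def)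
  obtain g' where g': "g' \<in> bounded_local" "L2_norm \<mu>s (\<lambda>x. g x - g' x) \<le> d" using g d(1) by (auto simp: approximable_def)
  have "L2_norm \<mu>s (\<lambda>x. a * (f x - f' x) + b * (g x - g' x))
      \<le> cmod a * L2_norm \<mu>s (\<lambda>x. f x - f' x) + cmod b * L2_norm \<mu>s (\<lambda>x. g x - g' x)"
    by (rule L2_norm_triangle_lincomb[OF L2_diff[OF fL bounded_local_L2[OF f'(1)]] L2_diff[OF gL bounded_local_L2[OF g'(1)]]])
  also have "\<dots> \<le> cmod a * d + cmod b * d" using f'(2) g'(2) by (intro add_mono mult_left_mono) auto
  also have "\<dots> \<le> e" using d(2) by (simp add: distrib_right)
  finally have "L2_norm \<mu>s (\<lambda>x. a * f x + b * g x - (a * f' x + b * g' x)) \<le> e" by (simp add: algebra_simps)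
  then show "\<exists>h\<in>bounded_local. L2_norm \<mu>s (\<lambda>x. a * f x + b * g x - h x) \<le> e"
    by (rule bexI[OF _ bounded_local_lincomb[OF f'(1) g'(1)]])
qed

lemma approximable_cong:
  assumes "approximable f" "\<And>x. x \<in> space \<mu>s \<Longrightarrow> f x = g x"
  shows "approximable g"
proof -
  have "g \<in> L2_space \<mu>s"
    using assms unfolding approximable_def L2_space_def
    by (auto cong: measurable_cong Bochner_Integration.integrable_cong)
  moreover have "L2_norm \<mu>s (\<lambda>x. g x - h x) = L2_norm \<mu>s (\<lambda>x. f x - h x)" for h
    unfolding L2_norm_def using assms(2) by (intro arg_cong[where f = sqrt] Bochner_Integration.integral_cong) auto
  ultimately show ?thesis using assms(1) by (simp add: approximable_def)
qed

lemma approximable_simple: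
  assumes s: "simple_function \<mu>s (s :: nat lgraph set \<Rightarrow> complex)"
  shows "approximable s"
proof -
  have fin: "finite (s ` space \<mu>s)" using s by (rule simple_functionD(1))
  have "approximable (\<lambda>x. \<Sum>y\<in>Y. y * indicator (s -` {y} \<inter> space \<mu>s) x)" if "finite Y" for Y
    using that
  proof (induction Y rule: finite_induct)
    case empty
    show ?case using approximable_indicator[of "{}"] by simp
  next
    case (insert y Y)
    have "approximable (\<lambda>x. indicator (s -` {y} \<inter> space \<mu>s) x)"
      using simple_functionD(2)[OF s, of "{y}"] by (intro approximable_indicator) (simp add: sets_mu_star)
    from approximable_lincomb[OF this insert.IH, of y 1] show ?case
      by (simp only: sum.insert[OF insert.hyps] mult_1)
  qed
  from this[OF fin] show ?thesis
  proof (rule approximable_cong)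
    fix x assume x: "x \<in> space \<mu>s"
    have "(\<Sum>y\<in>s ` space \<mu>s. y * indicator (s -` {y} \<inter> space \<mu>s) x) = (\<Sum>y\<in>s ` space \<mu>s. if y = s x then y else 0)"
      using x by (intro sum.cong) (auto simp: indicator_def)
    also have "\<dots> = s x" using fin x by simp
    finally show "(\<Sum>y\<in>s ` space \<mu>s. y * indicator (s -` {y} \<inter> space \<mu>s) x) = s x" .
  qed
qed

text \<open>Simple functions are combinations of indicators, and dense by dominated convergence.\<close>

lemma bounded_local_dense:
  assumes f: "f \<in> L2_space \<mu>s" and e: "e > 0"
  shows "\<exists>g\<in>bounded_local. L2_norm \<mu>s (\<lambda>x. f x - g x) \<le> e"
proof -
  note [measurable] = L2_measurable[OF f]
  obtain s where s: "\<And>i. simple_function \<mu>s (s i)" "\<And>x. x \<in> space \<mu>s \<Longrightarrow> (\<lambda>i. s i x) \<longlonglongrightarrow> f x"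
      "\<And>i x. x \<in> space \<mu>s \<Longrightarrow> dist (s i x) 0 \<le> 2 * dist (f x) 0"
    using borel_measurable_implies_sequence_metric[OF L2_measurable[OF f], of 0] by blast
  have [measurable]: "s i \<in> borel_measurable \<mu>s" for i by (rule borel_measurable_simple_function[OF s(1)])
  have "(\<lambda>i. \<integral>x. (cmod (f x - s i x))\<^sup>2 \<partial>\<mu>s) \<longlonglongrightarrow> (\<integral>x. 0 \<partial>\<mu>s)"
  proof (rule integral_dominated_convergence[where w = "\<lambda>x. 9 * (cmod (f x))\<^sup>2"])
    show "integrable \<mu>s (\<lambda>x. 9 * (cmod (f x))\<^sup>2)" using L2_integrable_sq[OF f] by simp
    show "AE x in \<mu>s. (\<lambda>i. (cmod (f x - s i x))\<^sup>2) \<longlonglongrightarrow> 0"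
    proof (rule AE_I2)
      fix x assume "x \<in> space \<mu>s"
      then have "(\<lambda>i. (cmod (f x - s i x))\<^sup>2) \<longlonglongrightarrow> (cmod (f x - f x))\<^sup>2" by (intro tendsto_intros s(2))
      then show "(\<lambda>i. (cmod (f x - s i x))\<^sup>2) \<longlonglongrightarrow> 0" by simp
    qed
    show "AE x in \<mu>s. norm ((cmod (f x - s i x))\<^sup>2) \<le> 9 * (cmod (f x))\<^sup>2" for i
    proof (rule AE_I2)
      fix x assume x: "x \<in> space \<mu>s"
      have "cmod (f x - s i x) \<le> 3 * cmod (f x)"
        using norm_triangle_ineq4[of "f x" "s i x"] s(3)[OF x, of i] by simp
      then have "(cmod (f x - s i x))\<^sup>2 \<le> (3 * cmod (f x))\<^sup>2" by (intro power_mono) auto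
      then show "norm ((cmod (f x - s i x))\<^sup>2) \<le> 9 * (cmod (f x))\<^sup>2" by (simp add: power_mult_distrib)
    qed
  qed measurable
  from tendsto_real_sqrt[OF this] have "(\<lambda>i. L2_norm \<mu>s (\<lambda>x. f x - s i x)) \<longlonglongrightarrow> 0" by (simp add: L2_norm_def)
  from order_tendstoD(2)[OF this half_gt_zero[OF e]]
  have "\<exists>i. L2_norm \<mu>s (\<lambda>x. f x - s i x) < e / 2" by (rule eventually_happens'[OF sequentially_bot])
  then obtain i where i: "L2_norm \<mu>s (\<lambda>x. f x - s i x) < e / 2" ..
  have ap: "approximable (s i)" by (rule approximable_simple[OF s(1)])
  then have "\<exists>g\<in>bounded_local. L2_norm \<mu>s (\<lambda>x. s i x - g x) \<le> e / 2"
    using half_gt_zero[OF e] unfolding approximable_def by blast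
  then obtain g where g: "g \<in> bounded_local" "L2_norm \<mu>s (\<lambda>x. s i x - g x) \<le> e / 2" ..
  have sL: "s i \<in> L2_space \<mu>s" using ap by (simp add: approximable_def)
  have "L2_norm \<mu>s (\<lambda>x. (f x - s i x) + (s i x - g x)) \<le> L2_norm \<mu>s (\<lambda>x. f x - s i x) + L2_norm \<mu>s (\<lambda>x. s i x - g x)"
    by (rule L2_norm_triangle[OF L2_diff[OF f sL] L2_diff[OF sL bounded_local_L2[OF g(1)]]])
  then have "L2_norm \<mu>s (\<lambda>x. f x - g x) \<le> e" using i g(2) by simp
  then show ?thesis using g(1) by blast
qed

end

section \<open>The Markov operator of a graph\<close>

text \<open>Tonelli's theorem for the double sum over the symmetric edge relation.\<close>

lemma graph_reversible:
  assumes G: "connected_graph G" and fin: "\<And>v. v \<in> verts G \<Longrightarrow> finite (edges G `` {v})"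
  shows "reversible_graph (count_space (verts G)) (edges G) 1"
proof
  let ?V = "verts G" and ?E = "edges G"
  note E = connected_graphD[OF G]
  show "finite (?E `` {x})" "?E `` {x} \<subseteq> space (count_space ?V)" if "x \<in> space (count_space ?V)" for x
    using that fin E(1) by auto
  show "(\<lambda>x. \<Sum>y\<in>?E `` {x}. f y) \<in> borel_measurable (count_space ?V)" for f :: "'a \<Rightarrow> ennreal" by simp
  fix f g :: "'a \<Rightarrow> ennreal"
  have expand: "(\<integral>\<^sup>+x. (\<Sum>y\<in>?E `` {x}. k x y) \<partial>count_space ?V)
      = (\<integral>\<^sup>+x. \<integral>\<^sup>+y. k x y * indicator ?E (x, y) \<partial>count_space UNIV \<partial>count_space UNIV)" for k :: "'a \<Rightarrow> 'a \<Rightarrow> ennreal"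
  proof -
    have "(\<integral>\<^sup>+x. (\<Sum>y\<in>?E `` {x}. k x y) \<partial>count_space ?V)
        = (\<integral>\<^sup>+x. (\<Sum>y\<in>?E `` {x}. k x y) * indicator ?V x \<partial>count_space UNIV)"
      by (subst nn_integral_count_space_indicator) auto
    also have "\<dots> = (\<integral>\<^sup>+x. \<integral>\<^sup>+y. k x y * indicator ?E (x, y) \<partial>count_space UNIV \<partial>count_space UNIV)"
    proof (rule nn_integral_cong)
      fix x
      show "(\<Sum>y\<in>?E `` {x}. k x y) * indicator ?V x = (\<integral>\<^sup>+y. k x y * indicator ?E (x, y) \<partial>count_space UNIV)"
      proof (cases "x \<in> ?V")
        case True
        have "(\<integral>\<^sup>+y. k x y * indicator ?E (x, y) \<partial>count_space UNIV) = (\<Sum>y\<in>?E `` {x}. k x y * indicator ?E (x, y))"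
          by (rule nn_integral_count_space'[OF fin[OF True]]) (auto simp: indicator_def)
        also have "\<dots> = (\<Sum>y\<in>?E `` {x}. k x y)" by (intro sum.cong) auto
        finally show ?thesis using True by simp
      next
        case False
        then have "(x, y) \<notin> ?E" for y using E(1) by blast
        then show ?thesis using False by simp
      qed
    qed
    finally show ?thesis .
  qed
  have "(\<integral>\<^sup>+x. (\<Sum>y\<in>?E `` {x}. f y) * g x \<partial>count_space ?V) = (\<integral>\<^sup>+x. (\<Sum>y\<in>?E `` {x}. f y * g x) \<partial>count_space ?V)"
    by (simp add: sum_distrib_right)
  also have "\<dots> = (\<integral>\<^sup>+x. \<integral>\<^sup>+y. f y * g x * indicator ?E (x, y) \<partial>count_space UNIV \<partial>count_space UNIV)"
    by (rule expand)
  also have "\<dots> = (\<integral>\<^sup>+y. \<integral>\<^sup>+x. f y * g x * indicator ?E (x, y) \<partial>count_space UNIV \<partial>count_space UNIV)"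
    using nn_integral_fst_count_space[of "\<lambda>(x, y). f y * g x * indicator ?E (x, y)"]
      nn_integral_snd_count_space[of "\<lambda>(x, y). f y * g x * indicator ?E (x, y)"] by simp
  also have "\<dots> = (\<integral>\<^sup>+y. \<integral>\<^sup>+x. f y * g x * indicator ?E (y, x) \<partial>count_space UNIV \<partial>count_space UNIV)"
    using E(2) by (intro nn_integral_cong) (auto simp: indicator_def dest: symD)
  also have "\<dots> = (\<integral>\<^sup>+y. (\<Sum>x\<in>?E `` {y}. f y * g x) \<partial>count_space ?V)" by (rule expand[symmetric])
  also have "\<dots> = (\<integral>\<^sup>+x. f x * (\<Sum>y\<in>?E `` {x}. g y) \<partial>count_space ?V)" by (simp add: sum_distrib_left)
  finally show "(\<integral>\<^sup>+x. (\<Sum>y\<in>?E `` {x}. f y) * g x \<partial>count_space ?V) = (\<integral>\<^sup>+x. f x * (\<Sum>y\<in>?E `` {x}. g y) \<partial>count_space ?V)" .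
qed simp

lemma graph_self_adjoint:
  assumes G: "connected_graph G" and fin: "\<And>v. v \<in> verts G \<Longrightarrow> finite (edges G `` {v})"
  shows "self_adjoint_contraction (degree_measure G) (L2_space (degree_measure G)) (markov (edges G))"
proof -
  interpret gr: reversible_graph "count_space (verts G)" "edges G" 1 by (rule graph_reversible[OF assms])
  have dm: "degree_measure G = gr.deg_measure"
    unfolding degree_measure_def point_measure_def gr.deg_measure_def by simp
  show ?thesis
    unfolding dm
  proof
    show "(\<lambda>x. a * f x + b * g x) \<in> L2_space gr.deg_measure"
      if "f \<in> L2_space gr.deg_measure" "g \<in> L2_space gr.deg_measure" for f g a b using that by (rule L2_lincomb)
    show "markov (edges G) f \<in> L2_space gr.deg_measure" if "f \<in> L2_space gr.deg_measure" for f
      by (rule gr.markov_L2(1)[OF that])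
    show "L2_norm gr.deg_measure (markov (edges G) f) \<le> L2_norm gr.deg_measure f" if "f \<in> L2_space gr.deg_measure" for f
      by (rule gr.markov_L2(2)[OF that])
    show "markov (edges G) (\<lambda>x. a * f x + b * g x) = (\<lambda>x. a * markov (edges G) f x + b * markov (edges G) g x)" for f g a b
      by (rule markov_lincomb)
    show "L2_inner gr.deg_measure (markov (edges G) f) g = L2_inner gr.deg_measure f (markov (edges G) g)"
      if "f \<in> L2_space gr.deg_measure" "g \<in> L2_space gr.deg_measure" for f g by (rule gr.markov_sym[OF that])
  qed auto
qed

lemma markov_cong: "(\<And>w. w \<in> E `` {v} \<Longrightarrow> g w = g' w) \<Longrightarrow> markov E g v = markov E g' v"
  unfolding markov_def by (intro arg_cong2[where f = "(*)"] sum.cong refl)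

text \<open>\<open>defect\<close> is quadratic in the Markov operator, so it sees two steps.\<close>

lemma defect_cong:
  assumes "\<And>w. w \<in> nball E 2 {v} \<Longrightarrow> g w = g' w"
  shows "defect z (markov E) g v = defect z (markov E) g' v"
proof -
  have 1: "nball E 1 {v} = {v} \<union> E `` {v}" using nball_Suc[of E 0 "{v}"] by (simp add: nball_0)
  have 2: "nball E 2 {v} = nball E 1 {v} \<union> E `` nball E 1 {v}"
    using nball_Suc[of E 1 "{v}"] by (simp add: numeral_2_eq_2)
  have "g v = g' v" using assms unfolding 2 1 by blast
  moreover have "markov E g v = markov E g' v" using assms unfolding 2 1 by (intro markov_cong) blast
  moreover have "markov E (markov E g) v = markov E (markov E g') v"
    using assms unfolding 2 1 by (intro markov_cong) blast
  ultimately show ?thesis unfolding defect_def by simp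
qed

lemma L2_inner_sum_right:
  assumes "finite I" "f \<in> L2_space M" "\<And>i. i \<in> I \<Longrightarrow> h i \<in> L2_space M"
  shows "L2_inner M f (\<lambda>x. \<Sum>i\<in>I. a i * h i x) = (\<Sum>i\<in>I. cnj (a i) * L2_inner M f (h i))"
  using assms(1,3)
proof (induction I rule: finite_induct)
  case empty
  then show ?case by (simp add: L2_inner_def)
next
  case (insert i I)
  have s: "(\<lambda>x. \<Sum>i\<in>I. a i * h i x) \<in> L2_space M" using insert by (intro L2_sum L2_scale) auto
  have "h i \<in> L2_space M" using insert.prems by simp
  from L2_inner_lincomb_right[OF this s assms(2), of "a i" 1] show ?case
    using insert by simp
qed

lemma L2_inner_sum_left:
  assumes "finite I" "f \<in> L2_space M" "\<And>i. i \<in> I \<Longrightarrow> h i \<in> L2_space M"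
  shows "L2_inner M (\<lambda>x. \<Sum>i\<in>I. a i * h i x) f = (\<Sum>i\<in>I. a i * L2_inner M (h i) f)"
proof -
  have "L2_inner M (\<lambda>x. \<Sum>i\<in>I. a i * h i x) f = cnj (\<Sum>i\<in>I. cnj (a i) * L2_inner M f (h i))"
    by (subst L2_inner_cnj) (simp only: L2_inner_sum_right[OF assms])
  also have "\<dots> = (\<Sum>i\<in>I. a i * cnj (L2_inner M f (h i)))" by simp
  finally show ?thesis by (subst (2) L2_inner_cnj)
qed

definition delta :: "'a \<Rightarrow> 'a \<Rightarrow> complex" where
  "delta w x = (if x = w then 1 else 0)"

lemma sum_delta: "finite W \<Longrightarrow> (\<Sum>w\<in>W. a w * delta w x) = (if x \<in> W then a x else 0)"
  by (simp add: delta_def if_distrib[of "(*) _"] cong: if_cong)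

context unimodular_quasi_transitive
begin

abbreviation "dm \<equiv> degree_measure H"

sublocale Gr: self_adjoint_contraction dm "L2_space dm" "markov E"
  by (rule graph_self_adjoint[OF conn nbrs(1)])

sublocale Rn: self_adjoint_contraction \<mu>s R "markov B"
  by (rule random_self_adjoint)

abbreviation "Kg z \<equiv> defect z (markov E)"
abbreviation "Kb z \<equiv> defect z (markov B)"

lemma nball_V: "v \<in> V \<Longrightarrow> finite (nball E r {v}) \<and> nball E r {v} \<subseteq> V"
  using nball_finite[of "{v}" V E r] E_sub nbrs(1) by simp

lemma pow_lincomb: "(Kg z ^^ n) (\<lambda>x. a * f x + b * g x) = (\<lambda>x. a * (Kg z ^^ n) f x + b * (Kg z ^^ n) g x)"
  by (induction n) (simp_all add: Gr.defect_lincomb)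

lemma pow_sum:
  assumes "finite W"
  shows "(Kg z ^^ n) (\<lambda>x. \<Sum>w\<in>W. a w * f w x) = (\<lambda>x. \<Sum>w\<in>W. a w * (Kg z ^^ n) (f w) x)"
  using assms
proof (induction W rule: finite_induct)
  case empty
  show ?case using pow_lincomb[where z = z and n = n and a = 0 and b = 0 and f = "\<lambda>x. 0" and g = "\<lambda>x. 0"] by simp
next
  case (insert w W)
  show ?case
    using pow_lincomb[where z = z and n = n and a = "a w" and b = 1 and f = "f w" and g = "\<lambda>x. \<Sum>w\<in>W. a w * f w x"] insert by simp
qed

lemma pow_local:
  assumes "v \<in> V"
  shows "\<exists>W. finite W \<and> W \<subseteq> V \<and> (\<forall>g g'. (\<forall>w\<in>W. g w = g' w) \<longrightarrow> (Kg z ^^ n) g v = (Kg z ^^ n) g' v)"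
  using assms
proof (induction n arbitrary: v)
  case 0
  then show ?case by (intro exI[of _ "{v}"]) auto
next
  case (Suc n)
  let ?S = "nball E 2 {v}"
  have S: "finite ?S" "?S \<subseteq> V" using nball_V[OF Suc.prems] by blast+
  have "\<forall>w\<in>?S. \<exists>W. finite W \<and> W \<subseteq> V \<and> (\<forall>g g'. (\<forall>w\<in>W. g w = g' w) \<longrightarrow> (Kg z ^^ n) g w = (Kg z ^^ n) g' w)"
    using Suc.IH S(2) by blast
  from bchoice[OF this] obtain W where
    W: "\<forall>w\<in>?S. finite (W w) \<and> W w \<subseteq> V \<and> (\<forall>g g'. (\<forall>x\<in>W w. g x = g' x) \<longrightarrow> (Kg z ^^ n) g w = (Kg z ^^ n) g' w)" ..
  have "(Kg z ^^ Suc n) g v = (Kg z ^^ Suc n) g' v" if eq: "\<forall>w\<in>(\<Union>w\<in>?S. W w). g w = g' w" for g g'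
  proof -
    have "(Kg z ^^ n) g w = (Kg z ^^ n) g' w" if w: "w \<in> ?S" for w
    proof -
      have "\<forall>x\<in>W w. g x = g' x" using eq w by blast
      then show ?thesis using W w by blast
    qed
    then show ?thesis by (simp only: funpow.simps o_apply) (rule defect_cong)
  qed
  then show ?case using W S(1) by (intro exI[of _ "\<Union>w\<in>?S. W w"]) blast
qed

text \<open>The index set may be enlarged at will, so that prescribed vertices can be included in it.\<close>

lemma kernel_expansion:
  assumes v: "v \<in> V"
  shows "\<exists>W. finite W \<and> W \<subseteq> V \<and> (\<forall>W'. finite W' \<and> W \<subseteq> W' \<longrightarrow>
    (\<forall>g. (Kg z ^^ n) g v = (\<Sum>w\<in>W'. g w * (Kg z ^^ n) (delta w) v)))"
proof -
  obtain W where W: "finite W" "W \<subseteq> V" "\<forall>g g'. (\<forall>w\<in>W. g w = g' w) \<longrightarrow> (Kg z ^^ n) g v = (Kg z ^^ n) g' v"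
    using pow_local[OF v, where z = z and n = n] by (elim exE conjE)
  have "(Kg z ^^ n) g v = (\<Sum>w\<in>W'. g w * (Kg z ^^ n) (delta w) v)" if W': "finite W'" "W \<subseteq> W'" for W' g
  proof -
    have "\<forall>w\<in>W. g w = (\<Sum>u\<in>W'. g u * delta u w)"
    proof
      fix w assume "w \<in> W"
      then have "w \<in> W'" using W'(2) by (rule subsetD[rotated])
      then show "g w = (\<Sum>u\<in>W'. g u * delta u w)" unfolding sum_delta[OF W'(1)] by (simp only: if_True)
    qed
    from W(3)[THEN spec, THEN spec, THEN mp, OF this]
    have "(Kg z ^^ n) g v = (Kg z ^^ n) (\<lambda>x. \<Sum>u\<in>W'. g u * delta u x) v" .
    then show ?thesis unfolding pow_sum[OF W'(1)] .
  qed
  then show ?thesis using W(1,2) by blast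
qed

lemma emeasure_dm: "v \<in> V \<Longrightarrow> emeasure dm {v} = ennreal (real (vertex_degree E v))"
  unfolding degree_measure_def by (subst emeasure_point_measure_finite2) auto

lemma measurable_dm: "f \<in> borel_measurable dm"
  unfolding degree_measure_def by (simp add: measurable_def space_point_measure sets_point_measure)

lemma delta_sq: "(cmod (delta v x))\<^sup>2 = indicator {v} x"
  by (simp add: delta_def)

lemma singleton_dm: "v \<in> V \<Longrightarrow> {v} \<in> sets dm"
  by (simp add: degree_measure_def sets_point_measure)

lemma delta_L2:
  assumes v: "v \<in> V"
  shows "delta v \<in> L2_space dm" "(L2_norm dm (delta v))\<^sup>2 = real (vertex_degree E v)"
proof -
  have i: "integrable dm (indicator {v} :: nat \<Rightarrow> real)"
    by (rule integrable_real_indicator[OF singleton_dm[OF v]]) (simp add: emeasure_dm[OF v])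
  then show "delta v \<in> L2_space dm" by (intro L2_spaceI[OF measurable_dm]) (simp only: delta_sq)
  have "(L2_norm dm (delta v))\<^sup>2 = (\<integral>x. indicator {v} x \<partial>dm)" unfolding L2_norm_sq delta_sq ..
  also have "\<dots> = measure dm ({v} \<inter> space dm)" by simp
  also have "\<dots> = real (vertex_degree E v)"
    using emeasure_dm[OF v] v by (simp add: measure_def degree_measure_def space_point_measure)
  finally show "(L2_norm dm (delta v))\<^sup>2 = real (vertex_degree E v)" .
qed

lemma L2_inner_delta:
  assumes v: "v \<in> V"
  shows "L2_inner dm h (delta v) = of_nat (vertex_degree E v) * h v"
proof -
  have i: "integrable dm (indicator {v} :: nat \<Rightarrow> real)"
    by (rule integrable_real_indicator[OF singleton_dm[OF v]]) (simp add: emeasure_dm[OF v])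
  have "L2_inner dm h (delta v) = (\<integral>x. indicator {v} x *\<^sub>R h v \<partial>dm)"
    unfolding L2_inner_def by (intro Bochner_Integration.integral_cong) (auto simp: delta_def indicator_def)
  also have "\<dots> = (\<integral>x. indicator {v} x \<partial>dm) *\<^sub>R h v" by (rule integral_scaleR_left) (rule i)
  also have "(\<integral>x. indicator {v} x \<partial>dm) = real (vertex_degree E v)"
    using delta_L2(2)[OF v] unfolding L2_norm_sq delta_sq .
  finally show ?thesis by (simp add: scaleR_conv_of_real)
qed

text \<open>The degree measure gives every vertex mass at least \<open>1\<close>.\<close>

lemma pointwise_le_norm:
  assumes h: "h \<in> L2_space dm" and v: "v \<in> V"
  shows "cmod (h v) \<le> L2_norm dm h"
proof -
  let ?d = "real (vertex_degree E v)"
  have d: "1 \<le> ?d" using degree_pos[OF v] by simp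
  have n: "L2_norm dm (delta v) = sqrt ?d" using delta_L2(2)[OF v] L2_norm_nonneg real_sqrt_unique by metis
  have "sqrt ?d * (sqrt ?d * cmod (h v)) = ?d * cmod (h v)" by simp
  also have "\<dots> = cmod (L2_inner dm h (delta v))" unfolding L2_inner_delta[OF v] by (simp add: norm_mult)
  also have "\<dots> \<le> L2_norm dm h * sqrt ?d" using L2_Cauchy_Schwarz[OF h delta_L2(1)[OF v]] unfolding n .
  finally have "sqrt ?d * cmod (h v) \<le> L2_norm dm h"
    using d mult_left_le_imp_le[of "sqrt ?d" "sqrt ?d * cmod (h v)" "L2_norm dm h"] by (simp add: mult.commute)
  moreover have "1 * cmod (h v) \<le> sqrt ?d * cmod (h v)" using d by (intro mult_right_mono) auto
  ultimately show ?thesis by simp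
qed

section \<open>Exponential decay of the kernel\<close>

text \<open>The link between the two operators: on the graph and on the random subspace alike, the defect has norm
  at most \<open>q\<close> exactly when this holds.  The constants may depend on \<open>u\<close> and \<open>v\<close>.\<close>

definition kernel_decay :: "complex \<Rightarrow> real \<Rightarrow> bool" where
  "kernel_decay z q \<longleftrightarrow> (\<forall>u\<in>V. \<forall>v\<in>V. \<exists>C. \<forall>n. cmod ((Kg z ^^ n) (delta u) v) \<le> C * q ^ n)"

lemma kernel_decay_of_graph_bound:
  assumes q: "0 < q" and b: "\<forall>f\<in>L2_space dm. L2_norm dm (Kg z f) \<le> q * L2_norm dm f"
  shows "kernel_decay z q"
  unfolding kernel_decay_def
proof (intro ballI exI allI)
  fix u v n assume u: "u \<in> V" and v: "v \<in> V"
  have "cmod ((Kg z ^^ n) (delta u) v) \<le> L2_norm dm ((Kg z ^^ n) (delta u))"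
    by (rule pointwise_le_norm[OF Gr.defect_pow_in[OF delta_L2(1)[OF u]] v])
  also have "\<dots> \<le> q ^ n * L2_norm dm (delta u)"
    by (rule Gr.defect_pow_norm[OF delta_L2(1)[OF u]]) (use q b in auto)
  finally show "cmod ((Kg z ^^ n) (delta u) v) \<le> L2_norm dm (delta u) * q ^ n" by (simp add: mult.commute)
qed

lemma finite_support_dense:
  assumes f: "f \<in> L2_space dm" and e: "e > 0"
  shows "\<exists>F. finite F \<and> F \<subseteq> V \<and> L2_norm dm (\<lambda>x. f x - (\<Sum>v\<in>F. f v * delta v x)) \<le> e"
proof -
  let ?g = "\<lambda>n x. \<Sum>v\<in>V \<inter> {..<n}. f v * delta v x"
  have g: "?g n x = (if x \<in> V \<and> x < n then f x else 0)" for n x by (simp add: sum_delta)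
  have "(\<lambda>n. \<integral>x. (cmod (f x - ?g n x))\<^sup>2 \<partial>dm) \<longlonglongrightarrow> (\<integral>x. 0 \<partial>dm)"
  proof (rule integral_dominated_convergence[where w = "\<lambda>x. (cmod (f x))\<^sup>2"])
    show "integrable dm (\<lambda>x. (cmod (f x))\<^sup>2)" by (rule L2_integrable_sq[OF f])
    show "(\<lambda>x. 0) \<in> borel_measurable dm" by simp
    show "(\<lambda>x. (cmod (f x - ?g n x))\<^sup>2) \<in> borel_measurable dm" for n
      unfolding degree_measure_def by (simp add: measurable_def space_point_measure sets_point_measure)
    show "AE x in dm. (\<lambda>n. (cmod (f x - ?g n x))\<^sup>2) \<longlonglongrightarrow> 0"
    proof (rule AE_I2)
      fix x assume "x \<in> space dm"
      then have x: "x \<in> V" by (simp add: degree_measure_def space_point_measure)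
      have "\<forall>\<^sub>F n in sequentially. (cmod (f x - ?g n x))\<^sup>2 = 0"
        using eventually_gt_at_top[of x] by eventually_elim (simp add: g x)
      then show "(\<lambda>n. (cmod (f x - ?g n x))\<^sup>2) \<longlonglongrightarrow> 0" by (rule tendsto_eventually)
    qed
    show "AE x in dm. norm ((cmod (f x - ?g n x))\<^sup>2) \<le> (cmod (f x))\<^sup>2" for n
      by (rule AE_I2) (simp add: g)
  qed
  from tendsto_real_sqrt[OF this] have "(\<lambda>n. L2_norm dm (\<lambda>x. f x - ?g n x)) \<longlonglongrightarrow> 0" by (simp add: L2_norm_def)
  from order_tendstoD(2)[OF this e]
  have "\<exists>n. L2_norm dm (\<lambda>x. f x - ?g n x) < e" by (rule eventually_happens'[OF sequentially_bot])
  then obtain n where "L2_norm dm (\<lambda>x. f x - ?g n x) < e" ..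
  then show ?thesis by (intro exI[of _ "V \<inter> {..<n}"]) simp
qed

text \<open>For a finitely supported function the inner products of the growth condition are finite combinations
  of kernel entries.\<close>

lemma graph_bound_of_kernel_decay:
  assumes q: "0 < q" and k: "kernel_decay z q" and f: "f \<in> L2_space dm"
  shows "L2_norm dm (Kg z f) \<le> q * L2_norm dm f"
proof (rule Gr.defect_bound_of_dense[OF _ q _ _ f])
  define Y where "Y = {g. \<exists>F a. finite F \<and> F \<subseteq> V \<and> g = (\<lambda>x. \<Sum>v\<in>F. a v * delta v x)}"
  have YL: "(\<lambda>x. \<Sum>v\<in>F. a v * delta v x) \<in> L2_space dm" if "finite F" "F \<subseteq> V" for F a
    using that by (intro L2_sum L2_scale delta_L2(1)) auto
  then show "Y \<subseteq> L2_space dm" unfolding Y_def by blast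
  show "\<exists>g\<in>Y. L2_norm dm (\<lambda>x. f x - g x) \<le> e" if fe: "f \<in> L2_space dm" "e > 0" for f e
  proof -
    obtain F where F: "finite F" "F \<subseteq> V" "L2_norm dm (\<lambda>x. f x - (\<Sum>v\<in>F. f v * delta v x)) \<le> e"
      using finite_support_dense[OF fe] by (elim exE conjE)
    have "(\<lambda>x. \<Sum>v\<in>F. f v * delta v x) \<in> Y" unfolding Y_def using F(1,2) by blast
    with F(3) show ?thesis by (rule bexI)
  qed
  fix g assume "g \<in> Y"
  then obtain F a where F: "finite F" "F \<subseteq> V" and g: "g = (\<lambda>x. \<Sum>v\<in>F. a v * delta v x)" unfolding Y_def by blast
  have gL: "g \<in> L2_space dm" unfolding g by (rule YL[OF F])
  have "\<forall>u v. \<exists>C. u \<in> F \<longrightarrow> v \<in> F \<longrightarrow> (\<forall>n. cmod ((Kg z ^^ n) (delta u) v) \<le> C * q ^ n)"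
    using k F(2) unfolding kernel_decay_def by blast
  then obtain C where C: "\<And>u v n. u \<in> F \<Longrightarrow> v \<in> F \<Longrightarrow> cmod ((Kg z ^^ n) (delta u) v) \<le> C u v * q ^ n" by metis
  let ?C = "\<Sum>v\<in>F. cmod (a v) * (real (vertex_degree E v) * (\<Sum>u\<in>F. cmod (a u) * C u v))"
  have "cmod (L2_inner dm ((Kg z ^^ n) g) g) \<le> ?C * q ^ n" for n
  proof -
    have KL: "(Kg z ^^ n) g \<in> L2_space dm" by (rule Gr.defect_pow_in[OF gL])
    have Kv: "(Kg z ^^ n) g v = (\<Sum>u\<in>F. a u * (Kg z ^^ n) (delta u) v)" for v
      unfolding g pow_sum[OF F(1)] ..
    have "L2_inner dm ((Kg z ^^ n) g) g = (\<Sum>v\<in>F. cnj (a v) * L2_inner dm ((Kg z ^^ n) g) (delta v))"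
      by (subst (2) g, rule L2_inner_sum_right[OF F(1) KL]) (use delta_L2(1) F(2) in blast)
    also have "\<dots> = (\<Sum>v\<in>F. cnj (a v) * (of_nat (vertex_degree E v) * (\<Sum>u\<in>F. a u * (Kg z ^^ n) (delta u) v)))"
      using F(2) by (intro sum.cong refl) (simp add: L2_inner_delta Kv subset_iff)
    also have "cmod \<dots> \<le> (\<Sum>v\<in>F. cmod (a v) * (real (vertex_degree E v) * (\<Sum>u\<in>F. cmod (a u) * (C u v * q ^ n))))"
    proof (rule sum_norm_le)
      fix v assume v: "v \<in> F"
      have "cmod (\<Sum>u\<in>F. a u * (Kg z ^^ n) (delta u) v) \<le> (\<Sum>u\<in>F. cmod (a u) * (C u v * q ^ n))"
        by (rule sum_norm_le) (simp add: norm_mult mult_left_mono C v)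
      then show "cmod (cnj (a v) * (of_nat (vertex_degree E v) * (\<Sum>u\<in>F. a u * (Kg z ^^ n) (delta u) v)))
          \<le> cmod (a v) * (real (vertex_degree E v) * (\<Sum>u\<in>F. cmod (a u) * (C u v * q ^ n)))"
        unfolding norm_mult complex_mod_cnj norm_of_nat by (intro mult_left_mono) auto
    qed
    also have "\<dots> = ?C * q ^ n" by (simp add: sum_distrib_left sum_distrib_right mult.assoc)
    finally show ?thesis .
  qed
  then show "\<exists>C. \<forall>n. cmod (L2_inner dm ((Kg z ^^ n) g) g) \<le> C * q ^ n" by blast
qed

text \<open>For an injective labelling \<open>L \<xi>\<close> identifies the graph with a component of the graphing.\<close>

lemma pow_L:
  assumes xi: "\<xi> \<in> space P" "inj_on \<xi> V" and v: "v \<in> V"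
  shows "(Kb z ^^ n) f (L \<xi> v) = (Kg z ^^ n) (\<lambda>w. f (L \<xi> w)) v"
  using v
proof (induction n arbitrary: v)
  case (Suc n)
  let ?h = "(Kb z ^^ n) f"
  have V1: "w \<in> V" if "w \<in> E `` {v}" for w using that nbrs(3) by blast
  have "Kb z ?h (L \<xi> v) = Kg z (\<lambda>w. ?h (L \<xi> w)) v"
  proof -
    have 1: "markov B ?h (L \<xi> v) = markov E (\<lambda>w. ?h (L \<xi> w)) v" by (rule markov_L[OF Suc.prems xi])
    have "markov B (markov B ?h) (L \<xi> v) = markov E (\<lambda>w. markov B ?h (L \<xi> w)) v" by (rule markov_L[OF Suc.prems xi])
    also have "\<dots> = markov E (markov E (\<lambda>w. ?h (L \<xi> w))) v"
      by (rule markov_cong) (rule markov_L[OF V1 xi])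
    finally show ?thesis unfolding defect_def 1 by simp
  qed
  also have "\<dots> = Kg z ((Kg z ^^ n) (\<lambda>w. f (L \<xi> w))) v"
    by (rule defect_cong) (use Suc.IH nball_V[OF Suc.prems, of 2] in blast)
  finally show ?case by simp
qed simp

text \<open>Pairing the operator of the graphing with \<open>g\<close> over a fixed root only sees the vertices \<open>w\<close>
  over which \<open>f\<close> correlates with \<open>g\<close>.\<close>

lemma fibre_inner_expansion:
  assumes v: "v \<in> V" and f: "f \<in> R" and g: "g \<in> L2_space P" and N: "finite N" "N \<subseteq> V"
    and zero: "\<And>w. w \<in> V \<Longrightarrow> w \<notin> N \<Longrightarrow> L2_inner P (\<lambda>\<xi>. f (L \<xi> w)) g = 0"
  shows "L2_inner P (\<lambda>\<xi>. (Kb z ^^ n) f (L \<xi> v)) g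
    = (\<Sum>w\<in>N. (Kg z ^^ n) (delta w) v * L2_inner P (\<lambda>\<xi>. f (L \<xi> w)) g)"
proof -
  let ?h = "(Kb z ^^ n) f" and ?k = "\<lambda>w. (Kg z ^^ n) (delta w) v"
  have hR: "?h \<in> R" by (rule Rn.defect_pow_in[OF f])
  have hL: "?h \<in> L2_space \<mu>s" by (rule subsetD[OF R_sub hR])
  have fL: "f \<in> L2_space \<mu>s" by (rule subsetD[OF R_sub f])
  have hv: "(\<lambda>\<xi>. ?h (L \<xi> v)) \<in> L2_space P" by (rule L2_fibre[OF hL v])
  obtain W where W: "finite W" "W \<subseteq> V" "\<forall>W'. finite W' \<and> W \<subseteq> W' \<longrightarrow>
      (\<forall>g. (Kg z ^^ n) g v = (\<Sum>w\<in>W'. g w * (Kg z ^^ n) (delta w) v))"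
    using kernel_expansion[OF v, where z = z and n = n] by (elim exE conjE)
  let ?W = "N \<union> W"
  have W': "finite ?W" "?W \<subseteq> V" "N \<subseteq> ?W" using W N by auto
  have exp: "(Kg z ^^ n) g v = (\<Sum>w\<in>?W. g w * ?k w)" for g using W(3) W'(1) by blast
  have fw: "(\<lambda>\<xi>. f (L \<xi> w)) \<in> L2_space P" if "w \<in> ?W" for w by (rule L2_fibre[OF fL subsetD[OF W'(2) that]])
  have sL: "(\<lambda>\<xi>. \<Sum>w\<in>?W. ?k w * f (L \<xi> w)) \<in> L2_space P" by (rule L2_sum[OF W'(1) L2_scale[OF fw]])
  have "L2_inner P (\<lambda>\<xi>. ?h (L \<xi> v)) g = L2_inner P (\<lambda>\<xi>. \<Sum>w\<in>?W. ?k w * f (L \<xi> w)) g"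
    unfolding L2_inner_def
  proof (rule integral_cong_AE)
    show "(\<lambda>\<xi>. ?h (L \<xi> v) * cnj (g \<xi>)) \<in> borel_measurable P"
      by (rule borel_measurable_integrable[OF L2_inner_integrable[OF hv g]])
    show "(\<lambda>\<xi>. (\<Sum>w\<in>?W. ?k w * f (L \<xi> w)) * cnj (g \<xi>)) \<in> borel_measurable P"
      by (rule borel_measurable_integrable[OF L2_inner_integrable[OF sL g]])
    show "AE \<xi> in P. ?h (L \<xi> v) * cnj (g \<xi>) = (\<Sum>w\<in>?W. ?k w * f (L \<xi> w)) * cnj (g \<xi>)"
      using AE_inj
    proof eventually_elim
      case (elim \<xi>)
      have "?h (L \<xi> v) = (\<Sum>w\<in>?W. f (L \<xi> w) * ?k w)"
        unfolding pow_L[OF conjunct1[OF elim] conjunct2[OF elim] v] by (rule exp)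
      also have "\<dots> = (\<Sum>w\<in>?W. ?k w * f (L \<xi> w))" by (rule sum.cong[OF refl]) (rule mult.commute)
      finally show ?case by (rule arg_cong)
    qed
  qed
  also have "\<dots> = (\<Sum>w\<in>?W. ?k w * L2_inner P (\<lambda>\<xi>. f (L \<xi> w)) g)"
    by (rule L2_inner_sum_left[OF W'(1) g fw])
  also have "\<dots> = (\<Sum>w\<in>N. ?k w * L2_inner P (\<lambda>\<xi>. f (L \<xi> w)) g)"
  proof (rule sum.mono_neutral_right[OF W'(1,3)], rule ballI)
    fix w assume "w \<in> ?W - N"
    then have "w \<in> V" "w \<notin> N" using W'(2) by auto
    from zero[OF this] show "?k w * L2_inner P (\<lambda>\<xi>. f (L \<xi> w)) g = 0" by simp
  qed
  finally show ?thesis .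
qed

subsection \<open>The centred label of the root\<close>

text \<open>The label of the root, centred at the mean \<open>1 / 2\<close> of the uniform distribution.  Outside of the space the root
  label is arbitrary; the value \<open>0\<close> makes the function bounded.\<close>

definition root_fun :: "nat lgraph set \<Rightarrow> complex" where
  "root_fun x = of_real (if x \<in> space LM then root_label x - 1 / 2 else 0)"

lemma root_fun_L: "v \<in> V \<Longrightarrow> \<xi> \<in> space P \<Longrightarrow> root_fun (L \<xi> v) = of_real (\<xi> v - 1 / 2)"
  unfolding root_fun_def using L_in_space[of v \<xi>] root_label_lclass[OF labelled_in[of v \<xi>]] by (simp add: L_def)

lemma label_measurable_uniform: "v \<in> V \<Longrightarrow> (\<lambda>\<xi>. \<xi> v) \<in> measurable P uniform01"
  unfolding label_measure_def by (rule measurable_component_singleton)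

lemma id_uniform01: "(\<lambda>x. x) \<in> borel_measurable uniform01"
  by (rule measurable_restrict_space1) simp

lemma integral_label:
  fixes h :: "real \<Rightarrow> real"
  assumes v: "v \<in> V" and h: "h \<in> borel_measurable borel"
  shows "(\<integral>\<xi>. h (\<xi> v) \<partial>P) = (\<integral>x. h x * indicator {0..1} x \<partial>lborel)"
proof -
  have hm: "h \<in> borel_measurable uniform01" using measurable_compose[OF id_uniform01 h] .
  have "(\<integral>\<xi>. h (\<xi> v) \<partial>P) = (\<integral>x. h x \<partial>distr P uniform01 (\<lambda>\<xi>. \<xi> v))"
    by (rule integral_distr[OF label_measurable_uniform[OF v] hm, symmetric])
  also have "\<dots> = (\<integral>x. h x \<partial>uniform01)" unfolding distr_label_component[OF v] ..
  also have "\<dots> = (\<integral>x. h x * indicator {0..1} x \<partial>lborel)"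
    by (subst integral_restrict_space) (simp_all add: mult.commute)
  finally show ?thesis .
qed

lemma label_bounded:
  assumes "v \<in> V" "\<xi> \<in> space P"
  shows "\<bar>\<xi> v - 1 / 2\<bar> \<le> 1"
proof -
  have "\<xi> v \<in> {0..1}" using assms unfolding space_label_measure by (auto simp: PiE_iff)
  then show ?thesis by (simp add: abs_if)
qed

lemma label_measurable: "v \<in> V \<Longrightarrow> (\<lambda>\<xi>. \<xi> v) \<in> borel_measurable P"
  by (rule label_component_measurable)

lemma integrable_bounded_P: "f \<in> borel_measurable P \<Longrightarrow> (\<And>\<xi>. \<xi> \<in> space P \<Longrightarrow> \<bar>f \<xi>\<bar> \<le> C) \<Longrightarrow> integrable P (f :: _ \<Rightarrow> real)"
  by (rule P.integrable_const_bound[of _ C]) auto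

lemma label_mean: "v \<in> V \<Longrightarrow> (\<integral>\<xi>. \<xi> v - 1 / 2 \<partial>P) = 0"
proof -
  assume v: "v \<in> V"
  have "integrable P (\<lambda>\<xi>. \<xi> v)"
  proof (rule integrable_bounded_P[of _ 2])
    show "\<bar>\<xi> v\<bar> \<le> 2" if "\<xi> \<in> space P" for \<xi> using label_bounded[OF v that] by argo
  qed (rule label_measurable[OF v])
  then have "(\<integral>\<xi>. \<xi> v - 1 / 2 \<partial>P) = (\<integral>\<xi>. \<xi> v \<partial>P) - 1 / 2" by (simp add: P.prob_space)
  also have "(\<integral>\<xi>. \<xi> v \<partial>P) = (\<integral>x. x ^ 1 * indicator {0..1} x \<partial>lborel)" using integral_label[OF v, of "\<lambda>x. x"] by simp
  also have "\<dots> = 1 / 2" by (subst integral_power) auto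
  finally show ?thesis by simp
qed

lemma label_covariance:
  assumes u: "u \<in> V" and v: "v \<in> V"
  shows "(\<integral>\<xi>. (\<xi> u - 1 / 2) * (\<xi> v - 1 / 2) \<partial>P) = (if u = v then 1 / 12 else 0)"
proof (cases "u = v")
  case True
  have m: "(\<lambda>\<xi>. \<xi> v) \<in> borel_measurable P" by (rule label_measurable[OF v])
  have b: "\<bar>\<xi> v\<bar> \<le> 2" if "\<xi> \<in> space P" for \<xi> using label_bounded[OF v that] by argo
  have i1: "integrable P (\<lambda>\<xi>. \<xi> v)" by (rule integrable_bounded_P[of _ 2, OF m]) (rule b)
  have i2: "integrable P (\<lambda>\<xi>. (\<xi> v)\<^sup>2)"
  proof (rule integrable_bounded_P[of _ 4])
    show "\<bar>(\<xi> v)\<^sup>2\<bar> \<le> 4" if "\<xi> \<in> space P" for \<xi>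
      using power_mono[OF b[OF that], of 2] by simp
  qed (use m in measurable)
  have "(\<integral>\<xi>. (\<xi> v - 1 / 2) * (\<xi> v - 1 / 2) \<partial>P) = (\<integral>\<xi>. (\<xi> v)\<^sup>2 - \<xi> v + 1 / 4 \<partial>P)"
    by (intro Bochner_Integration.integral_cong) (auto simp: power2_eq_square algebra_simps)
  also have "\<dots> = (\<integral>\<xi>. (\<xi> v)\<^sup>2 \<partial>P) - (\<integral>\<xi>. \<xi> v \<partial>P) + 1 / 4" using i1 i2 by (simp add: P.prob_space)
  also have "(\<integral>\<xi>. \<xi> v \<partial>P) = (\<integral>x. x ^ 1 * indicator {0..1} x \<partial>lborel)" using integral_label[OF v, of "\<lambda>x. x"] by simp
  also have "\<dots> = 1 / 2" by (subst integral_power) auto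
  also have "(\<integral>\<xi>. (\<xi> v)\<^sup>2 \<partial>P) = (\<integral>x. x ^ 2 * indicator {0..1} x \<partial>lborel)" using integral_label[OF v, of "\<lambda>x. x\<^sup>2"] by simp
  also have "\<dots> = 1 / 3" by (subst integral_power) auto
  finally show ?thesis using True by simp
next
  case False
  have "P.indep_var (PiM {u} (\<lambda>_. uniform01)) (\<lambda>\<xi>. restrict (\<lambda>i. \<xi> i) {u})
      (PiM {v} (\<lambda>_. uniform01)) (\<lambda>\<xi>. restrict (\<lambda>i. \<xi> i) {v})"
    using u v False V_ne by (intro P.indep_var_restrict[OF indep_labels]) auto
  then have "P.indep_var borel ((\<lambda>f. f u - 1 / 2) \<circ> (\<lambda>\<xi>. restrict (\<lambda>i. \<xi> i) {u}))
      borel ((\<lambda>f. f v - 1 / 2) \<circ> (\<lambda>\<xi>. restrict (\<lambda>i. \<xi> i) {v}))"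
  proof (rule P.indep_var_compose)
    have c: "(\<lambda>f. f w) \<in> borel_measurable (PiM {w} (\<lambda>_. uniform01))" for w :: nat
      by (rule measurable_compose[OF _ id_uniform01, of "\<lambda>f. f w"]) (rule measurable_component_singleton, simp)
    note [measurable] = c
    show "(\<lambda>f. f u - 1 / 2) \<in> borel_measurable (PiM {u} (\<lambda>_. uniform01))"
      "(\<lambda>f. f v - 1 / 2) \<in> borel_measurable (PiM {v} (\<lambda>_. uniform01))" by measurable
  qed
  then have ind: "P.indep_var borel (\<lambda>\<xi>. \<xi> u - 1 / 2) borel (\<lambda>\<xi>. \<xi> v - 1 / 2)" by (simp add: comp_def)
  have int: "integrable P (\<lambda>\<xi>. \<xi> w - 1 / 2)" if w: "w \<in> V" for w
    by (rule integrable_bounded_P[of _ 1]) (use label_measurable[OF w] label_bounded[OF w] in auto)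
  show ?thesis using P.indep_var_lebesgue_integral[OF ind int[OF u] int[OF v]] label_mean[OF u] False by simp
qed

lemma root_fun_in_R: "root_fun \<in> R"
  unfolding R_iff
proof (intro conjI ballI)
  have m: "root_fun \<in> borel_measurable LM"
  proof -
    have "(\<lambda>x. complex_of_real (root_label x - 1 / 2)) \<in> borel_measurable LM"
      using root_label_measurable by measurable
    then show ?thesis by (subst measurable_cong[where g = "\<lambda>x. complex_of_real (root_label x - 1 / 2)"]) (auto simp: root_fun_def)
  qed
  show "root_fun \<in> L2_space \<mu>s"
  proof (rule mus.L2_bounded[of _ 1])
    show "root_fun \<in> borel_measurable \<mu>s" using m unfolding borel_measurable_mu_star .
    fix x
    show "cmod (root_fun x) \<le> 1"
    proof (cases "x \<in> space LM")
      case True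
      then obtain G \<xi> v where x: "x = lclass (G, \<xi>, v)" "(G, \<xi>, v) \<in> lgraphs D" unfolding space_labelled_space by auto
      have "\<xi> v \<in> {0..1}" using lgraphsD[OF x(2)] by blast
      then show ?thesis using True unfolding root_fun_def x(1) root_label_lclass[OF x(2)] by (simp add: abs_if del: of_real_diff)
    qed (simp add: root_fun_def)
  qed
  fix v assume v: "v \<in> V"
  have "(\<integral>\<xi>. root_fun (L \<xi> v) \<partial>P) = (\<integral>\<xi>. complex_of_real (\<xi> v - 1 / 2) \<partial>P)"
    by (intro Bochner_Integration.integral_cong refl root_fun_L[OF v])
  also have "\<dots> = 0" unfolding integral_complex_of_real label_mean[OF v] by simp
  finally show "(\<integral>\<xi>. root_fun (L \<xi> v) \<partial>P) = 0" .
qed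

text \<open>The centred labels are orthogonal, so the inner product of \<open>defect\<^sup>n root_fun\<close> over \<open>v\<close> with
  the centred label of \<open>u\<close> is the kernel at \<open>(u, v)\<close>, up to the variance \<open>1 / 12\<close>.\<close>

lemma kernel_decay_of_random_bound:
  assumes q: "0 < q" and b: "\<forall>f\<in>R. L2_norm \<mu>s (Kb z f) \<le> q * L2_norm \<mu>s f"
  shows "kernel_decay z q"
  unfolding kernel_decay_def
proof (intro ballI)
  fix u v assume u: "u \<in> V" and v: "v \<in> V"
  obtain a where a: "a > 0" "\<forall>f\<in>L2_space \<mu>s. (\<lambda>\<xi>. f (L \<xi> v)) \<in> L2_space P \<and>
      a * (L2_norm P (\<lambda>\<xi>. f (L \<xi> v)))\<^sup>2 \<le> (L2_norm \<mu>s f)\<^sup>2" using L2_fibre_bound[OF v] by (elim exE conjE)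
  define \<eta> where "\<eta> w \<xi> = complex_of_real (\<xi> w - 1 / 2)" for w :: nat and \<xi> :: "nat \<Rightarrow> real"
  have etaL: "\<eta> w \<in> L2_space P" if w: "w \<in> V" for w
  proof (rule P.L2_bounded[of _ 1])
    show "\<eta> w \<in> borel_measurable P" unfolding \<eta>_def using label_measurable[OF w] by measurable
    show "cmod (\<eta> w \<xi>) \<le> 1" if "\<xi> \<in> space P" for \<xi>
      unfolding \<eta>_def norm_of_real by (rule label_bounded[OF w that])
  qed
  have eta_inner: "(\<integral>\<xi>. \<eta> w \<xi> * cnj (\<eta> u \<xi>) \<partial>P) = (if w = u then 1 / 12 else 0)" if w: "w \<in> V" for w
  proof -
    have "(\<integral>\<xi>. \<eta> w \<xi> * cnj (\<eta> u \<xi>) \<partial>P) = (\<integral>\<xi>. complex_of_real ((\<xi> w - 1 / 2) * (\<xi> u - 1 / 2)) \<partial>P)"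
      unfolding \<eta>_def by simp
    also have "\<dots> = complex_of_real (if w = u then 1 / 12 else 0)"
      unfolding integral_complex_of_real label_covariance[OF w u] ..
    finally show ?thesis by simp
  qed
  have "cmod ((Kg z ^^ n) (delta u) v) \<le> (12 * (L2_norm \<mu>s root_fun / sqrt a * L2_norm P (\<eta> u))) * q ^ n" for n
  proof -
    let ?h = "(Kb z ^^ n) root_fun"
    have hR: "?h \<in> R" by (rule Rn.defect_pow_in[OF root_fun_in_R])
    have hL: "?h \<in> L2_space \<mu>s" using hR R_sub by blast
    have hv: "(\<lambda>\<xi>. ?h (L \<xi> v)) \<in> L2_space P" using a(2) hL by blast
    have inner: "L2_inner P (\<lambda>\<xi>. root_fun (L \<xi> w)) (\<eta> u) = (if w = u then 1 / 12 else 0)" if w: "w \<in> V" for w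
    proof -
      have "L2_inner P (\<lambda>\<xi>. root_fun (L \<xi> w)) (\<eta> u) = (\<integral>\<xi>. \<eta> w \<xi> * cnj (\<eta> u \<xi>) \<partial>P)"
        unfolding L2_inner_def
        by (rule Bochner_Integration.integral_cong[OF refl]) (simp only: root_fun_L[OF w] \<eta>_def)
      then show ?thesis using eta_inner[OF w] by (rule trans)
    qed
    have "L2_inner P (\<lambda>\<xi>. ?h (L \<xi> v)) (\<eta> u)
        = (\<Sum>w\<in>{u}. (Kg z ^^ n) (delta w) v * L2_inner P (\<lambda>\<xi>. root_fun (L \<xi> w)) (\<eta> u))"
      by (rule fibre_inner_expansion[OF v root_fun_in_R etaL[OF u]]) (use u inner in auto)
    also have "\<dots> = (Kg z ^^ n) (delta u) v * (1 / 12)" using inner[OF u] by simp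
    finally have "L2_inner P (\<lambda>\<xi>. ?h (L \<xi> v)) (\<eta> u) = (Kg z ^^ n) (delta u) v * (1 / 12)" .
    then have "(Kg z ^^ n) (delta u) v = 12 * L2_inner P (\<lambda>\<xi>. ?h (L \<xi> v)) (\<eta> u)" by (simp only:) simp
    then have "cmod ((Kg z ^^ n) (delta u) v) = 12 * cmod (L2_inner P (\<lambda>\<xi>. ?h (L \<xi> v)) (\<eta> u))"
      by (simp only: norm_mult norm_numeral)
    also have "cmod (L2_inner P (\<lambda>\<xi>. ?h (L \<xi> v)) (\<eta> u)) \<le> L2_norm P (\<lambda>\<xi>. ?h (L \<xi> v)) * L2_norm P (\<eta> u)"
      by (rule L2_Cauchy_Schwarz[OF hv etaL[OF u]])
    also have "L2_norm P (\<lambda>\<xi>. ?h (L \<xi> v)) \<le> q ^ n * L2_norm \<mu>s root_fun / sqrt a"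
    proof -
      have "a * (L2_norm P (\<lambda>\<xi>. ?h (L \<xi> v)))\<^sup>2 \<le> (L2_norm \<mu>s ?h)\<^sup>2" using a(2) hL by blast
      also have "\<dots> \<le> (q ^ n * L2_norm \<mu>s root_fun)\<^sup>2"
        using Rn.defect_pow_norm[where z = z and n = n and q = q, OF root_fun_in_R] q b by (intro power_mono) auto
      finally have "(sqrt a * L2_norm P (\<lambda>\<xi>. ?h (L \<xi> v)))\<^sup>2 \<le> (q ^ n * L2_norm \<mu>s root_fun)\<^sup>2"
        using a(1) by (simp add: power_mult_distrib)
      then have "sqrt a * L2_norm P (\<lambda>\<xi>. ?h (L \<xi> v)) \<le> q ^ n * L2_norm \<mu>s root_fun"
        by (rule power2_le_imp_le) (use q in simp)
      then show ?thesis using a(1) by (simp add: pos_le_divide_eq mult.commute)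
    qed
    finally show ?thesis by (simp add: mult_right_mono ac_simps)
  qed
  then show "\<exists>C. \<forall>n. cmod ((Kg z ^^ n) (delta u) v) \<le> C * q ^ n" by blast
qed

end

section \<open>Local functions decorrelate\<close>

context unimodular_quasi_transitive
begin

definition depends_on :: "nat set \<Rightarrow> ((nat \<Rightarrow> real) \<Rightarrow> complex) \<Rightarrow> bool" where
  "depends_on A f \<longleftrightarrow> (\<forall>\<xi>\<in>space P. \<forall>\<xi>'\<in>space P. (\<forall>u\<in>A. \<xi> u = \<xi>' u) \<longrightarrow> f \<xi> = f \<xi>')"

lemma depends_onD:
  "depends_on A f \<Longrightarrow> \<xi> \<in> space P \<Longrightarrow> \<xi>' \<in> space P \<Longrightarrow> \<forall>u\<in>A. \<xi> u = \<xi>' u \<Longrightarrow> f \<xi> = f \<xi>'"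
  unfolding depends_on_def by blast

text \<open>The default label \<open>0\<close> is an element of the unit interval, so the extension is again a labelling.\<close>

lemma extend_labels_measurable:
  assumes "A \<subseteq> V"
  shows "(\<lambda>\<zeta>. \<lambda>u\<in>V. if u \<in> A then \<zeta> u else 0) \<in> measurable (PiM A (\<lambda>_. uniform01)) P"
  unfolding label_measure_def
proof (rule measurable_restrict)
  fix u assume "u \<in> V"
  show "(\<lambda>\<zeta>. if u \<in> A then \<zeta> u else 0) \<in> measurable (PiM A (\<lambda>_. uniform01)) uniform01"
  proof (cases "u \<in> A")
    case True
    have "(\<lambda>\<zeta>. \<zeta> u) \<in> measurable (PiM A (\<lambda>_. uniform01)) uniform01"
      using True by (rule measurable_component_singleton)
    then show ?thesis using True by simp
  next
    case False
    have "(0::real) \<in> space uniform01" by (simp add: space_restrict_space)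
    then have "(\<lambda>\<zeta>. 0) \<in> measurable (PiM A (\<lambda>_. uniform01)) uniform01" by (rule measurable_const)
    then show ?thesis using False by simp
  qed
qed

lemma depends_on_factor:
  assumes A: "A \<subseteq> V" and f: "f \<in> borel_measurable P" and d: "depends_on A f"
  shows "\<exists>F\<in>borel_measurable (PiM A (\<lambda>_. uniform01)). \<forall>\<xi>\<in>space P. F (restrict \<xi> A) = f \<xi>"
proof
  let ?e = "\<lambda>\<zeta>. \<lambda>u\<in>V. if u \<in> A then \<zeta> u else 0"
  have em: "?e \<in> measurable (PiM A (\<lambda>_. uniform01)) P" by (rule extend_labels_measurable[OF A])
  show "(\<lambda>\<zeta>. f (?e \<zeta>)) \<in> borel_measurable (PiM A (\<lambda>_. uniform01))" by (rule measurable_compose[OF em f])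
  show "\<forall>\<xi>\<in>space P. f (?e (restrict \<xi> A)) = f \<xi>"
  proof
    fix \<xi> assume xi: "\<xi> \<in> space P"
    have "restrict \<xi> A \<in> space (PiM A (\<lambda>_. uniform01))"
      using xi A unfolding label_measure_def by (auto simp: space_PiM)
    then have e: "?e (restrict \<xi> A) \<in> space P" by (rule measurable_space[OF em])
    have "\<forall>u\<in>A. ?e (restrict \<xi> A) u = \<xi> u" using A by auto
    then show "f (?e (restrict \<xi> A)) = f \<xi>" by (rule depends_onD[OF d e xi])
  qed
qed

text \<open>The functions factor through the labels on \<open>A\<close> and on \<open>C\<close>, which are independent.\<close>

lemma depends_on_disjoint_integral:
  assumes AC: "A \<subseteq> V" "C \<subseteq> V" "A \<inter> C = {}"
    and f: "integrable P f" "depends_on A f" and g: "integrable P g" "depends_on C g"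
  shows "(\<integral>\<xi>. f \<xi> * g \<xi> \<partial>P) = (\<integral>\<xi>. f \<xi> \<partial>P) * (\<integral>\<xi>. g \<xi> \<partial>P)"
proof -
  obtain F where F: "F \<in> borel_measurable (PiM A (\<lambda>_. uniform01))" "\<And>\<xi>. \<xi> \<in> space P \<Longrightarrow> F (restrict \<xi> A) = f \<xi>"
    using depends_on_factor[OF AC(1) borel_measurable_integrable[OF f(1)] f(2)] by blast
  obtain G where G: "G \<in> borel_measurable (PiM C (\<lambda>_. uniform01))" "\<And>\<xi>. \<xi> \<in> space P \<Longrightarrow> G (restrict \<xi> C) = g \<xi>"
    using depends_on_factor[OF AC(2) borel_measurable_integrable[OF g(1)] g(2)] by blast
  have "P.indep_var (PiM A (\<lambda>_. uniform01)) (\<lambda>\<xi>. restrict (\<lambda>i. \<xi> i) A)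
      (PiM C (\<lambda>_. uniform01)) (\<lambda>\<xi>. restrict (\<lambda>i. \<xi> i) C)"
    by (rule P.indep_var_restrict[OF indep_labels[OF V_ne] AC(3,1,2)])
  from P.indep_var_compose[OF this F(1) G(1)]
  have ind: "P.indep_var borel (\<lambda>\<xi>. F (restrict \<xi> A)) borel (\<lambda>\<xi>. G (restrict \<xi> C))" by (simp add: comp_def)
  have iF: "integrable P (\<lambda>\<xi>. F (restrict \<xi> A)) \<longleftrightarrow> integrable P f"
    by (rule Bochner_Integration.integrable_cong[OF refl F(2)])
  have iG: "integrable P (\<lambda>\<xi>. G (restrict \<xi> C)) \<longleftrightarrow> integrable P g"
    by (rule Bochner_Integration.integrable_cong[OF refl G(2)])
  have "(\<integral>\<xi>. f \<xi> * g \<xi> \<partial>P) = (\<integral>\<xi>. F (restrict \<xi> A) * G (restrict \<xi> C) \<partial>P)"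
    by (rule Bochner_Integration.integral_cong[OF refl]) (simp only: F(2) G(2))
  also have "\<dots> = (\<integral>\<xi>. F (restrict \<xi> A) \<partial>P) * (\<integral>\<xi>. G (restrict \<xi> C) \<partial>P)"
    by (rule P.indep_var_lebesgue_integral[OF ind iffD2[OF iF f(1)] iffD2[OF iG g(1)]])
  also have "(\<integral>\<xi>. F (restrict \<xi> A) \<partial>P) = (\<integral>\<xi>. f \<xi> \<partial>P)"
    by (rule Bochner_Integration.integral_cong[OF refl F(2)])
  also have "(\<integral>\<xi>. G (restrict \<xi> C) \<partial>P) = (\<integral>\<xi>. g \<xi> \<partial>P)"
    by (rule Bochner_Integration.integral_cong[OF refl G(2)])
  finally show ?thesis .
qed

lemma local_on_depends: "local_on r f \<Longrightarrow> v \<in> V \<Longrightarrow> depends_on (nball E r {v}) (\<lambda>\<xi>. f (L \<xi> v))"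
  unfolding depends_on_def by (intro ballI impI) (rule local_onD)

lemma meeting_balls_finite:
  assumes v: "v \<in> V"
  shows "finite {w \<in> V. nball E r {w} \<inter> nball E r {v} \<noteq> {}}"
proof (rule finite_subset)
  let ?S = "nball E r (nball E r {v})"
  have S: "finite (nball E r {v})" "nball E r {v} \<subseteq> V" using nball_V[OF v] by blast+
  show "finite ?S" using nball_finite[OF S E_sub] nbrs(1) by blast
  show "{w \<in> V. nball E r {w} \<inter> nball E r {v} \<noteq> {}} \<subseteq> ?S"
  proof
    fix w assume "w \<in> {w \<in> V. nball E r {w} \<inter> nball E r {v} \<noteq> {}}"
    then obtain u where u: "u \<in> nball E r {w}" "u \<in> nball E r {v}" by blast
    obtain n where n: "n \<le> r" "(w, u) \<in> E ^^ n" using u(1) unfolding nball_def by blast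
    have "(u, w) \<in> E ^^ m" if "(w, u) \<in> E ^^ m" for m
      using that
    proof (induction m arbitrary: u)
      case (Suc m)
      then obtain y where y: "(w, y) \<in> E ^^ m" "(y, u) \<in> E" by (elim relpow_Suc_E)
      show ?case by (rule relpow_Suc_I2[OF symD[OF symE y(2)] Suc.IH[OF y(1)]])
    qed simp
    then have "(u, w) \<in> E ^^ n" using n(2) by blast
    then show "w \<in> ?S" by (rule nballI[OF u(2) n(1)])
  qed
qed

text \<open>Over a root \<open>v\<close> only the vertices \<open>w\<close> whose ball meets that of \<open>v\<close> contribute to the inner product, by independence
  and since \<open>f\<close> has mean zero on the fibres.  These are finitely many kernel entries, independently of \<open>n\<close>.\<close>

lemma local_correlation_growth:
  assumes q: "0 < q" and k: "kernel_decay z q" and f: "f \<in> R" "f \<in> bounded_local"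
  shows "\<exists>C. \<forall>n. cmod (L2_inner \<mu>s ((Kb z ^^ n) f) f) \<le> C * q ^ n"
proof -
  obtain r where r: "local_on r f" using f(2) unfolding bounded_local_def by blast
  have fL: "f \<in> L2_space \<mu>s" by (rule subsetD[OF R_sub f(1)])
  have fv: "(\<lambda>\<xi>. f (L \<xi> v)) \<in> L2_space P" if "v \<in> V" for v by (rule L2_fibre[OF fL that])
  have f0: "(\<integral>\<xi>. f (L \<xi> v) \<partial>P) = 0" if "v \<in> V" for v using f(1) that unfolding R_iff by blast
  define N where "N v = {w \<in> V. nball E r {w} \<inter> nball E r {v} \<noteq> {}}" for v
  define c where "c w v = L2_inner P (\<lambda>\<xi>. f (L \<xi> w)) (\<lambda>\<xi>. f (L \<xi> v))" for w v
  have N: "finite (N v)" "N v \<subseteq> V" if "v \<in> V" for v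
    unfolding N_def using meeting_balls_finite[OF that] by auto
  have c0: "c w v = 0" if w: "w \<in> V" "w \<notin> N v" and v: "v \<in> V" for w v
  proof -
    have "nball E r {w} \<inter> nball E r {v} = {}" using w unfolding N_def by blast
    moreover have "depends_on (nball E r {v}) (\<lambda>\<xi>. cnj (f (L \<xi> v)))"
      by (rule local_on_depends[OF local_on_comp[OF r] v])
    moreover have "integrable P (\<lambda>\<xi>. cnj (f (L \<xi> v)))" using L2_integrable_P[OF fv[OF v]] by simp
    ultimately have "c w v = (\<integral>\<xi>. f (L \<xi> w) \<partial>P) * (\<integral>\<xi>. cnj (f (L \<xi> v)) \<partial>P)"
      unfolding c_def L2_inner_def using nball_V[OF w(1)] nball_V[OF v]
      by (intro depends_on_disjoint_integral[of "nball E r {w}" "nball E r {v}"] L2_integrable_P[OF fv[OF w(1)]]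
        local_on_depends[OF r w(1)]) blast+
    then show ?thesis by (simp add: f0[OF w(1)])
  qed
  have "\<forall>u v. \<exists>C. u \<in> V \<longrightarrow> v \<in> V \<longrightarrow> (\<forall>n. cmod ((Kg z ^^ n) (delta u) v) \<le> C * q ^ n)"
    using k unfolding kernel_decay_def by blast
  then obtain C where C: "\<And>u v n. u \<in> V \<Longrightarrow> v \<in> V \<Longrightarrow> cmod ((Kg z ^^ n) (delta u) v) \<le> C u v * q ^ n" by metis
  let ?C = "\<Sum>i\<in>reps. swt i * (\<Sum>w\<in>N i. C w i * cmod (c w i))"
  have "cmod (L2_inner \<mu>s ((Kb z ^^ n) f) f) \<le> ?C * q ^ n" for n
  proof -
    have hL: "(Kb z ^^ n) f \<in> L2_space \<mu>s" by (rule subsetD[OF R_sub Rn.defect_pow_in[OF f(1)]])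
    have "cmod (L2_inner \<mu>s ((Kb z ^^ n) f) f)
        = cmod (\<Sum>i\<in>reps. of_real (swt i) * L2_inner P (\<lambda>\<xi>. (Kb z ^^ n) f (L \<xi> i)) (\<lambda>\<xi>. f (L \<xi> i)))"
      unfolding L2_inner_mu_star[OF hL fL] ..
    also have "\<dots> \<le> (\<Sum>i\<in>reps. swt i * ((\<Sum>w\<in>N i. C w i * cmod (c w i)) * q ^ n))"
    proof (rule sum_norm_le)
      fix i assume "i \<in> reps"
      then have i: "i \<in> V" using reps_sub by blast
      have "L2_inner P (\<lambda>\<xi>. (Kb z ^^ n) f (L \<xi> i)) (\<lambda>\<xi>. f (L \<xi> i)) = (\<Sum>w\<in>N i. (Kg z ^^ n) (delta w) i * c w i)"
        unfolding c_def by (rule fibre_inner_expansion[OF i f(1) fv[OF i] N[OF i]]) (use c0 i in \<open>simp add: c_def\<close>)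
      also have "cmod \<dots> \<le> (\<Sum>w\<in>N i. (C w i * q ^ n) * cmod (c w i))"
        using N(2)[OF i] by (intro sum_norm_le) (auto simp: norm_mult intro!: mult_right_mono C[OF _ i])
      also have "\<dots> = (\<Sum>w\<in>N i. C w i * cmod (c w i)) * q ^ n" unfolding sum_distrib_right by (rule sum.cong[OF refl]) (simp only: mult.assoc mult.commute[of "q ^ n"])
      finally show "cmod (of_real (swt i) * L2_inner P (\<lambda>\<xi>. (Kb z ^^ n) f (L \<xi> i)) (\<lambda>\<xi>. f (L \<xi> i)))
          \<le> swt i * ((\<Sum>w\<in>N i. C w i * cmod (c w i)) * q ^ n)"
        using swt_pos[OF i] unfolding norm_mult norm_of_real by (simp add: mult_left_mono)
    qed
    also have "\<dots> = ?C * q ^ n" by (simp add: sum_distrib_right mult.assoc)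
    finally show ?thesis .
  qed
  then show ?thesis by blast
qed

text \<open>Subtracting from a local function its conditional mean given the unlabelled graph is the
  orthogonal projection to \<open>R\<close>.  The mean is a function of the orbit of the root, so what remains is still bounded
  and local.\<close>

lemma centred_local_dense:
  assumes f: "f \<in> R" and e: "e > 0"
  shows "\<exists>h\<in>R \<inter> bounded_local. L2_norm \<mu>s (\<lambda>x. f x - h x) \<le> e"
proof -
  have fL: "f \<in> L2_space \<mu>s" by (rule subsetD[OF R_sub f])
  obtain g where g: "g \<in> bounded_local" "L2_norm \<mu>s (\<lambda>x. f x - g x) \<le> e"
    using bounded_local_dense[OF fL e] by blast
  have gL: "g \<in> L2_space \<mu>s" by (rule bounded_local_L2[OF g(1)])
  have gm: "g \<in> borel_measurable LM" using g(1) by (simp add: bounded_local_def)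
  define a where "a v = (\<integral>\<xi>. g (L \<xi> v) \<partial>P)" for v
  define m where "m x = (\<Sum>i\<in>reps. a i * indicator {cls i} (forget_labels x))" for x
  have mL: "m (L \<xi> v) = a v" if v: "v \<in> V" and xi: "\<xi> \<in> space P" for v \<xi>
  proof -
    obtain i \<phi> where i: "i \<in> reps" "graph_iso \<phi> H H" "\<phi> i = v" using rep_exists[OF v] by blast
    have iV: "i \<in> V" using i(1) reps_sub by blast
    have ci: "cls i = cls v" using i(2,3) unfolding cls_eq_iff[OF iV v] by blast
    have "m (L \<xi> v) = (\<Sum>j\<in>reps. a j * indicator {cls j} (cls i))"
      unfolding m_def forget_L[OF v xi] ci ..
    also have "\<dots> = (\<Sum>j\<in>reps. if j = i then a i else 0)"
    proof (rule sum.cong[OF refl])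
      fix j assume j: "j \<in> reps"
      have "cls i = cls j \<longleftrightarrow> j = i" using bij_reps i(1) j by (auto simp: bij_betw_def dest: inj_onD)
      then show "a j * indicator {cls j} (cls i) = (if j = i then a i else 0)" by (simp add: indicator_def)
    qed
    also have "\<dots> = a i" using finite_reps i(1) by simp
    also have "a i = a v" unfolding a_def using integral_L_aut[OF i(2) iV gm] i(3) by simp
    finally show ?thesis .
  qed
  have mb: "m \<in> bounded_local"
    unfolding bounded_local_def
  proof (intro CollectI conjI)
    show "m \<in> borel_measurable LM"
      unfolding m_def
    proof (intro borel_measurable_sum borel_measurable_times borel_measurable_const)
      fix i assume "i \<in> reps"
      then have "i \<in> V" using reps_sub by blast
      then have "(indicator {cls i} :: _ \<Rightarrow> complex) \<in> borel_measurable (rooted_space D 1)"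
        using cls_singleton unfolding sets_nu by (intro borel_measurable_indicator) blast
      then show "(\<lambda>x. indicator {cls i} (forget_labels x) :: complex) \<in> borel_measurable LM"
        by (rule measurable_compose[OF forget_labels_measurable])
    qed
    have "cmod (m x) \<le> (\<Sum>i\<in>reps. cmod (a i))" for x
      unfolding m_def by (rule sum_norm_le) (auto simp: norm_mult indicator_def)
    then show "\<exists>C. \<forall>x. cmod (m x) \<le> C" by blast
    show "\<exists>r. local_on r m"
      by (rule exI[of _ 0], rule local_onI) (simp add: mL)
  qed
  have m2: "m \<in> L2_space \<mu>s" by (rule bounded_local_L2[OF mb])
  define h where "h x = g x - m x" for x
  have hb: "h \<in> bounded_local" using bounded_local_lincomb[OF g(1) mb, of 1 "- 1"] by (simp add: h_def[abs_def])
  have hR: "h \<in> R"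
    unfolding R_iff
  proof (intro conjI ballI)
    show "h \<in> L2_space \<mu>s" by (rule bounded_local_L2[OF hb])
    fix v assume v: "v \<in> V"
    have "(\<integral>\<xi>. h (L \<xi> v) \<partial>P) = (\<integral>\<xi>. g (L \<xi> v) - a v \<partial>P)"
      by (rule Bochner_Integration.integral_cong[OF refl]) (simp add: h_def mL[OF v])
    also have "\<dots> = 0" using L2_integrable_P[OF L2_fibre[OF gL v]] by (simp add: a_def P.prob_space)
    finally show "(\<integral>\<xi>. h (L \<xi> v) \<partial>P) = 0" .
  qed
  have dR: "(\<lambda>x. f x - h x) \<in> R" by (rule Rn.in_X_diff[OF f hR])
  have dL: "(\<lambda>x. f x - h x) \<in> L2_space \<mu>s" by (rule subsetD[OF R_sub dR])
  \<comment> \<open>\<open>f - g = (f - h) - m\<close> is an orthogonal decomposition\<close>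
  have orth: "L2_inner \<mu>s (\<lambda>x. f x - h x) m = 0"
  proof -
    have "L2_inner P (\<lambda>\<xi>. f (L \<xi> i) - h (L \<xi> i)) (\<lambda>\<xi>. m (L \<xi> i)) = 0" if "i \<in> reps" for i
    proof -
      have i: "i \<in> V" using that reps_sub by blast
      have "L2_inner P (\<lambda>\<xi>. f (L \<xi> i) - h (L \<xi> i)) (\<lambda>\<xi>. m (L \<xi> i)) = (\<integral>\<xi>. (f (L \<xi> i) - h (L \<xi> i)) * cnj (a i) \<partial>P)"
        unfolding L2_inner_def by (rule Bochner_Integration.integral_cong[OF refl]) (simp only: mL[OF i])
      also have "\<dots> = (\<integral>\<xi>. f (L \<xi> i) - h (L \<xi> i) \<partial>P) * cnj (a i)" by (rule integral_mult_left_zero)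
      also have "(\<integral>\<xi>. f (L \<xi> i) - h (L \<xi> i) \<partial>P) = 0" using dR i unfolding R_iff by blast
      finally show ?thesis by simp
    qed
    then show ?thesis unfolding L2_inner_mu_star[OF dL m2] by simp
  qed
  have "(\<lambda>x. 1 * (f x - h x) + (- 1) * m x) = (\<lambda>x. f x - g x)" by (simp add: h_def)
  then have "(L2_norm \<mu>s (\<lambda>x. f x - g x))\<^sup>2 = (L2_norm \<mu>s (\<lambda>x. f x - h x))\<^sup>2 + (L2_norm \<mu>s m)\<^sup>2"
    using L2_norm_lincomb_sq[OF dL m2, of 1 "- 1"] orth by simp
  then have "(L2_norm \<mu>s (\<lambda>x. f x - h x))\<^sup>2 \<le> (L2_norm \<mu>s (\<lambda>x. f x - g x))\<^sup>2" by simp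
  then have "L2_norm \<mu>s (\<lambda>x. f x - h x) \<le> L2_norm \<mu>s (\<lambda>x. f x - g x)"
    by (rule power2_le_imp_le) simp
  with g(2) have "L2_norm \<mu>s (\<lambda>x. f x - h x) \<le> e" by (rule order_trans[rotated])
  moreover have "h \<in> R \<inter> bounded_local" using hR hb by (rule IntI)
  ultimately show ?thesis by (rule bexI)
qed

lemma random_bound_of_kernel_decay:
  assumes q: "0 < q" and k: "kernel_decay z q" and f: "f \<in> R"
  shows "L2_norm \<mu>s (Kb z f) \<le> q * L2_norm \<mu>s f"
proof (rule Rn.defect_bound_of_dense[OF _ q _ _ f])
  show "R \<inter> bounded_local \<subseteq> R" by blast
  show "\<exists>g\<in>R \<inter> bounded_local. L2_norm \<mu>s (\<lambda>x. f x - g x) \<le> e" if fe: "f \<in> R" "e > 0" for f e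
    by (rule centred_local_dense[OF fe])
  show "\<exists>C. \<forall>n. cmod (L2_inner \<mu>s ((Kb z ^^ n) f) f) \<le> C * q ^ n" if "f \<in> R \<inter> bounded_local" for f
    using that by (intro local_correlation_growth[OF q k]) auto
qed

theorem random_spectrum_eq: "random_spectrum D \<nu> = graph_spectrum H"
proof -
  have "z \<notin> random_spectrum D \<nu> \<longleftrightarrow> z \<notin> graph_spectrum H" for z
  proof -
    have iff: "(\<forall>f\<in>R. L2_norm \<mu>s (Kb z f) \<le> q * L2_norm \<mu>s f) \<longleftrightarrow>
        (\<forall>f\<in>L2_space dm. L2_norm dm (Kg z f) \<le> q * L2_norm dm f)" if q: "0 < q" for q
      using kernel_decay_of_random_bound[OF q] random_bound_of_kernel_decay[OF q]
        kernel_decay_of_graph_bound[OF q] graph_bound_of_kernel_decay[OF q] by blast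
    have ne: "R \<noteq> {}" "L2_space dm \<noteq> {}" using root_fun_in_R L2_zero by blast+
    show ?thesis
      unfolding random_spectrum_def graph_spectrum_def Rn.notin_spectrum_iff[OF ne(1)] Gr.notin_spectrum_iff[OF ne(2)]
    proof (rule arg_cong[where f = Ex], rule ext)
      fix q
      show "(0 < q \<and> q < 1 \<and> (\<forall>f\<in>R. L2_norm \<mu>s (Kb z f) \<le> q * L2_norm \<mu>s f)) \<longleftrightarrow>
          (0 < q \<and> q < 1 \<and> (\<forall>f\<in>L2_space dm. L2_norm dm (Kg z f) \<le> q * L2_norm dm f))"
        by (cases "0 < q") (simp_all only: iff simp_thms)
    qed
  qed
  then show ?thesis by blast
qed

end

section \<open>Invariance of the spectrum under isomorphism\<close>

lemma connected_graph_iso: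
  assumes iso: "graph_iso \<phi> G H" and G: "connected_graph G"
  shows "connected_graph H"
proof -
  note g = connected_graphD[OF G]
  have b: "bij_betw \<phi> (verts G) (verts H)" and e: "edges H = map_prod \<phi> \<phi> ` edges G"
    using iso by (auto simp: graph_iso_def)
  have inj: "inj_on \<phi> (verts G)" and V: "verts H = \<phi> ` verts G" using b by (auto simp: bij_betw_def)
  have eI: "(\<phi> u, \<phi> v) \<in> edges H" if "(u, v) \<in> edges G" for u v using that e by force
  have eE: "\<exists>u v. x = \<phi> u \<and> y = \<phi> v \<and> (u, v) \<in> edges G" if "(x, y) \<in> edges H" for x y using that e by auto
  have path: "(\<phi> u, \<phi> v) \<in> (edges H)\<^sup>*" if "(u, v) \<in> (edges G)\<^sup>*" for u v
    using that by (induction rule: rtrancl_induct) (auto intro: rtrancl_into_rtrancl eI)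
  show ?thesis
    unfolding connected_graph_def
  proof (intro conjI ballI)
    show "verts H \<noteq> {}" using G V by (auto simp: connected_graph_def)
    show "edges H \<subseteq> verts H \<times> verts H"
    proof
      fix p assume p: "p \<in> edges H"
      then obtain u v where "p = (\<phi> u, \<phi> v)" "(u, v) \<in> edges G" using eE by (cases p) blast
      moreover from this(2) have "u \<in> verts G" "v \<in> verts G" using g(1) by auto
      ultimately show "p \<in> verts H \<times> verts H" unfolding V by simp
    qed
    show "sym (edges H)" using eE eI symD[OF g(2)] by (intro symI) metis
    show "irrefl (edges H)"
    proof (rule irreflI)
      fix x show "(x, x) \<notin> edges H"
      proof
        assume "(x, x) \<in> edges H"
        then obtain u v where uv: "x = \<phi> u" "x = \<phi> v" "(u, v) \<in> edges G" using eE by blast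
        then have "u = v" using inj g(1) by (metis inj_onD mem_Sigma_iff subsetD)
        then show False using uv(3) G by (auto simp: connected_graph_def irrefl_def)
      qed
    qed
    fix x y assume "x \<in> verts H" "y \<in> verts H"
    then obtain u v where "u \<in> verts G" "v \<in> verts G" "x = \<phi> u" "y = \<phi> v" unfolding V by blast
    then show "(x, y) \<in> (edges H)\<^sup>*" using path G by (simp add: connected_graph_def)
  qed
qed

lemma nbrs_iso:
  assumes iso: "graph_iso \<phi> G H" and G: "connected_graph G" and v: "v \<in> verts G"
  shows "edges H `` {\<phi> v} = \<phi> ` (edges G `` {v})"
proof -
  have inj: "inj_on \<phi> (verts G)" and e: "edges H = map_prod \<phi> \<phi> ` edges G"
    using iso by (auto simp: graph_iso_def bij_betw_def)
  have "y \<in> \<phi> ` (edges G `` {v})" if "(\<phi> v, y) \<in> edges H" for y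
  proof -
    have "(\<phi> v, y) \<in> map_prod \<phi> \<phi> ` edges G" using that unfolding e .
    then obtain a b where ab: "(a, b) \<in> edges G" "\<phi> v = \<phi> a" "y = \<phi> b" by auto
    have "a \<in> verts G" using ab(1) connected_graphD(1)[OF G] by blast
    then have "v = a" by (rule inj_onD[OF inj ab(2) v])
    then show ?thesis using ab by blast
  qed
  moreover have "(\<phi> v, \<phi> w) \<in> edges H" if "(v, w) \<in> edges G" for w using that e by force
  ultimately show ?thesis by blast
qed

lemma nbrs_inj_iso:
  assumes "graph_iso \<phi> G H" "connected_graph G"
  shows "inj_on \<phi> (edges G `` {v})"
proof (rule inj_on_subset)
  show "inj_on \<phi> (verts G)" using assms(1) by (simp add: graph_iso_def bij_betw_def)
  show "edges G `` {v} \<subseteq> verts G" using connected_graphD(1)[OF assms(2)] by blast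
qed

lemma degree_iso:
  assumes "graph_iso \<phi> G H" "connected_graph G" "v \<in> verts G"
  shows "vertex_degree (edges H) (\<phi> v) = vertex_degree (edges G) v"
  unfolding vertex_degree_def nbrs_iso[OF assms] by (rule card_image[OF nbrs_inj_iso[OF assms(1,2)]])

lemma markov_iso:
  assumes "graph_iso \<phi> G H" "connected_graph G" "v \<in> verts G"
  shows "markov (edges H) f (\<phi> v) = markov (edges G) (\<lambda>u. f (\<phi> u)) v"
  unfolding markov_def degree_iso[OF assms] nbrs_iso[OF assms]
  by (simp add: sum.reindex[OF nbrs_inj_iso[OF assms(1,2)]])

lemma defect_iso:
  assumes iso: "graph_iso \<phi> G H" and G: "connected_graph G" and v: "v \<in> verts G"
  shows "defect z (markov (edges H)) f (\<phi> v) = defect z (markov (edges G)) (\<lambda>u. f (\<phi> u)) v"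
proof -
  have "markov (edges H) (markov (edges H) f) (\<phi> v) = markov (edges G) (\<lambda>u. markov (edges H) f (\<phi> u)) v"
    by (rule markov_iso[OF assms])
  also have "\<dots> = markov (edges G) (markov (edges G) (\<lambda>u. f (\<phi> u))) v"
    by (rule markov_cong, rule markov_iso[OF iso G]) (use connected_graphD(1)[OF G] in blast)
  finally show ?thesis unfolding defect_def markov_iso[OF assms] by simp
qed

lemma degree_measure_iso:
  assumes iso: "graph_iso \<phi> G H" and G: "connected_graph G"
  shows "degree_measure H = distr (degree_measure G) (count_space (verts H)) \<phi>"
proof -
  have b: "bij_betw \<phi> (verts G) (verts H)" using iso by (simp add: graph_iso_def)
  have "degree_measure H = density (distr (count_space (verts G)) (count_space (verts H)) \<phi>)
      (\<lambda>v. ennreal (vertex_degree (edges H) v))"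
    unfolding degree_measure_def point_measure_def distr_bij_count_space[OF b] ..
  also have "\<dots> = distr (density (count_space (verts G)) (\<lambda>v. ennreal (vertex_degree (edges H) (\<phi> v)))) (count_space (verts H)) \<phi>"
    by (rule density_distr) (use b in \<open>auto simp: bij_betw_def\<close>)
  also have "density (count_space (verts G)) (\<lambda>v. ennreal (vertex_degree (edges H) (\<phi> v))) = degree_measure G"
    unfolding degree_measure_def point_measure_def
    by (rule density_cong) (auto simp: degree_iso[OF assms])
  finally show ?thesis .
qed

lemma L2_iso:
  fixes G :: "'a graph" and H :: "'b graph"
  assumes iso: "graph_iso \<phi> G H" and G: "connected_graph G"
  shows "f \<in> L2_space (degree_measure H) \<longleftrightarrow> (\<lambda>u. f (\<phi> u)) \<in> L2_space (degree_measure G)"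
    and "L2_norm (degree_measure H) f = L2_norm (degree_measure G) (\<lambda>u. f (\<phi> u))"
proof -
  have "\<phi> ` verts G = verts H" using iso by (auto simp: graph_iso_def bij_betw_def)
  then have m: "\<phi> \<in> measurable (degree_measure G) (count_space (verts H))"
    unfolding degree_measure_def by (simp add: measurable_def space_point_measure sets_point_measure) blast
  have all: "g \<in> borel_measurable (degree_measure K)" for K :: "'c graph" and g :: "'c \<Rightarrow> complex"
    unfolding degree_measure_def by (simp add: measurable_def space_point_measure sets_point_measure)
  have "integrable (degree_measure H) (\<lambda>x. (cmod (f x))\<^sup>2) \<longleftrightarrow> integrable (degree_measure G) (\<lambda>u. (cmod (f (\<phi> u)))\<^sup>2)"
    unfolding degree_measure_iso[OF assms] by (rule integrable_distr_eq[OF m]) simp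
  then show "f \<in> L2_space (degree_measure H) \<longleftrightarrow> (\<lambda>u. f (\<phi> u)) \<in> L2_space (degree_measure G)"
    by (simp only: L2_space_def mem_Collect_eq all simp_thms)
  have "(\<integral>x. (cmod (f x))\<^sup>2 \<partial>degree_measure H) = (\<integral>u. (cmod (f (\<phi> u)))\<^sup>2 \<partial>degree_measure G)"
    unfolding degree_measure_iso[OF assms] by (rule integral_distr[OF m]) simp
  then show "L2_norm (degree_measure H) f = L2_norm (degree_measure G) (\<lambda>u. f (\<phi> u))" by (simp add: L2_norm_def)
qed

lemma graph_notin_spectrum_iff:
  assumes G: "connected_graph G" and d: "degree_bounded D G"
  shows "z \<notin> graph_spectrum G \<longleftrightarrow> (\<exists>q. 0 < q \<and> q < 1 \<and> (\<forall>f\<in>L2_space (degree_measure G).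
    L2_norm (degree_measure G) (defect z (markov (edges G)) f) \<le> q * L2_norm (degree_measure G) f))"
proof -
  have "self_adjoint_contraction (degree_measure G) (L2_space (degree_measure G)) (markov (edges G))"
    using d by (intro graph_self_adjoint[OF G]) (simp add: degree_bounded_def)
  moreover have "L2_space (degree_measure G) \<noteq> {}" using L2_zero by blast
  ultimately show ?thesis unfolding graph_spectrum_def by (rule self_adjoint_contraction.notin_spectrum_iff)
qed

lemma degree_bounded_iso:
  assumes iso: "graph_iso \<phi> G H" and G: "connected_graph G" and d: "degree_bounded D G"
  shows "degree_bounded D H"
  unfolding degree_bounded_def
proof
  fix x assume "x \<in> verts H"
  moreover have "verts H = \<phi> ` verts G" using iso by (auto simp: graph_iso_def bij_betw_def)
  ultimately obtain v where v: "v \<in> verts G" "x = \<phi> v" by auto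
  show "finite (edges H `` {x}) \<and> vertex_degree (edges H) x \<le> D"
    using d v(1) unfolding v(2) nbrs_iso[OF iso G v(1)] degree_iso[OF iso G v(1)] by (simp add: degree_bounded_def)
qed

lemma L2_norm_degree_cong:
  assumes "\<And>v. v \<in> verts G \<Longrightarrow> f v = g v"
  shows "L2_norm (degree_measure G) f = L2_norm (degree_measure G) g"
proof -
  have "(\<integral>x. (cmod (f x))\<^sup>2 \<partial>degree_measure G) = (\<integral>x. (cmod (g x))\<^sup>2 \<partial>degree_measure G)"
    by (rule Bochner_Integration.integral_cong[OF refl]) (simp add: assms degree_measure_def space_point_measure)
  then show ?thesis unfolding L2_norm_def by (rule arg_cong)
qed

text \<open>Through \<open>notin_spectrum_iff\<close> only the defect has to be transported along \<open>\<phi>\<close>, and no inverse operator.  The other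
  inclusion follows from the inverse isomorphism.\<close>

lemma graph_spectrum_iso:
  assumes iso: "graph_iso \<phi> G H" and G: "connected_graph G" and d: "degree_bounded D G"
  shows "graph_spectrum G \<subseteq> graph_spectrum H"
proof -
  have "z \<notin> graph_spectrum G" if z: "z \<notin> graph_spectrum H" for z
  proof -
    note dH = degree_bounded_iso[OF assms] and cH = connected_graph_iso[OF iso G]
    let ?\<psi> = "the_inv_into (verts G) \<phi>"
    have inv: "graph_iso ?\<psi> H G" by (rule graph_iso_inv[OF iso connected_graphD(1)[OF G]])
    obtain q where q: "0 < q" "q < 1" "\<And>f. f \<in> L2_space (degree_measure H) \<Longrightarrow>
        L2_norm (degree_measure H) (defect z (markov (edges H)) f) \<le> q * L2_norm (degree_measure H) f"
      using z unfolding graph_notin_spectrum_iff[OF cH dH] by blast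
    have "L2_norm (degree_measure G) (defect z (markov (edges G)) f) \<le> q * L2_norm (degree_measure G) f"
      if f: "f \<in> L2_space (degree_measure G)" for f
    proof -
      let ?f = "\<lambda>x. f (?\<psi> x)"
      have "L2_norm (degree_measure G) (defect z (markov (edges G)) f)
          = L2_norm (degree_measure H) (\<lambda>x. defect z (markov (edges G)) f (?\<psi> x))" by (rule L2_iso(2)[OF inv cH])
      also have "\<dots> = L2_norm (degree_measure H) (defect z (markov (edges H)) ?f)"
        by (rule L2_norm_degree_cong) (rule defect_iso[OF inv cH])
      also have "\<dots> \<le> q * L2_norm (degree_measure H) ?f"
        by (rule q(3)) (rule iffD1[OF L2_iso(1)[OF inv cH] f])
      also have "L2_norm (degree_measure H) ?f = L2_norm (degree_measure G) f" by (rule L2_iso(2)[OF inv cH, symmetric])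
      finally show ?thesis .
    qed
    then show ?thesis unfolding graph_notin_spectrum_iff[OF G d] using q(1,2) by blast
  qed
  then show ?thesis by blast
qed

text \<open>Used to replace a graph on an arbitrary vertex type by one of its copies on the natural numbers.\<close>

lemma unimodular_quasi_transitive_iso:
  assumes iso: "graph_iso \<phi> G H" and G: "connected_graph G" "no_isolated G" "degree_bounded D G" "quasi_transitive G"
    and law: "unimodular_law D G \<nu>"
  shows "unimodular_quasi_transitive H D \<nu>"
proof
  note g = connected_graphD(1)[OF G(1)]
  show cH: "connected_graph H" by (rule connected_graph_iso[OF iso G(1)])
  let ?\<psi> = "the_inv_into (verts G) \<phi>"
  have inv: "graph_iso ?\<psi> H G" by (rule graph_iso_inv[OF iso g])
  have bij: "bij_betw \<phi> (verts G) (verts H)" using iso by (simp add: graph_iso_def)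
  have VH: "verts H = \<phi> ` verts G" using iso by (auto simp: graph_iso_def bij_betw_def)
  show "no_isolated H"
    using G(2) unfolding no_isolated_def VH by (auto simp: nbrs_iso[OF iso G(1)])
  show "degree_bounded D H" by (rule degree_bounded_iso[OF iso G(1,3)])
  have "orbit H (\<phi> v) = \<phi> ` orbit G v" if v: "v \<in> verts G" for v
  proof -
    have vv: "?\<psi> (\<phi> v) = v" by (rule the_inv_into_f_f[OF bij_betw_imp_inj_on[OF bij] v])
    have 1: "\<alpha> (\<phi> v) \<in> \<phi> ` orbit G v" if \<alpha>: "graph_iso \<alpha> H H" for \<alpha>
    proof -
      have "\<alpha> (\<phi> v) \<in> verts H" using \<alpha> v VH by (auto simp: graph_iso_def bij_betw_def)
      then have "\<phi> (?\<psi> (\<alpha> (\<phi> v))) = \<alpha> (\<phi> v)" by (rule f_the_inv_into_f_bij_betw[OF bij])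
      moreover have "graph_iso (?\<psi> \<circ> (\<alpha> \<circ> \<phi>)) G G" by (rule graph_iso_comp[OF graph_iso_comp[OF iso \<alpha>] inv])
      then have "(?\<psi> \<circ> (\<alpha> \<circ> \<phi>)) v \<in> orbit G v" unfolding orbit_def by blast
      ultimately show ?thesis by (metis comp_apply imageI)
    qed
    have 2: "\<phi> (\<beta> v) \<in> orbit H (\<phi> v)" if \<beta>: "graph_iso \<beta> G G" for \<beta>
    proof -
      have "graph_iso (\<phi> \<circ> (\<beta> \<circ> ?\<psi>)) H H" by (rule graph_iso_comp[OF graph_iso_comp[OF inv \<beta>] iso])
      then have "(\<phi> \<circ> (\<beta> \<circ> ?\<psi>)) (\<phi> v) \<in> orbit H (\<phi> v)" unfolding orbit_def by blast
      then show ?thesis by (simp add: vv)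
    qed
    show ?thesis
    proof
      show "orbit H (\<phi> v) \<subseteq> \<phi> ` orbit G v" using 1 by (auto simp: orbit_def)
      show "\<phi> ` orbit G v \<subseteq> orbit H (\<phi> v)" using 2 by (auto simp: orbit_def[of G])
    qed
  qed
  then have "orbit H ` verts H = (\<lambda>S. \<phi> ` S) ` orbit G ` verts G" unfolding VH image_image by (rule image_cong[OF refl])
  then show "quasi_transitive H" using G(4) by (simp add: quasi_transitive_def)
  have "AE c in \<nu>. \<exists>\<phi>. graph_iso \<phi> G (the_graph c)" using law by (simp add: unimodular_law_def)
  then have "AE c in \<nu>. \<exists>\<phi>. graph_iso \<phi> H (the_graph c)"
    by (rule AE_mp) (intro AE_I2 impI, elim exE, rule exI, rule graph_iso_comp[OF inv])
  then show "unimodular_law D H \<nu>" using law by (simp add: unimodular_law_def)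
qed

theorem theorem1p6:
  fixes G :: "'a graph" and T :: "'b graph" and D :: nat
    and \<nu> :: "nat rgraph set measure"
  assumes "connected_graph G" and "no_isolated G" and "degree_bounded D G"
    and "quasi_transitive G"
    and "is_tree T" and "quasi_isometric G T"
    and "unimodular_law D G \<nu>"
  shows "random_spectrum D \<nu> = graph_spectrum G"
proof -
  interpret nu: prob_space \<nu> using assms(7) by (simp add: unimodular_law_def)
  have "AE c in \<nu>. \<exists>\<phi>. graph_iso \<phi> G (the_graph c)" using assms(7) by (simp add: unimodular_law_def)
  from eventually_happens'[OF nu.ae_filter_bot this]
  obtain c \<phi> where iso: "graph_iso \<phi> G (the_graph c)" by (elim exE)
  interpret unimodular_quasi_transitive "the_graph c" D \<nu>
    by (rule unimodular_quasi_transitive_iso[OF iso assms(1-4,7)])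
  have "graph_spectrum (the_graph c) = graph_spectrum G"
  proof
    show "graph_spectrum G \<subseteq> graph_spectrum (the_graph c)" by (rule graph_spectrum_iso[OF iso assms(1,3)])
    show "graph_spectrum (the_graph c) \<subseteq> graph_spectrum G"
      by (rule graph_spectrum_iso[OF graph_iso_inv[OF iso connected_graphD(1)[OF assms(1)]] conn deg])
  qed
  then show ?thesis by (simp only: random_spectrum_eq)
qed

end
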